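(* Let $\beta<\beta_0$, let $h\ge 0$ be any external field, and let $k\ge 1$ be an integer. There is a constant $C$, depending on $k,\beta,\Delta^2,\Lambda$ but not on $N$, such that for every $N$, every species $s\in\mathscr{S}$ and every $i\in I_s$, $$\mathbb{E}\left(\langle \sigma_i\rangle-\tanh\left(\frac{\beta}{\sqrt N}\sum_{t=1}^m\ \sum_{j\in I_t,\ j\neq i} g_{i,j}\langle\sigma_j\rangle+h-\beta^2\big(\Delta^2\Lambda(\mathbf 1-\mathbf q)\big)_s\langle\sigma_i\rangle\right)\right)^{2k}\le\frac{C}{N^k}.$$
   Context: Multi-species Sherrington-Kirkpatrick (MSK) model. Let $\mathscr{S}=\{1,\dots,m\}$, $m\ge 2$, be the set of species. For each $N$, the index set $\{1,\dots,N\}$ is partitioned into disjoint sets $I_s$, $s\in\mathscr{S}$. The ratios $\lambda_{s,N}=|I_s|/N$ converge to $\lambda_s\in(0,1)$ as $N\to\infty$; throughout, $\lambda_{s,N}$ is identified with $\lambda_s$, i.e. $|I_s|=\lambda_sN$. Put $\Lambda=\mathrm{diag}(\lambda_1,\dots,\lambda_m)$. The disorder $(g_{i,j})_{1\le i<j\le N}$ consists of independent centered Gaussian random variables with $\mathbb{E}g_{i,j}^2=\Delta_{s,t}^2$ for $i\in I_s$, $j\in I_t$; set $g_{j,i}=g_{i,j}$. The variance profile matrix $\Delta^2=(\Delta^2_{s,t})_{s,t=1}^m$ is symmetric with nonnegative entries, and is not assumed positive semi-definite. For $\sigma\in\Sigma_N=\{-1,+1\}^N$, inverse temperature $\beta>0$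 and external field $h\ge 0$, the Hamiltonian is $$H_N(\sigma)=\frac{\beta}{\sqrt N}\sum_{1\le i<j\le N}g_{i,j}\sigma_i\sigma_j+h\sum_{i=1}^N\sigma_i .$$ The Gibbs measure is $G_N(\sigma)=\exp(H_N(\sigma))/\sum_{\tau\in\Sigma_N}\exp(H_N(\tau))$, and $\langle\cdot\rangle$ denotes the Gibbs mean, that is, expectation under $G_N$ with the disorder fixed. $\mathbb{E}$ is expectation over the disorder. Critical parameters: $\beta_c=\rho(\Delta^2\Lambda)^{-1/2}$, where $\rho$ is the spectral radius (largest absolute value of the eigenvalues); $\alpha=1+\mathbf 1\{\Delta^2\text{ is indefinite}\}$, so $\alpha=1$ if $\Delta^2$ is positive semi-definite and $\alpha=2$ otherwise; $\beta_0=\beta_c/\sqrt{4\alpha}$. The vector $\mathbf q=(q_1,\dots,q_m)^{\top}$ is the unique solution, for $\beta<\beta_0$, of $$q_s=\mathbb{E}\tanh^2\!\big(\beta\eta\sqrt{(\Delta^2\Lambda\mathbf q)_s}+h\big),\quad s=1,\dots,m,\qquad \eta\sim N(0,1).$$ $\mathbf 1\in\mathbb{R}^m$ is the all-ones vector, and $(\cdot)_s$ denotes the $s$-th coordinate. *)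

theory Defs
  imports "HOL-Probability.Probability" "Jordan_Normal_Form.Spectral_Radius"
begin

no_notation vec_nth (infixl "$" 90)
no_notation inner (infixl "\<bullet>" 70)
hide_const (open) Finite_Cartesian_Product.mat Finite_Cartesian_Product.vec

(* The species are 0, ..., m - 1, so that vectors and matrices indexed by species are the
   m-dimensional ones of Jordan_Normal_Form.  The sites are 1, ..., N. *)

definition positive_semidefinite :: "real mat \<Rightarrow> bool" where
  "positive_semidefinite A \<longleftrightarrow> square_mat A \<and> transpose_mat A = A \<and>
     (\<forall>v \<in> carrier_vec (dim_row A). 0 \<le> v \<bullet> (A *\<^sub>v v))"

text \<open>The argument \<open>D\<close> below is the variance profile matrix, whose entries are already the squares
  \<open>\<Delta>\<^sub>s\<^sub>t\<^sup>2\<close>, and \<open>L\<close> is the diagonal matrix of the species ratios.\<close>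

(* If the spectral radius is 0 (for positive ratios this means D = 0, no disorder), the
   critical inverse temperature is infinite; 0 powr (-1/2) would be 0. *)
definition beta_c :: "real mat \<Rightarrow> real mat \<Rightarrow> ereal" where
  "beta_c D L = (let r = spectral_radius (map_mat complex_of_real (D * L))
     in if r = 0 then \<infinity> else ereal (r powr (- 1 / 2)))"

definition alpha :: "real mat \<Rightarrow> real" where
  "alpha D = (if positive_semidefinite D then 1 else 2)"

definition beta_0 :: "real mat \<Rightarrow> real mat \<Rightarrow> ereal" where
  "beta_0 D L = beta_c D L / ereal (sqrt (4 * alpha D))"

definition overlap_fixed_point ::
    "nat \<Rightarrow> real mat \<Rightarrow> real mat \<Rightarrow> real \<Rightarrow> real \<Rightarrow> real vec \<Rightarrow> bool" where
  "overlap_fixed_point m D L \<beta> h q \<longleftrightarrow> q \<in> carrier_vec m \<and>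
     (\<forall>s<m. q $ s =
       (\<integral>x. (tanh (\<beta> * x * sqrt (((D * L) *\<^sub>v q) $ s) + h))\<^sup>2 \<partial>std_normal_distribution))"

definition species_partition :: "nat \<Rightarrow> (nat \<Rightarrow> real) \<Rightarrow> nat \<Rightarrow> (nat \<Rightarrow> nat set) \<Rightarrow> bool" where
  "species_partition m lam N I \<longleftrightarrow>
     disjoint_family_on I {..<m} \<and> (\<Union>s<m. I s) = {1..N} \<and>
     (\<forall>s<m. real (card (I s)) = lam s * real N)"

definition site_pairs :: "nat \<Rightarrow> (nat \<times> nat) set" where
  "site_pairs N = {(i, j). 1 \<le> i \<and> i < j \<and> j \<le> N}"

(* Variance v = 0 is allowed and gives the point mass at 0; normal_density would not. *)
definition centered_gaussian :: "real \<Rightarrow> real measure" where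
  "centered_gaussian v = distr std_normal_distribution borel (\<lambda>x. sqrt v * x)"

definition msk_disorder ::
    "nat \<Rightarrow> real mat \<Rightarrow> nat \<Rightarrow> (nat \<Rightarrow> nat set) \<Rightarrow> 'w measure \<Rightarrow> (nat \<Rightarrow> nat \<Rightarrow> 'w \<Rightarrow> real) \<Rightarrow> bool" where
  "msk_disorder m D N I M g \<longleftrightarrow>
     prob_space M \<and>
     prob_space.indep_vars M (\<lambda>_. borel) (\<lambda>(i, j). g i j) (site_pairs N) \<and>
     (\<forall>s<m. \<forall>t<m. \<forall>i\<in>I s. \<forall>j\<in>I t. i < j \<longrightarrow>
        distr M borel (g i j) = centered_gaussian (D $$ (s, t))) \<and>
     (\<forall>i\<in>{1..N}. \<forall>j\<in>{1..N}. \<forall>\<omega>\<in>space M. g j i \<omega> = g i j \<omega>)"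

definition spin_configs :: "nat \<Rightarrow> (nat \<Rightarrow> real) set" where
  "spin_configs N = {1..N} \<rightarrow>\<^sub>E {-1, 1}"

text \<open>In the following \<open>g\<close> is one realization of the disorder.\<close>

definition hamiltonian ::
    "real \<Rightarrow> real \<Rightarrow> nat \<Rightarrow> (nat \<Rightarrow> nat \<Rightarrow> real) \<Rightarrow> (nat \<Rightarrow> real) \<Rightarrow> real" where
  "hamiltonian \<beta> h N g \<sigma> =
     \<beta> / sqrt (real N) * (\<Sum>(i, j)\<in>site_pairs N. g i j * \<sigma> i * \<sigma> j) + h * (\<Sum>i=1..N. \<sigma> i)"

definition gibbs_weight ::
    "real \<Rightarrow> real \<Rightarrow> nat \<Rightarrow> (nat \<Rightarrow> nat \<Rightarrow> real) \<Rightarrow> (nat \<Rightarrow> real) \<Rightarrow> real" where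
  "gibbs_weight \<beta> h N g \<sigma> =
     exp (hamiltonian \<beta> h N g \<sigma>) / (\<Sum>\<tau>\<in>spin_configs N. exp (hamiltonian \<beta> h N g \<tau>))"

definition gibbs_mean ::
    "real \<Rightarrow> real \<Rightarrow> nat \<Rightarrow> (nat \<Rightarrow> nat \<Rightarrow> real) \<Rightarrow> ((nat \<Rightarrow> real) \<Rightarrow> real) \<Rightarrow> real" where
  "gibbs_mean \<beta> h N g f = (\<Sum>\<sigma>\<in>spin_configs N. f \<sigma> * gibbs_weight \<beta> h N g \<sigma>)"

definition magnetization :: "real \<Rightarrow> real \<Rightarrow> nat \<Rightarrow> (nat \<Rightarrow> nat \<Rightarrow> real) \<Rightarrow> nat \<Rightarrow> real" where
  "magnetization \<beta> h N g i = gibbs_mean \<beta> h N g (\<lambda>\<sigma>. \<sigma> i)"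

(* The Thouless-Anderson-Palmer effective field at a site i of species s. *)
definition tap_field ::
    "nat \<Rightarrow> real mat \<Rightarrow> real mat \<Rightarrow> real \<Rightarrow> real \<Rightarrow> real vec \<Rightarrow> nat \<Rightarrow> (nat \<Rightarrow> nat set) \<Rightarrow>
     (nat \<Rightarrow> nat \<Rightarrow> real) \<Rightarrow> nat \<Rightarrow> nat \<Rightarrow> real" where
  "tap_field m D L \<beta> h q N I g s i =
     \<beta> / sqrt (real N) * (\<Sum>t<m. \<Sum>j\<in>I t - {i}. g i j * magnetization \<beta> h N g j)
     + h
     - \<beta>\<^sup>2 * (((D * L) *\<^sub>v (Matrix.vec m (\<lambda>_. 1) - q)) $ s) * magnetization \<beta> h N g i"

end

(* Remove the site i and let <.> be the Gibbs mean of the remaining sites. The local field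
   l = beta / sqrt N * sum_j g_ij sigma_j at i is Gaussian and independent of <.>. With
   x = l - <l> and v = beta^2 (Delta^2 Lambda (1 - q))_s, the magnetization and the mean local
   field of the full system are explicit in terms of y(z) = <exp(z x - z^2 v / 2)> and of y'(z) at
   z = 1 and z = -1, and the equation is exact when y = 1 and y' = 0 at these points. The distance
   of y(z) from 1, for complex z, is controlled in L^2k by the covariances of x, that is by the
   deviations of the species overlaps from N lambda_t q_t; Cauchy's integral formula then gives
   the same bound for y'.

   The overlaps concentrate by Guerra's interpolation towards independent Gaussian fields of
   variance (Delta^2 Lambda q)_s, for which q is the mean overlap. Latala's argument bounds the
   derivative along the path by averages of the quadratic form of Delta^2 in the deviations, which
   is at most the spectral radius of Delta^2 Lambda times sum_t (deviation_t)^2 / lambda_t. *)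

theory Submission
  imports Defs "HOL-Complex_Analysis.Complex_Analysis" "HOL-Real_Asymp.Real_Asymp"
begin

section \<open>Gaussian measures\<close>

text \<open>The threshold is an account of one exponent. At the independent end of the path,
  \<open>exp (\<kappa> * Y)\<close>, with \<open>Y\<close> the normalised sum of squared deviations,
  has a bounded mean for \<open>\<kappa> < 1 / 2\<close>, because the product of two replica spins
  is sub-Gaussian with constant 1. The path costs
  \<open>2 * alpha * \<beta>\<^sup>2 * \<rho>\<close> of the exponent, so a positive exponent
  survives if \<open>4 * alpha * \<beta>\<^sup>2 * \<rho> < 1\<close>; with the spectral radius for
  \<open>\<rho>\<close> this is \<open>\<beta> < beta_0\<close>. The deviations then have
  \<open>2 k\<close>-th moments of order \<open>N ^ k\<close>, and the covariances carry a factor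
  \<open>1 / N\<close>: this is the rate. The obstacle is that \<open>y - 1\<close> has to be as
  small as the covariances, not as their square roots, in every moment. Its moments are therefore
  expanded exactly over replicas, and their lower orders are shown to cancel. A removed site leaves
  the scaling by \<open>N\<close> in place, so that a species count may be off by one, and
  \<open>h\<close> enters the bounds on the overlaps only through
  \<open>0 \<le> q \<le> 1\<close>.\<close>

lemma prob_space_centered_gaussian: "prob_space (centered_gaussian v)"
  unfolding centered_gaussian_def
  by (rule prob_space.prob_space_distr) (auto intro: prob_space_normal_density)

lemma sets_centered_gaussian [simp, measurable_cong]: "sets (centered_gaussian v) = sets borel"
  by (simp add: centered_gaussian_def)

lemma space_centered_gaussian [simp]: "space (centered_gaussian v) = UNIV"
  by (simp add: centered_gaussian_def)

lemma integral_centered_gaussian: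
  fixes f :: "real \<Rightarrow> 'b::{banach, second_countable_topology}"
  assumes [measurable]: "f \<in> borel_measurable borel"
  shows "(\<integral>x. f x \<partial>centered_gaussian v) = (\<integral>x. f (sqrt v * x) \<partial>std_normal_distribution)"
  unfolding centered_gaussian_def by (rule integral_distr) simp_all

lemma integrable_centered_gaussian_iff:
  fixes f :: "real \<Rightarrow> 'b::{banach, second_countable_topology}"
  assumes [measurable]: "f \<in> borel_measurable borel"
  shows "integrable (centered_gaussian v) f \<longleftrightarrow> integrable std_normal_distribution (\<lambda>x. f (sqrt v * x))"
  unfolding centered_gaussian_def by (rule integrable_distr_eq) simp_all

text \<open>Completing the square: an exponential tilt is a translation, so that exponential
  integrals reduce to integrals of the shifted density.\<close>

lemma std_normal_density_shift: "exp (a * x) * std_normal_density x = exp (a\<^sup>2 / 2) * std_normal_density (x - a)"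
  by (simp add: std_normal_density_def exp_add [symmetric] power2_eq_square field_simps)

text \<open>The real part of the exponent is absorbed by translating the density; the imaginary part
  then gives the characteristic function of the standard normal law.\<close>

lemma std_normal_exp_integrable: "integrable std_normal_distribution (\<lambda>x. exp (a * x))"
  and std_normal_complex_exp:
    "(\<integral>x. exp (Complex a b * of_real x) \<partial>std_normal_distribution) = exp ((Complex a b)\<^sup>2 / 2)"
proof -
  have "integrable lborel (\<lambda>x. std_normal_density (- a + 1 * x))"
    by (rule lborel_integrable_real_affine) simp_all
  then have "integrable lborel (\<lambda>x. exp (a\<^sup>2 / 2) * std_normal_density (x - a))"
    by simp
  then have "integrable lborel (\<lambda>x. std_normal_density x * exp (a * x))"
    by (simp only: std_normal_density_shift [symmetric] mult.commute [of "exp (a * _)"])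
  then show "integrable std_normal_distribution (\<lambda>x. exp (a * x))"
    by (simp add: integrable_density normal_density_nonneg)
next
  have "(\<integral>x. exp (Complex a b * of_real x) \<partial>std_normal_distribution)
      = (\<integral>x. std_normal_density x *\<^sub>R exp (Complex a b * of_real x) \<partial>lborel)"
    by (rule integral_density) (auto simp: normal_density_nonneg)
  also have "\<dots> = (\<integral>x. (exp (a\<^sup>2 / 2) * std_normal_density (x - a)) *\<^sub>R exp (\<i> * of_real (b * x)) \<partial>lborel)"
  proof (rule Bochner_Integration.integral_cong)
    fix x
    have "exp (Complex a b * of_real x) = of_real (exp (a * x)) * exp (\<i> * of_real (b * x))"
      by (simp add: exp_of_real [symmetric] exp_add [symmetric] complex_eq_iff Complex_eq algebra_simps)
    then show "std_normal_density x *\<^sub>R exp (Complex a b * of_real x) =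
        (exp (a\<^sup>2 / 2) * std_normal_density (x - a)) *\<^sub>R exp (\<i> * of_real (b * x))"
      using std_normal_density_shift [of a x] by (simp add: scaleR_conv_of_real mult_ac flip: of_real_mult)
  qed simp
  also have "\<dots> = (\<integral>x. (exp (a\<^sup>2 / 2) * std_normal_density x) *\<^sub>R exp (\<i> * of_real (b * (a + x))) \<partial>lborel)"
    by (subst lborel_integral_real_affine [where c = 1 and t = a]) simp_all
  also have "\<dots> = of_real (exp (a\<^sup>2 / 2)) * exp (\<i> * of_real (b * a)) *
      (\<integral>x. std_normal_density x *\<^sub>R exp (\<i> * of_real (b * x)) \<partial>lborel)"
    by (subst integral_mult_right_zero [symmetric])
       (rule Bochner_Integration.integral_cong,
         auto simp: scaleR_conv_of_real exp_add [symmetric] algebra_simps)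
  also have "(\<integral>x. std_normal_density x *\<^sub>R exp (\<i> * of_real (b * x)) \<partial>lborel)
      = (\<integral>x. exp (\<i> * of_real (b * x)) \<partial>std_normal_distribution)"
    by (rule integral_density [symmetric]) (auto simp: normal_density_nonneg)
  also have "\<dots> = char std_normal_distribution b"
    by (simp add: char_def)
  also have "\<dots> = of_real (exp (- (b\<^sup>2) / 2))"
    by (simp add: char_std_normal_distribution)
  also have "of_real (exp (a\<^sup>2 / 2)) * exp (\<i> * of_real (b * a)) * of_real (exp (- (b\<^sup>2) / 2))
      = exp ((Complex a b)\<^sup>2 / 2)"
    by (simp add: exp_of_real [symmetric] exp_add [symmetric] Complex_eq power2_eq_square algebra_simps
         add_divide_distrib diff_divide_distrib)
  finally show "(\<integral>x. exp (Complex a b * of_real x) \<partial>std_normal_distribution) = exp ((Complex a b)\<^sup>2 / 2)" .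
qed

lemma gaussian_exp_integrable: "integrable (centered_gaussian v) (\<lambda>x. exp (a * x))"
  using std_normal_exp_integrable [of "a * sqrt v"]
  by (simp add: integrable_centered_gaussian_iff mult.assoc)

lemma gaussian_exp_abs_integrable: "integrable (centered_gaussian v) (\<lambda>x. exp (a * \<bar>x\<bar>))"
proof (rule Bochner_Integration.integrable_bound)
  show "integrable (centered_gaussian v) (\<lambda>x. exp (a * x) + exp (- a * x))"
    by (intro Bochner_Integration.integrable_add gaussian_exp_integrable)
  show "AE x in centered_gaussian v. norm (exp (a * \<bar>x\<bar>)) \<le> norm (exp (a * x) + exp (- a * x))"
  proof (rule AE_I2)
    fix x
    have "exp (a * \<bar>x\<bar>) \<le> exp (a * x) + exp (- a * x)"
      by (cases "0 \<le> x") (auto simp: abs_if)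
    then show "norm (exp (a * \<bar>x\<bar>)) \<le> norm (exp (a * x) + exp (- a * x))"
      by simp
  qed
qed simp

lemma gaussian_complex_exp:
  fixes w :: complex
  assumes "0 \<le> v"
  shows "(\<integral>x. exp (w * of_real x) \<partial>centered_gaussian v) = exp (of_real v * w\<^sup>2 / 2)"
proof -
  obtain a b where ab: "of_real (sqrt v) * w = Complex a b"
    by (cases "of_real (sqrt v) * w")
  have "(\<integral>x. exp (w * of_real x) \<partial>centered_gaussian v)
      = (\<integral>x. exp (Complex a b * of_real x) \<partial>std_normal_distribution)"
    by (subst integral_centered_gaussian) (simp_all add: ab [symmetric] mult_ac)
  also have "\<dots> = exp ((of_real (sqrt v) * w)\<^sup>2 / 2)"
    unfolding ab by (rule std_normal_complex_exp)
  also have "(of_real (sqrt v) * w)\<^sup>2 = of_real v * w\<^sup>2"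
    using assms by (simp add: power_mult_distrib flip: of_real_power)
  finally show ?thesis .
qed

section \<open>Integration by parts and differentiation under the integral\<close>

text \<open>Stein's identity: \<open>x\<close> times the density is minus the derivative of the
  density, so the two sides differ by the integral over the line of the derivative of
  \<open>f\<close> times the density, and that product vanishes at infinity.\<close>

lemma std_normal_integration_by_parts:
  fixes f f' :: "real \<Rightarrow> real"
  assumes der: "\<And>x. (f has_real_derivative f' x) (at x)"
    and cont: "continuous_on UNIV f'"
    and bound: "\<And>x. \<bar>f x\<bar> \<le> K" "\<And>x. \<bar>f' x\<bar> \<le> K"
  shows "(\<integral>x. x * f x \<partial>std_normal_distribution) = (\<integral>x. f' x \<partial>std_normal_distribution)"
proof -
  let ?n = std_normal_density
  have contf: "continuous_on UNIV f"
    using der by (meson DERIV_continuous_on DERIV_subset top_greatest)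
  have [measurable]: "f \<in> borel_measurable borel" "f' \<in> borel_measurable borel"
    using contf cont by (auto intro: borel_measurable_continuous_onI)
  have dn: "(?n has_real_derivative - x * ?n x) (at x)" for x
    unfolding std_normal_density_def [abs_def]
    by (auto intro!: derivative_eq_intros simp: field_simps)
  have d: "((\<lambda>x. f x * ?n x) has_real_derivative (f' x * ?n x - x * f x * ?n x)) (at x)" for x
    by (rule derivative_eq_intros der dn refl | simp add: algebra_simps)+
  have int1: "integrable lborel (\<lambda>x. ?n x * f' x)"
  proof (rule Bochner_Integration.integrable_bound)
    show "integrable lborel (\<lambda>x. ?n x * K)" by simp
    show "AE x in lborel. norm (?n x * f' x) \<le> norm (?n x * K)"
      using bound(2) by (auto simp: abs_mult intro!: mult_left_mono order_trans [OF bound(2) abs_ge_self])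
  qed simp
  have int2: "integrable lborel (\<lambda>x. ?n x * (x * f x))"
  proof (rule Bochner_Integration.integrable_bound)
    show "integrable lborel (\<lambda>x. (?n x * \<bar>x\<bar>) * K)"
      using integrable_std_normal_moment_abs [of 1] by simp
    show "AE x in lborel. norm (?n x * (x * f x)) \<le> norm ((?n x * \<bar>x\<bar>) * K)"
      using bound(1) by (auto simp: abs_mult mult.assoc intro!: mult_left_mono order_trans [OF bound(1) abs_ge_self])
  qed simp
  \<comment> \<open>\<open>f\<close> is bounded, so the product vanishes along every filter on which
    \<open>x\<^sup>2\<close> tends to infinity; one proof serves both ends of the line.\<close>
  have lim: "((\<lambda>x. f x * ?n x) \<longlongrightarrow> 0) F" if "filterlim (\<lambda>x::real. x\<^sup>2 / 2) at_top F" for F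
  proof -
    have "((\<lambda>x::real. exp (- (x\<^sup>2 / 2))) \<longlongrightarrow> 0) F"
      by (rule filterlim_compose [OF exp_at_bot])
         (use that in \<open>simp add: filterlim_uminus_at_top [symmetric] filterlim_uminus_at_bot\<close>)
    then have "((\<lambda>x. K * (1 / sqrt (2 * pi) * exp (- (x\<^sup>2 / 2)))) \<longlongrightarrow> K * (1 / sqrt (2 * pi) * 0)) F"
      by (intro tendsto_intros)
    then have *: "((\<lambda>x. K * ?n x) \<longlongrightarrow> 0) F"
      by (simp add: std_normal_density_def)
    show ?thesis
      by (rule Lim_null_comparison [OF always_eventually *])
         (auto simp: abs_mult intro!: mult_right_mono bound)
  qed
  have "(LBINT x=-\<infinity>..\<infinity>. f' x * ?n x - x * f x * ?n x) = 0 - 0"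
  proof (rule interval_integral_FTC_integrable)
    show "((\<lambda>x. f x * ?n x) has_vector_derivative f' x * ?n x - x * f x * ?n x) (at x)" for x
      using d by (simp add: has_real_derivative_iff_has_vector_derivative)
    show "isCont (\<lambda>x. f' x * ?n x - x * f x * ?n x) x" for x
      unfolding std_normal_density_def
      using cont contf by (auto intro!: continuous_intros simp: continuous_on_eq_continuous_at)
    show "set_integrable lborel (einterval (-\<infinity>) \<infinity>) (\<lambda>x. f' x * ?n x - x * f x * ?n x)"
      using Bochner_Integration.integrable_diff [OF int1 int2]
      by (simp add: set_integrable_def mult_ac)
    show "(((\<lambda>x. f x * ?n x) \<circ> real_of_ereal) \<longlongrightarrow> 0) (at_right (-\<infinity>))"
      unfolding ereal_tendsto_simps
      by (rule lim) real_asymp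
    show "(((\<lambda>x. f x * ?n x) \<circ> real_of_ereal) \<longlongrightarrow> 0) (at_left \<infinity>)"
      unfolding ereal_tendsto_simps
      by (rule lim) real_asymp
  qed simp
  then have "(\<integral>x. ?n x * f' x - ?n x * (x * f x) \<partial>lborel) = 0"
    by (simp add: interval_lebesgue_integral_def set_lebesgue_integral_def mult_ac)
  then have "(\<integral>x. ?n x * f' x \<partial>lborel) = (\<integral>x. ?n x * (x * f x) \<partial>lborel)"
    by (simp add: Bochner_Integration.integral_diff [OF int1 int2])
  then show ?thesis
    by (simp add: integral_density normal_density_nonneg)
qed

text \<open>Scaling of the standard case. Multiplying by \<open>sqrt v\<close>, never dividing,
  covers the point mass at \<open>v = 0\<close>.\<close>

lemma gaussian_integration_by_parts:
  fixes f f' :: "real \<Rightarrow> real"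
  assumes "0 \<le> v"
    and der: "\<And>x. (f has_real_derivative f' x) (at x)"
    and cont: "continuous_on UNIV f'"
    and bound: "\<And>x. \<bar>f x\<bar> \<le> K" "\<And>x. \<bar>f' x\<bar> \<le> K"
  shows "(\<integral>x. x * f x \<partial>centered_gaussian v) = v * (\<integral>x. f' x \<partial>centered_gaussian v)"
proof -
  have contf: "continuous_on UNIV f"
    using der by (meson DERIV_continuous_on DERIV_subset top_greatest)
  have [measurable]: "f \<in> borel_measurable borel" "f' \<in> borel_measurable borel"
    using contf cont by (auto intro: borel_measurable_continuous_onI)
  have K: "0 \<le> sqrt v * K" "0 \<le> K"
    using assms(1) order_trans [OF abs_ge_zero bound(1)] by auto
  have "(\<integral>x. x * f (sqrt v * x) \<partial>std_normal_distribution)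
      = (\<integral>x. sqrt v * f' (sqrt v * x) \<partial>std_normal_distribution)"
  proof (rule std_normal_integration_by_parts)
    show "((\<lambda>x. f (sqrt v * x)) has_real_derivative sqrt v * f' (sqrt v * x)) (at x)" for x
    proof -
      have "((\<lambda>x. sqrt v * x) has_real_derivative sqrt v) (at x)"
        by (auto intro!: derivative_eq_intros)
      from DERIV_chain2 [OF der this] show ?thesis
        by (simp add: mult.commute)
    qed
    show "continuous_on UNIV (\<lambda>x. sqrt v * f' (sqrt v * x))"
      by (intro continuous_intros continuous_on_compose2 [OF cont]) auto
    \<comment> \<open>A single constant has to bound the rescaled function and its derivative, which
      has gained a factor \<open>sqrt v\<close>.\<close>
    show "\<bar>f (sqrt v * x)\<bar> \<le> (1 + sqrt v) * K" for x
      using bound(1) [of "sqrt v * x"] K by (simp add: distrib_right)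
    show "\<bar>sqrt v * f' (sqrt v * x)\<bar> \<le> (1 + sqrt v) * K" for x
    proof -
      have "\<bar>sqrt v * f' (sqrt v * x)\<bar> \<le> sqrt v * K"
        using assms(1) by (simp add: abs_mult bound(2) mult_left_mono)
      then show ?thesis
        using K(2) by (simp add: distrib_right)
    qed
  qed
  then have "sqrt v * (\<integral>x. x * f (sqrt v * x) \<partial>std_normal_distribution)
      = sqrt v * sqrt v * (\<integral>x. f' (sqrt v * x) \<partial>std_normal_distribution)"
    by simp
  then show ?thesis
    using assms(1) by (simp add: integral_centered_gaussian mult.assoc flip: Bochner_Integration.integral_mult_right_zero)
qed

text \<open>Dominated convergence along an arbitrary sequence tending to \<open>t\<close>; the mean
  value inequality transfers the bound \<open>B\<close> from the derivative to the difference
  quotients.\<close>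

lemma has_real_derivative_integral:
  fixes F F' :: "real \<Rightarrow> 'a \<Rightarrow> real"
  assumes t: "t \<in> {a<..<b}"
    and der: "\<And>s y. s \<in> {a<..<b} \<Longrightarrow> y \<in> space M \<Longrightarrow> ((\<lambda>s. F s y) has_real_derivative F' s y) (at s)"
    and int: "\<And>s. s \<in> {a<..<b} \<Longrightarrow> integrable M (F s)"
    and meas: "F' t \<in> borel_measurable M"
    and bound: "\<And>s y. s \<in> {a<..<b} \<Longrightarrow> y \<in> space M \<Longrightarrow> \<bar>F' s y\<bar> \<le> B y"
    and B: "integrable M B"
  shows "((\<lambda>s. \<integral>y. F s y \<partial>M) has_real_derivative (\<integral>y. F' t y \<partial>M)) (at t)"
  unfolding has_field_derivative_iff tendsto_at_iff_sequentially
proof (intro allI impI)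
  fix X :: "nat \<Rightarrow> real"
  assume X: "\<forall>i. X i \<in> UNIV - {t}" and lim: "X \<longlonglongrightarrow> t"
  have ev: "eventually (\<lambda>i. X i \<in> {a<..<b}) sequentially"
    by (rule topological_tendstoD [OF lim]) (use t in auto)
  \<comment> \<open>The sequence may lie outside the interval finitely often; the value 0 there
    keeps measurability and domination valid for every index.\<close>
  define Q where "Q i y = (if X i \<in> {a<..<b} then (F (X i) y - F t y) / (X i - t) else 0)" for i y
  have "(\<lambda>i. \<integral>y. Q i y \<partial>M) \<longlonglongrightarrow> (\<integral>y. F' t y \<partial>M)"
  proof (rule integral_dominated_convergence [where w = B])
    show "F' t \<in> borel_measurable M" "integrable M B" by fact+
    show "Q i \<in> borel_measurable M" for i
    proof (cases "X i \<in> {a<..<b}")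
      case True
      note [measurable] = borel_measurable_integrable [OF int [OF True]] borel_measurable_integrable [OF int [OF t]]
      have "Q i = (\<lambda>y. (F (X i) y - F t y) / (X i - t))"
        using True by (auto simp: Q_def)
      then show ?thesis by simp
    next
      case False
      then have "Q i = (\<lambda>y. 0)" by (auto simp: Q_def)
      then show ?thesis by simp
    qed
    show "AE y in M. (\<lambda>i. Q i y) \<longlonglongrightarrow> F' t y"
    proof (rule AE_I2)
      fix y assume y: "y \<in> space M"
      have "((\<lambda>x. (F x y - F t y) / (x - t)) \<circ> X) \<longlonglongrightarrow> F' t y"
        using der [OF t y] X lim unfolding has_field_derivative_iff tendsto_at_iff_sequentially by blast
      then show "(\<lambda>i. Q i y) \<longlonglongrightarrow> F' t y"
      proof (rule Lim_transform_eventually)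
        show "\<forall>\<^sub>F i in sequentially. ((\<lambda>x. (F x y - F t y) / (x - t)) \<circ> X) i = Q i y"
          using ev by eventually_elim (simp add: Q_def)
      qed
    qed
    show "AE y in M. norm (Q i y) \<le> B y" for i
    proof (rule AE_I2)
      fix y assume y: "y \<in> space M"
      have B0: "0 \<le> B y" using bound [OF t y] by linarith
      show "norm (Q i y) \<le> B y"
      proof (cases "X i \<in> {a<..<b}")
        case True
        have "norm (F (X i) y - F t y) \<le> B y * norm (X i - t)"
        proof (rule field_differentiable_bound [where S = "{a<..<b}"])
          show "((\<lambda>s. F s y) has_field_derivative F' s y) (at s within {a<..<b})" if "s \<in> {a<..<b}" for s
            using der [OF that y] by (rule has_field_derivative_at_within)
          show "norm (F' s y) \<le> B y" if "s \<in> {a<..<b}" for s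
            using bound [OF that y] by simp
        qed (use True t in auto)
        moreover have "X i \<noteq> t" using X by auto
        ultimately show ?thesis
          using True by (simp add: Q_def divide_le_eq)
      next
        case False
        then show ?thesis by (simp only: Q_def if_False norm_zero B0)
      qed
    qed
  qed
  moreover have "eventually (\<lambda>i. (\<integral>y. Q i y \<partial>M)
      = ((\<lambda>s. ((\<integral>y. F s y \<partial>M) - (\<integral>y. F t y \<partial>M)) / (s - t)) \<circ> X) i) sequentially"
    using ev
  proof eventually_elim
    case (elim i)
    then have "(\<integral>y. Q i y \<partial>M) = (\<integral>y. (F (X i) y - F t y) / (X i - t) \<partial>M)"
      by (simp add: Q_def)
    also have "\<dots> = ((\<integral>y. F (X i) y \<partial>M) - (\<integral>y. F t y \<partial>M)) / (X i - t)"
      using int [OF elim] int [OF t] by simp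
    finally show ?case by simp
  qed
  ultimately show "((\<lambda>s. ((\<integral>y. F s y \<partial>M) - (\<integral>y. F t y \<partial>M)) / (s - t)) \<circ> X) \<longlonglongrightarrow> (\<integral>y. F' t y \<partial>M)"
    by (rule Lim_transform_eventually)
qed

section \<open>Finite products of Gaussian measures\<close>

abbreviation gaussian_product :: "'j set \<Rightarrow> ('j \<Rightarrow> real) \<Rightarrow> ('j \<Rightarrow> real) measure" where
  "gaussian_product J v \<equiv> PiM J (\<lambda>j. centered_gaussian (v j))"

lemma product_prob_space_gaussian: "product_prob_space (\<lambda>j. centered_gaussian (v j))"
  by (intro product_prob_spaceI prob_space_centered_gaussian)

lemma prob_space_gaussian_product: "prob_space (gaussian_product J v)"
  by (intro prob_space_PiM prob_space_centered_gaussian)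

lemma gaussian_product_component:
  "j \<in> J \<Longrightarrow> (\<lambda>y. y j) \<in> borel_measurable (gaussian_product J v)"
  using measurable_component_singleton [of j J "\<lambda>j. centered_gaussian (v j)"]
  by (simp cong: measurable_cong_sets)

text \<open>Supplies the dominating functions for everything that grows at most exponentially in the
  coordinates.\<close>

lemma gaussian_product_integrable_exp_abs:
  assumes "finite J"
  shows "integrable (gaussian_product J v) (\<lambda>y. exp (a * (\<Sum>j\<in>J. \<bar>y j\<bar>)))"
proof -
  interpret product_prob_space "\<lambda>j. centered_gaussian (v j)"
    by (rule product_prob_space_gaussian)
  have "integrable (gaussian_product J v) (\<lambda>y. \<Prod>j\<in>J. exp (a * \<bar>y j\<bar>))"
    using assms by (intro product_integrable_prod gaussian_exp_abs_integrable)
  then show ?thesis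
    using assms by (simp add: exp_sum sum_distrib_left)
qed

lemma gaussian_product_integrable_abs:
  assumes "finite J"
  shows "integrable (gaussian_product J v) (\<lambda>y. \<Sum>j\<in>J. \<bar>y j\<bar>)"
proof (rule Bochner_Integration.integrable_bound)
  show "integrable (gaussian_product J v) (\<lambda>y. exp (1 * (\<Sum>j\<in>J. \<bar>y j\<bar>)))"
    by (rule gaussian_product_integrable_exp_abs [OF assms])
  have "\<bar>x\<bar> \<le> exp x" if "0 \<le> x" for x :: real
    using that exp_ge_add_one_self [of x] by linarith
  then show "AE y in gaussian_product J v. norm (\<Sum>j\<in>J. \<bar>y j\<bar>) \<le> norm (exp (1 * (\<Sum>j\<in>J. \<bar>y j\<bar>)))"
    by (auto intro!: AE_I2 simp: sum_nonneg)
qed (intro borel_measurable_sum borel_measurable_abs gaussian_product_component)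

lemma gaussian_product_complex_exp:
  fixes w :: "'j \<Rightarrow> complex"
  assumes "finite J" and "\<And>j. j \<in> J \<Longrightarrow> 0 \<le> v j"
  shows "(\<integral>y. exp (\<Sum>j\<in>J. w j * of_real (y j)) \<partial>gaussian_product J v) = exp ((\<Sum>j\<in>J. of_real (v j) * (w j)\<^sup>2) / 2)"
proof -
  interpret product_prob_space "\<lambda>j. centered_gaussian (v j)"
    by (rule product_prob_space_gaussian)
  have "(\<integral>y. exp (\<Sum>j\<in>J. w j * of_real (y j)) \<partial>gaussian_product J v)
      = (\<integral>y. (\<Prod>j\<in>J. exp (w j * of_real (y j))) \<partial>gaussian_product J v)"
    by (simp only: exp_sum [OF assms(1)])
  also have "\<dots> = (\<Prod>j\<in>J. \<integral>x. exp (w j * of_real x) \<partial>centered_gaussian (v j))"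
  proof (rule product_integral_prod [OF assms(1)])
    fix j
    show "integrable (centered_gaussian (v j)) (\<lambda>x. exp (w j * complex_of_real x))"
    proof (rule Bochner_Integration.integrable_bound [OF gaussian_exp_integrable [of _ "Re (w j)"]])
      have "(\<lambda>x. exp (w j * complex_of_real x)) \<in> borel_measurable borel"
        by (intro borel_measurable_continuous_onI continuous_intros)
      then show "(\<lambda>x. exp (w j * complex_of_real x)) \<in> borel_measurable (centered_gaussian (v j))"
        by (simp only: measurable_cong_sets [OF sets_centered_gaussian refl])
      show "AE x in centered_gaussian (v j). norm (exp (w j * complex_of_real x)) \<le> norm (exp (Re (w j) * x))"
        by (rule AE_I2) (simp only: norm_exp_eq_Re, simp)
    qed
  qed
  also have "\<dots> = (\<Prod>j\<in>J. exp (of_real (v j) * (w j)\<^sup>2 / 2))"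
    by (rule prod.cong [OF refl]) (rule gaussian_complex_exp [OF assms(2)])
  also have "\<dots> = exp ((\<Sum>j\<in>J. of_real (v j) * (w j)\<^sup>2) / 2)"
    by (simp only: exp_sum [OF assms(1)] sum_divide_distrib)
  finally show ?thesis .
qed

lemma gaussian_product_integrable_component_mult:
  assumes "finite J" "j \<in> J" and [measurable]: "G \<in> borel_measurable (gaussian_product J v)"
    and bound: "\<And>y. \<bar>G y\<bar> \<le> K"
  shows "integrable (gaussian_product J v) (\<lambda>y. y j * G y)"
proof (rule Bochner_Integration.integrable_bound)
  show "integrable (gaussian_product J v) (\<lambda>y. (\<Sum>j\<in>J. \<bar>y j\<bar>) * K)"
    using gaussian_product_integrable_abs [OF assms(1)] by simp
  have "\<bar>y j\<bar> * \<bar>G y\<bar> \<le> (\<Sum>j\<in>J. \<bar>y j\<bar>) * \<bar>K\<bar>" for y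
  proof (rule mult_mono)
    show "\<bar>y j\<bar> \<le> (\<Sum>j\<in>J. \<bar>y j\<bar>)"
      by (rule member_le_sum [where f = "\<lambda>j. \<bar>y j\<bar>"]) (use assms(1,2) in simp_all)
    show "\<bar>G y\<bar> \<le> \<bar>K\<bar>"
      using bound [of y] by linarith
  qed (simp_all add: sum_nonneg)
  then show "AE y in gaussian_product J v. norm (y j * G y) \<le> norm ((\<Sum>j\<in>J. \<bar>y j\<bar>) * K)"
    by (intro AE_I2) (simp add: abs_mult sum_nonneg)
qed (intro borel_measurable_times gaussian_product_component assms)

text \<open>Fubini isolates the coordinate \<open>j\<close>, and the one-dimensional identity
  applies for each fixed value of the others.\<close>

lemma gaussian_product_integration_by_parts:
  fixes G G' :: "('j \<Rightarrow> real) \<Rightarrow> real"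
  assumes J: "finite J" "j \<in> J" and v: "0 \<le> v j"
    and meas: "G \<in> borel_measurable (gaussian_product J v)" "G' \<in> borel_measurable (gaussian_product J v)"
    and der: "\<And>y u. ((\<lambda>u. G (y(j := u))) has_real_derivative G' (y(j := u))) (at u)"
    and cont: "\<And>y. continuous_on UNIV (\<lambda>u. G' (y(j := u)))"
    and bound: "\<And>y. \<bar>G y\<bar> \<le> K" "\<And>y. \<bar>G' y\<bar> \<le> K"
  shows "(\<integral>y. y j * G y \<partial>gaussian_product J v) = v j * (\<integral>y. G' y \<partial>gaussian_product J v)"
proof -
  interpret product_prob_space "\<lambda>j. centered_gaussian (v j)"
    by (rule product_prob_space_gaussian)
  interpret GP: prob_space "gaussian_product J v"
    by (rule prob_space_gaussian_product)
  have J': "insert j (J - {j}) = J" "finite (J - {j})" "j \<notin> J - {j}"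
    using J by (simp_all add: insert_absorb)
  have "(\<integral>y. y j * G y \<partial>gaussian_product J v)
      = (\<integral>x. (\<integral>u. (x(j := u)) j * G (x(j := u)) \<partial>centered_gaussian (v j)) \<partial>gaussian_product (J - {j}) v)"
    using product_integral_insert [OF J'(2,3), of "\<lambda>y. y j * G y"]
      gaussian_product_integrable_component_mult [OF J meas(1) bound(1)]
    unfolding J'(1) by simp
  also have "\<dots> = (\<integral>x. v j * (\<integral>u. G' (x(j := u)) \<partial>centered_gaussian (v j)) \<partial>gaussian_product (J - {j}) v)"
  proof (rule Bochner_Integration.integral_cong [OF refl])
    fix x
    show "(\<integral>u. (x(j := u)) j * G (x(j := u)) \<partial>centered_gaussian (v j))
        = v j * (\<integral>u. G' (x(j := u)) \<partial>centered_gaussian (v j))"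
      unfolding fun_upd_same by (rule gaussian_integration_by_parts [OF v der cont bound])
  qed
  also have "\<dots> = v j * (\<integral>x. (\<integral>u. G' (x(j := u)) \<partial>centered_gaussian (v j)) \<partial>gaussian_product (J - {j}) v)"
    by simp
  also have "(\<integral>x. (\<integral>u. G' (x(j := u)) \<partial>centered_gaussian (v j)) \<partial>gaussian_product (J - {j}) v)
      = (\<integral>y. G' y \<partial>gaussian_product J v)"
    using product_integral_insert [OF J'(2,3), of G'] GP.integrable_const_bound [of G' K] meas(2) bound(2)
    unfolding J'(1) by simp
  finally show ?thesis .
qed

section \<open>Gaussian interpolation of Gibbs averages\<close>

definition gibbs :: "'s set \<Rightarrow> ('s \<Rightarrow> real) \<Rightarrow> 's \<Rightarrow> real" where
  "gibbs S H \<sigma> = exp (H \<sigma>) / (\<Sum>\<tau>\<in>S. exp (H \<tau>))"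

lemma partition_function_pos: "finite S \<Longrightarrow> S \<noteq> {} \<Longrightarrow> 0 < (\<Sum>\<tau>\<in>S. exp (H \<tau> :: real))"
  by (simp add: sum_pos)

lemma gibbs_nonneg: "0 \<le> gibbs S H \<sigma>"
  by (simp add: gibbs_def sum_nonneg)

lemma gibbs_sum: "finite S \<Longrightarrow> S \<noteq> {} \<Longrightarrow> (\<Sum>\<sigma>\<in>S. gibbs S H \<sigma>) = 1"
  using partition_function_pos [of S H] by (simp add: gibbs_def flip: sum_divide_distrib)

text \<open>The logarithmic derivative of a Gibbs weight is the derivative of the Hamiltonian minus
  its Gibbs mean.\<close>

lemma gibbs_has_derivative:
  assumes S: "finite S" "S \<noteq> {}" "\<sigma> \<in> S"
    and der: "\<And>\<tau>. \<tau> \<in> S \<Longrightarrow> ((\<lambda>u. H u \<tau>) has_real_derivative A \<tau>) (at u)"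
  shows "((\<lambda>u. gibbs S (H u) \<sigma>) has_real_derivative
      gibbs S (H u) \<sigma> * (A \<sigma> - (\<Sum>\<tau>\<in>S. gibbs S (H u) \<tau> * A \<tau>))) (at u)"
proof -
  let ?Z = "\<Sum>\<tau>\<in>S. exp (H u \<tau>)"
  have Z: "?Z \<noteq> 0" using partition_function_pos [OF S(1,2), of "H u"] by simp
  have dZ: "((\<lambda>u. \<Sum>\<tau>\<in>S. exp (H u \<tau>)) has_real_derivative (\<Sum>\<tau>\<in>S. exp (H u \<tau>) * A \<tau>)) (at u)"
    by (intro DERIV_sum DERIV_fun_exp der)
  have "((\<lambda>u. exp (H u \<sigma>) / (\<Sum>\<tau>\<in>S. exp (H u \<tau>))) has_real_derivative
      (exp (H u \<sigma>) * A \<sigma> * ?Z - exp (H u \<sigma>) * (\<Sum>\<tau>\<in>S. exp (H u \<tau>) * A \<tau>)) / (?Z * ?Z)) (at u)"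
    by (rule DERIV_divide [OF DERIV_fun_exp [OF der [OF S(3)]] dZ Z])
  moreover have "(\<Sum>\<tau>\<in>S. gibbs S (H u) \<tau> * A \<tau>) = (\<Sum>\<tau>\<in>S. exp (H u \<tau>) * A \<tau>) / ?Z"
    by (simp add: gibbs_def sum_divide_distrib)
  moreover have "(e * x * z - e * w) / (z * z) = e / z * (x - w / z)" if "z \<noteq> 0" for e x z w :: real
    using that by (simp add: field_simps)
  ultimately show ?thesis
    using Z unfolding gibbs_def [of S "H u" \<sigma>] by (simp add: gibbs_def [abs_def])
qed

lemma gibbs_continuous_on:
  assumes "finite S" "S \<noteq> {}" "\<And>\<tau>. \<tau> \<in> S \<Longrightarrow> continuous_on T (\<lambda>u. H u \<tau>)" "\<sigma> \<in> S"
  shows "continuous_on T (\<lambda>u. gibbs S (H u) \<sigma>)"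
  unfolding gibbs_def
  using assms partition_function_pos [OF assms(1,2)]
  by (intro continuous_intros) (auto simp: less_imp_neq [symmetric])

lemma gibbs_measurable:
  assumes "finite S" "\<And>\<tau>. \<tau> \<in> S \<Longrightarrow> (\<lambda>u. H u \<tau>) \<in> borel_measurable M" "\<sigma> \<in> S"
  shows "(\<lambda>u. gibbs S (H u) \<sigma>) \<in> borel_measurable M"
  unfolding gibbs_def using assms
  by (intro borel_measurable_divide borel_measurable_sum measurable_compose [OF _ borel_measurable_exp])

text \<open>A Hamiltonian linear in independent Gaussian coordinates. Those marked by
  \<open>up\<close> are switched on with \<open>sqrt t\<close> and the others off with
  \<open>sqrt (1 - t)\<close>, so that variances move linearly in time. \<open>A_square\<close>
  holds for multiples of products of signs and removes the diagonal terms from second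
  derivatives.\<close>

locale gaussian_interpolation =
  fixes S :: "'s set" and J :: "'j set" and v :: "'j \<Rightarrow> real" and A :: "'j \<Rightarrow> 's \<Rightarrow> real"
    and b :: "'s \<Rightarrow> real" and up :: "'j \<Rightarrow> bool" and \<alpha> :: "'j \<Rightarrow> real" and a :: real
  assumes S: "finite S" "S \<noteq> {}" and J: "finite J" and v: "\<And>j. j \<in> J \<Longrightarrow> 0 \<le> v j"
    and A_bound: "\<And>j \<sigma>. j \<in> J \<Longrightarrow> \<sigma> \<in> S \<Longrightarrow> \<bar>A j \<sigma>\<bar> \<le> a"
    and A_square: "\<And>j \<sigma>. j \<in> J \<Longrightarrow> \<sigma> \<in> S \<Longrightarrow> A j \<sigma> * A j \<sigma> = \<alpha> j"
begin

definition coef :: "'j \<Rightarrow> real \<Rightarrow> real" where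
  "coef j t = (if up j then sqrt t else sqrt (1 - t))"

definition coef' :: "'j \<Rightarrow> real \<Rightarrow> real" where
  "coef' j t = (if up j then 1 / (2 * sqrt t) else - 1 / (2 * sqrt (1 - t)))"

text \<open>The time derivative of \<open>(coef j t)\<^sup>2\<close>, that is, the direction in
  which the variance of the coordinate moves.\<close>

definition sign :: "'j \<Rightarrow> real" where "sign j = (if up j then 1 else - 1)"

definition X :: "real \<Rightarrow> ('j \<Rightarrow> real) \<Rightarrow> 's \<Rightarrow> real" where
  "X t y \<sigma> = b \<sigma> + (\<Sum>j\<in>J. coef j t * y j * A j \<sigma>)"

definition p :: "real \<Rightarrow> ('j \<Rightarrow> real) \<Rightarrow> 's \<Rightarrow> real" where
  "p t y = gibbs S (X t y)"

definition mean :: "real \<Rightarrow> ('j \<Rightarrow> real) \<Rightarrow> 'j \<Rightarrow> real" where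
  "mean t y j = (\<Sum>\<rho>\<in>S. p t y \<rho> * A j \<rho>)"

definition avg2 :: "('s \<Rightarrow> 's \<Rightarrow> real) \<Rightarrow> real \<Rightarrow> ('j \<Rightarrow> real) \<Rightarrow> real" where
  "avg2 f t y = (\<Sum>\<sigma>\<in>S. \<Sum>\<tau>\<in>S. f \<sigma> \<tau> * (p t y \<sigma> * p t y \<tau>))"

text \<open>Since \<open>A j \<sigma>\<^sup>2\<close> does not depend on \<open>\<sigma>\<close>, the first two derivatives of \<open>avg2 f t\<close> in the
  coordinate \<open>j\<close> are \<open>coef j t * D f j t\<close> and \<open>(coef j t)\<^sup>2 * DD f j t\<close>.\<close>

definition D :: "('s \<Rightarrow> 's \<Rightarrow> real) \<Rightarrow> 'j \<Rightarrow> real \<Rightarrow> ('j \<Rightarrow> real) \<Rightarrow> real" where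
  "D f j t y = (\<Sum>\<sigma>\<in>S. \<Sum>\<tau>\<in>S. f \<sigma> \<tau> * (p t y \<sigma> * p t y \<tau> * (A j \<sigma> + A j \<tau> - 2 * mean t y j)))"

definition DD :: "('s \<Rightarrow> 's \<Rightarrow> real) \<Rightarrow> 'j \<Rightarrow> real \<Rightarrow> ('j \<Rightarrow> real) \<Rightarrow> real" where
  "DD f j t y = (\<Sum>\<sigma>\<in>S. \<Sum>\<tau>\<in>S. f \<sigma> \<tau> * (p t y \<sigma> * p t y \<tau> *
     (2 * (A j \<sigma> * A j \<tau>) - 4 * mean t y j * (A j \<sigma> + A j \<tau>) + 6 * (mean t y j)\<^sup>2)))"

lemma p_nonneg: "0 \<le> p t y \<sigma>" by (simp add: p_def gibbs_nonneg)
lemma p_sum: "(\<Sum>\<sigma>\<in>S. p t y \<sigma>) = 1" using S by (simp add: p_def gibbs_sum)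

lemma mean_bound: assumes "j \<in> J" shows "\<bar>mean t y j\<bar> \<le> a"
proof -
  have "\<bar>mean t y j\<bar> \<le> (\<Sum>\<rho>\<in>S. \<bar>p t y \<rho> * A j \<rho>\<bar>)"
    unfolding mean_def by (rule sum_abs)
  also have "\<dots> \<le> (\<Sum>\<rho>\<in>S. p t y \<rho> * a)"
    using A_bound [OF assms] by (intro sum_mono) (simp add: abs_mult p_nonneg mult_left_mono)
  also have "\<dots> = a"
    by (simp add: p_sum flip: sum_distrib_right)
  finally show ?thesis .
qed

lemma X_measurable: "(\<lambda>y. X t y \<sigma>) \<in> borel_measurable (gaussian_product J v)"
  unfolding X_def
  by (intro borel_measurable_add borel_measurable_const borel_measurable_sum borel_measurable_times
      gaussian_product_component)

lemma p_measurable: "\<sigma> \<in> S \<Longrightarrow> (\<lambda>y. p t y \<sigma>) \<in> borel_measurable (gaussian_product J v)"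
  unfolding p_def using S(1) by (intro gibbs_measurable X_measurable)

lemma mean_measurable: "(\<lambda>y. mean t y j) \<in> borel_measurable (gaussian_product J v)"
  unfolding mean_def by (intro borel_measurable_sum borel_measurable_times borel_measurable_const p_measurable)

lemma avg2_measurable: "avg2 f t \<in> borel_measurable (gaussian_product J v)"
  unfolding avg2_def [abs_def]
  by (intro borel_measurable_sum borel_measurable_times borel_measurable_const p_measurable)

lemma D_measurable: "D f j t \<in> borel_measurable (gaussian_product J v)"
  unfolding D_def [abs_def]
  by (intro borel_measurable_sum borel_measurable_times borel_measurable_add borel_measurable_diff
      borel_measurable_const p_measurable mean_measurable)

lemma DD_measurable: "DD f j t \<in> borel_measurable (gaussian_product J v)"
  unfolding DD_def [abs_def]
  by (intro borel_measurable_sum borel_measurable_times borel_measurable_add borel_measurable_diff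
      borel_measurable_power borel_measurable_const p_measurable mean_measurable)

lemma double_sum_bound:
  assumes f: "\<And>\<sigma> \<tau>. \<sigma> \<in> S \<Longrightarrow> \<tau> \<in> S \<Longrightarrow> \<bar>f \<sigma> \<tau>\<bar> \<le> B"
    and g: "\<And>\<sigma> \<tau>. \<sigma> \<in> S \<Longrightarrow> \<tau> \<in> S \<Longrightarrow> \<bar>g \<sigma> \<tau>\<bar> \<le> K"
  shows "\<bar>\<Sum>\<sigma>\<in>S. \<Sum>\<tau>\<in>S. f \<sigma> \<tau> * (p t y \<sigma> * p t y \<tau> * g \<sigma> \<tau>)\<bar> \<le> B * K"
proof -
  have "\<bar>\<Sum>\<sigma>\<in>S. \<Sum>\<tau>\<in>S. f \<sigma> \<tau> * (p t y \<sigma> * p t y \<tau> * g \<sigma> \<tau>)\<bar>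
      \<le> (\<Sum>\<sigma>\<in>S. \<Sum>\<tau>\<in>S. \<bar>f \<sigma> \<tau> * (p t y \<sigma> * p t y \<tau> * g \<sigma> \<tau>)\<bar>)"
    by (rule order_trans [OF sum_abs sum_mono [OF sum_abs]])
  also have "\<dots> \<le> (\<Sum>\<sigma>\<in>S. \<Sum>\<tau>\<in>S. p t y \<sigma> * p t y \<tau> * (B * K))"
  proof (intro sum_mono)
    fix \<sigma> \<tau> assume st: "\<sigma> \<in> S" "\<tau> \<in> S"
    have "\<bar>f \<sigma> \<tau>\<bar> * \<bar>g \<sigma> \<tau>\<bar> \<le> B * K"
      using f [OF st] g [OF st] by (intro mult_mono) linarith+
    then have "p t y \<sigma> * p t y \<tau> * (\<bar>f \<sigma> \<tau>\<bar> * \<bar>g \<sigma> \<tau>\<bar>) \<le> p t y \<sigma> * p t y \<tau> * (B * K)"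
      by (intro mult_left_mono mult_nonneg_nonneg p_nonneg)
    then show "\<bar>f \<sigma> \<tau> * (p t y \<sigma> * p t y \<tau> * g \<sigma> \<tau>)\<bar> \<le> p t y \<sigma> * p t y \<tau> * (B * K)"
      by (simp add: abs_mult p_nonneg mult_ac)
  qed
  also have "\<dots> = B * K"
    by (simp add: p_sum flip: sum_distrib_left sum_distrib_right)
  finally show ?thesis .
qed

lemma avg2_bound:
  assumes f: "\<And>\<sigma> \<tau>. \<sigma> \<in> S \<Longrightarrow> \<tau> \<in> S \<Longrightarrow> \<bar>f \<sigma> \<tau>\<bar> \<le> B"
  shows "\<bar>avg2 f t y\<bar> \<le> B"
  using double_sum_bound [OF f, where g = "\<lambda>_ _. 1" and K = 1] unfolding avg2_def by simp

lemma D_bound: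
  assumes j: "j \<in> J" and f: "\<And>\<sigma> \<tau>. \<sigma> \<in> S \<Longrightarrow> \<tau> \<in> S \<Longrightarrow> \<bar>f \<sigma> \<tau>\<bar> \<le> B"
  shows "\<bar>D f j t y\<bar> \<le> B * (4 * a)"
  unfolding D_def
proof (rule double_sum_bound [OF f])
  fix \<sigma> \<tau> assume "\<sigma> \<in> S" "\<tau> \<in> S"
  then show "\<bar>A j \<sigma> + A j \<tau> - 2 * mean t y j\<bar> \<le> 4 * a"
    using A_bound [OF j, of \<sigma>] A_bound [OF j, of \<tau>] mean_bound [OF j, of t y] by linarith
qed

lemma DD_bound:
  assumes j: "j \<in> J" and f: "\<And>\<sigma> \<tau>. \<sigma> \<in> S \<Longrightarrow> \<tau> \<in> S \<Longrightarrow> \<bar>f \<sigma> \<tau>\<bar> \<le> B"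
  shows "\<bar>DD f j t y\<bar> \<le> B * (16 * a\<^sup>2)"
  unfolding DD_def
proof (rule double_sum_bound [OF f])
  fix \<sigma> \<tau> assume st: "\<sigma> \<in> S" "\<tau> \<in> S"
  note bounds = A_bound [OF j st(1)] A_bound [OF j st(2)] mean_bound [OF j, of t y]
  have m: "\<bar>x * z\<bar> \<le> a * a" if "\<bar>x\<bar> \<le> a" "\<bar>z\<bar> \<le> a" for x z
    unfolding abs_mult using that by (intro mult_mono) linarith+
  have "\<bar>A j \<sigma> * A j \<tau>\<bar> \<le> a * a" "\<bar>mean t y j * A j \<sigma>\<bar> \<le> a * a" "\<bar>mean t y j * A j \<tau>\<bar> \<le> a * a"
    "\<bar>mean t y j * mean t y j\<bar> \<le> a * a"
    by (rule m; rule bounds)+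
  moreover have "2 * (A j \<sigma> * A j \<tau>) - 4 * mean t y j * (A j \<sigma> + A j \<tau>) + 6 * (mean t y j)\<^sup>2
    = 2 * (A j \<sigma> * A j \<tau>) - 4 * (mean t y j * A j \<sigma>) - 4 * (mean t y j * A j \<tau>) + 6 * (mean t y j * mean t y j)"
    by (simp add: power2_eq_square algebra_simps)
  ultimately show "\<bar>2 * (A j \<sigma> * A j \<tau>) - 4 * mean t y j * (A j \<sigma> + A j \<tau>) + 6 * (mean t y j)\<^sup>2\<bar> \<le> 16 * a\<^sup>2"
    unfolding power2_eq_square [of a] by linarith
qed

lemma X_upd:
  assumes "j \<in> J"
  shows "X t (y(j := u)) \<sigma> = X t (y(j := 0)) \<sigma> + coef j t * u * A j \<sigma>"
proof -
  have "(\<Sum>i\<in>J. coef i t * (y(j := u)) i * A i \<sigma>) = coef j t * u * A j \<sigma> + (\<Sum>i\<in>J - {j}. coef i t * y i * A i \<sigma>)" for u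
    by (subst sum.remove [OF J assms]) simp
  from this [of u] this [of 0] show ?thesis
    unfolding X_def by simp
qed

lemma p_deriv_component:
  assumes "j \<in> J" "\<sigma> \<in> S"
  shows "((\<lambda>u. p t (y(j := u)) \<sigma>) has_real_derivative
     coef j t * (p t (y(j := u)) \<sigma> * (A j \<sigma> - mean t (y(j := u)) j))) (at u)"
proof -
  have "((\<lambda>u. gibbs S (X t (y(j := u))) \<sigma>) has_real_derivative
      gibbs S (X t (y(j := u))) \<sigma> * (coef j t * A j \<sigma> - (\<Sum>\<tau>\<in>S. gibbs S (X t (y(j := u))) \<tau> * (coef j t * A j \<tau>)))) (at u)"
  proof (rule gibbs_has_derivative [OF S assms(2)])
    fix \<tau>
    have "(\<lambda>u. X t (y(j := u)) \<tau>) = (\<lambda>u. X t (y(j := 0)) \<tau> + coef j t * u * A j \<tau>)"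
      by (rule ext) (rule X_upd [OF assms(1)])
    then show "((\<lambda>u. X t (y(j := u)) \<tau>) has_real_derivative coef j t * A j \<tau>) (at u)"
      by (auto intro!: derivative_eq_intros)
  qed
  moreover have "(\<Sum>\<tau>\<in>S. gibbs S (X t (y(j := u))) \<tau> * (coef j t * A j \<tau>)) = coef j t * mean t (y(j := u)) j"
    by (simp add: mean_def p_def sum_distrib_left mult_ac)
  ultimately show ?thesis
    by (simp add: p_def algebra_simps)
qed

text \<open>The derivative of a Gibbs mean is a Gibbs variance, whose second moment is the constant
  \<open>\<alpha> j\<close> by \<open>A_square\<close>.\<close>

lemma mean_deriv_component:
  assumes "j \<in> J"
  shows "((\<lambda>u. mean t (y(j := u)) j) has_real_derivative
     coef j t * (\<alpha> j - (mean t (y(j := u)) j)\<^sup>2)) (at u)"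
proof -
  have "((\<lambda>u. \<Sum>\<rho>\<in>S. p t (y(j := u)) \<rho> * A j \<rho>) has_real_derivative
     (\<Sum>\<rho>\<in>S. coef j t * (p t (y(j := u)) \<rho> * (A j \<rho> - mean t (y(j := u)) j)) * A j \<rho>)) (at u)"
    by (intro DERIV_sum DERIV_cmult_right p_deriv_component assms)
  moreover have "(\<lambda>u. \<Sum>\<rho>\<in>S. p t (y(j := u)) \<rho> * A j \<rho>) = (\<lambda>u. mean t (y(j := u)) j)"
    by (simp add: mean_def)
  moreover have "(\<Sum>\<rho>\<in>S. coef j t * (p t (y(j := u)) \<rho> * (A j \<rho> - mean t (y(j := u)) j)) * A j \<rho>)
     = (\<Sum>\<rho>\<in>S. coef j t * (p t (y(j := u)) \<rho> * \<alpha> j - mean t (y(j := u)) j * (p t (y(j := u)) \<rho> * A j \<rho>)))"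
    using A_square [OF assms] by (intro sum.cong refl) (auto simp: algebra_simps)
  moreover have "\<dots> = coef j t * (\<alpha> j - (mean t (y(j := u)) j)\<^sup>2)"
    by (simp add: sum_subtractf p_sum power2_eq_square mean_def [symmetric] flip: sum_distrib_left sum_distrib_right)
  ultimately show ?thesis by simp
qed

lemma D_deriv_component:
  assumes j: "j \<in> J"
  shows "((\<lambda>u. D f j t (y(j := u))) has_real_derivative coef j t * DD f j t (y(j := u))) (at u)"
proof -
  let ?y = "y(j := u)"
  let ?dp = "\<lambda>\<sigma>. coef j t * (p t ?y \<sigma> * (A j \<sigma> - mean t ?y j))"
  have "((\<lambda>u. D f j t (y(j := u))) has_real_derivative
     (\<Sum>\<sigma>\<in>S. \<Sum>\<tau>\<in>S. f \<sigma> \<tau> * (coef j t * (p t ?y \<sigma> * p t ?y \<tau> *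
       (2 * (A j \<sigma> * A j \<tau>) - 4 * mean t ?y j * (A j \<sigma> + A j \<tau>) + 6 * (mean t ?y j)\<^sup>2))))) (at u)"
    unfolding D_def
  proof (intro DERIV_sum DERIV_cmult)
    fix \<sigma> \<tau> assume st: "\<sigma> \<in> S" "\<tau> \<in> S"
    note d = p_deriv_component [OF j st(1), of t y u] p_deriv_component [OF j st(2), of t y u]
      mean_deriv_component [OF j, of t y u]
    \<comment> \<open>These are the only terms of the derivative that \<open>DD\<close> does not
      display.\<close>
    have sq: "A j \<sigma> * A j \<sigma> + A j \<tau> * A j \<tau> - 2 * \<alpha> j = 0"
      using A_square [OF j st(1)] A_square [OF j st(2)] by simp
    show "((\<lambda>u. p t (y(j := u)) \<sigma> * p t (y(j := u)) \<tau> * (A j \<sigma> + A j \<tau> - 2 * mean t (y(j := u)) j))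
      has_real_derivative coef j t * (p t ?y \<sigma> * p t ?y \<tau> *
       (2 * (A j \<sigma> * A j \<tau>) - 4 * mean t ?y j * (A j \<sigma> + A j \<tau>) + 6 * (mean t ?y j)\<^sup>2))) (at u)"
    proof (rule DERIV_cong [OF DERIV_mult [OF DERIV_mult [OF d(1,2)] DERIV_diff [OF DERIV_const DERIV_cmult [OF d(3)]]]])
      have "(c * (p1 * (a1 - m)) * p2 + c * (p2 * (a2 - m)) * p1) * (a1 + a2 - 2 * m)
          + (0 - 2 * (c * (\<alpha>' - m\<^sup>2))) * (p1 * p2)
        = c * (p1 * p2 * ((a1 * a1 + a2 * a2 - 2 * \<alpha>') + (2 * (a1 * a2) - 4 * m * (a1 + a2) + 6 * m\<^sup>2)))"
        for c p1 p2 a1 a2 m \<alpha>' :: real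
        by (simp add: power2_eq_square algebra_simps)
      from this [of "coef j t" "p t ?y \<sigma>" "A j \<sigma>" "mean t ?y j" "p t ?y \<tau>" "A j \<tau>" "\<alpha> j", unfolded sq add_0]
      show "(?dp \<sigma> * p t ?y \<tau> + ?dp \<tau> * p t ?y \<sigma>) * (A j \<sigma> + A j \<tau> - 2 * mean t ?y j)
          + (0 - 2 * (coef j t * (\<alpha> j - (mean t ?y j)\<^sup>2))) * (p t ?y \<sigma> * p t ?y \<tau>)
        = coef j t * (p t ?y \<sigma> * p t ?y \<tau> *
       (2 * (A j \<sigma> * A j \<tau>) - 4 * mean t ?y j * (A j \<sigma> + A j \<tau>) + 6 * (mean t ?y j)\<^sup>2))" .
    qed
  qed
  moreover have "(\<Sum>\<sigma>\<in>S. \<Sum>\<tau>\<in>S. f \<sigma> \<tau> * (coef j t * (p t ?y \<sigma> * p t ?y \<tau> *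
       (2 * (A j \<sigma> * A j \<tau>) - 4 * mean t ?y j * (A j \<sigma> + A j \<tau>) + 6 * (mean t ?y j)\<^sup>2))))
     = coef j t * DD f j t ?y"
    unfolding DD_def sum_distrib_left by (rule sum.cong [OF refl], rule sum.cong [OF refl], rule mult.left_commute)
  ultimately show ?thesis
    using DERIV_cong by blast
qed

lemma DD_continuous_component:
  assumes "j \<in> J"
  shows "continuous_on UNIV (\<lambda>u. DD f j t (y(j := u)))"
proof -
  have p: "continuous_on UNIV (\<lambda>u. p t (y(j := u)) \<sigma>)" if "\<sigma> \<in> S" for \<sigma>
    by (rule DERIV_continuous_on) (rule p_deriv_component [OF assms that])
  have m: "continuous_on UNIV (\<lambda>u. mean t (y(j := u)) j)"
    by (rule DERIV_continuous_on) (rule mean_deriv_component [OF assms])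
  show ?thesis
    unfolding DD_def by (intro continuous_intros p m)
qed

lemma expectation_component_D:
  assumes j: "j \<in> J" and f: "\<And>\<sigma> \<tau>. \<sigma> \<in> S \<Longrightarrow> \<tau> \<in> S \<Longrightarrow> \<bar>f \<sigma> \<tau>\<bar> \<le> B"
  shows "(\<integral>y. y j * D f j t y \<partial>gaussian_product J v) = v j * (coef j t * (\<integral>y. DD f j t y \<partial>gaussian_product J v))"
proof -
  let ?K = "B * (4 * a) + \<bar>coef j t\<bar> * (B * (16 * a\<^sup>2))"
  have pos: "0 \<le> B * (4 * a)" "0 \<le> \<bar>coef j t\<bar> * (B * (16 * a\<^sup>2))"
    using order_trans [OF abs_ge_zero D_bound [OF j f, where t = t and y = undefined]]
      order_trans [OF abs_ge_zero DD_bound [OF j f, where t = t and y = undefined]]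
    by (simp_all add: mult_nonneg_nonneg)
  have "(\<integral>y. y j * D f j t y \<partial>gaussian_product J v) = v j * (\<integral>y. coef j t * DD f j t y \<partial>gaussian_product J v)"
  proof (rule gaussian_product_integration_by_parts [OF J j v [OF j] D_measurable])
    show "(\<lambda>y. coef j t * DD f j t y) \<in> borel_measurable (gaussian_product J v)"
      by (intro borel_measurable_times borel_measurable_const DD_measurable)
    show "\<bar>D f j t y\<bar> \<le> ?K" for y
      using D_bound [where f = f and B = B and t = t and y = y, OF j f] pos by linarith
    show "\<bar>coef j t * DD f j t y\<bar> \<le> ?K" for y
    proof -
      have "\<bar>coef j t * DD f j t y\<bar> \<le> \<bar>coef j t\<bar> * (B * (16 * a\<^sup>2))"
        unfolding abs_mult by (intro mult_left_mono DD_bound j f) auto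
      then show ?thesis using pos by linarith
    qed
    show "continuous_on UNIV (\<lambda>u. coef j t * DD f j t (y(j := u)))" for y
      by (intro continuous_intros DD_continuous_component j)
  qed (rule D_deriv_component [OF j])
  then show ?thesis by simp
qed

lemma coef_deriv:
  assumes "t \<in> {0<..<1}"
  shows "(coef j has_real_derivative coef' j t) (at t)"
  using assms unfolding coef_def [abs_def] coef'_def
  by (cases "up j") (auto intro!: derivative_eq_intros simp: field_simps)

text \<open>Integration by parts yields a factor \<open>coef j t\<close>, which cancels the
  singularity of \<open>coef' j t\<close> at the ends of the interval; half the rate of change of
  the variance remains.\<close>

lemma coef_mult_coef':
  assumes "t \<in> {0<..<1}"
  shows "coef' j t * coef j t = sign j / 2"
  using assms by (simp add: coef_def coef'_def sign_def)

lemma p_deriv_time: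
  assumes "t \<in> {0<..<1}" "\<sigma> \<in> S"
  shows "((\<lambda>t. p t y \<sigma>) has_real_derivative p t y \<sigma> * (\<Sum>j\<in>J. coef' j t * y j * (A j \<sigma> - mean t y j))) (at t)"
proof -
  have "((\<lambda>t. gibbs S (X t y) \<sigma>) has_real_derivative gibbs S (X t y) \<sigma> *
      ((\<Sum>j\<in>J. coef' j t * y j * A j \<sigma>) - (\<Sum>\<tau>\<in>S. gibbs S (X t y) \<tau> * (\<Sum>j\<in>J. coef' j t * y j * A j \<tau>)))) (at t)"
  proof (rule gibbs_has_derivative [OF S assms(2)])
    fix \<tau>
    have "((\<lambda>t. b \<tau> + (\<Sum>j\<in>J. coef j t * y j * A j \<tau>)) has_real_derivative
      0 + (\<Sum>j\<in>J. coef' j t * y j * A j \<tau>)) (at t)"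
      by (intro DERIV_add DERIV_const DERIV_sum DERIV_cmult_right coef_deriv assms)
    then show "((\<lambda>t. X t y \<tau>) has_real_derivative (\<Sum>j\<in>J. coef' j t * y j * A j \<tau>)) (at t)"
      unfolding X_def by simp
  qed
  moreover have "(\<Sum>\<tau>\<in>S. gibbs S (X t y) \<tau> * (\<Sum>j\<in>J. coef' j t * y j * A j \<tau>)) = (\<Sum>j\<in>J. coef' j t * y j * mean t y j)"
    unfolding mean_def p_def sum_distrib_left by (subst sum.swap) (simp add: mult_ac)
  ultimately show ?thesis
    by (simp add: p_def sum_subtractf right_diff_distrib)
qed


lemma avg2_deriv_time:
  assumes t: "t \<in> {0<..<1}"
    and f: "\<And>\<sigma> \<tau>. \<sigma> \<in> S \<Longrightarrow> \<tau> \<in> S \<Longrightarrow> ((\<lambda>t. f t \<sigma> \<tau>) has_real_derivative f' \<sigma> \<tau>) (at t)"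
  shows "((\<lambda>t. avg2 (f t) t y) has_real_derivative avg2 f' t y + (\<Sum>j\<in>J. coef' j t * (y j * D (f t) j t y))) (at t)"
proof -
  let ?m = "\<lambda>\<sigma>. \<Sum>j\<in>J. coef' j t * y j * (A j \<sigma> - mean t y j)"
  have "((\<lambda>t. avg2 (f t) t y) has_real_derivative (\<Sum>\<sigma>\<in>S. \<Sum>\<tau>\<in>S. f' \<sigma> \<tau> * (p t y \<sigma> * p t y \<tau>) +
      ((p t y \<sigma> * ?m \<sigma>) * p t y \<tau> + (p t y \<tau> * ?m \<tau>) * p t y \<sigma>) * f t \<sigma> \<tau>)) (at t)"
    unfolding avg2_def by (intro DERIV_sum DERIV_mult f p_deriv_time t)
  moreover have "(\<Sum>\<sigma>\<in>S. \<Sum>\<tau>\<in>S. f' \<sigma> \<tau> * (p t y \<sigma> * p t y \<tau>) +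
      ((p t y \<sigma> * ?m \<sigma>) * p t y \<tau> + (p t y \<tau> * ?m \<tau>) * p t y \<sigma>) * f t \<sigma> \<tau>)
    = avg2 f' t y + (\<Sum>\<sigma>\<in>S. \<Sum>\<tau>\<in>S. \<Sum>j\<in>J. coef' j t * (y j * (f t \<sigma> \<tau> * (p t y \<sigma> * p t y \<tau> * (A j \<sigma> + A j \<tau> - 2 * mean t y j)))))"
    unfolding avg2_def sum.distrib [symmetric]
  proof (intro sum.cong refl)
    fix \<sigma> \<tau>
    have "((p t y \<sigma> * ?m \<sigma>) * p t y \<tau> + (p t y \<tau> * ?m \<tau>) * p t y \<sigma>) * f t \<sigma> \<tau>
      = f t \<sigma> \<tau> * (p t y \<sigma> * p t y \<tau>) * (?m \<sigma> + ?m \<tau>)"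
      by (simp only: ring_distribs mult_ac)
    also have "?m \<sigma> + ?m \<tau> = (\<Sum>j\<in>J. coef' j t * (y j * (A j \<sigma> + A j \<tau> - 2 * mean t y j)))"
      by (simp add: algebra_simps flip: sum.distrib)
    finally show "f' \<sigma> \<tau> * (p t y \<sigma> * p t y \<tau>) +
      ((p t y \<sigma> * ?m \<sigma>) * p t y \<tau> + (p t y \<tau> * ?m \<tau>) * p t y \<sigma>) * f t \<sigma> \<tau>
      = f' \<sigma> \<tau> * (p t y \<sigma> * p t y \<tau>) + (\<Sum>j\<in>J. coef' j t * (y j * (f t \<sigma> \<tau> * (p t y \<sigma> * p t y \<tau> * (A j \<sigma> + A j \<tau> - 2 * mean t y j)))))"
      by (simp only: sum_distrib_left mult_ac)
  qed
  moreover have "(\<Sum>\<sigma>\<in>S. \<Sum>\<tau>\<in>S. \<Sum>j\<in>J. coef' j t * (y j * (f t \<sigma> \<tau> * (p t y \<sigma> * p t y \<tau> * (A j \<sigma> + A j \<tau> - 2 * mean t y j)))))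
     = (\<Sum>j\<in>J. coef' j t * (y j * D (f t) j t y))"
  proof -
    have "(\<Sum>\<sigma>\<in>S. \<Sum>\<tau>\<in>S. \<Sum>j\<in>J. g \<sigma> \<tau> j) = (\<Sum>j\<in>J. \<Sum>\<sigma>\<in>S. \<Sum>\<tau>\<in>S. g \<sigma> \<tau> j)" for g :: "'s \<Rightarrow> 's \<Rightarrow> 'j \<Rightarrow> real"
      by (subst sum.swap [of _ J]) (subst sum.swap [of _ J], rule refl)
    then show ?thesis
      by (simp only: D_def sum_distrib_left)
  qed
  ultimately show ?thesis by (simp only:)
qed

text \<open>Differentiation in time brings down a coordinate \<open>y j\<close>, and integration by
  parts trades it for a further derivative in that coordinate.\<close>

lemma expectation_avg2_deriv:
  assumes t: "t \<in> {0<..<1}"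
    and f: "\<And>s \<sigma> \<tau>. s \<in> {0<..<1} \<Longrightarrow> \<sigma> \<in> S \<Longrightarrow> \<tau> \<in> S \<Longrightarrow> ((\<lambda>t. f t \<sigma> \<tau>) has_real_derivative f' s \<sigma> \<tau>) (at s)"
    and fB: "\<And>s \<sigma> \<tau>. s \<in> {0<..<1} \<Longrightarrow> \<sigma> \<in> S \<Longrightarrow> \<tau> \<in> S \<Longrightarrow> \<bar>f s \<sigma> \<tau>\<bar> \<le> B"
    and f'B: "\<And>s \<sigma> \<tau>. s \<in> {0<..<1} \<Longrightarrow> \<sigma> \<in> S \<Longrightarrow> \<tau> \<in> S \<Longrightarrow> \<bar>f' s \<sigma> \<tau>\<bar> \<le> B"
  shows "((\<lambda>t. \<integral>y. avg2 (f t) t y \<partial>gaussian_product J v) has_real_derivative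
     (\<integral>y. avg2 (f' t) t y + (\<Sum>j\<in>J. sign j * v j / 2 * DD (f t) j t y) \<partial>gaussian_product J v)) (at t)"
proof -
  interpret GP: prob_space "gaussian_product J v" by (rule prob_space_gaussian_product)
  let ?P = "gaussian_product J v"
  \<comment> \<open>\<open>coef'\<close> is unbounded near 0 and 1; domination is available on a
    smaller interval that still contains \<open>t\<close>.\<close>
  define \<delta> where "\<delta> = min t (1 - t) / 2"
  have \<delta>: "0 < \<delta>" "\<delta> < t" "t < 1 - \<delta>" using t by (auto simp: \<delta>_def min_def field_simps)
  define c where "c = 1 / (2 * sqrt \<delta>)"
  have c: "\<bar>coef' j s\<bar> \<le> c" if "s \<in> {\<delta><..<1 - \<delta>}" for j s
  proof -
    have "sqrt \<delta> \<le> sqrt s" "sqrt \<delta> \<le> sqrt (1 - s)" "0 < sqrt \<delta>" using that \<delta> by auto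
    then show ?thesis unfolding coef'_def c_def by (auto simp: frac_le)
  qed
  have sub: "s \<in> {0<..<1}" if "s \<in> {\<delta><..<1 - \<delta>}" for s using that \<delta> by auto
  let ?F' = "\<lambda>s y. avg2 (f' s) s y + (\<Sum>j\<in>J. coef' j s * (y j * D (f s) j s y))"
  have int_avg2: "integrable ?P (avg2 g s)" if "\<And>\<sigma> \<tau>. \<sigma> \<in> S \<Longrightarrow> \<tau> \<in> S \<Longrightarrow> \<bar>g \<sigma> \<tau>\<bar> \<le> B" for g s
    by (rule GP.integrable_const_bound [where B = B, OF _ avg2_measurable], rule AE_I2,
        unfold real_norm_def, rule avg2_bound [OF that])
  have int_yD: "integrable ?P (\<lambda>y. y j * D (f s) j s y)" if "j \<in> J" "s \<in> {0<..<1}" for j s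
    by (rule gaussian_product_integrable_component_mult [OF J that(1) D_measurable D_bound [OF that(1) fB [OF that(2)]]])
  have int_DD: "integrable ?P (DD (f s) j s)" if "j \<in> J" "s \<in> {0<..<1}" for j s
    by (rule GP.integrable_const_bound [where B = "B * (16 * a\<^sup>2)", OF _ DD_measurable], rule AE_I2,
        unfold real_norm_def, rule DD_bound [OF that(1) fB [OF that(2)]])
  have "((\<lambda>t. \<integral>y. avg2 (f t) t y \<partial>?P) has_real_derivative (\<integral>y. ?F' t y \<partial>?P)) (at t)"
  proof (rule has_real_derivative_integral [where a = \<delta> and b = "1 - \<delta>" and B = "\<lambda>y. B + c * (B * (4 * a)) * (\<Sum>j\<in>J. \<bar>y j\<bar>)"])
    show "t \<in> {\<delta><..<1 - \<delta>}" using \<delta> by simp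
    show "((\<lambda>t. avg2 (f t) t y) has_real_derivative ?F' s y) (at s)" if "s \<in> {\<delta><..<1 - \<delta>}" for s y
      by (rule avg2_deriv_time [OF sub [OF that] f [OF sub [OF that]]])
    show "integrable ?P (avg2 (f s) s)" if "s \<in> {\<delta><..<1 - \<delta>}" for s
      by (rule int_avg2 [OF fB [OF sub [OF that]]])
    show "?F' t \<in> borel_measurable ?P"
      by (intro borel_measurable_add borel_measurable_sum borel_measurable_times borel_measurable_const
          avg2_measurable D_measurable gaussian_product_component)
    show "integrable ?P (\<lambda>y. B + c * (B * (4 * a)) * (\<Sum>j\<in>J. \<bar>y j\<bar>))"
      by (rule Bochner_Integration.integrable_add [OF GP.integrable_const
            integrable_mult_right [OF gaussian_product_integrable_abs [OF J]]])
    show "\<bar>?F' s y\<bar> \<le> B + c * (B * (4 * a)) * (\<Sum>j\<in>J. \<bar>y j\<bar>)" if s: "s \<in> {\<delta><..<1 - \<delta>}" for s y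
    proof -
      have "\<bar>coef' j s * (y j * D (f s) j s y)\<bar> \<le> c * (B * (4 * a)) * \<bar>y j\<bar>" if j: "j \<in> J" for j
      proof -
        have "\<bar>coef' j s\<bar> * \<bar>D (f s) j s y\<bar> \<le> c * (B * (4 * a))"
          by (intro mult_mono c s D_bound j fB sub) (auto intro: order_trans [OF abs_ge_zero c [OF s]])
        then have "(\<bar>coef' j s\<bar> * \<bar>D (f s) j s y\<bar>) * \<bar>y j\<bar> \<le> c * (B * (4 * a)) * \<bar>y j\<bar>"
          by (rule mult_right_mono) simp
        then show ?thesis by (simp only: abs_mult mult_ac)
      qed
      then have "\<bar>\<Sum>j\<in>J. coef' j s * (y j * D (f s) j s y)\<bar> \<le> c * (B * (4 * a)) * (\<Sum>j\<in>J. \<bar>y j\<bar>)"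
        unfolding sum_distrib_left by (intro order_trans [OF sum_abs] sum_mono)
      moreover have "\<bar>avg2 (f' s) s y\<bar> \<le> B"
        by (intro avg2_bound f'B sub s)
      ultimately show ?thesis by linarith
    qed
  qed
  also have "(\<integral>y. ?F' t y \<partial>?P) = (\<integral>y. avg2 (f' t) t y \<partial>?P) + (\<Sum>j\<in>J. coef' j t * (\<integral>y. y j * D (f t) j t y \<partial>?P))"
  proof -
    have "(\<integral>y. ?F' t y \<partial>?P) = (\<integral>y. avg2 (f' t) t y \<partial>?P) + (\<integral>y. (\<Sum>j\<in>J. coef' j t * (y j * D (f t) j t y)) \<partial>?P)"
      by (rule Bochner_Integration.integral_add [OF int_avg2 [OF f'B [OF t]]
            Bochner_Integration.integrable_sum [OF integrable_mult_right [OF int_yD [OF _ t]]]])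
    also have "(\<integral>y. (\<Sum>j\<in>J. coef' j t * (y j * D (f t) j t y)) \<partial>?P) = (\<Sum>j\<in>J. \<integral>y. coef' j t * (y j * D (f t) j t y) \<partial>?P)"
      by (rule Bochner_Integration.integral_sum [OF integrable_mult_right [OF int_yD [OF _ t]]])
    finally show ?thesis
      by (simp only: Bochner_Integration.integral_mult_right_zero)
  qed
  also have "(\<Sum>j\<in>J. coef' j t * (\<integral>y. y j * D (f t) j t y \<partial>?P)) = (\<Sum>j\<in>J. sign j * v j / 2 * (\<integral>y. DD (f t) j t y \<partial>?P))"
  proof (intro sum.cong refl)
    fix j assume j: "j \<in> J"
    have "(\<integral>y. y j * D (f t) j t y \<partial>?P) = v j * (coef j t * (\<integral>y. DD (f t) j t y \<partial>?P))"
      by (rule expectation_component_D [OF j fB [OF t]])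
    then have "coef' j t * (\<integral>y. y j * D (f t) j t y \<partial>?P) = (coef' j t * coef j t) * v j * (\<integral>y. DD (f t) j t y \<partial>?P)"
      by (simp only: mult_ac)
    then show "coef' j t * (\<integral>y. y j * D (f t) j t y \<partial>?P) = sign j * v j / 2 * (\<integral>y. DD (f t) j t y \<partial>?P)"
      unfolding coef_mult_coef' [OF t] by simp
  qed
  also have "(\<integral>y. avg2 (f' t) t y \<partial>?P) + (\<Sum>j\<in>J. sign j * v j / 2 * (\<integral>y. DD (f t) j t y \<partial>?P))
      = (\<integral>y. avg2 (f' t) t y + (\<Sum>j\<in>J. sign j * v j / 2 * DD (f t) j t y) \<partial>?P)"
  proof -
    have "(\<integral>y. avg2 (f' t) t y + (\<Sum>j\<in>J. sign j * v j / 2 * DD (f t) j t y) \<partial>?P)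
        = (\<integral>y. avg2 (f' t) t y \<partial>?P) + (\<integral>y. (\<Sum>j\<in>J. sign j * v j / 2 * DD (f t) j t y) \<partial>?P)"
      by (rule Bochner_Integration.integral_add [OF int_avg2 [OF f'B [OF t]]
            Bochner_Integration.integrable_sum [OF integrable_mult_right [OF int_DD [OF _ t]]]])
    also have "(\<integral>y. (\<Sum>j\<in>J. sign j * v j / 2 * DD (f t) j t y) \<partial>?P) = (\<Sum>j\<in>J. \<integral>y. sign j * v j / 2 * DD (f t) j t y \<partial>?P)"
      by (rule Bochner_Integration.integral_sum [OF integrable_mult_right [OF int_DD [OF _ t]]])
    finally show ?thesis
      by (simp only: Bochner_Integration.integral_mult_right_zero)
  qed
  finally show ?thesis .
qed

text \<open>The square roots are not differentiable at the ends of the path, so a comparison of the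
  values at 0 and 1 needs continuity there besides the sign of the derivative inside.\<close>

lemma expectation_avg2_continuous:
  assumes f: "\<And>\<sigma> \<tau>. \<sigma> \<in> S \<Longrightarrow> \<tau> \<in> S \<Longrightarrow> continuous_on {0..1} (\<lambda>t. f t \<sigma> \<tau>)"
    and fB: "\<And>s \<sigma> \<tau>. s \<in> {0..1} \<Longrightarrow> \<sigma> \<in> S \<Longrightarrow> \<tau> \<in> S \<Longrightarrow> \<bar>f s \<sigma> \<tau>\<bar> \<le> B"
  shows "continuous_on {0..1} (\<lambda>t. \<integral>y. avg2 (f t) t y \<partial>gaussian_product J v)"
  unfolding continuous_on_sequentially
proof (intro allI ballI impI, elim conjE)
  interpret GP: prob_space "gaussian_product J v" by (rule prob_space_gaussian_product)
  fix x :: "nat \<Rightarrow> real" and t assume t: "t \<in> {0..1::real}" and x: "\<forall>n. x n \<in> {0..1}" "x \<longlonglongrightarrow> t"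
  have cont: "continuous_on {0..1} (\<lambda>t. avg2 (f t) t y)" for y
  proof -
    have coef: "continuous_on {0..1} (coef j)" for j
      by (cases "up j") (auto simp: coef_def [abs_def] intro!: continuous_intros)
    have X: "continuous_on {0..1} (\<lambda>t. X t y \<sigma>)" for \<sigma>
      unfolding X_def
      by (rule continuous_on_add [OF continuous_on_const], rule continuous_on_sum,
          rule continuous_on_mult [OF continuous_on_mult [OF coef continuous_on_const] continuous_on_const])
    have p: "continuous_on {0..1} (\<lambda>t. p t y \<sigma>)" if "\<sigma> \<in> S" for \<sigma>
      unfolding p_def by (rule gibbs_continuous_on [OF S X that])
    show ?thesis
      unfolding avg2_def
      by (rule continuous_on_sum, rule continuous_on_sum)
         (rule continuous_on_mult [OF f continuous_on_mult [OF p p]])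
  qed
  have "(\<lambda>n. \<integral>y. avg2 (f (x n)) (x n) y \<partial>gaussian_product J v) \<longlonglongrightarrow> (\<integral>y. avg2 (f t) t y \<partial>gaussian_product J v)"
  proof (rule integral_dominated_convergence [where w = "\<lambda>_. B"])
    show "AE y in gaussian_product J v. (\<lambda>n. avg2 (f (x n)) (x n) y) \<longlonglongrightarrow> avg2 (f t) t y"
    proof (rule AE_I2)
      fix y
      show "(\<lambda>n. avg2 (f (x n)) (x n) y) \<longlonglongrightarrow> avg2 (f t) t y"
        using cont [of y, unfolded continuous_on_sequentially, rule_format, OF t, of x] x by (simp add: comp_def)
    qed
    show "AE y in gaussian_product J v. norm (avg2 (f (x n)) (x n) y) \<le> B" for n
      by (rule AE_I2, unfold real_norm_def, rule avg2_bound, rule fB [OF x(1) [rule_format]])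
    show "integrable (gaussian_product J v) (\<lambda>_. B)" by (rule GP.integrable_const)
  qed (rule avg2_measurable)+
  then show "((\<lambda>t. \<integral>y. avg2 (f t) t y \<partial>gaussian_product J v) \<circ> x) \<longlonglongrightarrow> (\<integral>y. avg2 (f t) t y \<partial>gaussian_product J v)"
    by (simp add: comp_def)
qed

end

section \<open>Latala's comparison along the path\<close>

text \<open>For two independent copies the increments of \<open>a\<close> and of
  \<open>exp (\<kappa> * a)\<close> have the same sign; averaging their product gives twice the
  difference of the two sides.\<close>

lemma chebyshev_exp:
  fixes p a :: "'s \<Rightarrow> real"
  assumes p: "\<And>\<sigma>. \<sigma> \<in> S \<Longrightarrow> 0 \<le> p \<sigma>" and p1: "sum p S = 1" and \<kappa>: "0 \<le> \<kappa>"
  shows "(\<Sum>\<sigma>\<in>S. p \<sigma> * exp (\<kappa> * a \<sigma>)) * (\<Sum>\<sigma>\<in>S. p \<sigma> * a \<sigma>) \<le> (\<Sum>\<sigma>\<in>S. p \<sigma> * (exp (\<kappa> * a \<sigma>) * a \<sigma>))"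
proof -
  let ?f = "\<lambda>\<sigma>. exp (\<kappa> * a \<sigma>)"
  have mono: "0 \<le> (?f \<sigma> - ?f \<tau>) * (a \<sigma> - a \<tau>)" for \<sigma> \<tau>
  proof (cases "a \<sigma> \<le> a \<tau>")
    case True
    then have "?f \<sigma> \<le> ?f \<tau>" using \<kappa> by (simp only: exp_le_cancel_iff mult_left_mono)
    then show ?thesis using True by (intro mult_nonpos_nonpos) auto
  next
    case False
    then have "?f \<tau> \<le> ?f \<sigma>" using \<kappa> by (simp only: exp_le_cancel_iff mult_left_mono)
    then show ?thesis using False by (intro mult_nonneg_nonneg) auto
  qed
  have "0 \<le> (\<Sum>\<sigma>\<in>S. \<Sum>\<tau>\<in>S. p \<sigma> * p \<tau> * ((?f \<sigma> - ?f \<tau>) * (a \<sigma> - a \<tau>)))"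
    by (rule sum_nonneg, rule sum_nonneg, rule mult_nonneg_nonneg [OF mult_nonneg_nonneg [OF p p] mono])
  also have "\<dots> = (\<Sum>\<sigma>\<in>S. \<Sum>\<tau>\<in>S. (p \<sigma> * (?f \<sigma> * a \<sigma>)) * p \<tau> + p \<sigma> * (p \<tau> * (?f \<tau> * a \<tau>))
      - (p \<sigma> * ?f \<sigma>) * (p \<tau> * a \<tau>) - (p \<sigma> * a \<sigma>) * (p \<tau> * ?f \<tau>))"
    by (intro sum.cong refl) (simp add: algebra_simps)
  also have "\<dots> = 2 * ((\<Sum>\<sigma>\<in>S. p \<sigma> * (?f \<sigma> * a \<sigma>)) - (\<Sum>\<sigma>\<in>S. p \<sigma> * ?f \<sigma>) * (\<Sum>\<sigma>\<in>S. p \<sigma> * a \<sigma>))"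
    by (simp only: sum_subtractf sum.distrib sum_product [symmetric] p1) (simp add: mult.commute)
  finally show ?thesis by simp
qed

text \<open>By Chebyshev's association inequality, averages of \<open>Y\<close> against a third or fourth replica are at most
  the average of \<open>Y \<sigma> \<tau>\<close> itself. The coefficients \<open>1, - 2, - 2, 3\<close> add up to \<open>8\<close> in absolute value, and to \<open>4\<close>
  if \<open>Q \<ge> 0\<close> allows one to drop the negative terms.\<close>

lemma latala_inequality:
  fixes p :: "'s \<Rightarrow> real" and Y Q K :: "'s \<Rightarrow> 's \<Rightarrow> real"
  assumes S: "finite S" and p: "\<And>\<sigma>. \<sigma> \<in> S \<Longrightarrow> 0 \<le> p \<sigma>" and p1: "sum p S = 1" and \<kappa>: "0 \<le> \<kappa>"
    and Ysym: "\<And>\<sigma> \<tau>. Y \<sigma> \<tau> = Y \<tau> \<sigma>" and Y0: "\<And>\<sigma> \<tau>. 0 \<le> Y \<sigma> \<tau>"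
    and K: "\<And>\<sigma> \<tau>. \<sigma> \<in> S \<Longrightarrow> \<tau> \<in> S \<Longrightarrow> K \<sigma> \<tau> = c * Q \<sigma> \<tau> + c0" and c: "0 \<le> c"
    and Q: "\<And>\<sigma> \<tau>. \<bar>Q \<sigma> \<tau>\<bar> \<le> R * Y \<sigma> \<tau>" and R: "0 \<le> R"
    and al: "al = 1 \<and> (\<forall>\<sigma> \<tau>. 0 \<le> Q \<sigma> \<tau>) \<or> al = 2"
  shows "(\<Sum>\<sigma>\<in>S. \<Sum>\<tau>\<in>S. exp (\<kappa> * Y \<sigma> \<tau>) * (p \<sigma> * p \<tau> *
      (K \<sigma> \<tau> - 2 * ((\<Sum>\<rho>\<in>S. p \<rho> * K \<sigma> \<rho>) + (\<Sum>\<rho>\<in>S. p \<rho> * K \<tau> \<rho>)) + 3 * (\<Sum>\<rho>\<in>S. p \<rho> * (\<Sum>\<rho>'\<in>S. p \<rho>' * K \<rho> \<rho>')))))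
    \<le> 4 * al * c * R * (\<Sum>\<sigma>\<in>S. \<Sum>\<tau>\<in>S. exp (\<kappa> * Y \<sigma> \<tau>) * (p \<sigma> * p \<tau> * Y \<sigma> \<tau>))" (is "?L \<le> _")
proof -
  let ?f = "\<lambda>\<sigma> \<tau>. exp (\<kappa> * Y \<sigma> \<tau>)"
  define E where "E = (\<Sum>\<sigma>\<in>S. \<Sum>\<tau>\<in>S. ?f \<sigma> \<tau> * (p \<sigma> * p \<tau> * Y \<sigma> \<tau>))"
  define q1 where "q1 \<sigma> = (\<Sum>\<rho>\<in>S. p \<rho> * Q \<sigma> \<rho>)" for \<sigma>
  define q2 where "q2 = (\<Sum>\<rho>\<in>S. p \<rho> * q1 \<rho>)"
  define T12 where "T12 = (\<Sum>\<sigma>\<in>S. \<Sum>\<tau>\<in>S. ?f \<sigma> \<tau> * (p \<sigma> * p \<tau> * Q \<sigma> \<tau>))"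
  define T13 where "T13 = (\<Sum>\<sigma>\<in>S. \<Sum>\<tau>\<in>S. ?f \<sigma> \<tau> * (p \<sigma> * p \<tau> * q1 \<sigma>))"
  define T23 where "T23 = (\<Sum>\<sigma>\<in>S. \<Sum>\<tau>\<in>S. ?f \<sigma> \<tau> * (p \<sigma> * p \<tau> * q1 \<tau>))"
  define T0 where "T0 = (\<Sum>\<sigma>\<in>S. \<Sum>\<tau>\<in>S. ?f \<sigma> \<tau> * (p \<sigma> * p \<tau>))"
  have K1: "(\<Sum>\<rho>\<in>S. p \<rho> * K \<sigma> \<rho>) = c * q1 \<sigma> + c0" if "\<sigma> \<in> S" for \<sigma>
  proof -
    have "(\<Sum>\<rho>\<in>S. p \<rho> * K \<sigma> \<rho>) = (\<Sum>\<rho>\<in>S. c * (p \<rho> * Q \<sigma> \<rho>) + p \<rho> * c0)"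
      using K [OF that] by (intro sum.cong refl) (simp add: algebra_simps)
    also have "\<dots> = c * q1 \<sigma> + c0"
      by (simp add: sum.distrib q1_def p1 flip: sum_distrib_left sum_distrib_right)
    finally show ?thesis .
  qed
  have K2: "(\<Sum>\<rho>\<in>S. p \<rho> * (\<Sum>\<rho>'\<in>S. p \<rho>' * K \<rho> \<rho>')) = c * q2 + c0"
  proof -
    have "(\<Sum>\<rho>\<in>S. p \<rho> * (\<Sum>\<rho>'\<in>S. p \<rho>' * K \<rho> \<rho>')) = (\<Sum>\<rho>\<in>S. c * (p \<rho> * q1 \<rho>) + p \<rho> * c0)"
      using K1 by (intro sum.cong refl) (simp add: algebra_simps)
    also have "\<dots> = c * q2 + c0"
      by (simp add: sum.distrib q2_def p1 flip: sum_distrib_left sum_distrib_right)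
    finally show ?thesis .
  qed
  \<comment> \<open>The constant \<open>c0\<close> drops out, since the coefficients 1, -2, -2 and 3
    add up to 0.\<close>
  have "?L = (\<Sum>\<sigma>\<in>S. \<Sum>\<tau>\<in>S. c * (?f \<sigma> \<tau> * (p \<sigma> * p \<tau> * Q \<sigma> \<tau>) - 2 * (?f \<sigma> \<tau> * (p \<sigma> * p \<tau> * q1 \<sigma>))
      - 2 * (?f \<sigma> \<tau> * (p \<sigma> * p \<tau> * q1 \<tau>)) + 3 * q2 * (?f \<sigma> \<tau> * (p \<sigma> * p \<tau>))))"
    using K K1 K2 by (intro sum.cong refl) (simp add: algebra_simps)
  also have "\<dots> = c * (T12 - 2 * T13 - 2 * T23 + 3 * q2 * T0)"
    unfolding T12_def T13_def T23_def T0_def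
    by (simp only: sum_distrib_left [symmetric] sum.distrib sum_subtractf)
  finally have L: "?L = c * (T12 - 2 * T13 - 2 * T23 + 3 * q2 * T0)" .
  have f0: "0 \<le> ?f \<sigma> \<tau>" for \<sigma> \<tau> by simp
  have q1: "\<bar>q1 \<sigma>\<bar> \<le> R * (\<Sum>\<rho>\<in>S. p \<rho> * Y \<sigma> \<rho>)" for \<sigma>
    unfolding q1_def sum_distrib_left
  proof (intro order_trans [OF sum_abs] sum_mono)
    fix \<rho> assume "\<rho> \<in> S"
    then have "p \<rho> * \<bar>Q \<sigma> \<rho>\<bar> \<le> p \<rho> * (R * Y \<sigma> \<rho>)"
      by (intro mult_left_mono Q p)
    then show "\<bar>p \<rho> * Q \<sigma> \<rho>\<bar> \<le> R * (p \<rho> * Y \<sigma> \<rho>)"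
      using p [OF \<open>\<rho> \<in> S\<close>] by (simp add: abs_mult mult_ac)
  qed
  have T12: "T12 \<le> R * E"
    unfolding T12_def E_def sum_distrib_left
  proof (intro sum_mono)
    fix \<sigma> \<tau> assume "\<sigma> \<in> S" "\<tau> \<in> S"
    then have "?f \<sigma> \<tau> * (p \<sigma> * p \<tau> * Q \<sigma> \<tau>) \<le> ?f \<sigma> \<tau> * (p \<sigma> * p \<tau> * (R * Y \<sigma> \<tau>))"
      using Q [of \<sigma> \<tau>] by (intro mult_left_mono mult_nonneg_nonneg p) auto
    then show "?f \<sigma> \<tau> * (p \<sigma> * p \<tau> * Q \<sigma> \<tau>) \<le> R * (?f \<sigma> \<tau> * (p \<sigma> * p \<tau> * Y \<sigma> \<tau>))"
      by (simp only: mult_ac)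
  qed
  have T13_eq: "T13 = (\<Sum>\<sigma>\<in>S. p \<sigma> * ((\<Sum>\<tau>\<in>S. p \<tau> * ?f \<sigma> \<tau>) * q1 \<sigma>))"
    unfolding T13_def sum_distrib_left sum_distrib_right by (intro sum.cong refl) (simp only: mult_ac)
  have T13_abs: "\<bar>T13\<bar> \<le> R * E"
  proof -
    have "\<bar>T13\<bar> \<le> (\<Sum>\<sigma>\<in>S. p \<sigma> * (R * (\<Sum>\<tau>\<in>S. p \<tau> * (?f \<sigma> \<tau> * Y \<sigma> \<tau>))))"
      unfolding T13_eq
    proof (intro order_trans [OF sum_abs] sum_mono)
      fix \<sigma> assume s: "\<sigma> \<in> S"
      have F: "0 \<le> (\<Sum>\<tau>\<in>S. p \<tau> * ?f \<sigma> \<tau>)" by (intro sum_nonneg mult_nonneg_nonneg p f0)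
      have "(\<Sum>\<tau>\<in>S. p \<tau> * ?f \<sigma> \<tau>) * \<bar>q1 \<sigma>\<bar> \<le> (\<Sum>\<tau>\<in>S. p \<tau> * ?f \<sigma> \<tau>) * (R * (\<Sum>\<rho>\<in>S. p \<rho> * Y \<sigma> \<rho>))"
        by (intro mult_left_mono q1 F)
      also have "\<dots> = R * ((\<Sum>\<tau>\<in>S. p \<tau> * ?f \<sigma> \<tau>) * (\<Sum>\<rho>\<in>S. p \<rho> * Y \<sigma> \<rho>))"
        by (simp only: mult_ac)
      \<comment> \<open>Association for fixed \<open>\<sigma>\<close>: the average of
        \<open>Y\<close> over a third replica is replaced by the one over the second replica, which
        carries the exponential weight.\<close>
      also have "\<dots> \<le> R * (\<Sum>\<tau>\<in>S. p \<tau> * (?f \<sigma> \<tau> * Y \<sigma> \<tau>))"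
        by (intro mult_left_mono R chebyshev_exp p p1 \<kappa>)
      finally have "p \<sigma> * ((\<Sum>\<tau>\<in>S. p \<tau> * ?f \<sigma> \<tau>) * \<bar>q1 \<sigma>\<bar>) \<le> p \<sigma> * (R * (\<Sum>\<tau>\<in>S. p \<tau> * (?f \<sigma> \<tau> * Y \<sigma> \<tau>)))"
        by (intro mult_left_mono p s)
      then show "\<bar>p \<sigma> * ((\<Sum>\<tau>\<in>S. p \<tau> * ?f \<sigma> \<tau>) * q1 \<sigma>)\<bar> \<le> p \<sigma> * (R * (\<Sum>\<tau>\<in>S. p \<tau> * (?f \<sigma> \<tau> * Y \<sigma> \<tau>)))"
        using F p [OF s] by (simp only: abs_mult abs_of_nonneg)
    qed
    also have "\<dots> = R * E"
      unfolding E_def sum_distrib_left by (intro sum.cong refl) (simp only: mult_ac)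
    finally show ?thesis .
  qed
  have T23_eq: "T23 = T13"
    unfolding T13_def T23_def by (subst sum.swap, intro sum.cong refl) (simp only: Ysym mult_ac)
  \<comment> \<open>Here the third and fourth replicas are both independent of the weighted pair, so
    association is applied on \<open>S \<times> S\<close>.\<close>
  have T34_abs: "\<bar>q2 * T0\<bar> \<le> R * E"
  proof -
    let ?P = "\<lambda>(\<sigma>, \<tau>). p \<sigma> * p \<tau>" and ?Y = "\<lambda>(\<sigma>, \<tau>). Y \<sigma> \<tau>"
    have P1: "sum ?P (S \<times> S) = 1"
      by (simp add: sum.cartesian_product [symmetric] sum_product [symmetric] p1)
    have "(\<Sum>x\<in>S \<times> S. ?P x * exp (\<kappa> * ?Y x)) * (\<Sum>x\<in>S \<times> S. ?P x * ?Y x) \<le> (\<Sum>x\<in>S \<times> S. ?P x * (exp (\<kappa> * ?Y x) * ?Y x))"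
      by (rule chebyshev_exp [OF _ P1 \<kappa>]) (auto intro!: mult_nonneg_nonneg p)
    also have "(\<Sum>x\<in>S \<times> S. ?P x * (exp (\<kappa> * ?Y x) * ?Y x)) = E"
      unfolding E_def sum.cartesian_product by (intro sum.cong refl) (auto simp: mult_ac)
    also have "(\<Sum>x\<in>S \<times> S. ?P x * exp (\<kappa> * ?Y x)) = T0"
      unfolding T0_def sum.cartesian_product by (intro sum.cong refl) (auto simp: mult_ac)
    finally have *: "T0 * (\<Sum>x\<in>S \<times> S. ?P x * ?Y x) \<le> E" .
    have T0: "0 \<le> T0" unfolding T0_def by (intro sum_nonneg mult_nonneg_nonneg p f0)
    have "\<bar>q2\<bar> \<le> (\<Sum>\<rho>\<in>S. p \<rho> * (R * (\<Sum>\<tau>\<in>S. p \<tau> * Y \<rho> \<tau>)))"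
      unfolding q2_def
      by (intro order_trans [OF sum_abs] sum_mono) (simp add: abs_mult p mult_left_mono q1)
    also have "\<dots> = R * (\<Sum>x\<in>S \<times> S. ?P x * ?Y x)"
    proof -
      have "(\<Sum>x\<in>S \<times> S. ?P x * ?Y x) = (\<Sum>\<sigma>\<in>S. \<Sum>\<tau>\<in>S. p \<sigma> * p \<tau> * Y \<sigma> \<tau>)"
        by (simp add: sum.cartesian_product split_def)
      then show ?thesis by (simp add: sum_distrib_left mult_ac)
    qed
    finally have "\<bar>q2\<bar> * T0 \<le> R * (\<Sum>x\<in>S \<times> S. ?P x * ?Y x) * T0"
      by (intro mult_right_mono T0)
    also have "\<dots> = R * (T0 * (\<Sum>x\<in>S \<times> S. ?P x * ?Y x))"
      by (simp only: mult_ac)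
    also have "\<dots> \<le> R * E"
      by (intro mult_left_mono R *)
    finally show ?thesis using T0 by (simp add: abs_mult)
  qed
  have "T12 - 2 * T13 - 2 * T23 + 3 * q2 * T0 \<le> 4 * al * R * E"
    using al
  proof (elim disjE conjE)
    assume "al = 1" and Q0: "\<forall>\<sigma> \<tau>. 0 \<le> Q \<sigma> \<tau>"
    have "0 \<le> T13"
      unfolding T13_def q1_def using Q0 by (intro sum_nonneg mult_nonneg_nonneg p f0) auto
    then show ?thesis
      using T12 T34_abs \<open>al = 1\<close> unfolding T23_eq by (simp add: mult.assoc)
  next
    assume "al = 2"
    then show ?thesis
      using T12 T34_abs T13_abs unfolding T23_eq by (simp add: mult.assoc)
  qed
  then have "c * (T12 - 2 * T13 - 2 * T23 + 3 * q2 * T0) \<le> c * (4 * al * R * E)"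
    by (rule mult_left_mono) (rule c)
  then show ?thesis
    unfolding L E_def [symmetric] by (simp only: mult_ac)
qed

text \<open>\<open>K\<close> is the time derivative of the covariance of \<open>X t\<close>. Summed
  over the coordinates, products with the means \<open>mean t y j\<close> become averages of
  \<open>K\<close> over a third and a fourth replica.\<close>

lemma (in gaussian_interpolation) sum_sign_DD:
  "(\<Sum>j\<in>J. sign j * v j / 2 * DD f j t y) =
     (let K = \<lambda>\<sigma> \<tau>. \<Sum>j\<in>J. sign j * v j * (A j \<sigma> * A j \<tau>); q = p t y in
      (\<Sum>\<sigma>\<in>S. \<Sum>\<tau>\<in>S. f \<sigma> \<tau> * (q \<sigma> * q \<tau> *
        (K \<sigma> \<tau> - 2 * ((\<Sum>\<rho>\<in>S. q \<rho> * K \<sigma> \<rho>) + (\<Sum>\<rho>\<in>S. q \<rho> * K \<tau> \<rho>))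
         + 3 * (\<Sum>\<rho>\<in>S. q \<rho> * (\<Sum>\<rho>'\<in>S. q \<rho>' * K \<rho> \<rho>'))))))"
proof -
  let ?K = "\<lambda>\<sigma> \<tau>. \<Sum>j\<in>J. sign j * v j * (A j \<sigma> * A j \<tau>)" and ?q = "p t y" and ?m = "mean t y"
  have K1: "(\<Sum>\<rho>\<in>S. ?q \<rho> * ?K \<sigma> \<rho>) = (\<Sum>j\<in>J. sign j * v j * (?m j * A j \<sigma>))" for \<sigma>
    unfolding mean_def sum_distrib_left sum_distrib_right by (subst sum.swap) (simp only: mult_ac)
  have K2: "(\<Sum>\<rho>\<in>S. ?q \<rho> * (\<Sum>j\<in>J. sign j * v j * (?m j * A j \<rho>))) = (\<Sum>j\<in>J. sign j * v j * (?m j)\<^sup>2)"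
  proof -
    have "(\<Sum>\<rho>\<in>S. ?q \<rho> * (\<Sum>j\<in>J. sign j * v j * (?m j * A j \<rho>))) = (\<Sum>j\<in>J. \<Sum>\<rho>\<in>S. ?q \<rho> * (sign j * v j * (?m j * A j \<rho>)))"
      unfolding sum_distrib_left by (rule sum.swap)
    also have "\<dots> = (\<Sum>j\<in>J. sign j * v j * ?m j * (\<Sum>\<rho>\<in>S. ?q \<rho> * A j \<rho>))"
      unfolding sum_distrib_left by (intro sum.cong refl) (simp only: mult_ac)
    also have "\<dots> = (\<Sum>j\<in>J. sign j * v j * (?m j)\<^sup>2)"
      by (intro sum.cong refl) (simp add: mean_def power2_eq_square)
    finally show ?thesis .
  qed
  have "(\<Sum>j\<in>J. sign j * v j / 2 * DD f j t y) = (\<Sum>\<sigma>\<in>S. \<Sum>\<tau>\<in>S. \<Sum>j\<in>J. sign j * v j / 2 * (f \<sigma> \<tau> * (?q \<sigma> * ?q \<tau> *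
     (2 * (A j \<sigma> * A j \<tau>) - 4 * ?m j * (A j \<sigma> + A j \<tau>) + 6 * (?m j)\<^sup>2))))"
    unfolding DD_def sum_distrib_left by (subst sum.swap [of _ J]) (subst sum.swap [of _ J], rule refl)
  also have "\<dots> = (\<Sum>\<sigma>\<in>S. \<Sum>\<tau>\<in>S. f \<sigma> \<tau> * (?q \<sigma> * ?q \<tau> *
        (?K \<sigma> \<tau> - 2 * ((\<Sum>j\<in>J. sign j * v j * (?m j * A j \<sigma>)) + (\<Sum>j\<in>J. sign j * v j * (?m j * A j \<tau>)))
         + 3 * (\<Sum>j\<in>J. sign j * v j * (?m j)\<^sup>2))))"
  proof (rule sum.cong [OF refl], rule sum.cong [OF refl])
    fix \<sigma> \<tau>
    have "(\<Sum>j\<in>J. sign j * v j / 2 * (f \<sigma> \<tau> * (?q \<sigma> * ?q \<tau> *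
       (2 * (A j \<sigma> * A j \<tau>) - 4 * ?m j * (A j \<sigma> + A j \<tau>) + 6 * (?m j)\<^sup>2))))
     = f \<sigma> \<tau> * (?q \<sigma> * ?q \<tau> * (\<Sum>j\<in>J. sign j * v j / 2 *
       (2 * (A j \<sigma> * A j \<tau>) - 4 * ?m j * (A j \<sigma> + A j \<tau>) + 6 * (?m j)\<^sup>2)))"
      unfolding sum_distrib_left by (intro sum.cong refl) (simp only: mult_ac)
    also have "(\<Sum>j\<in>J. sign j * v j / 2 * (2 * (A j \<sigma> * A j \<tau>) - 4 * ?m j * (A j \<sigma> + A j \<tau>) + 6 * (?m j)\<^sup>2))
      = (\<Sum>j\<in>J. sign j * v j * (A j \<sigma> * A j \<tau>) - 2 * (sign j * v j * (?m j * A j \<sigma>) + sign j * v j * (?m j * A j \<tau>))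
         + 3 * (sign j * v j * (?m j)\<^sup>2))"
      by (intro sum.cong refl) (simp add: field_simps)
    also have "\<dots> = ?K \<sigma> \<tau> - 2 * ((\<Sum>j\<in>J. sign j * v j * (?m j * A j \<sigma>)) + (\<Sum>j\<in>J. sign j * v j * (?m j * A j \<tau>)))
         + 3 * (\<Sum>j\<in>J. sign j * v j * (?m j)\<^sup>2)"
      by (simp only: sum.distrib sum_subtractf sum_distrib_left [symmetric])
    finally show "(\<Sum>j\<in>J. sign j * v j / 2 * (f \<sigma> \<tau> * (?q \<sigma> * ?q \<tau> *
       (2 * (A j \<sigma> * A j \<tau>) - 4 * ?m j * (A j \<sigma> + A j \<tau>) + 6 * (?m j)\<^sup>2)))) = f \<sigma> \<tau> * (?q \<sigma> * ?q \<tau> *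
        (?K \<sigma> \<tau> - 2 * ((\<Sum>j\<in>J. sign j * v j * (?m j * A j \<sigma>)) + (\<Sum>j\<in>J. sign j * v j * (?m j * A j \<tau>)))
         + 3 * (\<Sum>j\<in>J. sign j * v j * (?m j)\<^sup>2)))" .
  qed
  finally show ?thesis
    unfolding Let_def K1 K2 .
qed

text \<open>Along the path the exponent \<open>(\<kappa> - 4 * al * c * R * t) * Y\<close> decreases just fast enough to make the
  average monotone in \<open>t\<close>.\<close>

lemma (in gaussian_interpolation) latala_interpolation:
  fixes Y Q :: "'s \<Rightarrow> 's \<Rightarrow> real"
  assumes Ysym: "\<And>\<sigma> \<tau>. Y \<sigma> \<tau> = Y \<tau> \<sigma>" and Y0: "\<And>\<sigma> \<tau>. 0 \<le> Y \<sigma> \<tau>"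
    and K: "\<And>\<sigma> \<tau>. \<sigma> \<in> S \<Longrightarrow> \<tau> \<in> S \<Longrightarrow> (\<Sum>j\<in>J. sign j * v j * (A j \<sigma> * A j \<tau>)) = c * Q \<sigma> \<tau> + c0" and c: "0 \<le> c"
    and Q: "\<And>\<sigma> \<tau>. \<bar>Q \<sigma> \<tau>\<bar> \<le> R * Y \<sigma> \<tau>" and R: "0 \<le> R"
    and al: "al = 1 \<and> (\<forall>\<sigma> \<tau>. 0 \<le> Q \<sigma> \<tau>) \<or> al = 2"
    and \<kappa>: "4 * al * c * R \<le> \<kappa>"
  shows "(\<integral>y. avg2 (\<lambda>\<sigma> \<tau>. exp ((\<kappa> - 4 * al * c * R) * Y \<sigma> \<tau>)) 1 y \<partial>gaussian_product J v)
    \<le> (\<integral>y. avg2 (\<lambda>\<sigma> \<tau>. exp (\<kappa> * Y \<sigma> \<tau>)) 0 y \<partial>gaussian_product J v)"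
proof -
  define l where "l = 4 * al * c * R"
  have l: "0 \<le> l" "l \<le> \<kappa>" using al c R \<kappa> by (auto simp: l_def)
  define f where "f t \<sigma> \<tau> = exp ((\<kappa> - l * t) * Y \<sigma> \<tau>)" for t \<sigma> \<tau>
  define f' where "f' t \<sigma> \<tau> = - l * (exp ((\<kappa> - l * t) * Y \<sigma> \<tau>) * Y \<sigma> \<tau>)" for t \<sigma> \<tau>
  \<comment> \<open>One bound for \<open>f\<close> and \<open>f'\<close> that is uniform in time; it
    is finite because \<open>S\<close> is.\<close>
  define B where "B = (\<Sum>\<sigma>\<in>S. \<Sum>\<tau>\<in>S. (1 + l * Y \<sigma> \<tau>) * exp (\<kappa> * Y \<sigma> \<tau>))"
  have Bmem: "(1 + l * Y \<sigma> \<tau>) * exp (\<kappa> * Y \<sigma> \<tau>) \<le> B" if "\<sigma> \<in> S" "\<tau> \<in> S" for \<sigma> \<tau>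
  proof -
    have nn: "0 \<le> (1 + l * Y \<sigma> \<tau>) * exp (\<kappa> * Y \<sigma> \<tau>)" for \<sigma> \<tau>
      using l Y0 [of \<sigma> \<tau>] by (intro mult_nonneg_nonneg add_nonneg_nonneg) auto
    have "(1 + l * Y \<sigma> \<tau>) * exp (\<kappa> * Y \<sigma> \<tau>) \<le> (\<Sum>\<tau>\<in>S. (1 + l * Y \<sigma> \<tau>) * exp (\<kappa> * Y \<sigma> \<tau>))"
      by (rule member_le_sum [OF that(2) nn S(1)])
    also have "\<dots> \<le> B"
      unfolding B_def by (rule member_le_sum [OF that(1) sum_nonneg [OF nn] S(1)])
    finally show ?thesis .
  qed
  have fle: "f t \<sigma> \<tau> \<le> exp (\<kappa> * Y \<sigma> \<tau>)" if "0 \<le> t" for t \<sigma> \<tau>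
    unfolding f_def exp_le_cancel_iff using that l Y0 by (intro mult_right_mono) auto
  have fB: "\<bar>f t \<sigma> \<tau>\<bar> \<le> B" if "0 \<le> t" "\<sigma> \<in> S" "\<tau> \<in> S" for t \<sigma> \<tau>
  proof -
    have "\<bar>f t \<sigma> \<tau>\<bar> \<le> 1 * exp (\<kappa> * Y \<sigma> \<tau>)" using fle [OF that(1)] by (simp add: f_def)
    also have "\<dots> \<le> (1 + l * Y \<sigma> \<tau>) * exp (\<kappa> * Y \<sigma> \<tau>)" using l Y0 by (intro mult_right_mono) auto
    finally show ?thesis using Bmem [OF that(2,3)] by linarith
  qed
  have f'B: "\<bar>f' t \<sigma> \<tau>\<bar> \<le> B" if "0 \<le> t" "\<sigma> \<in> S" "\<tau> \<in> S" for t \<sigma> \<tau>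
  proof -
    have "\<bar>f' t \<sigma> \<tau>\<bar> = (l * Y \<sigma> \<tau>) * f t \<sigma> \<tau>" using l Y0 by (simp add: f'_def f_def abs_mult)
    also have "\<dots> \<le> (1 + l * Y \<sigma> \<tau>) * exp (\<kappa> * Y \<sigma> \<tau>)"
      using l Y0 fle [OF that(1)] by (intro mult_mono) (auto simp: f_def)
    finally show ?thesis using Bmem [OF that(2,3)] by linarith
  qed
  have der: "((\<lambda>t. f t \<sigma> \<tau>) has_real_derivative f' s \<sigma> \<tau>) (at s)" for s \<sigma> \<tau>
    unfolding f_def f'_def by (auto intro!: derivative_eq_intros)
  let ?\<phi> = "\<lambda>t. \<integral>y. avg2 (f t) t y \<partial>gaussian_product J v"
  have "?\<phi> 1 \<le> ?\<phi> 0"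
  proof (rule DERIV_nonpos_imp_decreasing_open [where a = 0 and b = 1])
    fix t :: real assume t: "0 < t" "t < 1"
    let ?d = "\<lambda>y. avg2 (f' t) t y + (\<Sum>j\<in>J. sign j * v j / 2 * DD (f t) j t y)"
    have "(?\<phi> has_real_derivative
       (\<integral>y. avg2 (f' t) t y + (\<Sum>j\<in>J. sign j * v j / 2 * DD (f t) j t y) \<partial>gaussian_product J v)) (at t)"
      by (rule expectation_avg2_deriv [where B = B]) (use t in \<open>auto intro: der fB f'B\<close>)
    moreover have neg: "?d y \<le> 0" for y
    proof -
      have "(\<Sum>j\<in>J. sign j * v j / 2 * DD (f t) j t y) \<le> 4 * al * c * R *
          (\<Sum>\<sigma>\<in>S. \<Sum>\<tau>\<in>S. exp ((\<kappa> - l * t) * Y \<sigma> \<tau>) * (p t y \<sigma> * p t y \<tau> * Y \<sigma> \<tau>))"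
        unfolding sum_sign_DD Let_def f_def
      proof (rule latala_inequality [OF S(1) p_nonneg p_sum _ Ysym Y0 K c Q R al])
        \<comment> \<open>Association requires a nonnegative exponent along the whole path, which is
          what the lower bound on \<open>\<kappa>\<close> provides.\<close>
        have "l * t \<le> l * 1" using t l by (intro mult_left_mono) auto
        then show "0 \<le> \<kappa> - l * t" using l by linarith
      qed
      also have "\<dots> = - avg2 (f' t) t y"
        unfolding avg2_def f'_def l_def [symmetric]
        by (simp add: sum_distrib_left sum_negf [symmetric] mult_ac)
      finally show ?thesis by simp
    qed
    moreover have "(\<integral>y. ?d y \<partial>gaussian_product J v) \<le> 0"
    proof -
      have "0 \<le> (\<integral>y. - ?d y \<partial>gaussian_product J v)"
        by (rule Bochner_Integration.integral_nonneg, unfold neg_0_le_iff_le, rule neg)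
      then show ?thesis unfolding Bochner_Integration.integral_minus by linarith
    qed
    ultimately show "\<exists>y. (?\<phi> has_real_derivative y) (at t) \<and> y \<le> 0"
      by (intro exI conjI)
  next
    show "continuous_on {0..1} ?\<phi>"
    proof (rule expectation_avg2_continuous [where B = B])
      show "continuous_on {0..1} (\<lambda>t. f t \<sigma> \<tau>)" for \<sigma> \<tau>
        unfolding f_def by (intro continuous_intros)
    qed (use fB in auto)
  qed simp
  moreover have "f 1 = (\<lambda>\<sigma> \<tau>. exp ((\<kappa> - 4 * al * c * R) * Y \<sigma> \<tau>))" "f 0 = (\<lambda>\<sigma> \<tau>. exp (\<kappa> * Y \<sigma> \<tau>))"
    by (simp_all add: f_def l_def fun_eq_iff)
  ultimately show ?thesis
    by (simp only:)
qed

section \<open>Concentration of the overlaps\<close>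

text \<open>Hoeffding's lemma for a sign of mean \<open>q\<close>: its range has length 2, whence
  \<open>(2 * u)\<^sup>2 / 8\<close>. Negative \<open>u\<close> follows by changing the signs of
  \<open>u\<close> and \<open>q\<close>.\<close>

lemma two_point_exp_le:
  fixes u q :: real
  assumes "\<bar>q\<bar> \<le> 1"
  shows "(1 + q) / 2 * exp u + (1 - q) / 2 * exp (- u) \<le> exp (u * q + u\<^sup>2 / 2)"
proof -
  have *: "(1 + q) / 2 * exp u + (1 - q) / 2 * exp (- u) \<le> exp (u * q + u\<^sup>2 / 2)"
    if u: "0 \<le> u" and q: "\<bar>q\<bar> \<le> 1" for u q :: real
  proof -
    let ?p = "(1 + q) / 2"
    have p: "0 \<le> ?p" using q by (simp add: abs_le_iff)
    have pos: "0 < 1 + ?p * (exp (2 * u) - 1)"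
      using p u by (intro add_pos_nonneg mult_nonneg_nonneg) auto
    have "- (2 * u) * ?p + ln (1 + ?p * (exp (2 * u) - 1)) \<le> (2 * u)\<^sup>2 / 8"
      by (rule Hoeffdings_lemma_aux) (use u p in auto)
    then have "ln (1 + ?p * (exp (2 * u) - 1)) \<le> u\<^sup>2 / 2 + u + u * q"
      by (simp add: power2_eq_square field_simps)
    then have "1 + ?p * (exp (2 * u) - 1) \<le> exp (u\<^sup>2 / 2 + u + u * q)"
      using pos by (simp add: ln_le_cancel_iff [symmetric] del: ln_le_cancel_iff)
    then have "exp (- u) * (1 + ?p * (exp (2 * u) - 1)) \<le> exp (- u) * exp (u\<^sup>2 / 2 + u + u * q)"
      by (intro mult_left_mono) auto
    also have "exp (- u) * exp (u\<^sup>2 / 2 + u + u * q) = exp (u * q + u\<^sup>2 / 2)"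
      unfolding exp_add [symmetric] by (rule arg_cong [where f = exp]) simp
    also have "exp (- u) * (1 + ?p * (exp (2 * u) - 1)) = (1 - ?p) * exp (- u) + ?p * (exp (- u) * exp (2 * u))"
      by (simp add: algebra_simps)
    also have "exp (- u) * exp (2 * u) = exp u"
      unfolding exp_add [symmetric] by (rule arg_cong [where f = exp]) simp
    also have "1 - ?p = (1 - q) / 2" by (simp add: field_simps)
    finally show ?thesis by simp
  qed
  show ?thesis
    using *[of u q] *[of "- u" "- q"] assms by (cases "0 \<le> u") (simp_all add: add.commute)
qed

lemma gaussian_exp_integral:
  assumes "0 \<le> v"
  shows "(\<integral>x. exp (a * x) \<partial>centered_gaussian v) = exp (v * a\<^sup>2 / 2)"
proof -
  have "complex_of_real (\<integral>x. exp (a * x) \<partial>centered_gaussian v) = (\<integral>x. exp (of_real a * of_real x) \<partial>centered_gaussian v)"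
    by (subst integral_complex_of_real [symmetric]) (simp only: exp_of_real [symmetric] of_real_mult)
  also have "\<dots> = of_real (exp (v * a\<^sup>2 / 2))"
    unfolding gaussian_complex_exp [OF assms] by (simp only: exp_of_real [symmetric]) simp
  finally show ?thesis by (simp only: of_real_eq_iff)
qed

lemma std_gaussian_square_exp_integrable:
  assumes \<kappa>: "\<kappa> < 1 / 2"
  shows "integrable (centered_gaussian 1) (\<lambda>x. exp (\<kappa> * x\<^sup>2 + c * \<bar>x\<bar>))"
proof -
  \<comment> \<open>\<open>2 * e\<close> is the distance of \<open>\<kappa>\<close> from
    \<open>1 / 2\<close>: one \<open>e\<close> absorbs the linear term, and the other leaves a
    Gaussian of variance \<open>1 / (2 * e)\<close>.\<close>
  define e where "e = (1 / 2 - \<kappa>) / 2"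
  have e: "0 < e" using \<kappa> by (simp add: e_def)
  define \<sigma> where "\<sigma> = 1 / sqrt (2 * e)"
  have \<sigma>: "0 < \<sigma>" "\<sigma>\<^sup>2 = 1 / (2 * e)" using e by (auto simp: \<sigma>_def power_divide)
  define K where "K = sqrt (2 * pi * \<sigma>\<^sup>2) * exp (c\<^sup>2 / (4 * e))"
  have int: "integrable lborel (\<lambda>x. K * normal_density 0 \<sigma> x)"
    using \<sigma> by (intro integrable_mult_right integrable_normal_density)
  have "integrable lborel (\<lambda>x. std_normal_density x * exp (\<kappa> * x\<^sup>2 + c * \<bar>x\<bar>))"
  proof (rule Bochner_Integration.integrable_bound [OF int])
    show "AE x in lborel. norm (std_normal_density x * exp (\<kappa> * x\<^sup>2 + c * \<bar>x\<bar>)) \<le> norm (K * normal_density 0 \<sigma> x)"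
    proof (rule AE_I2)
      fix x :: real
      have "0 \<le> (2 * e * \<bar>x\<bar> - c)\<^sup>2" by simp
      then have "4 * e * (c * \<bar>x\<bar>) \<le> 4 * e * (e * x\<^sup>2 + c\<^sup>2 / (4 * e))"
        using e by (simp add: power2_eq_square algebra_simps)
      then have "c * \<bar>x\<bar> \<le> e * x\<^sup>2 + c\<^sup>2 / (4 * e)"
        using e by simp
      then have le: "- x\<^sup>2 / 2 + (\<kappa> * x\<^sup>2 + c * \<bar>x\<bar>) \<le> c\<^sup>2 / (4 * e) + - x\<^sup>2 / (2 * \<sigma>\<^sup>2)"
        unfolding \<sigma>(2) using e by (simp add: e_def field_simps)
      have "std_normal_density x * exp (\<kappa> * x\<^sup>2 + c * \<bar>x\<bar>) \<le> 1 * exp (- x\<^sup>2 / 2) * exp (\<kappa> * x\<^sup>2 + c * \<bar>x\<bar>)"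
        unfolding std_normal_density_def using pi_ge_two
        by (intro mult_right_mono) (auto simp: field_simps)
      also have "\<dots> \<le> exp (c\<^sup>2 / (4 * e)) * exp (- x\<^sup>2 / (2 * \<sigma>\<^sup>2))"
        unfolding mult_1 exp_add [symmetric] exp_le_cancel_iff by (rule le)
      also have "\<dots> = K * normal_density 0 \<sigma> x"
        using \<sigma>(1) by (simp add: K_def normal_density_def)
      finally show "norm (std_normal_density x * exp (\<kappa> * x\<^sup>2 + c * \<bar>x\<bar>)) \<le> norm (K * normal_density 0 \<sigma> x)"
        using \<sigma>(1) by (simp add: normal_density_nonneg abs_mult K_def)
    qed
  qed measurable
  then have "integrable std_normal_distribution (\<lambda>x. exp (\<kappa> * x\<^sup>2 + c * \<bar>x\<bar>))"
    by (simp add: integrable_density normal_density_nonneg)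
  then show ?thesis
    by (subst integrable_centered_gaussian_iff) simp_all
qed

lemma sum_symmetric_pairs:
  fixes F :: "nat \<Rightarrow> nat \<Rightarrow> real"
  assumes V: "finite V" and sym: "\<And>i j. i \<in> V \<Longrightarrow> j \<in> V \<Longrightarrow> F i j = F j i"
  shows "(\<Sum>i\<in>V. \<Sum>j\<in>V. F i j) = 2 * (\<Sum>(i, j)\<in>{(i, j)\<in>V \<times> V. i < j}. F i j) + (\<Sum>i\<in>V. F i i)"
proof -
  let ?E = "{(i, j)\<in>V \<times> V. i < j}" and ?G = "{(i, j)\<in>V \<times> V. j < i}" and ?D = "{(i, j)\<in>V \<times> V. i = j}"
  have fin: "finite ?E" "finite ?G" "finite ?D"
    using V by (auto intro: finite_subset [OF _ finite_cartesian_product [OF V V]])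
  have "(\<Sum>i\<in>V. \<Sum>j\<in>V. F i j) = (\<Sum>(i, j)\<in>V \<times> V. F i j)" by (rule sum.cartesian_product)
  also have "V \<times> V = ?E \<union> (?G \<union> ?D)" by auto
  also have "(\<Sum>(i, j)\<in>?E \<union> (?G \<union> ?D). F i j) = (\<Sum>(i, j)\<in>?E. F i j) + ((\<Sum>(i, j)\<in>?G. F i j) + (\<Sum>(i, j)\<in>?D. F i j))"
    by (subst sum.union_disjoint, use fin in auto)+
  also have "(\<Sum>(i, j)\<in>?G. F i j) = (\<Sum>(i, j)\<in>?E. F i j)"
    by (rule sum.reindex_bij_witness [of _ prod.swap prod.swap]) (auto intro: sym)
  also have "(\<Sum>(i, j)\<in>?D. F i j) = (\<Sum>i\<in>V. F i i)"
    by (rule sum.reindex_bij_witness [of _ "\<lambda>i. (i, i)" fst]) auto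
  finally show ?thesis by simp
qed

section \<open>The interpolation for the system without one site\<close>

text \<open>The sites that remain after the removal of one, with the scaling \<open>N\<close> and
  the ratios \<open>lam\<close> of the full system; \<open>card_le\<close> and
  \<open>card_ge\<close> let a species fall short of its ratio by one site.\<close>

locale msk_sites =
  fixes m N :: nat and V :: "nat set" and sp :: "nat \<Rightarrow> nat" and d :: "nat \<Rightarrow> nat \<Rightarrow> real"
    and lam q :: "nat \<Rightarrow> real" and \<beta> h :: real
  assumes V: "finite V" and sp: "\<And>i. i \<in> V \<Longrightarrow> sp i < m"
    and d_sym: "\<And>s t. s < m \<Longrightarrow> t < m \<Longrightarrow> d s t = d t s"
    and d_nonneg: "\<And>s t. s < m \<Longrightarrow> t < m \<Longrightarrow> 0 \<le> d s t"
    and lam: "\<And>s. s < m \<Longrightarrow> 0 < lam s"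
    and q: "\<And>s. s < m \<Longrightarrow> 0 \<le> q s \<and> q s \<le> 1"
    and N: "0 < N" and \<beta>: "0 < \<beta>"
    and card_le: "\<And>s. s < m \<Longrightarrow> card {i \<in> V. sp i = s} \<le> lam s * N"
    and card_ge: "\<And>s. s < m \<Longrightarrow> lam s * N - 1 \<le> card {i \<in> V. sp i = s}"
    and q_fixed: "\<And>s. s < m \<Longrightarrow>
      q s = (\<integral>y. (tanh (\<beta> * y + h))\<^sup>2 \<partial>centered_gaussian (\<Sum>t<m. d s t * lam t * q t))"
begin

definition \<theta> :: "nat \<Rightarrow> real" where "\<theta> s = (\<Sum>t<m. d s t * lam t * q t)"

definition spins :: "(nat \<Rightarrow> real) set" where "spins = V \<rightarrow>\<^sub>E {-1, 1}"

definition edges :: "(nat \<times> nat) set" where "edges = {(i, j)\<in>V \<times> V. i < j}"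

text \<open>The coordinate \<open>(i, j)\<close> with \<open>i < j\<close> is the disorder on an edge, and \<open>(i, i)\<close> is an independent Gaussian
  field at the site \<open>i\<close>; the interpolation starts from the fields, at \<open>t = 0\<close>, and ends with the edges.\<close>

definition pairs :: "(nat \<times> nat) set" where "pairs = edges \<union> (\<lambda>i. (i, i)) ` V"

definition var :: "nat \<times> nat \<Rightarrow> real" where
  "var = (\<lambda>(i, j). if i < j then d (sp i) (sp j) else \<theta> (sp i))"

definition A :: "nat \<times> nat \<Rightarrow> (nat \<Rightarrow> real) \<Rightarrow> real" where
  "A = (\<lambda>(i, j) \<sigma>. if i < j then \<beta> / sqrt N * (\<sigma> i * \<sigma> j) else \<beta> * \<sigma> i)"

definition overlap :: "nat \<Rightarrow> (nat \<Rightarrow> real) \<Rightarrow> (nat \<Rightarrow> real) \<Rightarrow> real" where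
  "overlap s \<sigma> \<tau> = (\<Sum>i | i \<in> V \<and> sp i = s. \<sigma> i * \<tau> i)"

definition W :: "nat \<Rightarrow> (nat \<Rightarrow> real) \<Rightarrow> (nat \<Rightarrow> real) \<Rightarrow> real" where
  "W s \<sigma> \<tau> = overlap s \<sigma> \<tau> - N * lam s * q s"

text \<open>The weights \<open>1 / lam s\<close> give the norm in which the quadratic form
  \<open>Q\<close> is controlled by the spectral radius; the factor \<open>1 / N\<close> is the
  normalisation under which exponential moments are bounded uniformly in the size.\<close>

definition Y :: "(nat \<Rightarrow> real) \<Rightarrow> (nat \<Rightarrow> real) \<Rightarrow> real" where
  "Y \<sigma> \<tau> = (\<Sum>s<m. (W s \<sigma> \<tau>)\<^sup>2 / (lam s * N))"

definition Q :: "(nat \<Rightarrow> real) \<Rightarrow> (nat \<Rightarrow> real) \<Rightarrow> real" where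
  "Q \<sigma> \<tau> = (\<Sum>s<m. \<Sum>t<m. d s t * W s \<sigma> \<tau> * W t \<sigma> \<tau>)"

lemma \<theta>_nonneg: "s < m \<Longrightarrow> 0 \<le> \<theta> s"
  unfolding \<theta>_def using d_nonneg lam q by (intro sum_nonneg mult_nonneg_nonneg) (auto simp: less_imp_le)

lemma finite_spins: "finite spins" unfolding spins_def using V by (intro finite_PiE) auto
lemma spins_nonempty: "spins \<noteq> {}" unfolding spins_def by (simp add: PiE_eq_empty_iff)
lemma spin_values: "\<sigma> \<in> spins \<Longrightarrow> i \<in> V \<Longrightarrow> \<sigma> i = - 1 \<or> \<sigma> i = 1" unfolding spins_def by (auto dest: PiE_mem)
lemma spin_square: "\<sigma> \<in> spins \<Longrightarrow> i \<in> V \<Longrightarrow> \<sigma> i * \<sigma> i = 1" using spin_values by fastforce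
lemma spin_abs: "\<sigma> \<in> spins \<Longrightarrow> i \<in> V \<Longrightarrow> \<bar>\<sigma> i\<bar> = 1" using spin_values by fastforce

lemma finite_edges: "finite edges"
  unfolding edges_def using V by (auto intro: finite_subset [OF _ finite_cartesian_product [OF V V]])

lemma finite_pairs: "finite pairs" unfolding pairs_def using finite_edges V by simp

lemma pairs_cases:
  assumes "j \<in> pairs"
  obtains (edge) a b where "j = (a, b)" "a \<in> V" "b \<in> V" "a < b" | (site) a where "j = (a, a)" "a \<in> V"
  using assms unfolding pairs_def edges_def by auto

lemma N_sqrt: "1 \<le> sqrt N" using N by simp

sublocale GI: gaussian_interpolation spins pairs var A "\<lambda>\<sigma>. h * (\<Sum>i\<in>V. \<sigma> i)" "\<lambda>(i, j). i < j"
  "\<lambda>(i, j). if i < j then \<beta>\<^sup>2 / N else \<beta>\<^sup>2" \<beta>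
proof
  show "finite spins" "spins \<noteq> {}" "finite pairs"
    by (rule finite_spins spins_nonempty finite_pairs)+
  show "0 \<le> var j" if "j \<in> pairs" for j
    using that by (cases rule: pairs_cases) (auto simp: var_def intro!: \<theta>_nonneg d_nonneg sp)
  show "\<bar>A j \<sigma>\<bar> \<le> \<beta>" if "j \<in> pairs" "\<sigma> \<in> spins" for j \<sigma>
    using that(1)
  proof (cases rule: pairs_cases)
    case (edge a b)
    then have "\<bar>A j \<sigma>\<bar> = \<beta> / sqrt N"
      using \<beta> that(2) by (simp add: A_def abs_mult spin_abs)
    also have "\<dots> \<le> \<beta> / 1" using \<beta> N_sqrt by (intro divide_left_mono) auto
    finally show ?thesis by simp
  next
    case (site a)
    then show ?thesis using \<beta> that(2) by (simp add: A_def abs_mult spin_abs)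
  qed
  show "A j \<sigma> * A j \<sigma> = (case j of (i, j) \<Rightarrow> if i < j then \<beta>\<^sup>2 / N else \<beta>\<^sup>2)" if "j \<in> pairs" "\<sigma> \<in> spins" for j \<sigma>
    using that(1)
  proof (cases rule: pairs_cases)
    case (edge a b)
    have "\<beta> / sqrt N * (\<sigma> a * \<sigma> b) * (\<beta> / sqrt N * (\<sigma> a * \<sigma> b)) = (\<beta> / sqrt N)\<^sup>2 * (\<sigma> a * \<sigma> a) * (\<sigma> b * \<sigma> b)"
      by (simp add: power2_eq_square)
    also have "\<dots> = \<beta>\<^sup>2 / N"
      using edge that(2) N by (simp add: spin_square power_divide)
    finally show ?thesis using edge by (simp add: A_def)
  next
    case (site a)
    have "\<beta> * \<sigma> a * (\<beta> * \<sigma> a) = \<beta>\<^sup>2 * (\<sigma> a * \<sigma> a)" by (simp add: power2_eq_square)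
    then show ?thesis using site that(2) by (simp add: A_def spin_square)
  qed
qed

lemma sum_by_species: "(\<Sum>i\<in>V. g (sp i) * e i) = (\<Sum>s<m. g s * (\<Sum>i | i \<in> V \<and> sp i = s. e i))" for g e :: "nat \<Rightarrow> real"
proof -
  have "(\<Sum>i\<in>V. g (sp i) * e i) = (\<Sum>s<m. \<Sum>i | i \<in> V \<and> sp i = s. g (sp i) * e i)"
    by (rule sum.group [symmetric]) (use V sp in auto)
  also have "\<dots> = (\<Sum>s<m. g s * (\<Sum>i | i \<in> V \<and> sp i = s. e i))"
    unfolding sum_distrib_left by (intro sum.cong refl) auto
  finally show ?thesis .
qed

lemma Y_sym: "Y \<sigma> \<tau> = Y \<tau> \<sigma>"
  by (simp add: Y_def W_def overlap_def mult.commute)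

lemma Y_nonneg: "0 \<le> Y \<sigma> \<tau>"
  unfolding Y_def using lam by (intro sum_nonneg divide_nonneg_nonneg mult_nonneg_nonneg) (auto simp: less_imp_le)

text \<open>The part of the kernel common to all pairs of configurations: the diagonal of the
  quadratic form and the square of the centring. Constants cancel in the replica expansion.\<close>

definition K0 :: real where
  "K0 = - (\<beta>\<^sup>2 / (2 * N)) * ((\<Sum>i\<in>V. d (sp i) (sp i)) + N\<^sup>2 * (\<Sum>s<m. lam s * q s * \<theta> s))"

text \<open>Completing the square. The edges give half the quadratic form of the overlaps without
  its diagonal, and the fields give minus the linear terms \<open>\<theta> s * overlap s\<close>.
  With \<open>\<theta>\<close> built from \<open>q\<close> these are exactly the cross terms that
  centre the overlaps at \<open>N * lam s * q s\<close>, which explains the choice of the field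
  variances.\<close>

lemma interpolation_kernel:
  assumes st: "\<sigma> \<in> spins" "\<tau> \<in> spins"
  shows "(\<Sum>j\<in>pairs. GI.sign j * var j * (A j \<sigma> * A j \<tau>)) = \<beta>\<^sup>2 / (2 * N) * Q \<sigma> \<tau> + K0"
proof -
  let ?e = "\<lambda>i. \<sigma> i * \<tau> i" and ?T = "\<lambda>s. overlap s \<sigma> \<tau>"
  have ssq: "sqrt N * sqrt N = N" by simp
  have "(\<Sum>j\<in>pairs. GI.sign j * var j * (A j \<sigma> * A j \<tau>))
      = (\<Sum>j\<in>edges. GI.sign j * var j * (A j \<sigma> * A j \<tau>)) + (\<Sum>j\<in>(\<lambda>i. (i, i)) ` V. GI.sign j * var j * (A j \<sigma> * A j \<tau>))"
    unfolding pairs_def by (rule sum.union_disjoint) (use finite_edges V in \<open>auto simp: edges_def\<close>)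
  also have "(\<Sum>j\<in>edges. GI.sign j * var j * (A j \<sigma> * A j \<tau>)) = \<beta>\<^sup>2 / N * (\<Sum>(i, j)\<in>edges. d (sp i) (sp j) * ?e i * ?e j)"
    unfolding sum_distrib_left
    by (intro sum.cong refl) (use ssq in \<open>auto simp: edges_def GI.sign_def var_def A_def power2_eq_square field_simps\<close>)
  also have "(\<Sum>j\<in>(\<lambda>i. (i, i)) ` V. GI.sign j * var j * (A j \<sigma> * A j \<tau>)) = - \<beta>\<^sup>2 * (\<Sum>i\<in>V. \<theta> (sp i) * ?e i)"
    unfolding sum_distrib_left by (subst sum.reindex)
      (auto simp: inj_on_def GI.sign_def var_def A_def power2_eq_square mult_ac intro!: sum.cong)
  also have "(\<Sum>i\<in>V. \<theta> (sp i) * ?e i) = (\<Sum>s<m. \<theta> s * ?T s)"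
    unfolding overlap_def by (rule sum_by_species)
  also have "(\<Sum>(i, j)\<in>edges. d (sp i) (sp j) * ?e i * ?e j)
      = ((\<Sum>s<m. \<Sum>t<m. d s t * ?T s * ?T t) - (\<Sum>i\<in>V. d (sp i) (sp i))) / 2"
  proof -
    have "(\<Sum>i\<in>V. \<Sum>j\<in>V. d (sp i) (sp j) * ?e i * ?e j)
      = 2 * (\<Sum>(i, j)\<in>edges. d (sp i) (sp j) * ?e i * ?e j) + (\<Sum>i\<in>V. d (sp i) (sp i) * ?e i * ?e i)"
      unfolding edges_def by (rule sum_symmetric_pairs [OF V]) (use d_sym sp in auto)
    moreover have "(\<Sum>i\<in>V. d (sp i) (sp i) * ?e i * ?e i) = (\<Sum>i\<in>V. d (sp i) (sp i))"
    proof (intro sum.cong refl)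
      fix i assume i: "i \<in> V"
      have "d (sp i) (sp i) * ?e i * ?e i = d (sp i) (sp i) * (\<sigma> i * \<sigma> i) * (\<tau> i * \<tau> i)" by simp
      then show "d (sp i) (sp i) * ?e i * ?e i = d (sp i) (sp i)"
        using spin_square [OF st(1) i] spin_square [OF st(2) i] by (simp only: mult_1_right)
    qed
    moreover have "(\<Sum>i\<in>V. \<Sum>j\<in>V. d (sp i) (sp j) * ?e i * ?e j) = (\<Sum>s<m. \<Sum>t<m. d s t * ?T s * ?T t)"
    proof -
      have "(\<Sum>i\<in>V. \<Sum>j\<in>V. d (sp i) (sp j) * ?e i * ?e j) = (\<Sum>i\<in>V. (\<Sum>t<m. d (sp i) t * ?T t) * ?e i)"
      proof (intro sum.cong refl)
        fix i
        have "(\<Sum>j\<in>V. d (sp i) (sp j) * ?e i * ?e j) = (\<Sum>j\<in>V. d (sp i) (sp j) * ?e j) * ?e i"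
          unfolding sum_distrib_right by (intro sum.cong refl) simp
        also have "(\<Sum>j\<in>V. d (sp i) (sp j) * ?e j) = (\<Sum>t<m. d (sp i) t * ?T t)"
          unfolding overlap_def by (rule sum_by_species)
        finally show "(\<Sum>j\<in>V. d (sp i) (sp j) * ?e i * ?e j) = (\<Sum>t<m. d (sp i) t * ?T t) * ?e i" .
      qed
      also have "\<dots> = (\<Sum>s<m. (\<Sum>t<m. d s t * ?T t) * ?T s)"
        unfolding overlap_def by (rule sum_by_species)
      also have "\<dots> = (\<Sum>s<m. \<Sum>t<m. d s t * ?T s * ?T t)"
        unfolding sum_distrib_right by (intro sum.cong refl) simp
      finally show ?thesis .
    qed
    ultimately show ?thesis by simp
  qed
  also have "(\<Sum>s<m. \<Sum>t<m. d s t * ?T s * ?T t) = Q \<sigma> \<tau> + 2 * N * (\<Sum>s<m. \<theta> s * ?T s) - N\<^sup>2 * (\<Sum>s<m. lam s * q s * \<theta> s)"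
  proof -
    have 1: "(\<Sum>s<m. \<Sum>t<m. d s t * (lam s * q s) * ?T t) = (\<Sum>s<m. \<theta> s * ?T s)"
      unfolding \<theta>_def sum_distrib_right by (subst sum.swap) (auto intro!: sum.cong simp: d_sym mult_ac)
    have 2: "(\<Sum>s<m. \<Sum>t<m. d s t * ?T s * (lam t * q t)) = (\<Sum>s<m. \<theta> s * ?T s)"
      unfolding \<theta>_def sum_distrib_right by (auto intro!: sum.cong simp: mult_ac)
    have 3: "(\<Sum>s<m. \<Sum>t<m. d s t * (lam s * q s) * (lam t * q t)) = (\<Sum>s<m. lam s * q s * \<theta> s)"
      unfolding \<theta>_def sum_distrib_left by (auto intro!: sum.cong simp: mult_ac)
    have "Q \<sigma> \<tau> = (\<Sum>s<m. \<Sum>t<m. d s t * ?T s * ?T t - N * (d s t * ?T s * (lam t * q t))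
       - N * (d s t * (lam s * q s) * ?T t) + N\<^sup>2 * (d s t * (lam s * q s) * (lam t * q t)))"
      unfolding Q_def W_def by (intro sum.cong refl) (simp add: power2_eq_square algebra_simps)
    also have "\<dots> = (\<Sum>s<m. \<Sum>t<m. d s t * ?T s * ?T t) - N * (\<Sum>s<m. \<theta> s * ?T s) - N * (\<Sum>s<m. \<theta> s * ?T s)
        + N\<^sup>2 * (\<Sum>s<m. lam s * q s * \<theta> s)"
      by (simp only: sum.distrib sum_subtractf sum_distrib_left [symmetric] 1 2 3)
    finally show ?thesis by simp
  qed
  finally show ?thesis
    using N by (simp add: K0_def power2_eq_square field_simps)
qed

end

section \<open>The independent end of the path\<close>

text \<open>The Gibbs weight of a single spin with value \<open>a\<close> in the field
  \<open>x\<close>, for \<open>a\<close> equal to 1 or -1.\<close>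

definition spin_weight :: "real \<Rightarrow> real \<Rightarrow> real" where
  "spin_weight x a = exp (x * a) / (exp x + exp (- x))"

lemma spin_weight_nonneg: "0 \<le> spin_weight x a"
  by (simp add: spin_weight_def add_nonneg_nonneg)

lemma exp_plus_exp_pos: "0 < exp x + exp (- x :: real)"
  by (intro add_pos_pos) auto

lemma spin_weight_le_1: "a = - 1 \<or> a = 1 \<Longrightarrow> spin_weight x a \<le> 1"
  using exp_plus_exp_pos [of x] by (auto simp: spin_weight_def divide_le_eq)

lemma spin_weight_measurable: "(\<lambda>y. spin_weight (h + \<beta> * y) a) \<in> borel_measurable borel"
proof -
  have "exp (h + \<beta> * y) + exp (- (h + \<beta> * y)) \<noteq> 0" for y
    using exp_plus_exp_pos [of "h + \<beta> * y"] by linarith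
  then show ?thesis
    unfolding spin_weight_def by (intro borel_measurable_continuous_onI continuous_intros) blast
qed

text \<open>The joint law of the spins of two replicas at one site; the replicas share the Gaussian
  field.\<close>

definition pair_weight :: "real \<Rightarrow> real \<Rightarrow> real \<Rightarrow> real \<Rightarrow> real \<Rightarrow> real" where
  "pair_weight \<beta> h v a b = (\<integral>y. spin_weight (h + \<beta> * y) a * spin_weight (h + \<beta> * y) b \<partial>centered_gaussian v)"

lemma spin_weight_pair_integrable:
  assumes "a = - 1 \<or> a = 1" "b = - 1 \<or> b = 1"
  shows "integrable (centered_gaussian v) (\<lambda>y. spin_weight (h + \<beta> * y) a * spin_weight (h + \<beta> * y) b)"
proof -
  interpret prob_space "centered_gaussian v" by (rule prob_space_centered_gaussian)
  have "(\<lambda>y. spin_weight (h + \<beta> * y) a * spin_weight (h + \<beta> * y) b) \<in> borel_measurable (centered_gaussian v)"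
    unfolding measurable_cong_sets [OF sets_centered_gaussian refl]
    by (intro borel_measurable_times spin_weight_measurable)
  moreover have "norm (spin_weight (h + \<beta> * y) a * spin_weight (h + \<beta> * y) b) \<le> 1" for y
    using spin_weight_le_1 [OF assms(1), of "h + \<beta> * y"] spin_weight_le_1 [OF assms(2), of "h + \<beta> * y"]
    by (simp add: abs_mult spin_weight_nonneg mult_le_one)
  ultimately show ?thesis
    by (intro integrable_const_bound [where B = 1] AE_I2)
qed

text \<open>Given the field, the two spins are independent with mean \<open>tanh\<close>, so they
  agree with probability \<open>(1 + tanh\<^sup>2) / 2\<close>. After averaging, their product is a
  sign whose mean is the right-hand side of the fixed point equation.\<close>

lemma pair_weight_exp_sum:
  "(pair_weight \<beta> h v 1 1 + pair_weight \<beta> h v (- 1) (- 1)) * exp u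
      + (pair_weight \<beta> h v 1 (- 1) + pair_weight \<beta> h v (- 1) 1) * exp (- u)
    = (1 + (\<integral>y. (tanh (\<beta> * y + h))\<^sup>2 \<partial>centered_gaussian v)) / 2 * exp u
      + (1 - (\<integral>y. (tanh (\<beta> * y + h))\<^sup>2 \<partial>centered_gaussian v)) / 2 * exp (- u)"
proof -
  interpret prob_space "centered_gaussian v" by (rule prob_space_centered_gaussian)
  let ?w = "\<lambda>a y. spin_weight (h + \<beta> * y) a"
  have same: "?w 1 y * ?w 1 y + ?w (- 1) y * ?w (- 1) y = 1 / 2 + (tanh (\<beta> * y + h))\<^sup>2 / 2"
    and diff: "?w 1 y * ?w (- 1) y + ?w (- 1) y * ?w 1 y = 1 / 2 - (tanh (\<beta> * y + h))\<^sup>2 / 2" for y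
  proof -
    define a b where "a = exp (\<beta> * y + h)" and "b = exp (- (\<beta> * y + h))"
    have ab: "a + b \<noteq> 0" using exp_plus_exp_pos [of "\<beta> * y + h"] by (simp add: a_def b_def)
    have w: "?w 1 y = a / (a + b)" "?w (- 1) y = b / (a + b)" "tanh (\<beta> * y + h) = (a - b) / (a + b)"
      by (simp_all add: spin_weight_def a_def b_def tanh_altdef add.commute)
    show "?w 1 y * ?w 1 y + ?w (- 1) y * ?w (- 1) y = 1 / 2 + (tanh (\<beta> * y + h))\<^sup>2 / 2"
      and "?w 1 y * ?w (- 1) y + ?w (- 1) y * ?w 1 y = 1 / 2 - (tanh (\<beta> * y + h))\<^sup>2 / 2"
    proof -
      let ?s = "(a + b) * (a + b)"
      have s: "?s \<noteq> 0" using ab by simp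
      have sq: "(a - b)\<^sup>2 = 2 * (a * a + b * b) - ?s" and ab2: "a * b + b * a = ?s - (a * a + b * b)"
        by (simp_all add: power2_eq_square algebra_simps)
      have T: "((a - b) / (a + b))\<^sup>2 = 2 * ((a * a + b * b) / ?s) - 1"
        unfolding power_divide sq power2_eq_square [of "a + b"] using s by (simp add: diff_divide_distrib)
      show "?w 1 y * ?w 1 y + ?w (- 1) y * ?w (- 1) y = 1 / 2 + (tanh (\<beta> * y + h))\<^sup>2 / 2"
      proof -
        have "a / (a + b) * (a / (a + b)) + b / (a + b) * (b / (a + b)) = (a * a + b * b) / ?s"
          by (simp add: add_divide_distrib)
        moreover have "1 / 2 + (2 * t - 1) / 2 = t" for t :: real by (simp add: diff_divide_distrib)
        ultimately show ?thesis unfolding w T by (simp only:)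
      qed
      have "?w 1 y * ?w (- 1) y + ?w (- 1) y * ?w 1 y = (a * b + b * a) / ?s"
        unfolding w by (simp add: add_divide_distrib)
      also have "\<dots> = 1 - (a * a + b * b) / ?s"
        unfolding ab2 using s by (simp add: diff_divide_distrib)
      also have "\<dots> = 1 / 2 - (2 * ((a * a + b * b) / ?s) - 1) / 2"
      proof -
        have "1 - t = 1 / 2 - (2 * t - 1) / 2" for t :: real by (simp add: diff_divide_distrib)
        then show ?thesis .
      qed
      finally show "?w 1 y * ?w (- 1) y + ?w (- 1) y * ?w 1 y = 1 / 2 - (tanh (\<beta> * y + h))\<^sup>2 / 2"
        unfolding w(3) T .
    qed
  qed
  have int: "integrable (centered_gaussian v) (\<lambda>y. ?w a y * ?w b y)" if "a \<in> {- 1, 1}" "b \<in> {- 1, 1}" for a b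
    using that by (intro spin_weight_pair_integrable) auto
  have tanh_int: "integrable (centered_gaussian v) (\<lambda>y. (tanh (\<beta> * y + h))\<^sup>2 / 2)"
  proof -
    have "(\<lambda>y. (tanh (\<beta> * y + h))\<^sup>2 / 2) = (\<lambda>y. (?w 1 y * ?w 1 y + ?w (- 1) y * ?w (- 1) y) - 1 / 2)"
    proof (rule ext)
      fix y
      show "(tanh (\<beta> * y + h))\<^sup>2 / 2 = (?w 1 y * ?w 1 y + ?w (- 1) y * ?w (- 1) y) - 1 / 2"
        using same [of y] by linarith
    qed
    then show ?thesis
      by (simp only:) (intro Bochner_Integration.integrable_diff Bochner_Integration.integrable_add int integrable_const, auto)
  qed
  have "pair_weight \<beta> h v 1 1 + pair_weight \<beta> h v (- 1) (- 1) = (\<integral>y. 1 / 2 + (tanh (\<beta> * y + h))\<^sup>2 / 2 \<partial>centered_gaussian v)"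
    unfolding pair_weight_def same [symmetric]
    by (rule Bochner_Integration.integral_add [symmetric]) (rule int; simp)+
  also have "\<dots> = 1 / 2 + (\<integral>y. (tanh (\<beta> * y + h))\<^sup>2 / 2 \<partial>centered_gaussian v)"
    by (subst Bochner_Integration.integral_add [OF integrable_const tanh_int]) (simp add: prob_space [unfolded space_centered_gaussian])
  finally have 1: "pair_weight \<beta> h v 1 1 + pair_weight \<beta> h v (- 1) (- 1) = (1 + (\<integral>y. (tanh (\<beta> * y + h))\<^sup>2 \<partial>centered_gaussian v)) / 2"
    by (simp add: add_divide_distrib)
  have "pair_weight \<beta> h v 1 (- 1) + pair_weight \<beta> h v (- 1) 1 = (\<integral>y. 1 / 2 - (tanh (\<beta> * y + h))\<^sup>2 / 2 \<partial>centered_gaussian v)"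
    unfolding pair_weight_def diff [symmetric]
    by (rule Bochner_Integration.integral_add [symmetric]) (rule int; simp)+
  also have "\<dots> = 1 / 2 - (\<integral>y. (tanh (\<beta> * y + h))\<^sup>2 / 2 \<partial>centered_gaussian v)"
    by (subst Bochner_Integration.integral_diff [OF integrable_const tanh_int]) (simp add: prob_space [unfolded space_centered_gaussian])
  finally have 2: "pair_weight \<beta> h v 1 (- 1) + pair_weight \<beta> h v (- 1) 1 = (1 - (\<integral>y. (tanh (\<beta> * y + h))\<^sup>2 \<partial>centered_gaussian v)) / 2"
    by (simp add: diff_divide_distrib)
  show ?thesis by (simp only: 1 2)
qed

text \<open>Free of \<open>N\<close>, \<open>h\<close> and \<open>q\<close>, with integrable factors
  for \<open>\<kappa> < 1 / 2\<close>. The linear term in the exponent pays for the site that a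
  species may lack.\<close>

definition overlap_bound :: "nat \<Rightarrow> (nat \<Rightarrow> real) \<Rightarrow> real \<Rightarrow> real" where
  "overlap_bound m lam \<kappa> = (\<Prod>s<m. \<integral>x. exp (\<kappa> * x\<^sup>2 + sqrt (2 * \<kappa> / lam s) * \<bar>x\<bar>) \<partial>centered_gaussian 1)"

lemma (in gaussian_interpolation) avg2_scale: "c * avg2 f t y = avg2 (\<lambda>\<sigma> \<tau>. c * f \<sigma> \<tau>) t y"
  unfolding avg2_def sum_distrib_left by (simp only: mult.assoc)

lemma (in gaussian_interpolation) avg2_mono:
  "(\<And>\<sigma> \<tau>. f \<sigma> \<tau> \<le> g \<sigma> \<tau>) \<Longrightarrow> avg2 f t y \<le> avg2 g t y"
  unfolding avg2_def by (intro sum_mono mult_right_mono mult_nonneg_nonneg p_nonneg)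

context msk_sites
begin

lemma spin_sum_prod:
  "(\<Sum>\<sigma>\<in>spins. \<Prod>i\<in>V. g i (\<sigma> i)) = (\<Prod>i\<in>V. g i (- 1) + g i 1)" for g :: "nat \<Rightarrow> real \<Rightarrow> real"
  unfolding spins_def by (subst prod_sum_PiE [symmetric]) (use V in auto)

lemma gibbs_independent:
  "gibbs spins (\<lambda>\<sigma>. \<Sum>i\<in>V. x i * \<sigma> i) \<sigma> = (\<Prod>i\<in>V. spin_weight (x i) (\<sigma> i))"
proof -
  have "(\<Sum>\<tau>\<in>spins. exp (\<Sum>i\<in>V. x i * \<tau> i)) = (\<Sum>\<tau>\<in>spins. \<Prod>i\<in>V. exp (x i * \<tau> i))"
    by (simp only: exp_sum [OF V])
  also have "\<dots> = (\<Prod>i\<in>V. exp (x i * - 1) + exp (x i * 1))"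
    by (rule spin_sum_prod)
  finally show ?thesis
    by (simp add: gibbs_def exp_sum [OF V] spin_weight_def prod_dividef add.commute)
qed

lemma X_0: "GI.X 0 y \<sigma> = (\<Sum>i\<in>V. (h + \<beta> * y (i, i)) * \<sigma> i)"
proof -
  have "(\<Sum>j\<in>pairs. GI.coef j 0 * y j * A j \<sigma>)
      = (\<Sum>j\<in>edges. GI.coef j 0 * y j * A j \<sigma>) + (\<Sum>j\<in>(\<lambda>i. (i, i)) ` V. GI.coef j 0 * y j * A j \<sigma>)"
    unfolding pairs_def by (rule sum.union_disjoint) (use finite_edges V in \<open>auto simp: edges_def\<close>)
  also have "(\<Sum>j\<in>edges. GI.coef j 0 * y j * A j \<sigma>) = 0"
    by (rule sum.neutral) (auto simp: edges_def GI.coef_def)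
  also have "(\<Sum>j\<in>(\<lambda>i. (i, i)) ` V. GI.coef j 0 * y j * A j \<sigma>) = (\<Sum>i\<in>V. \<beta> * y (i, i) * \<sigma> i)"
    by (subst sum.reindex) (auto simp: inj_on_def GI.coef_def A_def intro!: sum.cong)
  finally show ?thesis
    unfolding GI.X_def by (simp add: sum_distrib_left distrib_right sum.distrib)
qed

lemma X_1: "GI.X 1 y \<sigma> = h * (\<Sum>i\<in>V. \<sigma> i) + \<beta> / sqrt N * (\<Sum>(i, j)\<in>edges. y (i, j) * \<sigma> i * \<sigma> j)"
proof -
  have "(\<Sum>j\<in>pairs. GI.coef j 1 * y j * A j \<sigma>)
      = (\<Sum>j\<in>edges. GI.coef j 1 * y j * A j \<sigma>) + (\<Sum>j\<in>(\<lambda>i. (i, i)) ` V. GI.coef j 1 * y j * A j \<sigma>)"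
    unfolding pairs_def by (rule sum.union_disjoint) (use finite_edges V in \<open>auto simp: edges_def\<close>)
  also have "(\<Sum>j\<in>edges. GI.coef j 1 * y j * A j \<sigma>) = \<beta> / sqrt N * (\<Sum>(i, j)\<in>edges. y (i, j) * \<sigma> i * \<sigma> j)"
    unfolding sum_distrib_left by (intro sum.cong refl) (auto simp: edges_def GI.coef_def A_def)
  also have "(\<Sum>j\<in>(\<lambda>i. (i, i)) ` V. GI.coef j 1 * y j * A j \<sigma>) = 0"
    by (rule sum.neutral) (auto simp: GI.coef_def)
  finally show ?thesis
    unfolding GI.X_def by simp
qed

abbreviation r :: "nat \<Rightarrow> real \<Rightarrow> real \<Rightarrow> real" where
  "r s \<equiv> pair_weight \<beta> h (\<theta> s)"

text \<open>Each field acts on one spin, so the two replica weights factorise over the sites and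
  each factor involves its own Gaussian coordinate.\<close>

lemma expectation_avg2_0:
  "(\<integral>y. GI.avg2 f 0 y \<partial>gaussian_product pairs var) = (\<Sum>\<sigma>\<in>spins. \<Sum>\<tau>\<in>spins. f \<sigma> \<tau> * (\<Prod>i\<in>V. r (sp i) (\<sigma> i) (\<tau> i)))"
proof -
  interpret product_prob_space "\<lambda>j. centered_gaussian (var j)"
    by (rule product_prob_space_gaussian)
  let ?F = "\<lambda>\<sigma> \<tau> i u. spin_weight (h + \<beta> * u) (\<sigma> i) * spin_weight (h + \<beta> * u) (\<tau> i)"
  \<comment> \<open>The factor 1 on the edges extends the product to all coordinates, as the
    factorisation of the product measure requires.\<close>
  let ?G = "\<lambda>\<sigma> \<tau> j u. if fst j < snd j then 1 else ?F \<sigma> \<tau> (fst j) u"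
  have avg: "GI.avg2 f 0 y = (\<Sum>\<sigma>\<in>spins. \<Sum>\<tau>\<in>spins. f \<sigma> \<tau> * (\<Prod>j\<in>pairs. ?G \<sigma> \<tau> j (y j)))" for y
    unfolding GI.avg2_def
  proof (intro sum.cong refl)
    fix \<sigma> \<tau>
    have p: "GI.p 0 y \<sigma> = (\<Prod>i\<in>V. spin_weight (h + \<beta> * y (i, i)) (\<sigma> i))" for \<sigma>
      unfolding GI.p_def X_0 [abs_def] by (rule gibbs_independent)
    have "(\<Prod>j\<in>pairs. ?G \<sigma> \<tau> j (y j)) = (\<Prod>j\<in>edges. ?G \<sigma> \<tau> j (y j)) * (\<Prod>j\<in>(\<lambda>i. (i, i)) ` V. ?G \<sigma> \<tau> j (y j))"
      unfolding pairs_def by (rule prod.union_disjoint) (use finite_edges V in \<open>auto simp: edges_def\<close>)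
    also have "(\<Prod>j\<in>edges. ?G \<sigma> \<tau> j (y j)) = 1"
      by (rule prod.neutral) (auto simp: edges_def)
    also have "(\<Prod>j\<in>(\<lambda>i. (i, i)) ` V. ?G \<sigma> \<tau> j (y j)) = (\<Prod>i\<in>V. ?F \<sigma> \<tau> i (y (i, i)))"
      by (subst prod.reindex) (auto simp: inj_on_def)
    finally show "f \<sigma> \<tau> * (GI.p 0 y \<sigma> * GI.p 0 y \<tau>) = f \<sigma> \<tau> * (\<Prod>j\<in>pairs. ?G \<sigma> \<tau> j (y j))"
      by (simp add: p prod.distrib)
  qed
  have G_int: "integrable (centered_gaussian (var j)) (?G \<sigma> \<tau> j)" if "\<sigma> \<in> spins" "\<tau> \<in> spins" "j \<in> pairs" for \<sigma> \<tau> j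
    using that(3)
  proof (cases rule: pairs_cases)
    case (edge a b)
    have "?G \<sigma> \<tau> j = (\<lambda>u. 1)" using edge by (auto simp: fun_eq_iff)
    then show ?thesis by (simp only:) (rule finite_measure.integrable_const [OF prob_space.finite_measure [OF prob_space_centered_gaussian]])
  next
    case (site a)
    then have "?G \<sigma> \<tau> j = ?F \<sigma> \<tau> a" by (auto simp: fun_eq_iff)
    then show ?thesis
      using spin_weight_pair_integrable [OF spin_values [OF that(1) site(2)] spin_values [OF that(2) site(2)]]
      by (simp only:)
  qed
  have prod_int: "integrable (gaussian_product pairs var) (\<lambda>y. \<Prod>j\<in>pairs. ?G \<sigma> \<tau> j (y j))" if "\<sigma> \<in> spins" "\<tau> \<in> spins" for \<sigma> \<tau>
    by (rule product_integrable_prod [OF finite_pairs G_int [OF that]])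
  have prod_val: "(\<integral>y. (\<Prod>j\<in>pairs. ?G \<sigma> \<tau> j (y j)) \<partial>gaussian_product pairs var) = (\<Prod>i\<in>V. r (sp i) (\<sigma> i) (\<tau> i))"
    if "\<sigma> \<in> spins" "\<tau> \<in> spins" for \<sigma> \<tau>
  proof -
    have "(\<integral>y. (\<Prod>j\<in>pairs. ?G \<sigma> \<tau> j (y j)) \<partial>gaussian_product pairs var) = (\<Prod>j\<in>pairs. \<integral>u. ?G \<sigma> \<tau> j u \<partial>centered_gaussian (var j))"
      by (rule product_integral_prod [OF finite_pairs G_int [OF that]])
    also have "\<dots> = (\<Prod>j\<in>edges. \<integral>u. ?G \<sigma> \<tau> j u \<partial>centered_gaussian (var j)) * (\<Prod>j\<in>(\<lambda>i. (i, i)) ` V. \<integral>u. ?G \<sigma> \<tau> j u \<partial>centered_gaussian (var j))"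
      unfolding pairs_def by (rule prod.union_disjoint) (use finite_edges V in \<open>auto simp: edges_def\<close>)
    also have "(\<Prod>j\<in>edges. \<integral>u. ?G \<sigma> \<tau> j u \<partial>centered_gaussian (var j)) = 1"
      by (rule prod.neutral) (auto simp: edges_def prob_space.prob_space [OF prob_space_centered_gaussian, unfolded space_centered_gaussian])
    also have "(\<Prod>j\<in>(\<lambda>i. (i, i)) ` V. \<integral>u. ?G \<sigma> \<tau> j u \<partial>centered_gaussian (var j)) = (\<Prod>i\<in>V. r (sp i) (\<sigma> i) (\<tau> i))"
      by (subst prod.reindex) (auto simp: inj_on_def var_def pair_weight_def)
    finally show ?thesis by simp
  qed
  have "(\<integral>y. GI.avg2 f 0 y \<partial>gaussian_product pairs var)
      = (\<Sum>\<sigma>\<in>spins. \<integral>y. (\<Sum>\<tau>\<in>spins. f \<sigma> \<tau> * (\<Prod>j\<in>pairs. ?G \<sigma> \<tau> j (y j))) \<partial>gaussian_product pairs var)"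
    unfolding avg by (rule Bochner_Integration.integral_sum) (intro Bochner_Integration.integrable_sum integrable_mult_right prod_int)
  also have "\<dots> = (\<Sum>\<sigma>\<in>spins. \<Sum>\<tau>\<in>spins. \<integral>y. f \<sigma> \<tau> * (\<Prod>j\<in>pairs. ?G \<sigma> \<tau> j (y j)) \<partial>gaussian_product pairs var)"
    by (rule sum.cong [OF refl], rule Bochner_Integration.integral_sum, rule integrable_mult_right, rule prod_int)
  also have "\<dots> = (\<Sum>\<sigma>\<in>spins. \<Sum>\<tau>\<in>spins. f \<sigma> \<tau> * (\<Prod>i\<in>V. r (sp i) (\<sigma> i) (\<tau> i)))"
    by (rule sum.cong [OF refl], rule sum.cong [OF refl]) (simp only: Bochner_Integration.integral_mult_right_zero prod_val)
  finally show ?thesis .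
qed

text \<open>The products \<open>\<sigma> i * \<tau> i\<close> are independent signs of mean
  \<open>q (sp i)\<close>, so Hoeffding's bound applies site by site. The linear terms cancel
  against the centring except for the error in the species counts, which costs
  \<open>\<bar>u s\<bar>\<close>.\<close>

lemma exponential_overlap_bound:
  fixes u :: "nat \<Rightarrow> real"
  shows "(\<Sum>\<sigma>\<in>spins. \<Sum>\<tau>\<in>spins. exp (\<Sum>s<m. u s * W s \<sigma> \<tau>) * (\<Prod>i\<in>V. r (sp i) (\<sigma> i) (\<tau> i)))
    \<le> exp (\<Sum>s<m. lam s * N * (u s)\<^sup>2 / 2 + \<bar>u s\<bar>)"
proof -
  let ?c = "\<Sum>s<m. u s * (N * lam s * q s)"
  let ?n = "\<lambda>s. real (card {i \<in> V. sp i = s})"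
  have split: "exp (\<Sum>s<m. u s * W s \<sigma> \<tau>) = exp (- ?c) * (\<Prod>i\<in>V. exp (u (sp i) * (\<sigma> i * \<tau> i)))" for \<sigma> \<tau>
  proof -
    have "(\<Sum>s<m. u s * W s \<sigma> \<tau>) = (\<Sum>s<m. u s * overlap s \<sigma> \<tau>) - ?c"
      by (simp add: W_def right_diff_distrib sum_subtractf)
    also have "(\<Sum>s<m. u s * overlap s \<sigma> \<tau>) = (\<Sum>i\<in>V. u (sp i) * (\<sigma> i * \<tau> i))"
      unfolding overlap_def by (rule sum_by_species [symmetric])
    finally show ?thesis
      by (simp add: exp_sum [OF V, symmetric] exp_add [symmetric])
  qed
  have "(\<Sum>\<sigma>\<in>spins. \<Sum>\<tau>\<in>spins. exp (\<Sum>s<m. u s * W s \<sigma> \<tau>) * (\<Prod>i\<in>V. r (sp i) (\<sigma> i) (\<tau> i)))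
      = exp (- ?c) * (\<Sum>\<sigma>\<in>spins. \<Sum>\<tau>\<in>spins. \<Prod>i\<in>V. r (sp i) (\<sigma> i) (\<tau> i) * exp (u (sp i) * (\<sigma> i * \<tau> i)))"
    unfolding split sum_distrib_left by (intro sum.cong refl) (simp add: prod.distrib mult_ac)
  also have "(\<Sum>\<sigma>\<in>spins. \<Sum>\<tau>\<in>spins. \<Prod>i\<in>V. r (sp i) (\<sigma> i) (\<tau> i) * exp (u (sp i) * (\<sigma> i * \<tau> i)))
      = (\<Sum>\<sigma>\<in>spins. \<Prod>i\<in>V. r (sp i) (\<sigma> i) (- 1) * exp (u (sp i) * (\<sigma> i * - 1)) + r (sp i) (\<sigma> i) 1 * exp (u (sp i) * (\<sigma> i * 1)))"
    by (rule sum.cong [OF refl], rule spin_sum_prod)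
  also have "\<dots> = (\<Prod>i\<in>V. (r (sp i) (- 1) (- 1) * exp (u (sp i) * (- 1 * - 1)) + r (sp i) (- 1) 1 * exp (u (sp i) * (- 1 * 1)))
      + (r (sp i) 1 (- 1) * exp (u (sp i) * (1 * - 1)) + r (sp i) 1 1 * exp (u (sp i) * (1 * 1))))"
    by (rule spin_sum_prod)
  also have "\<dots> = (\<Prod>i\<in>V. (1 + q (sp i)) / 2 * exp (u (sp i)) + (1 - q (sp i)) / 2 * exp (- u (sp i)))"
  proof (intro prod.cong refl)
    fix i assume "i \<in> V"
    then have "q (sp i) = (\<integral>y. (tanh (\<beta> * y + h))\<^sup>2 \<partial>centered_gaussian (\<theta> (sp i)))"
      unfolding \<theta>_def by (intro q_fixed sp)
    then show "(r (sp i) (- 1) (- 1) * exp (u (sp i) * (- 1 * - 1)) + r (sp i) (- 1) 1 * exp (u (sp i) * (- 1 * 1)))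
      + (r (sp i) 1 (- 1) * exp (u (sp i) * (1 * - 1)) + r (sp i) 1 1 * exp (u (sp i) * (1 * 1)))
      = (1 + q (sp i)) / 2 * exp (u (sp i)) + (1 - q (sp i)) / 2 * exp (- u (sp i))"
      using pair_weight_exp_sum [of \<beta> h "\<theta> (sp i)" "u (sp i)"] by (simp add: algebra_simps)
  qed
  also have "\<dots> \<le> (\<Prod>i\<in>V. exp (u (sp i) * q (sp i) + (u (sp i))\<^sup>2 / 2))"
  proof (intro prod_mono conjI)
    fix i assume i: "i \<in> V"
    then have "\<bar>q (sp i)\<bar> \<le> 1" "0 \<le> q (sp i)" "q (sp i) \<le> 1" using q [OF sp [OF i]] by auto
    then show "(1 + q (sp i)) / 2 * exp (u (sp i)) + (1 - q (sp i)) / 2 * exp (- u (sp i)) \<le> exp (u (sp i) * q (sp i) + (u (sp i))\<^sup>2 / 2)"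
      by (intro two_point_exp_le)
    show "0 \<le> (1 + q (sp i)) / 2 * exp (u (sp i)) + (1 - q (sp i)) / 2 * exp (- u (sp i))"
      using \<open>0 \<le> q (sp i)\<close> \<open>q (sp i) \<le> 1\<close> by (intro add_nonneg_nonneg mult_nonneg_nonneg) simp_all
  qed
  also have "\<dots> = exp (\<Sum>i\<in>V. (u (sp i) * q (sp i) + (u (sp i))\<^sup>2 / 2) * 1)"
    by (simp only: exp_sum [OF V] mult_1_right)
  also have "(\<Sum>i\<in>V. (u (sp i) * q (sp i) + (u (sp i))\<^sup>2 / 2) * 1) = (\<Sum>s<m. (u s * q s + (u s)\<^sup>2 / 2) * ?n s)"
    by (subst sum_by_species [where g = "\<lambda>s. u s * q s + (u s)\<^sup>2 / 2"]) simp
  also have "exp (- ?c) * exp (\<Sum>s<m. (u s * q s + (u s)\<^sup>2 / 2) * ?n s)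
      = exp (\<Sum>s<m. (u s)\<^sup>2 / 2 * ?n s + u s * q s * (?n s - lam s * N))"
    unfolding exp_add [symmetric] sum_negf [symmetric] sum.distrib [symmetric]
    by (intro arg_cong [where f = exp] sum.cong refl) (simp add: algebra_simps)
  also have "\<dots> \<le> exp (\<Sum>s<m. lam s * N * (u s)\<^sup>2 / 2 + \<bar>u s\<bar>)"
    unfolding exp_le_cancel_iff
  proof (intro sum_mono add_mono)
    fix s assume "s \<in> {..<m}"
    then have s: "s < m" by simp
    show "(u s)\<^sup>2 / 2 * ?n s \<le> lam s * N * (u s)\<^sup>2 / 2"
      using mult_right_mono [OF card_le [OF s], of "(u s)\<^sup>2 / 2"] by (simp add: mult_ac)
    \<comment> \<open>The count differs from \<open>lam s * N\<close> by at most one, and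
      \<open>q s\<close> lies between 0 and 1.\<close>
    have "\<bar>u s * q s * (?n s - lam s * N)\<bar> \<le> \<bar>u s\<bar> * 1 * 1"
      unfolding abs_mult using q [OF s] card_le [OF s] card_ge [OF s]
      by (intro mult_mono) (auto simp: abs_le_iff)
    then show "u s * q s * (?n s - lam s * N) \<le> \<bar>u s\<bar>" by linarith
  qed
  finally show ?thesis by simp
qed

text \<open>A Gaussian integral linearises the squares in \<open>Y\<close>; at \<open>t = 0\<close> the sites are independent.\<close>

lemma expectation_exp_Y_0:
  assumes \<kappa>: "0 \<le> \<kappa>" "\<kappa> < 1 / 2"
  shows "(\<integral>y. GI.avg2 (\<lambda>\<sigma> \<tau>. exp (\<kappa> * Y \<sigma> \<tau>)) 0 y \<partial>gaussian_product pairs var) \<le> overlap_bound m lam \<kappa>"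
proof -
  interpret G: product_prob_space "\<lambda>_::nat. centered_gaussian 1"
    by (rule product_prob_space_gaussian)
  let ?\<gamma> = "gaussian_product {..<m} (\<lambda>_. 1)"
  let ?w = "\<lambda>\<sigma> \<tau>. \<Prod>i\<in>V. r (sp i) (\<sigma> i) (\<tau> i)"
  \<comment> \<open>With this scale \<open>(c s * W s \<sigma> \<tau>)\<^sup>2 / 2\<close> is
    \<open>\<kappa>\<close> times the summand of \<open>Y\<close> for the species
    \<open>s\<close>.\<close>
  define c where "c s = sqrt (2 * \<kappa> / (lam s * N))" for s
  have c2: "(c s)\<^sup>2 = 2 * \<kappa> / (lam s * N)" if "s < m" for s
    unfolding c_def using \<kappa> lam [OF that] by (simp add: less_imp_le)
  have int: "integrable ?\<gamma> (\<lambda>x. \<Prod>s\<in>{..<m}. exp (c s * W s \<sigma> \<tau> * x s))" for \<sigma> \<tau>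
    by (rule G.product_integrable_prod) (auto intro: gaussian_exp_integrable)
  have HS: "exp (\<kappa> * Y \<sigma> \<tau>) = (\<integral>x. (\<Prod>s\<in>{..<m}. exp (c s * W s \<sigma> \<tau> * x s)) \<partial>?\<gamma>)" for \<sigma> \<tau>
  proof -
    have "(\<integral>x. (\<Prod>s\<in>{..<m}. exp (c s * W s \<sigma> \<tau> * x s)) \<partial>?\<gamma>) = (\<Prod>s\<in>{..<m}. \<integral>x. exp (c s * W s \<sigma> \<tau> * x) \<partial>centered_gaussian 1)"
      by (rule G.product_integral_prod) (auto intro: gaussian_exp_integrable)
    also have "\<dots> = (\<Prod>s\<in>{..<m}. exp (\<kappa> * ((W s \<sigma> \<tau>)\<^sup>2 / (lam s * N))))"
    proof (intro prod.cong refl)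
      fix s assume "s \<in> {..<m}"
      then have "1 * (c s * W s \<sigma> \<tau>)\<^sup>2 / 2 = \<kappa> * ((W s \<sigma> \<tau>)\<^sup>2 / (lam s * N))"
        by (simp add: power_mult_distrib c2)
      then show "(\<integral>x. exp (c s * W s \<sigma> \<tau> * x) \<partial>centered_gaussian 1) = exp (\<kappa> * ((W s \<sigma> \<tau>)\<^sup>2 / (lam s * N)))"
        by (simp only: gaussian_exp_integral [OF zero_le_one])
    qed
    also have "\<dots> = exp (\<kappa> * Y \<sigma> \<tau>)"
      by (simp add: Y_def sum_distrib_left exp_sum)
    finally show ?thesis by simp
  qed
  have "(\<integral>y. GI.avg2 (\<lambda>\<sigma> \<tau>. exp (\<kappa> * Y \<sigma> \<tau>)) 0 y \<partial>gaussian_product pairs var)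
      = (\<Sum>\<sigma>\<in>spins. \<Sum>\<tau>\<in>spins. \<integral>x. (\<Prod>s\<in>{..<m}. exp (c s * W s \<sigma> \<tau> * x s)) * ?w \<sigma> \<tau> \<partial>?\<gamma>)"
    unfolding expectation_avg2_0 HS by (simp only: Bochner_Integration.integral_mult_left_zero)
  also have "\<dots> = (\<integral>x. (\<Sum>\<sigma>\<in>spins. \<Sum>\<tau>\<in>spins. (\<Prod>s\<in>{..<m}. exp (c s * W s \<sigma> \<tau> * x s)) * ?w \<sigma> \<tau>) \<partial>?\<gamma>)"
  proof -
    have "(\<integral>x. (\<Sum>\<sigma>\<in>spins. \<Sum>\<tau>\<in>spins. (\<Prod>s\<in>{..<m}. exp (c s * W s \<sigma> \<tau> * x s)) * ?w \<sigma> \<tau>) \<partial>?\<gamma>)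
      = (\<Sum>\<sigma>\<in>spins. \<integral>x. (\<Sum>\<tau>\<in>spins. (\<Prod>s\<in>{..<m}. exp (c s * W s \<sigma> \<tau> * x s)) * ?w \<sigma> \<tau>) \<partial>?\<gamma>)"
      by (rule Bochner_Integration.integral_sum) (intro Bochner_Integration.integrable_sum integrable_mult_left int)
    also have "\<dots> = (\<Sum>\<sigma>\<in>spins. \<Sum>\<tau>\<in>spins. \<integral>x. (\<Prod>s\<in>{..<m}. exp (c s * W s \<sigma> \<tau> * x s)) * ?w \<sigma> \<tau> \<partial>?\<gamma>)"
      by (rule sum.cong [OF refl], rule Bochner_Integration.integral_sum, rule integrable_mult_left, rule int)
    finally show ?thesis by simp
  qed
  also have "\<dots> \<le> (\<integral>x. (\<Prod>s\<in>{..<m}. exp (\<kappa> * (x s)\<^sup>2 + sqrt (2 * \<kappa> / lam s) * \<bar>x s\<bar>)) \<partial>?\<gamma>)"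
  proof (rule integral_mono)
    show "integrable ?\<gamma> (\<lambda>x. \<Sum>\<sigma>\<in>spins. \<Sum>\<tau>\<in>spins. (\<Prod>s\<in>{..<m}. exp (c s * W s \<sigma> \<tau> * x s)) * ?w \<sigma> \<tau>)"
      by (intro Bochner_Integration.integrable_sum integrable_mult_left int)
    show "integrable ?\<gamma> (\<lambda>x. \<Prod>s\<in>{..<m}. exp (\<kappa> * (x s)\<^sup>2 + sqrt (2 * \<kappa> / lam s) * \<bar>x s\<bar>))"
      by (rule G.product_integrable_prod) (auto intro: std_gaussian_square_exp_integrable \<kappa>)
    fix x :: "nat \<Rightarrow> real"
    have "(\<Sum>\<sigma>\<in>spins. \<Sum>\<tau>\<in>spins. (\<Prod>s\<in>{..<m}. exp (c s * W s \<sigma> \<tau> * x s)) * ?w \<sigma> \<tau>)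
        = (\<Sum>\<sigma>\<in>spins. \<Sum>\<tau>\<in>spins. exp (\<Sum>s<m. (c s * x s) * W s \<sigma> \<tau>) * ?w \<sigma> \<tau>)"
      by (intro sum.cong refl) (simp add: exp_sum mult_ac)
    also have "\<dots> \<le> exp (\<Sum>s<m. lam s * N * (c s * x s)\<^sup>2 / 2 + \<bar>c s * x s\<bar>)"
      by (rule exponential_overlap_bound)
    also have "\<dots> \<le> exp (\<Sum>s<m. \<kappa> * (x s)\<^sup>2 + sqrt (2 * \<kappa> / lam s) * \<bar>x s\<bar>)"
      unfolding exp_le_cancel_iff
    proof (intro sum_mono add_mono)
      fix s assume "s \<in> {..<m}"
      then have s: "s < m" by simp
      show "lam s * N * (c s * x s)\<^sup>2 / 2 \<le> \<kappa> * (x s)\<^sup>2"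
        using lam [OF s] N by (simp add: power_mult_distrib c2 [OF s])
      \<comment> \<open>\<open>N \<ge> 1\<close> removes the last dependence on the size.\<close>
      have "2 * \<kappa> / (lam s * N) \<le> 2 * \<kappa> / (lam s * 1)"
        using lam [OF s] N \<kappa> by (intro divide_left_mono mult_left_mono) auto
      then have "c s \<le> sqrt (2 * \<kappa> / lam s)" unfolding c_def by simp
      moreover have "0 \<le> c s" unfolding c_def using \<kappa> lam [OF s] by (simp add: less_imp_le)
      ultimately show "\<bar>c s * x s\<bar> \<le> sqrt (2 * \<kappa> / lam s) * \<bar>x s\<bar>"
        by (simp add: abs_mult mult_right_mono)
    qed
    also have "\<dots> = (\<Prod>s\<in>{..<m}. exp (\<kappa> * (x s)\<^sup>2 + sqrt (2 * \<kappa> / lam s) * \<bar>x s\<bar>))"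
      by (simp only: exp_sum finite_lessThan)
    finally show "(\<Sum>\<sigma>\<in>spins. \<Sum>\<tau>\<in>spins. (\<Prod>s\<in>{..<m}. exp (c s * W s \<sigma> \<tau> * x s)) * ?w \<sigma> \<tau>)
        \<le> (\<Prod>s\<in>{..<m}. exp (\<kappa> * (x s)\<^sup>2 + sqrt (2 * \<kappa> / lam s) * \<bar>x s\<bar>))" .
  qed
  also have "\<dots> = overlap_bound m lam \<kappa>"
    unfolding overlap_bound_def
    by (rule G.product_integral_prod) (auto intro: std_gaussian_square_exp_integrable \<kappa>)
  finally show ?thesis .
qed

section \<open>Concentration at the end of the path\<close>

text \<open>The factor \<open>N\<close> in the bound \<open>\<rho> * N * Y\<close> of
  \<open>Q\<close> cancels the \<open>1 / (2 * N)\<close> of the kernel, so the exponent lost along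
  the path does not depend on the size.\<close>

lemma exponential_concentration:
  assumes quad: "\<And>w. \<bar>\<Sum>s<m. \<Sum>t<m. d s t * w s * w t\<bar> \<le> \<rho> * (\<Sum>s<m. (w s)\<^sup>2 / lam s)" and \<rho>: "0 \<le> \<rho>"
    and al: "al = 1 \<and> (\<forall>w. 0 \<le> (\<Sum>s<m. \<Sum>t<m. d s t * w s * w t)) \<or> al = 2"
    and \<kappa>: "2 * al * \<beta>\<^sup>2 * \<rho> \<le> \<kappa>" "\<kappa> < 1 / 2"
  shows "(\<integral>y. GI.avg2 (\<lambda>\<sigma> \<tau>. exp ((\<kappa> - 2 * al * \<beta>\<^sup>2 * \<rho>) * Y \<sigma> \<tau>)) 1 y \<partial>gaussian_product pairs var) \<le> overlap_bound m lam \<kappa>"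
proof -
  have eq: "4 * al * (\<beta>\<^sup>2 / (2 * N)) * (\<rho> * N) = 2 * al * \<beta>\<^sup>2 * \<rho>"
    using N by (simp add: field_simps)
  have "(\<integral>y. GI.avg2 (\<lambda>\<sigma> \<tau>. exp ((\<kappa> - 4 * al * (\<beta>\<^sup>2 / (2 * N)) * (\<rho> * N)) * Y \<sigma> \<tau>)) 1 y \<partial>gaussian_product pairs var)
      \<le> (\<integral>y. GI.avg2 (\<lambda>\<sigma> \<tau>. exp (\<kappa> * Y \<sigma> \<tau>)) 0 y \<partial>gaussian_product pairs var)"
  proof (rule GI.latala_interpolation [OF Y_sym Y_nonneg interpolation_kernel])
    show "\<bar>Q \<sigma> \<tau>\<bar> \<le> \<rho> * N * Y \<sigma> \<tau>" for \<sigma> \<tau>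
    proof -
      have "N * Y \<sigma> \<tau> = (\<Sum>s<m. (W s \<sigma> \<tau>)\<^sup>2 / lam s)"
        unfolding Y_def sum_distrib_left using N by (intro sum.cong refl) auto
      then show ?thesis
        using quad [of "\<lambda>s. W s \<sigma> \<tau>"] by (simp add: Q_def mult.assoc)
    qed
    show "al = 1 \<and> (\<forall>\<sigma> \<tau>. 0 \<le> Q \<sigma> \<tau>) \<or> al = 2" using al by (auto simp: Q_def)
    show "4 * al * (\<beta>\<^sup>2 / (2 * N)) * (\<rho> * N) \<le> \<kappa>" unfolding eq by (rule \<kappa>)
  qed (use \<rho> in auto)
  also have "\<dots> \<le> overlap_bound m lam \<kappa>"
  proof (rule expectation_exp_Y_0 [OF _ \<kappa>(2)])
    have "0 \<le> 2 * al * \<beta>\<^sup>2 * \<rho>" using al \<rho> by auto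
    then show "0 \<le> \<kappa>" using \<kappa> by linarith
  qed
  finally show ?thesis unfolding eq .
qed

text \<open>\<open>x ^ k / fact k \<le> exp x\<close> with \<open>x\<close> equal to
  \<open>\<delta>\<close> times a single summand of \<open>Y\<close>; solving for the power of
  \<open>W\<close> produces the factor \<open>N ^ k\<close>.\<close>

lemma overlap_moment:
  assumes quad: "\<And>w. \<bar>\<Sum>s<m. \<Sum>t<m. d s t * w s * w t\<bar> \<le> \<rho> * (\<Sum>s<m. (w s)\<^sup>2 / lam s)" and \<rho>: "0 \<le> \<rho>"
    and al: "al = 1 \<and> (\<forall>w. 0 \<le> (\<Sum>s<m. \<Sum>t<m. d s t * w s * w t)) \<or> al = 2"
    and \<kappa>: "2 * al * \<beta>\<^sup>2 * \<rho> < \<kappa>" "\<kappa> < 1 / 2" and s: "s < m"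
  shows "(\<integral>y. GI.avg2 (\<lambda>\<sigma> \<tau>. (W s \<sigma> \<tau>) ^ (2 * k)) 1 y \<partial>gaussian_product pairs var)
    \<le> fact k * (lam s * N / (\<kappa> - 2 * al * \<beta>\<^sup>2 * \<rho>)) ^ k * overlap_bound m lam \<kappa>"
proof -
  interpret GP: prob_space "gaussian_product pairs var" by (rule prob_space_gaussian_product)
  define \<delta> where "\<delta> = \<kappa> - 2 * al * \<beta>\<^sup>2 * \<rho>"
  have \<delta>: "0 < \<delta>" using \<kappa> by (simp add: \<delta>_def)
  define c where "c = fact k * (lam s * N / \<delta>) ^ k"
  have c: "0 \<le> c" using lam [OF s] \<delta> by (simp add: c_def)
  have le: "(W s \<sigma> \<tau>) ^ (2 * k) \<le> c * exp (\<delta> * Y \<sigma> \<tau>)" for \<sigma> \<tau>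
  proof -
    define x where "x = \<delta> * ((W s \<sigma> \<tau>)\<^sup>2 / (lam s * N))"
    have x: "0 \<le> x" using \<delta> lam [OF s] by (simp add: x_def)
    have "(W s \<sigma> \<tau>)\<^sup>2 / (lam s * N) \<le> Y \<sigma> \<tau>"
      unfolding Y_def by (rule member_le_sum) (use s lam in \<open>auto simp: less_imp_le\<close>)
    then have "x \<le> \<delta> * Y \<sigma> \<tau>" unfolding x_def by (rule mult_left_mono) (use \<delta> in simp)
    have "x ^ k / fact k \<le> exp x"
    proof -
      have "x ^ k / fact k \<le> (\<Sum>n<Suc k. x ^ n / fact n)"
        by (rule member_le_sum [where f = "\<lambda>n. x ^ n / fact n"]) (use x in auto)
      also have "\<dots> \<le> exp x" 
        using sum_le_suminf [OF summable_exp_generic [of x], of "{..<Suc k}"] x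
        by (simp add: exp_def divide_inverse_commute)
      finally show ?thesis .
    qed
    also have "\<dots> \<le> exp (\<delta> * Y \<sigma> \<tau>)" using \<open>x \<le> \<delta> * Y \<sigma> \<tau>\<close> by simp
    finally have "c * (x ^ k / fact k) \<le> c * exp (\<delta> * Y \<sigma> \<tau>)" by (intro mult_left_mono c)
    moreover have "c * (x ^ k / fact k) = (W s \<sigma> \<tau>) ^ (2 * k)"
    proof -
      have "c * (x ^ k / fact k) = (lam s * N / \<delta>) ^ k * x ^ k"
        by (simp add: c_def)
      also have "\<dots> = (lam s * N / \<delta> * x) ^ k"
        by (rule power_mult_distrib [symmetric])
      also have "lam s * N / \<delta> * x = (W s \<sigma> \<tau>)\<^sup>2"
        using \<delta> lam [OF s] N by (simp add: x_def)
      finally show ?thesis by (simp add: power_mult)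
    qed
    ultimately show ?thesis by simp
  qed
  have int: "integrable (gaussian_product pairs var) (GI.avg2 f 1)" for f
  proof -
    have "\<bar>f \<sigma> \<tau>\<bar> \<le> (\<Sum>\<sigma>\<in>spins. \<Sum>\<tau>\<in>spins. \<bar>f \<sigma> \<tau>\<bar>)" if "\<sigma> \<in> spins" "\<tau> \<in> spins" for \<sigma> \<tau>
      by (rule order_trans [OF member_le_sum [where f = "\<lambda>\<tau>. \<bar>f \<sigma> \<tau>\<bar>", OF that(2)]
            member_le_sum [where f = "\<lambda>\<sigma>. \<Sum>\<tau>\<in>spins. \<bar>f \<sigma> \<tau>\<bar>", OF that(1)]])
         (auto simp: finite_spins sum_nonneg)
    then show ?thesis
      by (intro GP.integrable_const_bound [where B = "\<Sum>\<sigma>\<in>spins. \<Sum>\<tau>\<in>spins. \<bar>f \<sigma> \<tau>\<bar>"] GI.avg2_measurable AE_I2)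
         (simp add: GI.avg2_bound)
  qed
  have "(\<integral>y. GI.avg2 (\<lambda>\<sigma> \<tau>. (W s \<sigma> \<tau>) ^ (2 * k)) 1 y \<partial>gaussian_product pairs var)
      \<le> (\<integral>y. c * GI.avg2 (\<lambda>\<sigma> \<tau>. exp (\<delta> * Y \<sigma> \<tau>)) 1 y \<partial>gaussian_product pairs var)"
  proof (rule integral_mono [OF int integrable_mult_right [OF int]])
    fix y
    show "GI.avg2 (\<lambda>\<sigma> \<tau>. (W s \<sigma> \<tau>) ^ (2 * k)) 1 y \<le> c * GI.avg2 (\<lambda>\<sigma> \<tau>. exp (\<delta> * Y \<sigma> \<tau>)) 1 y"
      unfolding GI.avg2_scale by (rule GI.avg2_mono) (rule le)
  qed
  also have "\<dots> = c * (\<integral>y. GI.avg2 (\<lambda>\<sigma> \<tau>. exp (\<delta> * Y \<sigma> \<tau>)) 1 y \<partial>gaussian_product pairs var)"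
    by (rule Bochner_Integration.integral_mult_right_zero)
  also have "\<dots> \<le> c * overlap_bound m lam \<kappa>"
    unfolding \<delta>_def by (intro mult_left_mono c exponential_concentration quad \<rho> al less_imp_le \<kappa>)
  finally show ?thesis
    by (simp only: c_def \<delta>_def)
qed

end

section \<open>The cavity field\<close>

lemma tanh_diff_le: "\<bar>tanh x - tanh y\<bar> \<le> \<bar>x - y\<bar>" for x y :: real
proof -
  have "norm (tanh x - tanh y) \<le> 1 * norm (x - y)"
  proof (rule field_differentiable_bound [where S = UNIV])
    show "(tanh has_field_derivative 1 - tanh z ^ 2) (at z within UNIV)" for z :: real
      by (auto intro!: derivative_eq_intros)
    show "norm (1 - tanh z ^ 2) \<le> 1" for z :: real
    proof -
      have "\<bar>tanh z\<bar> \<le> 1" using tanh_real_bounds [of z] by auto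
      then have "tanh z ^ 2 \<le> 1" by (simp add: abs_square_le_1)
      then show ?thesis by simp
    qed
  qed auto
  then show ?thesis by simp
qed

text \<open>Adding the site tilts \<open>w\<close> by \<open>2 * cosh (f + h)\<close>. The tilt
  moves the mean local field from its cavity value \<open>r\<close> to \<open>r + v * si\<close>, up
  to terms in \<open>y'\<close>; subtracting \<open>v * si\<close> in the equation undoes this
  reaction. The field \<open>h\<close> enters through ratios of \<open>P\<close> and
  \<open>M\<close> only, so the bound is uniform in it.\<close>

lemma cavity_estimate:
  fixes w f :: "'s \<Rightarrow> real" and v h :: real
  assumes S: "finite S" and w: "\<And>\<sigma>. \<sigma> \<in> S \<Longrightarrow> 0 \<le> w \<sigma>" and w1: "sum w S = 1" and v: "0 \<le> v"
  defines "x \<equiv> \<lambda>\<sigma>. f \<sigma> - (\<Sum>\<tau>\<in>S. w \<tau> * f \<tau>)"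
  defines "y \<equiv> \<lambda>s. \<Sum>\<sigma>\<in>S. w \<sigma> * exp (s * x \<sigma> - s\<^sup>2 * v / 2)"
  defines "y' \<equiv> \<lambda>s. \<Sum>\<sigma>\<in>S. w \<sigma> * ((x \<sigma> - s * v) * exp (s * x \<sigma> - s\<^sup>2 * v / 2))"
  defines "Z \<equiv> \<Sum>\<sigma>\<in>S. w \<sigma> * (exp (f \<sigma> + h) + exp (- (f \<sigma> + h)))"
  defines "si \<equiv> (\<Sum>\<sigma>\<in>S. w \<sigma> * (exp (f \<sigma> + h) - exp (- (f \<sigma> + h)))) / Z"
  defines "L \<equiv> (\<Sum>\<sigma>\<in>S. w \<sigma> * (f \<sigma> * (exp (f \<sigma> + h) + exp (- (f \<sigma> + h))))) / Z"
  shows "\<bar>si - tanh (L + h - v * si)\<bar> \<le> exp (v / 2) * (\<bar>y 1 - 1\<bar> + \<bar>y (- 1) - 1\<bar> + \<bar>y' 1\<bar> + \<bar>y' (- 1)\<bar>)"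
proof -
  define r where "r = (\<Sum>\<tau>\<in>S. w \<tau> * f \<tau>)"
  define P where "P = exp (r + h + v / 2)"
  define M where "M = exp (- (r + h) + v / 2)"
  define e where "e = exp (v / 2)"
  have ell: "f \<sigma> = r + x \<sigma>" for \<sigma> by (simp add: x_def r_def)
  have x0: "(\<Sum>\<sigma>\<in>S. w \<sigma> * x \<sigma>) = 0"
    by (simp add: x_def right_diff_distrib sum_subtractf w1 flip: sum_distrib_right)
  have ep: "exp (f \<sigma> + h) = P * exp (1 * x \<sigma> - 1\<^sup>2 * v / 2)" for \<sigma>
    unfolding P_def ell exp_add [symmetric] by (rule arg_cong [where f = exp]) simp
  have em: "exp (- (f \<sigma> + h)) = M * exp (- 1 * x \<sigma> - (- 1)\<^sup>2 * v / 2)" for \<sigma>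
    unfolding M_def ell exp_add [symmetric] by (rule arg_cong [where f = exp]) simp
  have sp: "(\<Sum>\<sigma>\<in>S. w \<sigma> * exp (f \<sigma> + h)) = P * y 1"
    unfolding ep y_def sum_distrib_left by (intro sum.cong refl) (simp only: mult_ac)
  have sm: "(\<Sum>\<sigma>\<in>S. w \<sigma> * exp (- (f \<sigma> + h))) = M * y (- 1)"
    unfolding em y_def sum_distrib_left by (intro sum.cong refl) (simp only: mult_ac)
  have Z: "Z = P * y 1 + M * y (- 1)"
    unfolding Z_def distrib_left sum.distrib sp sm ..
  have si: "si = (P * y 1 - M * y (- 1)) / Z"
    unfolding si_def right_diff_distrib sum_subtractf sp sm ..
  have L: "L * Z = r * Z + P * (y' 1 + v * y 1) + M * (y' (- 1) - v * y (- 1))" if "Z \<noteq> 0"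
  proof -
    have 1: "(\<Sum>\<sigma>\<in>S. w \<sigma> * (x \<sigma> * exp (f \<sigma> + h))) = P * (y' 1 + v * y 1)"
      unfolding ep y'_def y_def distrib_left sum_distrib_left sum.distrib [symmetric]
      by (intro sum.cong refl) (simp add: algebra_simps)
    have 2: "(\<Sum>\<sigma>\<in>S. w \<sigma> * (x \<sigma> * exp (- (f \<sigma> + h)))) = M * (y' (- 1) - v * y (- 1))"
      unfolding em y'_def y_def right_diff_distrib sum_distrib_left sum_subtractf [symmetric]
      by (intro sum.cong refl) (simp add: algebra_simps)
    have "(\<Sum>\<sigma>\<in>S. w \<sigma> * (f \<sigma> * (exp (f \<sigma> + h) + exp (- (f \<sigma> + h)))))
        = (\<Sum>\<sigma>\<in>S. r * (w \<sigma> * (exp (f \<sigma> + h) + exp (- (f \<sigma> + h)))) + w \<sigma> * (x \<sigma> * exp (f \<sigma> + h)) + w \<sigma> * (x \<sigma> * exp (- (f \<sigma> + h))))"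
      by (intro sum.cong refl) (subst ell, simp only: ring_distribs mult_ac add_ac)
    also have "\<dots> = r * Z + P * (y' 1 + v * y 1) + M * (y' (- 1) - v * y (- 1))"
      unfolding sum.distrib 1 2 by (simp only: Z_def sum_distrib_left)
    finally show ?thesis using that by (simp add: L_def)
  qed
  \<comment> \<open>As \<open>x\<close> is centred, Jensen keeps \<open>y 1\<close> and
    \<open>y (- 1)\<close> above \<open>exp (- v / 2)\<close>; the denominator \<open>Z\<close> is
    therefore comparable with \<open>P + M\<close>.\<close>
  have jensen: "1 / e \<le> y s" if "s\<^sup>2 = 1" for s
  proof -
    have "(\<Sum>\<sigma>\<in>S. w \<sigma> * (1 + s * x \<sigma>)) \<le> (\<Sum>\<sigma>\<in>S. w \<sigma> * exp (s * x \<sigma>))"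
      by (intro sum_mono mult_left_mono exp_ge_add_one_self w)
    moreover have "(\<Sum>\<sigma>\<in>S. w \<sigma> * (1 + s * x \<sigma>)) = 1 + s * (\<Sum>\<sigma>\<in>S. w \<sigma> * x \<sigma>)"
      by (simp add: distrib_left sum.distrib w1 sum_distrib_left mult_ac)
    ultimately have "1 \<le> (\<Sum>\<sigma>\<in>S. w \<sigma> * exp (s * x \<sigma>))" by (simp add: x0)
    moreover have "y s = (\<Sum>\<sigma>\<in>S. w \<sigma> * exp (s * x \<sigma>)) / e"
      unfolding y_def e_def that sum_divide_distrib by (simp add: exp_diff)
    ultimately show ?thesis by (simp add: divide_right_mono e_def)
  qed
  have y1: "1 / e \<le> y 1" and y2: "1 / e \<le> y (- 1)" by (auto intro: jensen)
  have e: "1 \<le> e" "0 < e" using v by (auto simp: e_def)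
  have PM: "0 < P" "0 < M" by (simp_all add: P_def M_def)
  have ypos: "0 < y 1" "0 < y (- 1)" using y1 y2 e by (auto intro: less_le_trans [of 0 "1 / e"])
  have Zpos: "0 < Z" unfolding Z using PM ypos by (intro add_pos_pos mult_pos_pos)
  have ZPM: "P + M \<le> e * Z"
  proof -
    have "P * (1 / e) + M * (1 / e) \<le> Z" unfolding Z using y1 y2 PM by (intro add_mono mult_left_mono) auto
    then have "e * (P * (1 / e) + M * (1 / e)) \<le> e * Z" using e by (intro mult_left_mono) auto
    then show ?thesis using e by (simp add: distrib_left)
  qed
  have tanh_r: "tanh (r + h) = (P - M) / (P + M)"
  proof -
    have "P = e * exp (r + h)" "M = e * exp (- (r + h))"
      unfolding P_def M_def e_def exp_add [symmetric] by (rule arg_cong [where f = exp], simp)+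
    then have "(P - M) / (P + M) = (e * (exp (r + h) - exp (- (r + h)))) / (e * (exp (r + h) + exp (- (r + h))))"
      by (simp only: ring_distribs)
    also have "\<dots> = tanh (r + h)" using e by (simp add: tanh_altdef)
    finally show ?thesis by simp
  qed
  have first: "\<bar>si - tanh (r + h)\<bar> \<le> e * (\<bar>y 1 - 1\<bar> + \<bar>y (- 1) - 1\<bar>)"
  proof -
    have PM0: "P + M \<noteq> 0" "Z \<noteq> 0" using PM Zpos by auto
    have "si - tanh (r + h) = (P * y 1 - M * y (- 1)) / Z - (P - M) / (P + M)"
      by (simp only: si tanh_r)
    also have "\<dots> = ((P * y 1 - M * y (- 1)) * (P + M) - (P - M) * Z) / (Z * (P + M))"
      using PM0 by (simp add: diff_frac_eq)
    \<comment> \<open>The squares of \<open>P\<close> and \<open>M\<close> cancel, and what remains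
      is proportional to the difference of the two values of \<open>y\<close>.\<close>
    also have "(P * y 1 - M * y (- 1)) * (P + M) - (P - M) * Z = 2 * P * M * (y 1 - y (- 1))"
      unfolding Z by (simp add: algebra_simps)
    finally have "\<bar>si - tanh (r + h)\<bar> = 2 * P * M * \<bar>y 1 - y (- 1)\<bar> / (Z * (P + M))"
      using PM Zpos by (simp add: abs_mult)
    also have "\<dots> \<le> e * \<bar>y 1 - y (- 1)\<bar>"
    proof -
      have "2 * P * M \<le> (P + M) * (P + M)"
        using mult_pos_pos [OF PM] zero_le_square [of "P - M"] zero_le_square P_def
        by (simp add: algebra_simps)
      also have "\<dots> \<le> (e * Z) * (P + M)" using ZPM PM by (intro mult_right_mono) auto
      finally have "2 * P * M * \<bar>y 1 - y (- 1)\<bar> \<le> (e * Z) * (P + M) * \<bar>y 1 - y (- 1)\<bar>"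
        by (rule mult_right_mono) simp
      then show ?thesis using PM Zpos by (simp add: divide_le_eq mult_ac)
    qed
    also have "\<dots> \<le> e * (\<bar>y 1 - 1\<bar> + \<bar>y (- 1) - 1\<bar>)"
      using e by (intro mult_left_mono) auto
    finally show ?thesis .
  qed
  have second: "\<bar>(r + h) - (L + h - v * si)\<bar> \<le> e * (\<bar>y' 1\<bar> + \<bar>y' (- 1)\<bar>)"
  proof -
    have siZ: "si * Z = P * y 1 - M * y (- 1)" using Zpos by (simp add: si)
    have "(L - r - v * si) * Z = L * Z - r * Z - v * (si * Z)" by (simp add: algebra_simps)
    also have "\<dots> = P * y' 1 + M * y' (- 1)"
      unfolding siZ using L Zpos by (simp add: algebra_simps)
    finally have eq: "(L - r - v * si) * Z = P * y' 1 + M * y' (- 1)" .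
    have "\<bar>L - r - v * si\<bar> * Z = \<bar>(L - r - v * si) * Z\<bar>" using Zpos by (simp add: abs_mult)
    also have "\<dots> \<le> P * \<bar>y' 1\<bar> + M * \<bar>y' (- 1)\<bar>"
      unfolding eq using PM by (intro order_trans [OF abs_triangle_ineq]) (simp add: abs_mult)
    also have "\<dots> \<le> (P + M) * \<bar>y' 1\<bar> + (P + M) * \<bar>y' (- 1)\<bar>"
      using PM by (intro add_mono mult_right_mono) auto
    also have "\<dots> \<le> (e * Z) * (\<bar>y' 1\<bar> + \<bar>y' (- 1)\<bar>)"
      unfolding distrib_left [symmetric] by (intro mult_right_mono ZPM) auto
    finally have "\<bar>L - r - v * si\<bar> * Z \<le> (e * (\<bar>y' 1\<bar> + \<bar>y' (- 1)\<bar>)) * Z" by (simp only: mult_ac)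
    then have "\<bar>L - r - v * si\<bar> \<le> e * (\<bar>y' 1\<bar> + \<bar>y' (- 1)\<bar>)" using Zpos by (simp only: mult_le_cancel_right_pos)
    then show ?thesis by (simp add: abs_minus_commute algebra_simps)
  qed
  have "\<bar>si - tanh (L + h - v * si)\<bar> \<le> \<bar>si - tanh (r + h)\<bar> + \<bar>tanh (r + h) - tanh (L + h - v * si)\<bar>" by linarith
  also have "\<dots> \<le> e * (\<bar>y 1 - 1\<bar> + \<bar>y (- 1) - 1\<bar>) + e * (\<bar>y' 1\<bar> + \<bar>y' (- 1)\<bar>)"
    by (intro add_mono first order_trans [OF tanh_diff_le second])
  finally show ?thesis by (simp add: e_def distrib_left)
qed

section \<open>Averages over the row of the removed site\<close>

text \<open>Induction on the index: divide by \<open>t ^ i\<close> and let \<open>t\<close> tend to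
  0. A bound of order \<open>t ^ n\<close> with any constant whatsoever thus becomes an exact
  cancellation, free of that constant.\<close>

lemma polynomial_vanishes:
  fixes p :: "nat \<Rightarrow> complex"
  assumes bound: "\<And>t::real. 0 < t \<Longrightarrow> t \<le> 1 \<Longrightarrow> norm (\<Sum>i<n. p i * of_real t ^ i) \<le> C * t ^ n"
    and "i < n"
  shows "p i = 0"
  using \<open>i < n\<close>
proof (induction i rule: less_induct)
  case (less i)
  define K where "K = \<bar>C\<bar> + (\<Sum>j<n. norm (p j))"
  have le: "norm (p i) \<le> t * K" if t: "0 < t" "t \<le> 1" for t :: real
  proof -
    let ?T = "of_real t :: complex"
    have "(\<Sum>j<n. p j * ?T ^ j) = (\<Sum>j\<in>{i} \<union> {j. i < j \<and> j < n}. p j * ?T ^ j)"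
      by (rule sum.mono_neutral_right) (use less in \<open>auto simp: not_less\<close>)
    also have "\<dots> = p i * ?T ^ i + (\<Sum>j | i < j \<and> j < n. p j * ?T ^ j)"
      by (subst sum.union_disjoint) auto
    finally have "norm (p i * ?T ^ i) = norm ((\<Sum>j<n. p j * ?T ^ j) - (\<Sum>j | i < j \<and> j < n. p j * ?T ^ j))"
      by simp
    also have "\<dots> \<le> C * t ^ n + (\<Sum>j | i < j \<and> j < n. norm (p j * ?T ^ j))"
      by (rule order_trans [OF norm_triangle_ineq4 add_mono [OF bound [OF t] norm_sum]])
    also have "\<dots> \<le> \<bar>C\<bar> * t ^ Suc i + (\<Sum>j | i < j \<and> j < n. norm (p j) * t ^ Suc i)"
    proof (intro add_mono sum_mono)
      have pw: "t ^ j \<le> t ^ Suc i" if "i < j" for j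
        using t that by (intro power_decreasing) auto
      have "C * t ^ n \<le> \<bar>C\<bar> * t ^ n" using t by (intro mult_right_mono) auto
      also have "\<dots> \<le> \<bar>C\<bar> * t ^ Suc i" by (intro mult_left_mono pw less.prems) auto
      finally show "C * t ^ n \<le> \<bar>C\<bar> * t ^ Suc i" .
      fix j assume "j \<in> {j. i < j \<and> j < n}"
      then show "norm (p j * ?T ^ j) \<le> norm (p j) * t ^ Suc i"
        using t by (simp only: norm_mult norm_power norm_of_real abs_of_pos) (intro mult_left_mono pw, auto)
    qed
    also have "\<dots> = (\<bar>C\<bar> + (\<Sum>j | i < j \<and> j < n. norm (p j))) * t ^ Suc i"
      by (simp add: distrib_right sum_distrib_right)
    also have "\<dots> \<le> K * t ^ Suc i"
      unfolding K_def using t by (intro mult_right_mono add_left_mono sum_mono2) auto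
    finally have "norm (p i) * t ^ i \<le> (t * K) * t ^ i"
      using t by (simp add: norm_mult norm_power mult_ac)
    then show ?thesis using t by (simp add: mult_le_cancel_right)
  qed
  have "norm (p i) \<le> 0"
  proof (rule ccontr)
    assume "\<not> norm (p i) \<le> 0"
    then have pos: "0 < norm (p i)" by simp
    have K: "norm (p i) \<le> K" using le [of 1] by simp
    with pos have Kpos: "0 < K" by linarith
    \<comment> \<open>At this point the bound would read
      \<open>norm (p i) \<le> norm (p i) / 2\<close>.\<close>
    let ?t = "norm (p i) / (2 * K)"
    have "norm (p i) \<le> ?t * K"
      by (rule le) (use pos K Kpos in \<open>auto simp: divide_le_eq\<close>)
    then show False using pos Kpos by simp
  qed
  then show ?case by simp
qed

text \<open>Every summand is at most the largest one, whose power occurs on the right.\<close>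

lemma sum_power_le:
  fixes a :: "'i \<Rightarrow> real"
  assumes I: "finite I" and a: "\<And>i. i \<in> I \<Longrightarrow> 0 \<le> a i" and n: "0 < n"
  shows "(\<Sum>i\<in>I. a i) ^ n \<le> real (card I) ^ n * (\<Sum>i\<in>I. a i ^ n)"
proof (cases "I = {}")
  case True
  then show ?thesis using n by (simp add: zero_power)
next
  case False
  define M where "M = Max (a ` I)"
  have "M \<in> a ` I" unfolding M_def using I False by (intro Max_in) auto
  then obtain i where i: "i \<in> I" "M = a i" by auto
  have "(\<Sum>i\<in>I. a i) \<le> (\<Sum>i\<in>I. M)" unfolding M_def using I by (intro sum_mono Max_ge) auto
  then have "(\<Sum>i\<in>I. a i) ^ n \<le> (real (card I) * M) ^ n"
    by (intro power_mono sum_nonneg a) auto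
  also have "\<dots> = real (card I) ^ n * a i ^ n" by (simp add: power_mult_distrib i)
  also have "\<dots> \<le> real (card I) ^ n * (\<Sum>i\<in>I. a i ^ n)"
    by (intro mult_left_mono member_le_sum [OF i(1)] zero_le_power a I) auto
  finally show ?thesis .
qed

text \<open>Distributivity turns the sum over replica tuples into a product of sums over single
  replicas, all equal to 1 except at \<open>a\<close>.\<close>

lemma replica_marginal:
  fixes p :: "'t \<Rightarrow> real"
  assumes I: "finite I" "a \<in> I" and T: "finite T" and p1: "sum p T = 1"
  shows "(\<Sum>s\<in>I \<rightarrow>\<^sub>E T. (\<Prod>i\<in>I. p (s i)) * F (s a)) = (\<Sum>x\<in>T. p x * F x)"
proof -
  have "(\<Sum>s\<in>I \<rightarrow>\<^sub>E T. (\<Prod>i\<in>I. p (s i)) * F (s a)) = (\<Sum>s\<in>I \<rightarrow>\<^sub>E T. \<Prod>i\<in>I. p (s i) * (if i = a then F (s i) else 1))"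
    using I by (intro sum.cong refl) (simp add: prod.distrib prod.delta)
  also have "\<dots> = (\<Prod>i\<in>I. \<Sum>x\<in>T. p x * (if i = a then F x else 1))"
    using I T by (intro prod_sum_PiE [symmetric]) auto
  also have "\<dots> = (\<Prod>i\<in>I. if i = a then (\<Sum>x\<in>T. p x * F x) else 1)"
    using p1 by (intro prod.cong refl) auto
  also have "\<dots> = (\<Sum>x\<in>T. p x * F x)" using I by (simp add: prod.delta)
  finally show ?thesis .
qed

lemma replica_marginal2:
  fixes p :: "'t \<Rightarrow> real"
  assumes I: "finite I" "a \<in> I" "b \<in> I" "a \<noteq> b" and T: "finite T" and p1: "sum p T = 1"
  shows "(\<Sum>s\<in>I \<rightarrow>\<^sub>E T. (\<Prod>i\<in>I. p (s i)) * F (s a) (s b)) = (\<Sum>x\<in>T. \<Sum>y\<in>T. p x * p y * F x y)"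
proof -
  \<comment> \<open>Splitting according to the value \<open>z\<close> at \<open>b\<close> makes the
    summand a product over the replicas.\<close>
  let ?g = "\<lambda>z i x. p x * ((if i = a then F x z else 1) * (if i = b then of_bool (x = z) else 1))"
  have "(\<Sum>s\<in>I \<rightarrow>\<^sub>E T. (\<Prod>i\<in>I. p (s i)) * F (s a) (s b))
      = (\<Sum>s\<in>I \<rightarrow>\<^sub>E T. \<Sum>z\<in>T. \<Prod>i\<in>I. ?g z i (s i))"
  proof (intro sum.cong refl)
    fix s assume s: "s \<in> I \<rightarrow>\<^sub>E T"
    have "(\<Sum>z\<in>T. \<Prod>i\<in>I. ?g z i (s i)) = (\<Sum>z\<in>T. (\<Prod>i\<in>I. p (s i)) * (F (s a) z * of_bool (s b = z)))"
      using I by (intro sum.cong refl) (simp add: prod.distrib prod.delta)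
    also have "\<dots> = (\<Sum>z\<in>T. if s b = z then (\<Prod>i\<in>I. p (s i)) * F (s a) z else 0)"
      by (intro sum.cong refl) auto
    also have "\<dots> = (\<Prod>i\<in>I. p (s i)) * F (s a) (s b)"
      using T PiE_mem [OF s I(3)] by (simp add: sum.delta)
    finally show "(\<Prod>i\<in>I. p (s i)) * F (s a) (s b) = (\<Sum>z\<in>T. \<Prod>i\<in>I. ?g z i (s i))" by simp
  qed
  also have "\<dots> = (\<Sum>z\<in>T. \<Sum>s\<in>I \<rightarrow>\<^sub>E T. \<Prod>i\<in>I. ?g z i (s i))" by (rule sum.swap)
  also have "\<dots> = (\<Sum>z\<in>T. \<Prod>i\<in>I. \<Sum>x\<in>T. ?g z i x)"
    using I T by (intro sum.cong refl prod_sum_PiE [symmetric]) auto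
  also have "\<dots> = (\<Sum>z\<in>T. p z * (\<Sum>x\<in>T. p x * F x z))"
  proof (intro sum.cong refl)
    fix z assume z: "z \<in> T"
    have "(\<Prod>i\<in>I. \<Sum>x\<in>T. ?g z i x) = (\<Prod>i\<in>I. (if i = a then (\<Sum>x\<in>T. p x * F x z) else 1) * (if i = b then p z else 1))"
    proof (intro prod.cong refl)
      fix i
      have "(\<Sum>x\<in>T. p x * of_bool (x = z)) = (\<Sum>x\<in>T. if x = z then p x else 0)"
        by (intro sum.cong refl) auto
      then have "(\<Sum>x\<in>T. p x * of_bool (x = z)) = p z"
        using T z by (simp add: sum.delta)
      then show "(\<Sum>x\<in>T. ?g z i x) = (if i = a then (\<Sum>x\<in>T. p x * F x z) else 1) * (if i = b then p z else 1)"
        using I(4) p1 by auto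
    qed
    also have "\<dots> = p z * (\<Sum>x\<in>T. p x * F x z)" using I by (simp add: prod.distrib prod.delta)
    finally show "(\<Prod>i\<in>I. \<Sum>x\<in>T. ?g z i x) = p z * (\<Sum>x\<in>T. p x * F x z)" .
  qed
  also have "\<dots> = (\<Sum>x\<in>T. \<Sum>z\<in>T. p x * p z * F x z)"
    unfolding sum_distrib_left by (subst sum.swap) (simp add: mult_ac)
  finally show ?thesis .
qed

lemma gaussian_product_complex_exp_integrable:
  fixes w :: "'j \<Rightarrow> complex"
  assumes "finite J"
  shows "integrable (gaussian_product J v) (\<lambda>y. exp (\<Sum>j\<in>J. w j * of_real (y j)))"
proof -
  interpret product_prob_space "\<lambda>j. centered_gaussian (v j)"
    by (rule product_prob_space_gaussian)
  have "integrable (gaussian_product J v) (\<lambda>y. \<Prod>j\<in>J. exp (w j * of_real (y j)))"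
  proof (rule product_integrable_prod [OF assms])
    fix j
    show "integrable (centered_gaussian (v j)) (\<lambda>x. exp (w j * complex_of_real x))"
    proof (rule Bochner_Integration.integrable_bound [OF gaussian_exp_integrable [of _ "Re (w j)"]])
      have "(\<lambda>x. exp (w j * complex_of_real x)) \<in> borel_measurable borel"
        by (intro borel_measurable_continuous_onI continuous_intros)
      then show "(\<lambda>x. exp (w j * complex_of_real x)) \<in> borel_measurable (centered_gaussian (v j))"
        by (simp only: measurable_cong_sets [OF sets_centered_gaussian refl])
      show "AE x in centered_gaussian (v j). norm (exp (w j * complex_of_real x)) \<le> norm (exp (Re (w j) * x))"
        by (rule AE_I2) (simp only: norm_exp_eq_Re, simp)
    qed
  qed
  then show ?thesis by (simp only: exp_sum [OF assms])
qed

section \<open>The exponential average as a function of the row\<close>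

text \<open>\<open>w\<close> is to be the Gibbs measure without the site, frozen, and the Gaussian
  row \<open>g\<close> is independent of it. With \<open>\<xi>\<close> the scaled centred spins,
  \<open>x\<close> is the centred local field, \<open>c\<close> its covariance under the row, and
  \<open>Y\<close> the function whose distance from 1 matters.\<close>

locale row_average =
  fixes S :: "'s set" and w :: "'s \<Rightarrow> real" and J :: "'j set" and u :: "'j \<Rightarrow> real" and \<xi> :: "'j \<Rightarrow> 's \<Rightarrow> real"
    and v :: real
  assumes S: "finite S" and w: "\<And>\<sigma>. \<sigma> \<in> S \<Longrightarrow> 0 \<le> w \<sigma>" and w1: "sum w S = 1"
    and J: "finite J" and u: "\<And>j. j \<in> J \<Longrightarrow> 0 \<le> u j"
    and centered: "\<And>j. j \<in> J \<Longrightarrow> (\<Sum>\<sigma>\<in>S. w \<sigma> * \<xi> j \<sigma>) = 0" and v: "0 \<le> v"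
begin

definition x :: "('j \<Rightarrow> real) \<Rightarrow> 's \<Rightarrow> real" where "x g \<sigma> = (\<Sum>j\<in>J. g j * \<xi> j \<sigma>)"

definition c :: "'s \<Rightarrow> 's \<Rightarrow> real" where "c \<sigma> \<tau> = (\<Sum>j\<in>J. u j * \<xi> j \<sigma> * \<xi> j \<tau>)"

definition Y :: "('j \<Rightarrow> real) \<Rightarrow> complex \<Rightarrow> complex" where
  "Y g \<zeta> = (\<Sum>\<sigma>\<in>S. of_real (w \<sigma>) * exp (\<zeta> * of_real (x g \<sigma>) - \<zeta>\<^sup>2 * of_real v / 2))"

abbreviation G :: "('j \<Rightarrow> real) measure" where "G \<equiv> gaussian_product J u"

lemma x_mean: "(\<Sum>\<sigma>\<in>S. w \<sigma> * x g \<sigma>) = 0"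
proof -
  have "(\<Sum>\<sigma>\<in>S. w \<sigma> * x g \<sigma>) = (\<Sum>j\<in>J. g j * (\<Sum>\<sigma>\<in>S. w \<sigma> * \<xi> j \<sigma>))"
    unfolding x_def sum_distrib_left by (subst sum.swap) (simp only: mult_ac)
  then show ?thesis by (simp add: centered)
qed

lemma exp_sum_x_integrable:
  fixes a :: "'l \<Rightarrow> complex" and b :: complex
  shows "integrable G (\<lambda>g. exp ((\<Sum>l\<in>I. a l * of_real (x g (s l))) - b))"
proof -
  have "exp ((\<Sum>l\<in>I. a l * of_real (x g (s l))) - b) = exp (\<Sum>j\<in>J. (\<Sum>l\<in>I. a l * of_real (\<xi> j (s l))) * of_real (g j)) * exp (- b)" for g
  proof -
    have "(\<Sum>l\<in>I. a l * of_real (x g (s l))) = (\<Sum>j\<in>J. (\<Sum>l\<in>I. a l * of_real (\<xi> j (s l))) * of_real (g j))"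
      unfolding x_def of_real_sum sum_distrib_left sum_distrib_right by (subst sum.swap) (simp add: mult_ac)
    then show ?thesis by (simp only: exp_add [symmetric] diff_conv_add_uminus)
  qed
  then show ?thesis
    by (simp only:) (rule integrable_mult_left [OF gaussian_product_complex_exp_integrable [OF J]])
qed

text \<open>The exponent is linear in the row, so its Gaussian integral depends on the replicas
  through their covariances \<open>c\<close> alone. The coefficients are complex because half of the
  factors will be conjugated.\<close>

lemma exp_sum_x_integral:
  fixes a :: "'l \<Rightarrow> complex" and b :: complex
  shows "(\<integral>g. exp ((\<Sum>l\<in>I. a l * of_real (x g (s l))) - b) \<partial>G)
    = exp ((\<Sum>l\<in>I. \<Sum>l'\<in>I. a l * a l' * of_real (c (s l) (s l'))) / 2 - b)"
proof -
  let ?W = "\<lambda>j. \<Sum>l\<in>I. a l * of_real (\<xi> j (s l))"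
  have "exp ((\<Sum>l\<in>I. a l * of_real (x g (s l))) - b) = exp (\<Sum>j\<in>J. ?W j * of_real (g j)) * exp (- b)" for g
  proof -
    have "(\<Sum>l\<in>I. a l * of_real (x g (s l))) = (\<Sum>j\<in>J. ?W j * of_real (g j))"
      unfolding x_def of_real_sum sum_distrib_left sum_distrib_right by (subst sum.swap) (simp add: mult_ac)
    then show ?thesis by (simp only: exp_add [symmetric] diff_conv_add_uminus)
  qed
  then have "(\<integral>g. exp ((\<Sum>l\<in>I. a l * of_real (x g (s l))) - b) \<partial>G) = (\<integral>g. exp (\<Sum>j\<in>J. ?W j * of_real (g j)) \<partial>G) * exp (- b)"
    by (simp only: Bochner_Integration.integral_mult_left_zero)
  also have "\<dots> = exp ((\<Sum>j\<in>J. of_real (u j) * (?W j)\<^sup>2) / 2) * exp (- b)"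
    by (simp only: gaussian_product_complex_exp [OF J u])
  also have "(\<Sum>j\<in>J. of_real (u j) * (?W j)\<^sup>2) = (\<Sum>l\<in>I. \<Sum>l'\<in>I. a l * a l' * of_real (c (s l) (s l')))"
  proof -
    have "(\<Sum>j\<in>J. of_real (u j) * (?W j)\<^sup>2)
        = (\<Sum>j\<in>J. \<Sum>l\<in>I. \<Sum>l'\<in>I. a l * a l' * of_real (u j * \<xi> j (s l) * \<xi> j (s l')))"
    proof (intro sum.cong refl)
      fix j
      have "(?W j)\<^sup>2 = (\<Sum>l\<in>I. \<Sum>l'\<in>I. (a l * of_real (\<xi> j (s l))) * (a l' * of_real (\<xi> j (s l'))))"
        by (simp only: power2_eq_square sum_product)
      then show "of_real (u j) * (?W j)\<^sup>2 = (\<Sum>l\<in>I. \<Sum>l'\<in>I. a l * a l' * of_real (u j * \<xi> j (s l) * \<xi> j (s l')))"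
        by (simp only: sum_distrib_left of_real_mult mult_ac)
    qed
    also have "\<dots> = (\<Sum>l\<in>I. \<Sum>l'\<in>I. \<Sum>j\<in>J. a l * a l' * of_real (u j * \<xi> j (s l) * \<xi> j (s l')))"
      by (subst sum.swap) (intro sum.cong refl sum.swap)
    finally show ?thesis by (simp only: c_def of_real_sum sum_distrib_left)
  qed
  finally show ?thesis by (simp only: exp_add [symmetric] diff_conv_add_uminus)
qed

text \<open>The term of order \<open>sqrt t\<close> vanishes because \<open>x g\<close> is centred
  under \<open>w\<close>, so the deviation starts at order \<open>t\<close>. The factor exponential
  in the row need only be integrable: this is the a priori bound that forces the low Taylor
  coefficients to vanish.\<close>

lemma Y_quadratic_bound:
  assumes \<zeta>: "norm \<zeta> \<le> 2" and a: "\<And>j \<sigma>. j \<in> J \<Longrightarrow> \<sigma> \<in> S \<Longrightarrow> \<bar>\<xi> j \<sigma>\<bar> \<le> a" and t: "0 \<le> t" "t \<le> 1"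
  shows "norm (Y g (of_real (sqrt t) * \<zeta>) - 1) \<le> t * ((2 * exp (4 * v) + 2 * v) * exp (4 * a * (\<Sum>j\<in>J. \<bar>g j\<bar>)))"
proof -
  define W where "W \<sigma> = of_real (sqrt t) * \<zeta> * of_real (x g \<sigma>) - (of_real (sqrt t) * \<zeta>)\<^sup>2 * of_real v / 2" for \<sigma>
  define E where "E = a * (\<Sum>j\<in>J. \<bar>g j\<bar>)"
  have xE: "\<bar>x g \<sigma>\<bar> \<le> E" if "\<sigma> \<in> S" for \<sigma>
    unfolding x_def E_def sum_distrib_left
    using a [OF _ that] by (intro order_trans [OF sum_abs] sum_mono) (simp add: abs_mult mult.commute [of a] mult_left_mono)
  have E0: "0 \<le> E"
  proof -
    have "S \<noteq> {}" using w1 by auto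
    then obtain \<sigma> where "\<sigma> \<in> S" by auto
    then show ?thesis using xE [of \<sigma>] by linarith
  qed
  have sq: "(of_real (sqrt t) * \<zeta>)\<^sup>2 = of_real t * \<zeta>\<^sup>2"
    using t by (simp add: power_mult_distrib flip: of_real_power)
  have nsq: "norm (\<zeta>\<^sup>2) \<le> 4" using power_mono [OF \<zeta> norm_ge_zero, of 2] by (simp add: norm_power)
  have tt: "t \<le> sqrt t"
  proof -
    have "sqrt t * sqrt t \<le> sqrt t * 1" using t by (intro mult_left_mono) auto
    then show ?thesis using t by simp
  qed
  have W_le: "norm (W \<sigma>) \<le> sqrt t * (2 * E + 2 * v)" if "\<sigma> \<in> S" for \<sigma>
  proof -
    have "norm (W \<sigma>) \<le> norm (of_real (sqrt t) * \<zeta> * of_real (x g \<sigma>)) + norm (of_real t * \<zeta>\<^sup>2 * of_real v / 2)"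
      unfolding W_def sq by (rule norm_triangle_ineq4)
    also have "norm (of_real (sqrt t) * \<zeta> * of_real (x g \<sigma>)) = sqrt t * (norm \<zeta> * \<bar>x g \<sigma>\<bar>)"
      using t by (simp add: norm_mult)
    also have "\<dots> \<le> sqrt t * (2 * E)"
      using t xE [OF that] \<zeta> by (intro mult_left_mono mult_mono) auto
    also have "norm (of_real t * \<zeta>\<^sup>2 * of_real v / 2) = t * (norm (\<zeta>\<^sup>2) * v / 2)"
      using t v by (simp add: norm_mult norm_divide)
    also have "\<dots> \<le> sqrt t * (4 * v / 2)"
      using t v nsq tt by (intro mult_mono divide_right_mono mult_right_mono) auto
    finally show ?thesis by (simp add: distrib_left)
  qed
  let ?A = "2 * E + 2 * v"
  have A0: "0 \<le> ?A" using E0 v by simp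
  have st: "0 \<le> sqrt t" "sqrt t \<le> 1" using t by auto
  have step: "norm (exp (W \<sigma>) - 1 - W \<sigma>) \<le> t * (2 * exp (2 * ?A))" if s: "\<sigma> \<in> S" for \<sigma>
  proof -
    have "norm (exp (W \<sigma>) - (\<Sum>k\<le>1. W \<sigma> ^ k / fact k)) \<le> exp \<bar>Re (W \<sigma>)\<bar> * norm (W \<sigma>) ^ Suc 1 / fact 1"
      by (rule Taylor_exp)
    then have "norm (exp (W \<sigma>) - 1 - W \<sigma>) \<le> exp \<bar>Re (W \<sigma>)\<bar> * (norm (W \<sigma>))\<^sup>2"
      by (simp add: diff_diff_eq numeral_2_eq_2)
    also have "\<dots> \<le> exp ?A * (sqrt t * ?A)\<^sup>2"
    proof (intro mult_mono power_mono W_le s)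
      have "\<bar>Re (W \<sigma>)\<bar> \<le> norm (W \<sigma>)" by (rule abs_Re_le_cmod)
      also have "\<dots> \<le> sqrt t * ?A" by (rule W_le [OF s])
      also have "\<dots> \<le> 1 * ?A" using st A0 by (intro mult_right_mono)
      finally show "exp \<bar>Re (W \<sigma>)\<bar> \<le> exp ?A" by simp
    qed auto
    also have "(sqrt t * ?A)\<^sup>2 = t * ?A\<^sup>2" using t by (simp only: power_mult_distrib real_sqrt_pow2)
    also have "exp ?A * (t * ?A\<^sup>2) \<le> exp ?A * (t * (2 * exp ?A))"
    proof -
      have "1 + ?A + ?A\<^sup>2 / 2 \<le> exp ?A" by (rule exp_lower_Taylor_quadratic [OF A0])
      then have "?A\<^sup>2 \<le> 2 * exp ?A" using A0 by linarith
      then show ?thesis using t by (intro mult_left_mono) auto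
    qed
    also have "\<dots> = t * (2 * exp (2 * ?A))"
    proof -
      have "exp (2 * ?A) = exp ?A * exp ?A" by (simp only: mult_2 exp_add)
      then show ?thesis by (simp only: mult_ac)
    qed
    finally show ?thesis .
  qed
  have meanW: "(\<Sum>\<sigma>\<in>S. of_real (w \<sigma>) * W \<sigma>) = - (of_real t * \<zeta>\<^sup>2 * of_real v / 2)"
  proof -
    have "(\<Sum>\<sigma>\<in>S. of_real (w \<sigma>) * W \<sigma>)
        = of_real (sqrt t) * \<zeta> * of_real (\<Sum>\<sigma>\<in>S. w \<sigma> * x g \<sigma>) - of_real t * \<zeta>\<^sup>2 * of_real v / 2 * of_real (\<Sum>\<sigma>\<in>S. w \<sigma>)"
    proof -
      have "(\<Sum>\<sigma>\<in>S. of_real (w \<sigma>) * W \<sigma>) = (\<Sum>\<sigma>\<in>S. of_real (sqrt t) * \<zeta> * of_real (w \<sigma> * x g \<sigma>)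
          - of_real t * \<zeta>\<^sup>2 * of_real v / 2 * of_real (w \<sigma>))"
        by (intro sum.cong refl) (simp only: W_def sq right_diff_distrib of_real_mult, simp add: mult_ac)
      then show ?thesis
        by (simp only: sum_subtractf of_real_sum sum_distrib_left)
    qed
    then show ?thesis by (simp add: x_mean w1)
  qed
  have "Y g (of_real (sqrt t) * \<zeta>) - 1 = (\<Sum>\<sigma>\<in>S. of_real (w \<sigma>) * (exp (W \<sigma>) - 1 - W \<sigma>)) + (\<Sum>\<sigma>\<in>S. of_real (w \<sigma>) * W \<sigma>)"
  proof -
    have "(\<Sum>\<sigma>\<in>S. complex_of_real (w \<sigma>)) = 1" using w1 by (simp flip: of_real_sum)
    then show ?thesis
      by (simp add: Y_def W_def [symmetric] right_diff_distrib sum_subtractf)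
  qed
  also have "norm \<dots> \<le> (\<Sum>\<sigma>\<in>S. w \<sigma> * (t * (2 * exp (2 * ?A)))) + t * (2 * v)"
  proof (rule order_trans [OF norm_triangle_ineq], rule add_mono)
    have "norm (of_real (w \<sigma>) * (exp (W \<sigma>) - 1 - W \<sigma>)) \<le> w \<sigma> * (t * (2 * exp (2 * ?A)))" if "\<sigma> \<in> S" for \<sigma>
      unfolding norm_mult using mult_left_mono [OF step [OF that] w [OF that]] w [OF that] by simp
    then show "norm (\<Sum>\<sigma>\<in>S. of_real (w \<sigma>) * (exp (W \<sigma>) - 1 - W \<sigma>)) \<le> (\<Sum>\<sigma>\<in>S. w \<sigma> * (t * (2 * exp (2 * ?A))))"
      by (intro order_trans [OF norm_sum] sum_mono)
    have "norm (of_real t * \<zeta>\<^sup>2 * of_real v / 2) = t * (norm (\<zeta>\<^sup>2) * v / 2)"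
      using t v by (simp add: norm_mult norm_divide)
    also have "\<dots> \<le> t * (4 * v / 2)"
      using t v nsq by (intro mult_mono divide_right_mono mult_right_mono) auto
    finally show "norm (\<Sum>\<sigma>\<in>S. of_real (w \<sigma>) * W \<sigma>) \<le> t * (2 * v)"
      unfolding meanW norm_minus_cancel by linarith
  qed
  also have "\<dots> = t * (2 * (exp (4 * v) * exp (4 * E)) + 2 * v)"
  proof -
    have "exp (2 * ?A) = exp (4 * v) * exp (4 * E)"
      unfolding exp_add [symmetric] by (rule arg_cong [where f = exp]) simp
    then show ?thesis
      by (simp only: sum_distrib_right [symmetric] w1 mult_1_left distrib_left)
  qed
  also have "\<dots> \<le> t * ((2 * exp (4 * v) + 2 * v) * exp (4 * E))"
  proof (intro mult_left_mono t)
    have "2 * v * 1 \<le> 2 * v * exp (4 * E)" using v E0 by (intro mult_left_mono) auto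
    then show "2 * (exp (4 * v) * exp (4 * E)) + 2 * v \<le> (2 * exp (4 * v) + 2 * v) * exp (4 * E)"
      by (simp add: distrib_right)
  qed
  finally show ?thesis by (simp only: E_def mult.assoc)
qed

end

lemma exp_taylor_remainder:
  fixes z :: complex
  assumes "0 < n"
  shows "norm (exp z - (\<Sum>i<n. z ^ i / fact i)) \<le> norm z ^ n * exp (norm z)"
proof -
  obtain m where m: "n = Suc m" using assms by (cases n) auto
  have "norm (exp z - (\<Sum>i\<le>m. z ^ i / fact i)) \<le> exp \<bar>Re z\<bar> * norm z ^ Suc m / fact m"
    by (rule Taylor_exp)
  also have "\<dots> \<le> exp \<bar>Re z\<bar> * norm z ^ Suc m / 1"
    by (intro divide_left_mono mult_nonneg_nonneg) (auto simp: fact_ge_1)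
  also have "\<dots> \<le> norm z ^ n * exp (norm z)"
  proof -
    have "exp \<bar>Re z\<bar> \<le> exp (norm z)" using abs_Re_le_cmod [of z] by simp
    then have "exp \<bar>Re z\<bar> * norm z ^ n \<le> exp (norm z) * norm z ^ n" by (rule mult_right_mono) simp
    then show ?thesis by (simp add: m mult.commute)
  qed
  finally show ?thesis by (simp add: m lessThan_Suc_atMost)
qed

text \<open>The outer \<open>2 ^ n\<close> counts the choices between the exponential and the
  subtracted 1 in \<open>n\<close> factors; \<open>2 ^ n\<close> and \<open>(n * n) ^ n\<close> come
  from the power of a sum over pairs of replicas, the exponential from the Taylor remainder, and the
  last \<open>n * n\<close> from adding up the pairs.\<close>

definition row_const :: "nat \<Rightarrow> real \<Rightarrow> real" where
  "row_const n B = 2 ^ n * (2 ^ n * real (n * n) ^ n * exp (2 * (real (n * n) * B)) * real (n * n))"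

lemma row_const_nonneg: "0 \<le> row_const n B"
  by (simp add: row_const_def)

context row_average
begin

lemma Y_cnj: "Y g (cnj \<zeta>) = cnj (Y g \<zeta>)"
  by (simp add: Y_def exp_cnj)

text \<open>The expectation of \<open>\<bar>Y g (sqrt t * \<zeta>) - 1\<bar>\<^bsup>2 k\<^esup>\<close> is a sum over replicas of terms \<open>\<plusminus> exp (t * z)\<close>, where \<open>z\<close>
  is a sum of covariances. It is \<open>O(t\<^bsup>2 k\<^esup>)\<close> because \<open>x\<close> is centered, so the Taylor polynomial of degree less than
  \<open>2 k\<close> cancels and only the remainder, of order \<open>z\<^bsup>2 k\<^esup>\<close>, is left at \<open>t = 1\<close>.\<close>

lemma row_bound:
  assumes \<zeta>: "norm \<zeta> \<le> 2" and k: "0 < k"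
    and a: "\<And>j \<sigma>. j \<in> J \<Longrightarrow> \<sigma> \<in> S \<Longrightarrow> \<bar>\<xi> j \<sigma>\<bar> \<le> a"
    and B: "\<And>\<sigma> \<tau>. \<sigma> \<in> S \<Longrightarrow> \<tau> \<in> S \<Longrightarrow> \<bar>c \<sigma> \<tau>\<bar> \<le> B" "\<And>\<sigma>. \<sigma> \<in> S \<Longrightarrow> \<bar>c \<sigma> \<sigma> - v\<bar> \<le> B"
  shows "integrable G (\<lambda>g. norm (Y g \<zeta> - 1) ^ (2 * k))"
    and "(\<integral>g. norm (Y g \<zeta> - 1) ^ (2 * k) \<partial>G)
      \<le> row_const (2 * k) B * ((\<Sum>\<sigma>\<in>S. \<Sum>\<tau>\<in>S. w \<sigma> * w \<tau> * c \<sigma> \<tau> ^ (2 * k)) + (\<Sum>\<sigma>\<in>S. w \<sigma> * (c \<sigma> \<sigma> - v) ^ (2 * k)))"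
proof -
  define n where "n = 2 * k"
  have n: "0 < n" "even n" using k by (auto simp: n_def)
  \<comment> \<open>A factor \<open>Y - 1\<close> is a sum over \<open>T\<close>: the label 1 marks
    a term of \<open>Y\<close>, and the label 0 a term of the subtracted 1.\<close>
  define T where "T = {0, 1 :: real} \<times> S"
  define R where "R = {..<n} \<rightarrow>\<^sub>E T"
  \<comment> \<open>The modulus to the power \<open>2 * k\<close> is a product of \<open>k\<close>
    factors and \<open>k\<close> conjugates, and conjugating \<open>Y\<close> conjugates its
    argument.\<close>
  define zl where "zl l = (if l < k then \<zeta> else cnj \<zeta>)" for l :: nat
  define A where "A s = (\<Prod>l<n. (if fst (s l) = 1 then 1 else - 1) * of_real (w (snd (s l))) :: complex)" for s :: "nat \<Rightarrow> real \<times> 's"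
  define z where "z s = (\<Sum>l<n. \<Sum>l'<n. (of_real (fst (s l)) * zl l) * (of_real (fst (s l')) * zl l') * of_real (c (snd (s l)) (snd (s l')))) / 2
      - (\<Sum>l<n. of_real (fst (s l)) * ((zl l)\<^sup>2 * of_real v / 2))" for s
  define F where "F t g = norm (Y g (of_real (sqrt t) * \<zeta>) - 1) ^ n" for t g
  have fT: "finite T" using S by (simp add: T_def)
  have fR: "finite R" unfolding R_def using fT by (intro finite_PiE) auto

  define ex where "ex t s g = exp ((\<Sum>l<n. (of_real (sqrt t) * (of_real (fst (s l)) * zl l)) * of_real (x g (snd (s l))))
      - of_real t * (\<Sum>l<n. of_real (fst (s l)) * ((zl l)\<^sup>2 * of_real v / 2)))" for t :: real and s and g
  have sqt: "of_real (sqrt t) * of_real (sqrt t) = (of_real t :: complex)" if "0 \<le> t" for t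
    using that by (simp flip: of_real_mult)
  have expand: "of_real (F t g) = (\<Sum>s\<in>R. A s * ex t s g)" if t: "0 \<le> t" for t g
  proof -
    let ?q = "Y g (of_real (sqrt t) * \<zeta>) - 1"
    let ?f = "\<lambda>l p. ((if fst p = 1 then 1 else - 1) * of_real (w (snd p))) *
        exp (of_real (fst p) * (of_real (sqrt t) * zl l * of_real (x g (snd p)) - of_real t * ((zl l)\<^sup>2 * of_real v / 2)))"
    have factor: "(\<Sum>p\<in>T. ?f l p) = (if l < k then ?q else cnj ?q)" for l
    proof -
      have "(\<Sum>p\<in>T. ?f l p) = (\<Sum>b\<in>{0, 1}. \<Sum>\<sigma>\<in>S. ?f l (b, \<sigma>))"
        unfolding T_def by (simp add: sum.cartesian_product split_def)
      also have "\<dots> = - (\<Sum>\<sigma>\<in>S. of_real (w \<sigma>)) + (\<Sum>\<sigma>\<in>S. of_real (w \<sigma>) *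
          exp (of_real (sqrt t) * zl l * of_real (x g \<sigma>) - of_real t * ((zl l)\<^sup>2 * of_real v / 2)))"
        by (simp add: sum_negf)
      also have "(\<Sum>\<sigma>\<in>S. complex_of_real (w \<sigma>)) = 1" using w1 by (simp flip: of_real_sum)
      also have "(\<Sum>\<sigma>\<in>S. of_real (w \<sigma>) * exp (of_real (sqrt t) * zl l * of_real (x g \<sigma>) - of_real t * ((zl l)\<^sup>2 * of_real v / 2)))
          = Y g (of_real (sqrt t) * zl l)"
      proof -
        have "(of_real (sqrt t) * zl l)\<^sup>2 * of_real v / 2 = of_real t * ((zl l)\<^sup>2 * of_real v / 2)"
          unfolding power_mult_distrib power2_eq_square [of "of_real (sqrt t)"] sqt [OF t] by simp
        then show ?thesis by (simp only: Y_def)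
      qed
      also have "Y g (of_real (sqrt t) * zl l) = (if l < k then Y g (of_real (sqrt t) * \<zeta>) else cnj (Y g (of_real (sqrt t) * \<zeta>)))"
        by (simp add: zl_def flip: Y_cnj)
      finally show ?thesis by simp
    qed
    have "of_real (F t g) = (of_real (norm ?q))\<^sup>2 ^ k"
      by (simp add: F_def n_def power_mult)
    also have "\<dots> = ?q ^ k * cnj ?q ^ k"
      by (simp only: of_real_power [symmetric] complex_norm_square power_mult_distrib)
    also have "\<dots> = (\<Prod>l<n. if l < k then ?q else cnj ?q)"
    proof -
      have "(\<Prod>l<n. if l < k then ?q else cnj ?q) = (\<Prod>l\<in>{..<k} \<union> {k..<n}. if l < k then ?q else cnj ?q)"
        by (rule prod.cong) (auto simp: n_def)
      also have "\<dots> = (\<Prod>l\<in>{..<k}. if l < k then ?q else cnj ?q) * (\<Prod>l\<in>{k..<n}. if l < k then ?q else cnj ?q)"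
        by (rule prod.union_disjoint) auto
      also have "(\<Prod>l\<in>{..<k}. if l < k then ?q else cnj ?q) = (\<Prod>l\<in>{..<k}. ?q)" by (rule prod.cong) auto
      also have "(\<Prod>l\<in>{k..<n}. if l < k then ?q else cnj ?q) = (\<Prod>l\<in>{k..<n}. cnj ?q)" by (rule prod.cong) auto
      finally show ?thesis by (simp add: n_def)
    qed
    also have "\<dots> = (\<Prod>l<n. \<Sum>p\<in>T. ?f l p)" by (simp only: factor)
    also have "\<dots> = (\<Sum>s\<in>R. \<Prod>l<n. ?f l (s l))"
      unfolding R_def using fT by (intro prod_sum_PiE) auto
    also have "\<dots> = (\<Sum>s\<in>R. A s * ex t s g)"
    proof (intro sum.cong refl)
      fix s
      have "(\<Prod>l<n. ?f l (s l)) = A s * exp (\<Sum>l<n. of_real (fst (s l)) * (of_real (sqrt t) * zl l * of_real (x g (snd (s l)))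
          - of_real t * ((zl l)\<^sup>2 * of_real v / 2)))"
        by (simp only: prod.distrib A_def exp_sum [OF finite_lessThan])
      also have "(\<Sum>l<n. of_real (fst (s l)) * (of_real (sqrt t) * zl l * of_real (x g (snd (s l))) - of_real t * ((zl l)\<^sup>2 * of_real v / 2)))
         = (\<Sum>l<n. (of_real (sqrt t) * (of_real (fst (s l)) * zl l)) * of_real (x g (snd (s l))))
            - of_real t * (\<Sum>l<n. of_real (fst (s l)) * ((zl l)\<^sup>2 * of_real v / 2))"
        unfolding sum_distrib_left sum_subtractf [symmetric]
        by (intro sum.cong refl) (simp only: right_diff_distrib mult_ac)
      finally show "(\<Prod>l<n. ?f l (s l)) = A s * ex t s g" by (simp only: ex_def)
    qed
    finally show ?thesis .
  qed
  have ex_int: "integrable G (ex t s)" for t s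
    unfolding ex_def by (rule exp_sum_x_integrable [where s = "\<lambda>l. snd (s l)"])
  have ex_val: "(\<integral>g. ex t s g \<partial>G) = exp (of_real t * z s)" if t: "0 \<le> t" for t s
  proof -
    let ?a = "\<lambda>l. of_real (fst (s l)) * zl l"
    have "(\<integral>g. ex t s g \<partial>G) = exp ((\<Sum>l<n. \<Sum>l'<n. (of_real (sqrt t) * ?a l) * (of_real (sqrt t) * ?a l') * of_real (c (snd (s l)) (snd (s l')))) / 2
       - of_real t * (\<Sum>l<n. of_real (fst (s l)) * ((zl l)\<^sup>2 * of_real v / 2)))"
      unfolding ex_def by (rule exp_sum_x_integral [where s = "\<lambda>l. snd (s l)"])
    also have "(\<Sum>l<n. \<Sum>l'<n. (of_real (sqrt t) * ?a l) * (of_real (sqrt t) * ?a l') * of_real (c (snd (s l)) (snd (s l'))))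
       = of_real t * (\<Sum>l<n. \<Sum>l'<n. ?a l * ?a l' * of_real (c (snd (s l)) (snd (s l'))))"
      unfolding sum_distrib_left
    proof (intro sum.cong refl)
      fix l l'
      have "(of_real (sqrt t) * ?a l) * (of_real (sqrt t) * ?a l') * of_real (c (snd (s l)) (snd (s l')))
        = (of_real (sqrt t) * of_real (sqrt t)) * (?a l * ?a l' * of_real (c (snd (s l)) (snd (s l'))))"
        by (simp only: mult_ac)
      then show "(of_real (sqrt t) * ?a l) * (of_real (sqrt t) * ?a l') * of_real (c (snd (s l)) (snd (s l')))
        = of_real t * (?a l * ?a l' * of_real (c (snd (s l)) (snd (s l'))))"
        by (simp only: sqt [OF t])
    qed
    finally show ?thesis
      by (simp only: z_def right_diff_distrib times_divide_eq_right)
  qed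
  have F_int: "integrable G (F t)" and G_eq: "of_real (\<integral>g. F t g \<partial>G) = (\<Sum>s\<in>R. A s * exp (of_real t * z s))" if t: "0 \<le> t" for t
  proof -
    have int: "integrable G (\<lambda>g. \<Sum>s\<in>R. A s * ex t s g)"
      by (intro Bochner_Integration.integrable_sum integrable_mult_right ex_int)
    then have "integrable G (\<lambda>g. complex_of_real (F t g))" by (simp only: expand [OF t])
    then show "integrable G (F t)" by (simp only: complex_of_real_integrable_eq)
    have "of_real (\<integral>g. F t g \<partial>G) = (\<integral>g. (\<Sum>s\<in>R. A s * ex t s g) \<partial>G)"
      by (simp only: expand [OF t, symmetric] integral_complex_of_real)
    also have "\<dots> = (\<Sum>s\<in>R. \<integral>g. A s * ex t s g \<partial>G)"
      by (rule Bochner_Integration.integral_sum) (rule integrable_mult_right [OF ex_int])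
    also have "\<dots> = (\<Sum>s\<in>R. A s * exp (of_real t * z s))"
      by (simp only: Bochner_Integration.integral_mult_right_zero ex_val [OF t])
    finally show "of_real (\<integral>g. F t g \<partial>G) = (\<Sum>s\<in>R. A s * exp (of_real t * z s))" .
  qed
  have F1: "F 1 g = norm (Y g \<zeta> - 1) ^ (2 * k)" for g by (simp add: F_def n_def)
  show "integrable G (\<lambda>g. norm (Y g \<zeta> - 1) ^ (2 * k))"
  proof -
    have "F 1 = (\<lambda>g. norm (Y g \<zeta> - 1) ^ (2 * k))" by (rule ext) (rule F1)
    then show ?thesis using F_int [OF zero_le_one] by (simp only:)
  qed

  have F0: "0 \<le> F t g" for t g by (simp add: F_def)
  define K where "K = 2 * exp (4 * v) + 2 * v"
  define C1 where "C1 = (\<integral>g. K ^ n * exp (real n * (4 * a) * (\<Sum>j\<in>J. \<bar>g j\<bar>)) \<partial>G)"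
  have F_le: "(\<integral>g. F t g \<partial>G) \<le> t ^ n * C1" if t: "0 \<le> t" "t \<le> 1" for t
  proof -
    have "(\<integral>g. F t g \<partial>G) \<le> (\<integral>g. t ^ n * (K ^ n * exp (real n * (4 * a) * (\<Sum>j\<in>J. \<bar>g j\<bar>))) \<partial>G)"
    proof (rule integral_mono [OF F_int [OF t(1)]])
      show "integrable G (\<lambda>g. t ^ n * (K ^ n * exp (real n * (4 * a) * (\<Sum>j\<in>J. \<bar>g j\<bar>))))"
        by (intro integrable_mult_right gaussian_product_integrable_exp_abs J)
      fix g
      have "F t g \<le> (t * (K * exp (4 * a * (\<Sum>j\<in>J. \<bar>g j\<bar>)))) ^ n"
        unfolding F_def K_def by (intro power_mono Y_quadratic_bound \<zeta> a t) auto
      also have "\<dots> = t ^ n * (K ^ n * exp (real n * (4 * a) * (\<Sum>j\<in>J. \<bar>g j\<bar>)))"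
        by (simp only: power_mult_distrib exp_of_nat_mult [symmetric] mult.assoc)
      finally show "F t g \<le> t ^ n * (K ^ n * exp (real n * (4 * a) * (\<Sum>j\<in>J. \<bar>g j\<bar>)))" .
    qed
    then show ?thesis by (simp only: C1_def Bochner_Integration.integral_mult_right_zero)
  qed

  define p where "p i = (\<Sum>s\<in>R. A s * (z s ^ i / fact i))" for i
  have poly: "(\<Sum>i<n. p i * of_real t ^ i) = (\<Sum>s\<in>R. A s * (\<Sum>i<n. (of_real t * z s) ^ i / fact i))" for t :: real
    unfolding p_def sum_distrib_left sum_distrib_right
    by (subst sum.swap) (simp add: power_mult_distrib mult_ac)
  \<comment> \<open>\<open>C\<close> may grow with all the data; it forces the coefficients below to
    vanish and does not reach the final bound.\<close>
  define C where "C = \<bar>C1\<bar> + (\<Sum>s\<in>R. norm (A s) * (norm (z s) ^ n * exp (norm (z s))))"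
  have pb: "norm (\<Sum>i<n. p i * of_real t ^ i) \<le> C * t ^ n" if t: "0 < t" "t \<le> 1" for t :: real
  proof -
    have eq: "(\<Sum>i<n. p i * of_real t ^ i) = (\<Sum>s\<in>R. A s * exp (of_real t * z s))
        - (\<Sum>s\<in>R. A s * (exp (of_real t * z s) - (\<Sum>i<n. (of_real t * z s) ^ i / fact i)))"
      unfolding poly sum_subtractf [symmetric] by (intro sum.cong refl) (simp add: algebra_simps)
    have tri: "norm (\<Sum>i<n. p i * of_real t ^ i) \<le> norm (\<Sum>s\<in>R. A s * exp (of_real t * z s))
        + (\<Sum>s\<in>R. norm (A s * (exp (of_real t * z s) - (\<Sum>i<n. (of_real t * z s) ^ i / fact i))))"
      unfolding eq by (rule order_trans [OF norm_triangle_ineq4 add_left_mono [OF norm_sum]])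
    have e1: "norm (\<Sum>s\<in>R. A s * exp (of_real t * z s)) = (\<integral>g. F t g \<partial>G)"
    proof -
      have "0 \<le> (\<integral>g. F t g \<partial>G)" by (rule Bochner_Integration.integral_nonneg) (rule F0)
      then show ?thesis
        by (subst G_eq [OF less_imp_le [OF t(1)], symmetric]) (simp only: norm_of_real abs_of_nonneg)
    qed
    have e2: "(\<integral>g. F t g \<partial>G) \<le> \<bar>C1\<bar> * t ^ n"
    proof -
      have "t ^ n * C1 \<le> t ^ n * \<bar>C1\<bar>" using t by (intro mult_left_mono) auto
      then show ?thesis using F_le [OF less_imp_le [OF t(1)] t(2)] by (simp only: mult.commute [of "t ^ n"])
    qed
    have e3: "(\<Sum>s\<in>R. norm (A s * (exp (of_real t * z s) - (\<Sum>i<n. (of_real t * z s) ^ i / fact i))))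
        \<le> (\<Sum>s\<in>R. norm (A s) * (norm (z s) ^ n * exp (norm (z s))) * t ^ n)"
    proof (intro sum_mono)
      fix s
      have "norm (exp (of_real t * z s) - (\<Sum>i<n. (of_real t * z s) ^ i / fact i)) \<le> norm (of_real t * z s) ^ n * exp (norm (of_real t * z s))"
        by (rule exp_taylor_remainder [OF n(1)])
      also have "norm (of_real t * z s) = t * norm (z s)" using t by (simp add: norm_mult)
      also have "(t * norm (z s)) ^ n * exp (t * norm (z s)) \<le> (t * norm (z s)) ^ n * exp (1 * norm (z s))"
        using t by (intro mult_left_mono) (auto intro: mult_left_le_one_le)
      finally have "norm (A s) * norm (exp (of_real t * z s) - (\<Sum>i<n. (of_real t * z s) ^ i / fact i))
        \<le> norm (A s) * ((t * norm (z s)) ^ n * exp (1 * norm (z s)))"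
        by (rule mult_left_mono) simp
      then show "norm (A s * (exp (of_real t * z s) - (\<Sum>i<n. (of_real t * z s) ^ i / fact i)))
        \<le> norm (A s) * (norm (z s) ^ n * exp (norm (z s))) * t ^ n"
        by (simp only: norm_mult power_mult_distrib mult_1_left mult_ac)
    qed
    show ?thesis
      using tri e1 e2 e3 unfolding C_def distrib_right sum_distrib_right by linarith
  qed
  have p0: "p i = 0" if "i < n" for i by (rule polynomial_vanishes [OF pb that])
  have main: "(\<integral>g. F 1 g \<partial>G) \<le> (\<Sum>s\<in>R. norm (A s) * (norm (z s) ^ n * exp (norm (z s))))"
  proof -
    have "(\<Sum>s\<in>R. A s * (\<Sum>i<n. (z s) ^ i / fact i)) = 0"
      using poly [of 1] p0 by simp
    then have "of_real (\<integral>g. F 1 g \<partial>G) = (\<Sum>s\<in>R. A s * (exp (z s) - (\<Sum>i<n. (z s) ^ i / fact i)))"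
      using G_eq [of 1] by (simp add: right_diff_distrib sum_subtractf)
    then have "norm (of_real (\<integral>g. F 1 g \<partial>G) :: complex) \<le> (\<Sum>s\<in>R. norm (A s * (exp (z s) - (\<Sum>i<n. (z s) ^ i / fact i))))"
      by (simp only: norm_sum)
    also have "\<dots> \<le> (\<Sum>s\<in>R. norm (A s) * (norm (z s) ^ n * exp (norm (z s))))"
      unfolding norm_mult by (intro sum_mono mult_left_mono exp_taylor_remainder n) auto
    finally show ?thesis by simp
  qed

  \<comment> \<open>The normalisation by \<open>v\<close> is absorbed in the diagonal, using that a
    label equals its square; \<open>z s\<close> is then a quadratic form in quantities that are all
    small.\<close>
  define ct where "ct s l l' = c (snd (s l)) (snd (s l')) - (if l = l' then v else 0)" for s :: "nat \<Rightarrow> real \<times> 's" and l l'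
  \<comment> \<open>Halving turns \<open>w\<close> into probability weights on the labelled
    replicas.\<close>
  define wt where "wt p = w (snd p) / 2" for p :: "real \<times> 's"
  have RT: "s l \<in> T" if "s \<in> R" "l < n" for s l using that by (auto simp: R_def)
  have ct_B: "\<bar>ct s l l'\<bar> \<le> B" if "s \<in> R" "l < n" "l' < n" for s l l'
    using RT [OF that(1,2)] RT [OF that(1,3)] B by (auto simp: ct_def T_def)
  have B0: "0 \<le> B"
  proof -
    have "S \<noteq> {}" using w1 by auto
    then obtain \<sigma> where "\<sigma> \<in> S" by auto
    then show ?thesis using B(2) [of \<sigma>] by linarith
  qed
  have z_le: "norm (z s) \<le> 2 * (\<Sum>l<n. \<Sum>l'<n. \<bar>ct s l l'\<bar>)" if s: "s \<in> R" for s
  proof -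
    let ?b = "\<lambda>l. fst (s l)"
    have b: "?b l = 0 \<or> ?b l = 1" if "l < n" for l using RT [OF s that] by (auto simp: T_def)
    have zl: "norm (zl l) \<le> 2" for l using \<zeta> by (simp add: zl_def)
    have diag: "(\<Sum>l<n. of_real (?b l) * ((zl l)\<^sup>2 * of_real v / 2))
       = (\<Sum>l<n. \<Sum>l'<n. (of_real (?b l) * zl l) * (of_real (?b l') * zl l') * of_real (if l = l' then v else 0)) / 2"
      unfolding sum_divide_distrib
    proof (intro sum.cong refl)
      fix l assume l: "l \<in> {..<n}"
      have "(\<Sum>l'<n. (of_real (?b l) * zl l) * (of_real (?b l') * zl l') * of_real (if l = l' then v else 0))
        = (\<Sum>l'<n. if l = l' then (of_real (?b l) * zl l) * (of_real (?b l) * zl l) * of_real v else 0)"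
        by (intro sum.cong refl) auto
      also have "\<dots> = (of_real (?b l) * zl l) * (of_real (?b l) * zl l) * of_real v"
        using l by (simp add: sum.delta)
      also have "\<dots> = of_real (?b l) * ((zl l)\<^sup>2 * of_real v)"
        using b [of l] l by (auto simp: power2_eq_square)
      finally show "of_real (?b l) * ((zl l)\<^sup>2 * of_real v / 2)
        = (\<Sum>l'<n. (of_real (?b l) * zl l) * (of_real (?b l') * zl l') * of_real (if l = l' then v else 0) / 2)"
        by (simp add: sum_divide_distrib [symmetric])
    qed
    have "z s = (\<Sum>l<n. \<Sum>l'<n. (of_real (?b l) * zl l) * (of_real (?b l') * zl l') * of_real (ct s l l')) / 2"
      unfolding z_def diag ct_def of_real_diff right_diff_distrib sum_subtractf diff_divide_distrib ..
    also have "norm \<dots> \<le> (\<Sum>l<n. \<Sum>l'<n. norm ((of_real (?b l) * zl l) * (of_real (?b l') * zl l') * of_real (ct s l l'))) / 2"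
      by (simp add: norm_divide divide_right_mono order_trans [OF norm_sum sum_mono [OF norm_sum]])
    also have "\<dots> \<le> (\<Sum>l<n. \<Sum>l'<n. 4 * \<bar>ct s l l'\<bar>) / 2"
    proof (intro divide_right_mono sum_mono)
      fix l l' assume "l \<in> {..<n}" "l' \<in> {..<n}"
      then have bb: "\<bar>?b l\<bar> \<le> 1" "\<bar>?b l'\<bar> \<le> 1" using b [of l] b [of l'] by auto
      have m: "norm (of_real r * y :: complex) \<le> 2" if "\<bar>r\<bar> \<le> 1" "norm y \<le> 2" for r :: real and y
        using mult_mono [OF that] by (simp add: norm_mult)
      have "norm (of_real (?b l) * zl l) * norm (of_real (?b l') * zl l') \<le> 2 * 2"
        by (intro mult_mono m bb zl) auto
      then have "norm (of_real (?b l) * zl l) * norm (of_real (?b l') * zl l') * \<bar>ct s l l'\<bar> \<le> 4 * \<bar>ct s l l'\<bar>"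
        by (intro mult_right_mono) auto
      then show "norm ((of_real (?b l) * zl l) * (of_real (?b l') * zl l') * of_real (ct s l l')) \<le> 4 * \<bar>ct s l l'\<bar>"
        by (simp only: norm_mult norm_of_real)
    qed simp
    also have "\<dots> = 2 * (\<Sum>l<n. \<Sum>l'<n. \<bar>ct s l l'\<bar>)"
      by (simp add: sum_distrib_left [symmetric])
    finally show ?thesis .
  qed
  define D where "D = 2 ^ n * real (n * n) ^ n * exp (2 * (real (n * n) * B))"
  have term_le: "norm (z s) ^ n * exp (norm (z s)) \<le> D * (\<Sum>l<n. \<Sum>l'<n. ct s l l' ^ n)" if s: "s \<in> R" for s
  proof -
    let ?I = "{..<n} \<times> {..<n}"
    have pairs: "(\<Sum>l<n. \<Sum>l'<n. f l l') = (\<Sum>i\<in>?I. f (fst i) (snd i))" for f :: "nat \<Rightarrow> nat \<Rightarrow> real"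
      by (simp add: sum.cartesian_product split_def)
    have "(\<Sum>l<n. \<Sum>l'<n. \<bar>ct s l l'\<bar>) \<le> (\<Sum>l<n. \<Sum>l'<n. B)"
      using s by (intro sum_mono ct_B) auto
    then have "norm (z s) \<le> 2 * (real (n * n) * B)" using z_le [OF s] by simp
    then have e: "exp (norm (z s)) \<le> exp (2 * (real (n * n) * B))" by simp
    have "norm (z s) ^ n \<le> 2 ^ n * (\<Sum>i\<in>?I. \<bar>ct s (fst i) (snd i)\<bar>) ^ n"
      using power_mono [OF z_le [OF s] norm_ge_zero, of n] by (simp only: pairs power_mult_distrib)
    also have "\<dots> \<le> 2 ^ n * (real (card ?I) ^ n * (\<Sum>i\<in>?I. \<bar>ct s (fst i) (snd i)\<bar> ^ n))"
      by (intro mult_left_mono sum_power_le) (use n in auto)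
    also have "\<dots> = 2 ^ n * (real (n * n) ^ n * (\<Sum>l<n. \<Sum>l'<n. ct s l l' ^ n))"
      using n(2) by (simp only: pairs power_even_abs card_cartesian_product card_lessThan)
    finally have p: "norm (z s) ^ n \<le> 2 ^ n * (real (n * n) ^ n * (\<Sum>l<n. \<Sum>l'<n. ct s l l' ^ n))" .
    have "norm (z s) ^ n * exp (norm (z s)) \<le> 2 ^ n * (real (n * n) ^ n * (\<Sum>l<n. \<Sum>l'<n. ct s l l' ^ n)) * exp (2 * (real (n * n) * B))"
      by (rule mult_mono [OF p e order_trans [OF _ p]]) auto
    then show ?thesis by (simp only: D_def mult_ac)
  qed
  have normA: "norm (A s) = 2 ^ n * (\<Prod>l<n. wt (s l))" if s: "s \<in> R" for s
  proof -
    have "norm (A s) = (\<Prod>l<n. 2 * wt (s l))"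
      unfolding A_def prod_norm [symmetric]
    proof (intro prod.cong refl)
      fix l assume "l \<in> {..<n}"
      then have "0 \<le> w (snd (s l))" using RT [OF s, of l] w by (auto simp: T_def)
      then show "norm ((if fst (s l) = 1 then 1 else - 1) * complex_of_real (w (snd (s l)))) = 2 * wt (s l)"
        by (simp add: norm_mult wt_def)
    qed
    then show ?thesis by (simp add: prod.distrib)
  qed
  have wt_sum: "(\<Sum>p\<in>T. wt p * f (snd p)) = (\<Sum>\<sigma>\<in>S. w \<sigma> * f \<sigma>)" for f
  proof -
    have "(\<Sum>p\<in>T. wt p * f (snd p)) = (\<Sum>b\<in>{0, 1 :: real}. \<Sum>\<sigma>\<in>S. w \<sigma> / 2 * f \<sigma>)"
      unfolding T_def wt_def sum.cartesian_product by (simp only: split_def)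
    also have "\<dots> = (\<Sum>\<sigma>\<in>S. w \<sigma> * f \<sigma>)"
      by (simp add: sum_distrib_left)
    finally show ?thesis .
  qed
  have wt1: "sum wt T = 1" using wt_sum [of "\<lambda>_. 1"] w1 by simp
  define U where "U = (\<Sum>\<sigma>\<in>S. \<Sum>\<tau>\<in>S. w \<sigma> * w \<tau> * c \<sigma> \<tau> ^ n)"
  define U' where "U' = (\<Sum>\<sigma>\<in>S. w \<sigma> * (c \<sigma> \<sigma> - v) ^ n)"
  have U0: "0 \<le> U" "0 \<le> U'"
    unfolding U_def U'_def using w n(2) by (auto intro!: sum_nonneg mult_nonneg_nonneg zero_le_even_power)
  have marg: "(\<Sum>s\<in>R. (\<Prod>l<n. wt (s l)) * ct s l l' ^ n) \<le> U + U'" if l: "l < n" "l' < n" for l l'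
  proof (cases "l = l'")
    case True
    have "(\<Sum>s\<in>R. (\<Prod>l<n. wt (s l)) * ct s l l' ^ n) = (\<Sum>p\<in>T. wt p * (c (snd p) (snd p) - v) ^ n)"
      unfolding R_def ct_def True using replica_marginal [where F = "\<lambda>p. (c (snd p) (snd p) - v) ^ n" and p = wt and a = l', OF _ _ fT wt1] l
      by simp
    also have "\<dots> = U'" unfolding U'_def by (rule wt_sum)
    finally show ?thesis using U0 by simp
  next
    case False
    have "(\<Sum>s\<in>R. (\<Prod>l<n. wt (s l)) * ct s l l' ^ n) = (\<Sum>p\<in>T. \<Sum>p'\<in>T. wt p * wt p' * c (snd p) (snd p') ^ n)"
      unfolding R_def ct_def using replica_marginal2 [where F = "\<lambda>p p'. c (snd p) (snd p') ^ n" and p = wt and a = l and b = l', OF _ _ _ False fT wt1] l False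
      by simp
    also have "\<dots> = (\<Sum>p\<in>T. wt p * (\<Sum>\<tau>\<in>S. w \<tau> * c (snd p) \<tau> ^ n))"
      by (simp only: mult.assoc sum_distrib_left [symmetric] wt_sum [where f = "\<lambda>\<tau>. c _ \<tau> ^ n"])
    also have "\<dots> = U"
      unfolding U_def by (subst wt_sum [where f = "\<lambda>\<sigma>. \<Sum>\<tau>\<in>S. w \<tau> * c \<sigma> \<tau> ^ n"]) (simp only: sum_distrib_left mult.assoc)
    finally show ?thesis using U0 by simp
  qed
  have "(\<integral>g. F 1 g \<partial>G) \<le> (\<Sum>s\<in>R. 2 ^ n * (\<Prod>l<n. wt (s l)) * (D * (\<Sum>l<n. \<Sum>l'<n. ct s l l' ^ n)))"
  proof (rule order_trans [OF main sum_mono])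
    fix s assume s: "s \<in> R"
    have "norm (A s) * (norm (z s) ^ n * exp (norm (z s))) \<le> norm (A s) * (D * (\<Sum>l<n. \<Sum>l'<n. ct s l l' ^ n))"
      by (rule mult_left_mono [OF term_le [OF s] norm_ge_zero])
    then show "norm (A s) * (norm (z s) ^ n * exp (norm (z s))) \<le> 2 ^ n * (\<Prod>l<n. wt (s l)) * (D * (\<Sum>l<n. \<Sum>l'<n. ct s l l' ^ n))"
      by (simp only: normA [OF s])
  qed
  also have "\<dots> = 2 ^ n * D * (\<Sum>s\<in>R. \<Sum>l<n. \<Sum>l'<n. (\<Prod>l<n. wt (s l)) * ct s l l' ^ n)"
    by (simp only: sum_distrib_left mult_ac)
  also have "\<dots> = 2 ^ n * D * (\<Sum>l<n. \<Sum>l'<n. \<Sum>s\<in>R. (\<Prod>l<n. wt (s l)) * ct s l l' ^ n)"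
  proof -
    have "(\<Sum>s\<in>R. \<Sum>l<n. \<Sum>l'<n. f s l l') = (\<Sum>l<n. \<Sum>l'<n. \<Sum>s\<in>R. f s l l')" for f :: "(nat \<Rightarrow> real \<times> 's) \<Rightarrow> nat \<Rightarrow> nat \<Rightarrow> real"
      by (subst sum.swap) (rule sum.cong [OF refl], rule sum.swap)
    then show ?thesis by (simp only:)
  qed
  also have "\<dots> \<le> 2 ^ n * D * (\<Sum>l<n. \<Sum>l'<n. U + U')"
    by (intro mult_left_mono sum_mono marg) (auto simp: D_def)
  also have "\<dots> = row_const n B * (U + U')"
    by (simp add: row_const_def D_def)
  finally show "(\<integral>g. norm (Y g \<zeta> - 1) ^ (2 * k) \<partial>G)
      \<le> row_const (2 * k) B * ((\<Sum>\<sigma>\<in>S. \<Sum>\<tau>\<in>S. w \<sigma> * w \<tau> * c \<sigma> \<tau> ^ (2 * k)) + (\<Sum>\<sigma>\<in>S. w \<sigma> * (c \<sigma> \<sigma> - v) ^ (2 * k)))"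
    by (simp only: F1 n_def U_def U'_def)
qed

end

section \<open>From the exponential average to its derivative\<close>

text \<open>A convex power lies above its tangent; after scaling by \<open>a\<close> this is
  Bernoulli's inequality. It is the source of Jensen's inequality both for integrals and for finite
  averages.\<close>

lemma power_tangent_le:
  fixes a x :: real
  assumes "0 \<le> a" "0 \<le> x"
  shows "a ^ n + real n * a ^ (n - 1) * (x - a) \<le> x ^ n"
proof (cases "n = 0")
  case False
  then obtain k where k: "n = Suc k" by (cases n) auto
  show ?thesis
  proof (cases "a = 0")
    case True
    then show ?thesis using assms by (cases "k = 0") (auto simp: k zero_power)
  next
    case False
    then have a: "0 < a" using assms by simp
    have "1 + real n * (x / a - 1) \<le> (1 + (x / a - 1)) ^ n"
      by (rule Bernoulli_inequality) (use assms a in auto)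
    then have "a ^ n * (1 + real n * (x / a - 1)) \<le> a ^ n * (x / a) ^ n"
      using a by (intro mult_left_mono) auto
    also have "a ^ n * (x / a) ^ n = x ^ n" using a by (simp add: power_divide)
    also have "a ^ n * (1 + real n * (x / a - 1)) = a ^ n + real n * a ^ (n - 1) * (x - a)"
      using a by (simp add: k field_simps)
    finally show ?thesis .
  qed
qed simp

text \<open>Jensen's inequality, by integrating the tangent at the mean.\<close>

lemma (in prob_space) power_integral_le:
  fixes f :: "'a \<Rightarrow> real"
  assumes f: "integrable M f" "integrable M (\<lambda>x. f x ^ n)" and pos: "\<And>x. 0 \<le> f x"
  shows "(\<integral>x. f x \<partial>M) ^ n \<le> (\<integral>x. f x ^ n \<partial>M)"
proof -
  let ?a = "\<integral>x. f x \<partial>M"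
  have a: "0 \<le> ?a" by (rule Bochner_Integration.integral_nonneg) (rule pos)
  have "?a ^ n = (\<integral>x. ?a ^ n + real n * ?a ^ (n - 1) * (f x - ?a) \<partial>M)"
    using f(1) by (simp add: prob_space)
  also have "\<dots> \<le> (\<integral>x. f x ^ n \<partial>M)"
    by (intro integral_mono f(2) power_tangent_le a pos Bochner_Integration.integrable_add
        Bochner_Integration.integrable_diff integrable_mult_right integrable_const f(1))
  finally show ?thesis .
qed

text \<open>The parameter space of the circle in Cauchy's formula, as a probability measure so that
  Jensen's inequality applies.\<close>

definition unit_interval_measure :: "real measure" where
  "unit_interval_measure = restrict_space lborel {0..1}"

lemma prob_space_unit_interval: "prob_space unit_interval_measure"
  unfolding unit_interval_measure_def by (rule prob_spaceI) (simp add: emeasure_restrict_space space_restrict_space)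

lemma measurable_unit_interval: "f \<in> borel_measurable borel \<Longrightarrow> f \<in> borel_measurable unit_interval_measure"
  unfolding unit_interval_measure_def by (rule measurable_restrict_space1) simp

lemma integrable_unit_interval:
  fixes f :: "real \<Rightarrow> real"
  assumes "continuous_on UNIV f"
  shows "integrable unit_interval_measure f" "(\<integral>t. f t \<partial>unit_interval_measure) = integral {0..1} f"
proof -
  have "set_integrable lborel {0..1} f"
    by (rule borel_integrable_atLeastAtMost') (rule continuous_on_subset [OF assms], simp)
  then show "integrable unit_interval_measure f" "(\<integral>t. f t \<partial>unit_interval_measure) = integral {0..1} f"
    using set_borel_integral_eq_integral(2) [of "{0..1}" f]
    by (simp_all add: unit_interval_measure_def integrable_restrict_space integral_restrict_space
        set_integrable_def set_lebesgue_integral_def)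
qed

text \<open>In Cauchy's formula on the unit circle about \<open>z\<close>, the velocity of the
  parametrisation cancels one power of the kernel and the other power has modulus 1.\<close>

lemma norm_derivative_le_circle_average:
  fixes f :: "complex \<Rightarrow> complex"
  assumes f: "\<And>z. (f has_field_derivative f' z) (at z)"
  shows "norm (f' z) \<le> (\<integral>t. norm (f (z + exp (2 * of_real pi * \<i> * of_real t))) \<partial>unit_interval_measure)"
proof -
  let ?e = "\<lambda>t::real. exp (2 * of_real pi * \<i> * of_real t) :: complex"
  have hol: "f holomorphic_on A" for A
    using f by (auto simp: holomorphic_on_def field_differentiable_def intro: has_field_derivative_at_within)
  have cont: "continuous_on A f" for A by (rule holomorphic_on_imp_continuous_on [OF hol])
  have "(\<lambda>u. f u / (u - z)\<^sup>2) contour_integrable_on circlepath z 1"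
    and d: "(f has_field_derivative (1 / (2 * of_real pi * \<i>) * contour_integral (circlepath z 1) (\<lambda>u. f u / (u - z)\<^sup>2))) (at z)"
    by (rule Cauchy_derivative_integral_circlepath [OF cont hol]; simp)+
  have "contour_integral (circlepath z 1) (\<lambda>u. f u / (u - z)\<^sup>2)
      = integral {0..1} (\<lambda>t. f (circlepath z 1 t) / (circlepath z 1 t - z)\<^sup>2 * vector_derivative (circlepath z 1) (at t))"
    by (rule contour_integral_integral)
  also have "\<dots> = integral {0..1} (\<lambda>t. (2 * of_real pi * \<i>) * (f (z + ?e t) / ?e t))"
  proof (rule integral_cong)
    fix t :: real
    have "vector_derivative (circlepath z 1) (at t) = 2 * of_real pi * \<i> * ?e t"
      by (simp add: vector_derivative_circlepath)
    then show "f (circlepath z 1 t) / (circlepath z 1 t - z)\<^sup>2 * vector_derivative (circlepath z 1) (at t)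
        = (2 * of_real pi * \<i>) * (f (z + ?e t) / ?e t)"
      by (simp add: circlepath power2_eq_square)
  qed
  also have "\<dots> = (2 * of_real pi * \<i>) * integral {0..1} (\<lambda>t. f (z + ?e t) / ?e t)"
    by (rule integral_mult_right)
  finally have eq: "contour_integral (circlepath z 1) (\<lambda>u. f u / (u - z)\<^sup>2) = \<dots>" .
  have "f' z = integral {0..1} (\<lambda>t. f (z + ?e t) / ?e t)"
    using DERIV_unique [OF f d] unfolding eq by simp
  also have "norm \<dots> \<le> integral {0..1} (\<lambda>t. norm (f (z + ?e t)))"
  proof (rule integral_norm_bound_integral)
    show "(\<lambda>t. f (z + ?e t) / ?e t) integrable_on {0..1}" "(\<lambda>t. norm (f (z + ?e t))) integrable_on {0..1}"
      by (rule integrable_continuous_interval, intro continuous_intros continuous_on_compose2 [OF cont [of UNIV]]; simp)+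
    show "norm (f (z + ?e t) / ?e t) \<le> norm (f (z + ?e t))" for t
      by (simp add: norm_divide norm_exp_eq_Re)
  qed
  also have "\<dots> = (\<integral>t. norm (f (z + ?e t)) \<partial>unit_interval_measure)"
    by (rule integrable_unit_interval(2) [symmetric])
       (intro continuous_intros continuous_on_compose2 [OF cont [of UNIV]], auto)
  finally show ?thesis .
qed

context row_average
begin

definition Y' :: "('j \<Rightarrow> real) \<Rightarrow> complex \<Rightarrow> complex" where
  "Y' g \<zeta> = (\<Sum>\<sigma>\<in>S. of_real (w \<sigma>) * ((of_real (x g \<sigma>) - \<zeta> * of_real v) * exp (\<zeta> * of_real (x g \<sigma>) - \<zeta>\<^sup>2 * of_real v / 2)))"

lemma Y_has_derivative: "((\<lambda>\<zeta>. Y g \<zeta> - 1) has_field_derivative Y' g \<zeta>) (at \<zeta>)"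
proof -
  have "((\<lambda>\<zeta>. Y g \<zeta> - 1) has_field_derivative
     (\<Sum>\<sigma>\<in>S. of_real (w \<sigma>) * (exp (\<zeta> * of_real (x g \<sigma>) - \<zeta>\<^sup>2 * of_real v / 2) * (of_real (x g \<sigma>) - \<zeta> * of_real v))) - 0) (at \<zeta>)"
    unfolding Y_def
    by (intro DERIV_diff DERIV_sum DERIV_cmult DERIV_const DERIV_fun_exp) (auto intro!: derivative_eq_intros)
  then show ?thesis by (simp only: Y'_def diff_0_right mult.commute [of "exp _"])
qed

lemma x_measurable: "(\<lambda>g. x g \<sigma>) \<in> borel_measurable G"
  unfolding x_def
  by (intro borel_measurable_sum borel_measurable_times borel_measurable_const gaussian_product_component)

lemma measurable_exp_linear:
  assumes f: "f \<in> borel_measurable M" and e: "e \<in> borel_measurable M"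
  shows "(\<lambda>p. exp (e p * of_real (f p :: real) - (e p)\<^sup>2 * of_real v / 2) :: complex) \<in> borel_measurable M"
proof -
  have "(\<lambda>p. (e p, f p)) \<in> M \<rightarrow>\<^sub>M borel \<Otimes>\<^sub>M borel"
    using f e by (rule measurable_Pair [rotated])
  moreover have "(\<lambda>(z, r). exp (z * of_real r - z\<^sup>2 * of_real v / 2) :: complex) \<in> borel_measurable (borel \<Otimes>\<^sub>M borel)"
    unfolding borel_prod split_def by (intro borel_measurable_continuous_onI continuous_intros) auto
  ultimately have "(\<lambda>(z, r). exp (z * of_real r - z\<^sup>2 * of_real v / 2) :: complex) \<circ> (\<lambda>p. (e p, f p)) \<in> borel_measurable M"
    by (rule measurable_comp)
  then show ?thesis by (simp add: comp_def)
qed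

lemma Y_measurable_pair:
  assumes "e \<in> borel_measurable L"
  shows "(\<lambda>p. Y (fst p) (e (snd p))) \<in> borel_measurable (G \<Otimes>\<^sub>M L)"
  unfolding Y_def
  by (intro borel_measurable_sum borel_measurable_times borel_measurable_const measurable_exp_linear
      measurable_compose [OF measurable_fst x_measurable] measurable_compose [OF measurable_snd assms])

lemma Y'_measurable: "(\<lambda>g. Y' g \<zeta>) \<in> borel_measurable G"
proof -
  have "(\<lambda>g. complex_of_real (x g \<sigma>)) \<in> borel_measurable G" for \<sigma>
    by (rule measurable_compose [OF x_measurable]) (intro borel_measurable_continuous_onI continuous_intros)
  then show ?thesis
    unfolding Y'_def
    by (intro borel_measurable_sum borel_measurable_times borel_measurable_const borel_measurable_diff
        measurable_exp_linear x_measurable)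
qed

text \<open>The unit circle about a point of the unit disc stays in the disc of radius 2, where the
  bound on \<open>Y - 1\<close> holds uniformly. Jensen moves the power inside the circle average,
  and Tonelli exchanges it with the row average, which also yields integrability.\<close>

lemma row_derivative_bound:
  assumes \<zeta>: "norm \<zeta> \<le> 1" and k: "0 < k"
    and a: "\<And>j \<sigma>. j \<in> J \<Longrightarrow> \<sigma> \<in> S \<Longrightarrow> \<bar>\<xi> j \<sigma>\<bar> \<le> a"
    and B: "\<And>\<sigma> \<tau>. \<sigma> \<in> S \<Longrightarrow> \<tau> \<in> S \<Longrightarrow> \<bar>c \<sigma> \<tau>\<bar> \<le> B" "\<And>\<sigma>. \<sigma> \<in> S \<Longrightarrow> \<bar>c \<sigma> \<sigma> - v\<bar> \<le> B"
  defines "M \<equiv> row_const (2 * k) B * ((\<Sum>\<sigma>\<in>S. \<Sum>\<tau>\<in>S. w \<sigma> * w \<tau> * c \<sigma> \<tau> ^ (2 * k)) + (\<Sum>\<sigma>\<in>S. w \<sigma> * (c \<sigma> \<sigma> - v) ^ (2 * k)))"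
  shows "integrable G (\<lambda>g. norm (Y' g \<zeta>) ^ (2 * k))" and "(\<integral>g. norm (Y' g \<zeta>) ^ (2 * k) \<partial>G) \<le> M"
proof -
  let ?\<mu> = unit_interval_measure
  interpret U: prob_space ?\<mu> by (rule prob_space_unit_interval)
  interpret GP: prob_space G by (rule prob_space_gaussian_product)
  interpret P: pair_sigma_finite G ?\<mu> ..
  define e where "e t = \<zeta> + exp (2 * of_real pi * \<i> * of_real t)" for t :: real
  have e_meas: "e \<in> borel_measurable ?\<mu>"
    unfolding e_def by (intro measurable_unit_interval borel_measurable_continuous_onI continuous_intros)
  have e_norm: "norm (e t) \<le> 2" for t
  proof -
    have "norm (e t) \<le> norm \<zeta> + norm (exp (2 * of_real pi * \<i> * of_real t) :: complex)"
      unfolding e_def by (rule norm_triangle_ineq)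
    also have "norm (exp (2 * of_real pi * \<i> * of_real t) :: complex) = 1" by (simp add: norm_exp_eq_Re)
    finally show ?thesis using \<zeta> by linarith
  qed
  define F where "F g t = norm (Y g (e t) - 1) ^ (2 * k)" for g t
  have F0: "0 \<le> F g t" for g t by (simp add: F_def)
  have Ycont: "continuous_on UNIV (\<lambda>t. norm (Y g (e t) - 1))" for g
    unfolding Y_def e_def by (intro continuous_intros) auto
  have Fcont: "continuous_on UNIV (F g)" for g
    unfolding F_def [abs_def] by (intro continuous_on_power Ycont)
  have F_meas: "(\<lambda>p. ennreal (F (fst p) (snd p))) \<in> borel_measurable (G \<Otimes>\<^sub>M ?\<mu>)"
    unfolding F_def
    by (intro measurable_compose [OF _ measurable_ennreal] borel_measurable_power measurable_compose [OF _ borel_measurable_norm]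
        borel_measurable_diff borel_measurable_const Y_measurable_pair e_meas)
  have M0: "0 \<le> M"
    unfolding M_def using w
    by (intro mult_nonneg_nonneg add_nonneg_nonneg sum_nonneg row_const_nonneg) auto
  have point: "norm (Y' g \<zeta>) ^ (2 * k) \<le> (\<integral>t. F g t \<partial>?\<mu>)" for g
  proof -
    have "norm (Y' g \<zeta>) \<le> (\<integral>t. norm (Y g (e t) - 1) \<partial>?\<mu>)"
      unfolding e_def by (rule norm_derivative_le_circle_average [OF Y_has_derivative])
    then have "norm (Y' g \<zeta>) ^ (2 * k) \<le> (\<integral>t. norm (Y g (e t) - 1) \<partial>?\<mu>) ^ (2 * k)"
      by (rule power_mono) simp
    also have "\<dots> \<le> (\<integral>t. F g t \<partial>?\<mu>)"
      unfolding F_def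
      by (rule U.power_integral_le [OF integrable_unit_interval(1) [OF Ycont]
            integrable_unit_interval(1) [OF continuous_on_power [OF Ycont]]]) simp
    finally show ?thesis .
  qed
  have "(\<integral>\<^sup>+ g. ennreal (norm (Y' g \<zeta>) ^ (2 * k)) \<partial>G) \<le> (\<integral>\<^sup>+ g. (\<integral>\<^sup>+ t. ennreal (F g t) \<partial>?\<mu>) \<partial>G)"
  proof (rule nn_integral_mono)
    fix g
    have "(\<integral>\<^sup>+ t. ennreal (F g t) \<partial>?\<mu>) = ennreal (\<integral>t. F g t \<partial>?\<mu>)"
      by (rule nn_integral_eq_integral [OF integrable_unit_interval(1) [OF Fcont]]) (rule AE_I2, rule F0)
    then show "ennreal (norm (Y' g \<zeta>) ^ (2 * k)) \<le> (\<integral>\<^sup>+ t. ennreal (F g t) \<partial>?\<mu>)"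
      using ennreal_leI [OF point] by (simp only:)
  qed
  also have "\<dots> = (\<integral>\<^sup>+ t. (\<integral>\<^sup>+ g. ennreal (F g t) \<partial>G) \<partial>?\<mu>)"
    by (rule P.Fubini' [symmetric]) (use F_meas in \<open>simp only: split_def\<close>)
  also have "\<dots> \<le> (\<integral>\<^sup>+ t. ennreal M \<partial>?\<mu>)"
  proof (rule nn_integral_mono)
    fix t
    have "integrable G (\<lambda>g. F g t)"
      unfolding F_def by (rule row_bound(1) [OF e_norm k a B])
    then have "(\<integral>\<^sup>+ g. ennreal (F g t) \<partial>G) = ennreal (\<integral>g. F g t \<partial>G)"
      by (rule nn_integral_eq_integral) (rule AE_I2, rule F0)
    also have "\<dots> \<le> ennreal M"
    proof (rule ennreal_leI)
      show "(\<integral>g. F g t \<partial>G) \<le> M"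
        unfolding F_def M_def by (rule row_bound(2) [OF e_norm k a B])
    qed
    finally show "(\<integral>\<^sup>+ g. ennreal (F g t) \<partial>G) \<le> ennreal M" .
  qed
  also have "\<dots> = ennreal M"
    by (simp add: U.emeasure_space_1)
  finally have nn: "(\<integral>\<^sup>+ g. ennreal (norm (Y' g \<zeta>) ^ (2 * k)) \<partial>G) \<le> ennreal M" .
  have meas: "(\<lambda>g. norm (Y' g \<zeta>) ^ (2 * k)) \<in> borel_measurable G"
    by (intro borel_measurable_power measurable_compose [OF Y'_measurable borel_measurable_norm])
  show int: "integrable G (\<lambda>g. norm (Y' g \<zeta>) ^ (2 * k))"
  proof (rule integrableI_bounded [OF meas])
    have "(\<integral>\<^sup>+ g. ennreal (norm (norm (Y' g \<zeta>) ^ (2 * k))) \<partial>G) = (\<integral>\<^sup>+ g. ennreal (norm (Y' g \<zeta>) ^ (2 * k)) \<partial>G)"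
      by (simp only: real_norm_def abs_of_nonneg zero_le_power norm_ge_zero)
    also have "\<dots> < \<infinity>" using nn by (rule le_less_trans) simp
    finally show "(\<integral>\<^sup>+ g. ennreal (norm (norm (Y' g \<zeta>) ^ (2 * k))) \<partial>G) < \<infinity>" .
  qed
  have "(\<integral>\<^sup>+ g. ennreal (norm (Y' g \<zeta>) ^ (2 * k)) \<partial>G) = ennreal (\<integral>g. norm (Y' g \<zeta>) ^ (2 * k) \<partial>G)"
    by (rule nn_integral_eq_integral [OF int]) (rule AE_I2, simp)
  then show "(\<integral>g. norm (Y' g \<zeta>) ^ (2 * k) \<partial>G) \<le> M"
    using nn M0 by simp
qed

end

section \<open>The quadratic form of the variance profile\<close>

lemma smult_mat_mult_vec:
  fixes A :: "'a::comm_ring_1 mat"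
  assumes "A \<in> carrier_mat n m" "x \<in> carrier_vec m"
  shows "(c \<cdot>\<^sub>m A) *\<^sub>v x = c \<cdot>\<^sub>v (A *\<^sub>v x)"
  using assms by (intro eq_vecI) (auto simp: scalar_prod_def sum_distrib_left mult.assoc)

text \<open>Strictness matters for the powers: at spectral radius 1 they may in general grow through
  Jordan blocks, so the form is compared with some \<open>\<rho>\<close> strictly above the
  radius.\<close>

lemma spectral_radius_scale_less_1:
  fixes M :: "real mat"
  assumes M: "M \<in> carrier_mat m m" and m: "0 < m" and \<rho>: "0 < \<rho>"
    and sr: "spectral_radius (map_mat complex_of_real M) < \<rho>"
  shows "spectral_radius (map_mat complex_of_real ((1 / \<rho>) \<cdot>\<^sub>m M)) < 1"
proof -
  let ?A = "map_mat complex_of_real M" and ?B = "map_mat complex_of_real ((1 / \<rho>) \<cdot>\<^sub>m M)"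
  have A: "?A \<in> carrier_mat m m" and B: "?B \<in> carrier_mat m m" using M by auto
  have BA: "?B = of_real (1 / \<rho>) \<cdot>\<^sub>m ?A" using M by (intro eq_matI) auto
  obtain k where k: "k \<in> spectrum ?B" "spectral_radius ?B = cmod k"
    using spectral_radius_mem_max(1) [OF B m] by auto
  then obtain x where x: "x \<in> carrier_vec m" "x \<noteq> 0\<^sub>v m" "?B *\<^sub>v x = k \<cdot>\<^sub>v x"
    using B by (auto simp: spectrum_def eigenvalue_def eigenvector_def)
  have "?A *\<^sub>v x = (of_real \<rho> * k) \<cdot>\<^sub>v x"
  proof -
    have "of_real (1 / \<rho>) \<cdot>\<^sub>v (?A *\<^sub>v x) = k \<cdot>\<^sub>v x"
      using x(3) unfolding BA using smult_mat_mult_vec [OF A x(1)] by simp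
    then have "of_real \<rho> \<cdot>\<^sub>v (of_real (1 / \<rho>) \<cdot>\<^sub>v (?A *\<^sub>v x)) = of_real \<rho> \<cdot>\<^sub>v (k \<cdot>\<^sub>v x)" by simp
    then show ?thesis using \<rho> by (simp add: smult_smult_assoc)
  qed
  then have "of_real \<rho> * k \<in> spectrum ?A"
    using A x by (auto simp: spectrum_def eigenvalue_def eigenvector_def)
  then have "cmod (of_real \<rho> * k) \<le> spectral_radius ?A"
    by (intro spectral_radius_mem_max(2) [OF A m]) auto
  then have "\<rho> * cmod k < \<rho> * 1"
    using sr \<rho> by (simp only: norm_mult norm_of_real abs_of_pos mult_1_right)
  then show ?thesis using \<rho> unfolding k(2) by (simp only: mult_less_cancel_left_pos)
qed

text \<open>The bound comes from the Jordan normal form of the complexified matrix; its real entries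
  are read off afterwards.\<close>

lemma matrix_powers_bounded:
  fixes M :: "real mat"
  assumes M: "M \<in> carrier_mat m m" and sr: "spectral_radius (map_mat complex_of_real M) < 1"
  shows "\<exists>c. \<forall>n. \<forall>i<m. \<forall>j<m. \<bar>(M ^\<^sub>m n) $$ (i, j)\<bar> \<le> c"
proof -
  have A: "map_mat complex_of_real M \<in> carrier_mat m m" using M by auto
  obtain c where c: "\<And>n. norm_bound (map_mat complex_of_real M ^\<^sub>m n) c"
    using spectral_radius_jnf_norm_bound_less_1_upper_triangular [OF A sr] by auto
  have "\<bar>(M ^\<^sub>m n) $$ (i, j)\<bar> \<le> c" if "i < m" "j < m" for n i j
  proof -
    have P: "M ^\<^sub>m n \<in> carrier_mat m m" using M by simp
    have "map_mat complex_of_real M ^\<^sub>m n = map_mat complex_of_real (M ^\<^sub>m n)"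
      by (rule of_real_hom.mat_hom_pow [OF M, symmetric])
    then have "norm_bound (map_mat complex_of_real (M ^\<^sub>m n)) c" using c [of n] by simp
    then have "\<forall>i j. i < m \<longrightarrow> j < m \<longrightarrow> norm (map_mat complex_of_real (M ^\<^sub>m n) $$ (i, j)) \<le> c"
      unfolding norm_bound_def using P by (simp only: index_map_mat carrier_matD)
    then have "norm (map_mat complex_of_real (M ^\<^sub>m n) $$ (i, j)) \<le> c"
      using that by blast
    moreover have "map_mat complex_of_real (M ^\<^sub>m n) $$ (i, j) = of_real ((M ^\<^sub>m n) $$ (i, j))"
      using P that by (intro index_map_mat) auto
    ultimately show ?thesis by (simp only: norm_of_real)
  qed
  then show ?thesis by blast
qed

text \<open>Since the operator \<open>T\<close> below is self-adjoint for the weights \<open>lam\<close>, the Cauchy--Schwarz inequality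
  gives \<open>\<langle>T x, x\<rangle>\<^bsup>2\<^sup>j\<^esup> \<le> \<langle>T\<^bsup>2\<^sup>j\<^esup> x, x\<rangle> \<langle>x, x\<rangle>\<^bsup>2\<^sup>j - 1\<^esup>\<close>, so bounded powers force \<open>\<bar>\<langle>T x, x\<rangle>\<bar> \<le> \<langle>x, x\<rangle>\<close>.\<close>

lemma quadratic_form_le_of_powers_bounded:
  fixes M :: "real mat" and lam x :: "nat \<Rightarrow> real"
  assumes M: "M \<in> carrier_mat m m"
    and c: "\<And>n i j. i < m \<Longrightarrow> j < m \<Longrightarrow> \<bar>(M ^\<^sub>m n) $$ (i, j)\<bar> \<le> c"
    and sym: "\<And>s t. s < m \<Longrightarrow> t < m \<Longrightarrow> lam s * M $$ (s, t) = lam t * M $$ (t, s)"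
    and lam: "\<And>s. s < m \<Longrightarrow> 0 < lam s"
  shows "\<bar>\<Sum>s<m. \<Sum>t<m. lam s * M $$ (s, t) * x t * x s\<bar> \<le> (\<Sum>s<m. lam s * (x s)\<^sup>2)"
proof -
  define T where "T y = (\<lambda>s. \<Sum>t<m. M $$ (s, t) * y t)" for y :: "nat \<Rightarrow> real"
  define ip where "ip y z = (\<Sum>s<m. lam s * y s * z s)" for y z :: "nat \<Rightarrow> real"
  have adj: "ip (T y) z = ip y (T z)" for y z
  proof -
    have "ip (T y) z = (\<Sum>s<m. \<Sum>t<m. lam s * M $$ (s, t) * (y t * z s))"
      unfolding ip_def T_def sum_distrib_left sum_distrib_right by (intro sum.cong refl) (simp add: mult_ac)
    also have "\<dots> = (\<Sum>s<m. \<Sum>t<m. lam t * M $$ (t, s) * (y t * z s))"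
      by (intro sum.cong refl) (simp add: sym)
    also have "\<dots> = (\<Sum>t<m. \<Sum>s<m. lam t * M $$ (t, s) * (y t * z s))" by (rule sum.swap)
    also have "\<dots> = ip y (T z)"
      unfolding ip_def T_def sum_distrib_left by (intro sum.cong refl) (simp add: mult_ac)
    finally show ?thesis .
  qed
  have adj_pow: "ip ((T ^^ i) y) ((T ^^ j) z) = ip ((T ^^ (i + j)) y) z" for i j y z
  proof (induction j arbitrary: i z)
    case (Suc j)
    have "ip ((T ^^ i) y) ((T ^^ Suc j) z) = ip ((T ^^ Suc i) y) ((T ^^ j) z)" by (simp add: adj)
    also have "\<dots> = ip ((T ^^ (Suc i + j)) y) z" by (rule Suc.IH)
    finally show ?case by simp
  qed simp
  have cs: "(ip y z)\<^sup>2 \<le> ip y y * ip z z" for y z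
  proof -
    have "(\<Sum>s<m. (sqrt (lam s) * y s) * (sqrt (lam s) * z s))\<^sup>2
        \<le> (\<Sum>s<m. (sqrt (lam s) * y s)\<^sup>2) * (\<Sum>s<m. (sqrt (lam s) * z s)\<^sup>2)"
      by (rule Cauchy_Schwarz_ineq_sum)
    moreover have "(\<Sum>s<m. (sqrt (lam s) * y s) * (sqrt (lam s) * z s)) = ip y z" for y z
      unfolding ip_def
    proof (intro sum.cong refl)
      fix s assume "s \<in> {..<m}"
      then have "sqrt (lam s) * sqrt (lam s) = lam s" using lam by (simp add: less_imp_le)
      then have "(sqrt (lam s) * sqrt (lam s)) * (y s * z s) = lam s * (y s * z s)" by (simp only:)
      then show "(sqrt (lam s) * y s) * (sqrt (lam s) * z s) = lam s * y s * z s" by (simp only: mult_ac)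
    qed
    ultimately show ?thesis by (simp only: power2_eq_square)
  qed
  have pow: "(T ^^ n) y s = (\<Sum>t<m. (M ^\<^sub>m n) $$ (s, t) * y t)" if "s < m" for n y s
    using that
  proof (induction n arbitrary: y)
    case 0
    have "(\<Sum>t<m. (1\<^sub>m m) $$ (s, t) * y t) = (\<Sum>t<m. if s = t then y t else 0)"
      using 0 by (intro sum.cong refl) auto
    then show ?case using 0 M by (simp add: sum.delta)
  next
    case (Suc n)
    have P: "M ^\<^sub>m n \<in> carrier_mat m m" using M by simp
    have "(T ^^ Suc n) y s = (T ^^ n) (T y) s" by (simp add: funpow_swap1)
    also have "\<dots> = (\<Sum>r<m. (M ^\<^sub>m n) $$ (s, r) * (\<Sum>t<m. M $$ (r, t) * y t))"
      by (simp only: Suc.IH [OF Suc.prems] T_def)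
    also have "\<dots> = (\<Sum>r<m. \<Sum>t<m. (M ^\<^sub>m n) $$ (s, r) * M $$ (r, t) * y t)"
      unfolding sum_distrib_left by (simp only: mult.assoc)
    also have "\<dots> = (\<Sum>t<m. (\<Sum>r<m. (M ^\<^sub>m n) $$ (s, r) * M $$ (r, t)) * y t)"
      unfolding sum_distrib_right by (rule sum.swap)
    also have "\<dots> = (\<Sum>t<m. (M ^\<^sub>m Suc n) $$ (s, t) * y t)"
      using P M Suc.prems by (intro sum.cong refl) (simp add: scalar_prod_def atLeast0LessThan)
    finally show ?case .
  qed
  define a where "a n = ip ((T ^^ n) x) x" for n
  \<comment> \<open>A bound for the forms of all powers at once, from the entrywise bound
    \<open>c\<close>.\<close>
  define K where "K = (\<Sum>s<m. lam s * (\<Sum>t<m. c * \<bar>x t\<bar>) * \<bar>x s\<bar>)"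
  have a_le: "\<bar>a n\<bar> \<le> K" for n
    unfolding a_def ip_def K_def
  proof (intro order_trans [OF sum_abs] sum_mono)
    fix s assume "s \<in> {..<m}"
    then have s: "s < m" by simp
    have "\<bar>(T ^^ n) x s\<bar> \<le> (\<Sum>t<m. c * \<bar>x t\<bar>)"
      unfolding pow [OF s] using c [OF s]
      by (intro order_trans [OF sum_abs] sum_mono) (simp add: abs_mult mult_right_mono)
    then show "\<bar>lam s * (T ^^ n) x s * x s\<bar> \<le> lam s * (\<Sum>t<m. c * \<bar>x t\<bar>) * \<bar>x s\<bar>"
      using lam [OF s] by (simp add: abs_mult mult_left_mono mult_right_mono)
  qed
  have step: "(a n)\<^sup>2 \<le> a (n + n) * a 0" for n
    using cs [of "(T ^^ n) x" x] adj_pow [of n x n x] by (simp add: a_def)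
  have a0: "0 \<le> a 0" unfolding a_def ip_def using lam by (auto intro!: sum_nonneg simp: less_imp_le mult.assoc)
  have key: "\<bar>a 1\<bar> \<le> a 0"
  proof (cases "a 0 = 0")
    case True
    then show ?thesis using step [of 1] by simp
  next
    case False
    then have pos: "0 < a 0" using a0 by simp
    define b where "b n = a n / a 0" for n
    have bstep: "(b n)\<^sup>2 \<le> b (n + n)" for n
    proof -
      have "(a n)\<^sup>2 / (a 0)\<^sup>2 \<le> a (n + n) * a 0 / (a 0)\<^sup>2" by (intro divide_right_mono step) simp
      then show ?thesis using pos by (simp add: b_def power_divide power2_eq_square)
    qed
    have bpow: "\<bar>b 1\<bar> ^ (2 ^ j) \<le> \<bar>b (2 ^ j)\<bar>" for j
    proof (induction j)
      case (Suc j)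
      have "\<bar>b 1\<bar> ^ (2 ^ Suc j) = (\<bar>b 1\<bar> ^ (2 ^ j))\<^sup>2" by (simp add: power_mult [symmetric] mult.commute)
      also have "\<dots> \<le> \<bar>b (2 ^ j)\<bar>\<^sup>2" by (intro power_mono Suc) simp
      also have "\<dots> \<le> b (2 ^ j + 2 ^ j)" using bstep [of "2 ^ j"] by simp
      also have "\<dots> \<le> \<bar>b (2 ^ Suc j)\<bar>" by (simp add: mult_2)
      finally show ?case .
    qed simp
    have "\<bar>b 1\<bar> \<le> 1"
    proof (rule ccontr)
      assume "\<not> \<bar>b 1\<bar> \<le> 1"
      \<comment> \<open>A ratio above 1 would grow without limit along the exponents
        \<open>2 ^ n\<close>, against the bound \<open>K / a 0\<close> common to all powers.\<close>
      then obtain n where n: "K / a 0 < \<bar>b 1\<bar> ^ n" using real_arch_pow [of "\<bar>b 1\<bar>" "K / a 0"] by auto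
      have "n < 2 ^ n" by (rule less_exp)
      then have "\<bar>b 1\<bar> ^ n \<le> \<bar>b 1\<bar> ^ (2 ^ n)" using \<open>\<not> \<bar>b 1\<bar> \<le> 1\<close> by (intro power_increasing) auto
      also have "\<dots> \<le> \<bar>b (2 ^ n)\<bar>" by (rule bpow)
      also have "\<dots> \<le> K / a 0" unfolding b_def using a_le [of "2 ^ n"] pos by (simp add: divide_right_mono)
      finally show False using n by simp
    qed
    then show ?thesis using pos by (simp add: b_def)
  qed
  have "a 1 = (\<Sum>s<m. \<Sum>t<m. lam s * M $$ (s, t) * x t * x s)"
    unfolding a_def ip_def by (simp add: T_def sum_distrib_left sum_distrib_right mult_ac)
  moreover have "a 0 = (\<Sum>s<m. lam s * (x s)\<^sup>2)"
    unfolding a_def ip_def by (simp add: power2_eq_square mult.assoc)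
  ultimately show ?thesis using key by simp
qed

text \<open>With \<open>x s = w s / lam s\<close> the form of \<open>D\<close> in \<open>w\<close>
  becomes the form of the product of \<open>D\<close> with the ratios in \<open>x\<close>. That
  product is in general not symmetric, but it is self-adjoint for the weights
  \<open>lam\<close>.\<close>

lemma quadratic_form_le_spectral_radius:
  fixes D :: "real mat" and lam w :: "nat \<Rightarrow> real"
  assumes D: "D \<in> carrier_mat m m" and sym: "transpose_mat D = D" and m: "0 < m"
    and lam: "\<And>s. s < m \<Longrightarrow> 0 < lam s" and \<rho>: "0 < \<rho>"
    and sr: "spectral_radius (map_mat complex_of_real (D * mat_diag m lam)) < \<rho>"
  shows "\<bar>\<Sum>s<m. \<Sum>t<m. D $$ (s, t) * w s * w t\<bar> \<le> \<rho> * (\<Sum>s<m. (w s)\<^sup>2 / lam s)"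
proof -
  have DL: "D * mat_diag m lam = Matrix.mat m m (\<lambda>(i, j). D $$ (i, j) * lam j)"
    by (rule mat_diag_mult_right [OF D])
  define M where "M = (1 / \<rho>) \<cdot>\<^sub>m (D * mat_diag m lam)"
  have M: "M \<in> carrier_mat m m" unfolding M_def DL by simp
  have Mi: "M $$ (s, t) = D $$ (s, t) * lam t / \<rho>" if "s < m" "t < m" for s t
    unfolding M_def DL using that by simp
  have Dsym: "D $$ (s, t) = D $$ (t, s)" if "s < m" "t < m" for s t
    using sym that D index_transpose_mat(1) [of s D t] by auto
  have "D * mat_diag m lam \<in> carrier_mat m m" by (rule mult_carrier_mat [OF D mat_diag_dim])
  then have "spectral_radius (map_mat complex_of_real M) < 1"
    unfolding M_def by (rule spectral_radius_scale_less_1 [OF _ m \<rho> sr])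
  then obtain c where c: "\<And>n i j. i < m \<Longrightarrow> j < m \<Longrightarrow> \<bar>(M ^\<^sub>m n) $$ (i, j)\<bar> \<le> c"
    using matrix_powers_bounded [OF M] by blast
  let ?x = "\<lambda>s. w s / lam s"
  have "\<bar>\<Sum>s<m. \<Sum>t<m. lam s * M $$ (s, t) * ?x t * ?x s\<bar> \<le> (\<Sum>s<m. lam s * (?x s)\<^sup>2)"
    by (rule quadratic_form_le_of_powers_bounded [OF M c _ lam]) (auto simp: Mi Dsym)
  moreover have "(\<Sum>s<m. \<Sum>t<m. lam s * M $$ (s, t) * ?x t * ?x s) = (\<Sum>s<m. \<Sum>t<m. D $$ (s, t) * w s * w t) / \<rho>"
    unfolding sum_divide_distrib
  proof (intro sum.cong refl)
    fix s t assume "s \<in> {..<m}" "t \<in> {..<m}"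
    then show "lam s * M $$ (s, t) * ?x t * ?x s = D $$ (s, t) * w s * w t / \<rho>"
      using lam [of s] lam [of t] by (simp add: Mi)
  qed
  moreover have "(\<Sum>s<m. lam s * (?x s)\<^sup>2) = (\<Sum>s<m. (w s)\<^sup>2 / lam s)"
  proof (intro sum.cong refl)
    fix s assume "s \<in> {..<m}"
    then show "lam s * (?x s)\<^sup>2 = (w s)\<^sup>2 / lam s"
      using lam [of s] by (simp add: power2_eq_square)
  qed
  ultimately show ?thesis using \<rho> by (simp add: abs_divide divide_le_eq mult.commute)
qed

lemma positive_semidefinite_quadratic_form:
  assumes "positive_semidefinite D" "D \<in> carrier_mat m m"
  shows "0 \<le> (\<Sum>s<m. \<Sum>t<m. D $$ (s, t) * w s * w t)"
proof -
  let ?w = "Matrix.vec m w"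
  have "0 \<le> scalar_prod ?w (D *\<^sub>v ?w)"
    using assms unfolding positive_semidefinite_def by auto
  also have "scalar_prod ?w (D *\<^sub>v ?w) = (\<Sum>s<m. \<Sum>t<m. D $$ (s, t) * w s * w t)"
    using assms(2) by (simp add: scalar_prod_def atLeast0LessThan sum_distrib_left mult_ac)
  finally show ?thesis .
qed

lemma high_temperature_constant:
  assumes D: "D \<in> carrier_mat m m" and sym: "transpose_mat D = D" and m: "0 < m"
    and lam: "\<And>s. s < m \<Longrightarrow> 0 < lam s" and \<beta>: "0 < \<beta>" and less: "ereal \<beta> < beta_0 D (mat_diag m lam)"
  shows "\<exists>\<rho>>0. 4 * alpha D * \<beta>\<^sup>2 * \<rho> < 1 \<and>
    (\<forall>w. \<bar>\<Sum>s<m. \<Sum>t<m. D $$ (s, t) * w s * w t\<bar> \<le> \<rho> * (\<Sum>s<m. (w s)\<^sup>2 / lam s))"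
proof -
  define r where "r = spectral_radius (map_mat complex_of_real (D * mat_diag m lam))"
  define c where "c = 4 * alpha D * \<beta>\<^sup>2"
  have al: "0 < alpha D" by (simp add: alpha_def)
  have c: "0 < c" using al \<beta> by (simp add: c_def)
  have C: "map_mat complex_of_real (D * mat_diag m lam) \<in> carrier_mat m m"
    using D mat_diag_dim [of m lam] by auto
  have r0: "0 \<le> r" using spectral_radius_mem_max(1) [OF C m] by (auto simp: r_def)
  have cr: "c * r < 1"
  proof (cases "r = 0")
    case False
    then have r: "0 < r" using r0 by simp
    have "beta_0 D (mat_diag m lam) = ereal (r powr (- 1 / 2) / sqrt (4 * alpha D))"
      using r al by (simp add: beta_0_def beta_c_def r_def [symmetric] Let_def)
    then have "\<beta> < r powr (- 1 / 2) / sqrt (4 * alpha D)" using less by simp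
    then have "\<beta>\<^sup>2 < (r powr (- 1 / 2) / sqrt (4 * alpha D))\<^sup>2"
      using \<beta> by (intro power_strict_mono) auto
    also have "(r powr (- 1 / 2) / sqrt (4 * alpha D))\<^sup>2 = 1 / (r * (4 * alpha D))"
    proof -
      have "(r powr (- 1 / 2))\<^sup>2 = r powr (- 1)"
        by (simp add: power2_eq_square powr_add [symmetric])
      then show ?thesis using r al by (simp add: power_divide powr_minus divide_simps)
    qed
    finally show ?thesis using r al by (simp add: c_def field_simps)
  qed simp
  \<comment> \<open>The midpoint leaves room on both sides: above the spectral radius, for bounded
    powers, and below \<open>1 / c\<close>, for a positive exponent after the interpolation.\<close>
  define \<rho> where "\<rho> = (r + 1 / c) / 2"
  have "r < 1 / c" using cr c by (simp add: field_simps)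
  then have \<rho>: "r < \<rho>" "\<rho> < 1 / c" by (auto simp: \<rho>_def)
  show ?thesis
  proof (intro exI conjI allI)
    show "0 < \<rho>" using \<rho> r0 by linarith
    then show "\<bar>\<Sum>s<m. \<Sum>t<m. D $$ (s, t) * w s * w t\<bar> \<le> \<rho> * (\<Sum>s<m. (w s)\<^sup>2 / lam s)" for w
      using \<rho>(1) unfolding r_def by (intro quadratic_form_le_spectral_radius D sym m lam)
    show "4 * alpha D * \<beta>\<^sup>2 * \<rho> < 1"
      using \<rho>(2) c unfolding c_def [symmetric] by (simp add: field_simps)
  qed
qed

section \<open>Removal of a site\<close>

locale cavity =
  fixes N i :: nat and V :: "nat set"
  assumes sites: "{1..N} = insert i V" and i: "i \<notin> V"
begin

text \<open>The disorder is indexed by increasing pairs, so the pair of \<open>i\<close> and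
  \<open>j\<close> has to be sorted; \<open>other\<close> recovers \<open>j\<close> from it.\<close>

definition row :: "(nat \<times> nat) set" where "row = (\<lambda>j. (min i j, max i j)) ` V"

definition other :: "nat \<times> nat \<Rightarrow> nat" where "other e = (if fst e = i then snd e else fst e)"

definition edge_set :: "(nat \<times> nat) set" where "edge_set = {(a, b)\<in>V \<times> V. a < b}"

definition configs :: "(nat \<Rightarrow> real) set" where "configs = V \<rightarrow>\<^sub>E {- 1, 1}"

definition local_field :: "real \<Rightarrow> (nat \<times> nat \<Rightarrow> real) \<Rightarrow> (nat \<Rightarrow> real) \<Rightarrow> real" where
  "local_field \<beta> y \<sigma> = (\<Sum>e\<in>row. y e * (\<beta> / sqrt N * \<sigma> (other e)))"

definition cavity_hamiltonian :: "real \<Rightarrow> real \<Rightarrow> (nat \<times> nat \<Rightarrow> real) \<Rightarrow> (nat \<Rightarrow> real) \<Rightarrow> real" where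
  "cavity_hamiltonian \<beta> h y \<sigma> = h * (\<Sum>j\<in>V. \<sigma> j) + \<beta> / sqrt N * (\<Sum>(a, b)\<in>edge_set. y (a, b) * \<sigma> a * \<sigma> b)"

definition cavity_weight :: "real \<Rightarrow> real \<Rightarrow> (nat \<times> nat \<Rightarrow> real) \<Rightarrow> (nat \<Rightarrow> real) \<Rightarrow> real" where
  "cavity_weight \<beta> h y = gibbs configs (cavity_hamiltonian \<beta> h y)"

lemma V_finite: "finite V" using sites by (metis finite_atLeastAtMost finite_insert)

lemma row_finite: "finite row" unfolding row_def using V_finite by simp

lemma row_inj: "inj_on (\<lambda>j. (min i j, max i j)) V"
  using i by (auto simp: inj_on_def min_def max_def split: if_splits)

lemma other_row: "j \<in> V \<Longrightarrow> other (min i j, max i j) = j"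
  using i by (auto simp: other_def min_def max_def)

lemma sum_row: "(\<Sum>e\<in>row. F e) = (\<Sum>j\<in>V. F (min i j, max i j))"
  unfolding row_def by (subst sum.reindex [OF row_inj]) simp

lemma edge_row_disjoint: "edge_set \<inter> row = {}"
  using i by (auto simp: edge_set_def row_def min_def max_def split: if_splits)

lemma edge_set_finite: "finite edge_set"
  unfolding edge_set_def by (rule finite_subset [OF _ finite_cartesian_product [OF V_finite V_finite]]) auto

lemma site_pairs_split: "site_pairs N = edge_set \<union> row"
proof -
  have mem: "1 \<le> a \<and> a \<le> N \<longleftrightarrow> a = i \<or> a \<in> V" for a
    using arg_cong [OF sites, of "\<lambda>A. a \<in> A"] by (simp only: atLeastAtMost_iff insert_iff)
  show ?thesis
  proof (intro subset_antisym subsetI)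
    fix e assume "e \<in> site_pairs N"
    then obtain a b where e: "e = (a, b)" "1 \<le> a" "a < b" "b \<le> N" by (auto simp: site_pairs_def)
    then have ab: "a = i \<or> a \<in> V" "b = i \<or> b \<in> V" using mem [of a] mem [of b] by auto
    show "e \<in> edge_set \<union> row"
    proof (cases "a = i \<or> b = i")
      case True
      then show ?thesis
      proof
        assume "a = i"
        then have "e = (min i b, max i b)" "b \<in> V" using e ab by auto
        then show ?thesis unfolding row_def by blast
      next
        assume "b = i"
        then have "e = (min i a, max i a)" "a \<in> V" using e ab by auto
        then show ?thesis unfolding row_def by blast
      qed
    next
      case False
      then show ?thesis using e ab by (auto simp: edge_set_def)
    qed
  next
    fix e assume "e \<in> edge_set \<union> row"
    then show "e \<in> site_pairs N"
    proof
      assume "e \<in> edge_set"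
      then show ?thesis using mem by (auto simp: edge_set_def site_pairs_def)
    next
      assume "e \<in> row"
      then obtain j where j: "j \<in> V" "e = (min i j, max i j)" by (auto simp: row_def)
      then have "j \<noteq> i" using i by auto
      then show ?thesis using mem [of j] mem [of i] j by (auto simp: site_pairs_def min_def max_def)
    qed
  qed
qed

lemma configs_finite: "finite configs" unfolding configs_def using V_finite by (intro finite_PiE) auto

lemma configs_nonempty: "configs \<noteq> {}" unfolding configs_def by (simp add: PiE_eq_empty_iff)

lemma sum_spin_configs:
  "(\<Sum>\<tau>\<in>spin_configs N. F \<tau>) = (\<Sum>\<sigma>\<in>configs. F (\<sigma>(i := 1)) + F (\<sigma>(i := - 1)))" for F :: "(nat \<Rightarrow> real) \<Rightarrow> real"
proof -
  let ?B = "\<lambda>_::nat. {- 1, 1 :: real}"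
  have "spin_configs N = (\<lambda>(y, g). g(i := y)) ` ({- 1, 1} \<times> configs)"
    unfolding spin_configs_def sites configs_def by (rule PiE_insert_eq)
  moreover have "inj_on (\<lambda>(y, g). g(i := y)) ({- 1, 1 :: real} \<times> configs)"
    unfolding configs_def using inj_combinator [OF i, of ?B] by simp
  ultimately have "(\<Sum>\<tau>\<in>spin_configs N. F \<tau>) = (\<Sum>(y, \<sigma>)\<in>{- 1, 1} \<times> configs. F (\<sigma>(i := y)))"
    by (simp add: sum.reindex split_def)
  also have "\<dots> = (\<Sum>y\<in>{- 1, 1}. \<Sum>\<sigma>\<in>configs. F (\<sigma>(i := y)))"
    by (rule sum.cartesian_product [symmetric])
  also have "\<dots> = (\<Sum>\<sigma>\<in>configs. F (\<sigma>(i := 1)) + F (\<sigma>(i := - 1)))"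
    by (simp add: sum.distrib add.commute)
  finally show ?thesis .
qed

text \<open>\<open>\<lambda>a b. y (min a b, max a b)\<close> is the symmetric extension of
  coordinates on increasing pairs. The edges not in the row of \<open>i\<close> form the Hamiltonian
  of the remaining sites.\<close>

lemma hamiltonian_split:
  "hamiltonian \<beta> h N (\<lambda>a b. y (min a b, max a b)) (\<sigma>(i := a)) = cavity_hamiltonian \<beta> h y \<sigma> + a * (local_field \<beta> y \<sigma> + h)"
proof -
  let ?s = "\<sigma>(i := a)"
  have 1: "(\<Sum>(c, b)\<in>site_pairs N. y (min c b, max c b) * ?s c * ?s b)
    = (\<Sum>(c, b)\<in>edge_set. y (min c b, max c b) * ?s c * ?s b) + (\<Sum>(c, b)\<in>row. y (min c b, max c b) * ?s c * ?s b)"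
    unfolding site_pairs_split by (rule sum.union_disjoint [OF edge_set_finite row_finite edge_row_disjoint])
  have 2: "(\<Sum>(c, b)\<in>edge_set. y (min c b, max c b) * ?s c * ?s b) = (\<Sum>(a, b)\<in>edge_set. y (a, b) * \<sigma> a * \<sigma> b)"
    using i by (intro sum.cong refl) (auto simp: edge_set_def min_def max_def)
  have 3: "\<beta> / sqrt N * (\<Sum>(c, b)\<in>row. y (min c b, max c b) * ?s c * ?s b) = a * local_field \<beta> y \<sigma>"
  proof -
    have "(\<Sum>(c, b)\<in>row. y (min c b, max c b) * ?s c * ?s b) = (\<Sum>j\<in>V. y (min i j, max i j) * (a * \<sigma> j))"
      unfolding sum_row using i by (intro sum.cong refl) (auto simp: min_def max_def)
    moreover have "local_field \<beta> y \<sigma> = (\<Sum>j\<in>V. y (min i j, max i j) * (\<beta> / sqrt N * \<sigma> j))"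
      unfolding local_field_def sum_row by (intro sum.cong refl) (simp add: other_row)
    ultimately show ?thesis by (simp add: sum_distrib_left mult_ac)
  qed
  have 4: "(\<Sum>j = 1..N. ?s j) = a + (\<Sum>j\<in>V. \<sigma> j)"
  proof -
    have "(\<Sum>j = 1..N. ?s j) = ?s i + (\<Sum>j\<in>V. ?s j)" unfolding sites using V_finite i by simp
    also have "(\<Sum>j\<in>V. ?s j) = (\<Sum>j\<in>V. \<sigma> j)" using i by (intro sum.cong refl) auto
    finally show ?thesis by simp
  qed
  show ?thesis
    unfolding hamiltonian_def 1 distrib_left 2 3 4 cavity_hamiltonian_def by (simp add: algebra_simps)
qed

text \<open>Summing over the spin at \<open>i\<close> first leaves the Gibbs measure of the other
  sites, tilted by the exponential of the local field with either sign.\<close>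

lemma gibbs_mean_split:
  fixes f :: "(nat \<Rightarrow> real) \<Rightarrow> real"
  shows "gibbs_mean \<beta> h N (\<lambda>a b. y (min a b, max a b)) f
    = (\<Sum>\<sigma>\<in>configs. cavity_weight \<beta> h y \<sigma> * (f (\<sigma>(i := 1)) * exp (local_field \<beta> y \<sigma> + h) + f (\<sigma>(i := - 1)) * exp (- (local_field \<beta> y \<sigma> + h))))
      / (\<Sum>\<sigma>\<in>configs. cavity_weight \<beta> h y \<sigma> * (exp (local_field \<beta> y \<sigma> + h) + exp (- (local_field \<beta> y \<sigma> + h))))"
proof -
  let ?H = "hamiltonian \<beta> h N (\<lambda>a b. y (min a b, max a b))" and ?K = "cavity_hamiltonian \<beta> h y" and ?l = "\<lambda>\<sigma>. local_field \<beta> y \<sigma> + h"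
  define Z where "Z = (\<Sum>\<sigma>\<in>configs. exp (?K \<sigma>))"
  have Z: "0 < Z" unfolding Z_def by (rule partition_function_pos [OF configs_finite configs_nonempty])
  have num: "(\<Sum>\<tau>\<in>spin_configs N. F \<tau> * exp (?H \<tau>)) = Z * (\<Sum>\<sigma>\<in>configs. cavity_weight \<beta> h y \<sigma> * (F (\<sigma>(i := 1)) * exp (?l \<sigma>) + F (\<sigma>(i := - 1)) * exp (- ?l \<sigma>)))" for F
  proof -
    have "exp (?K \<sigma>) = Z * cavity_weight \<beta> h y \<sigma>" for \<sigma>
      using Z by (simp add: cavity_weight_def gibbs_def Z_def)
    moreover have "exp (?H (\<sigma>(i := 1))) = exp (?K \<sigma>) * exp (?l \<sigma>)" "exp (?H (\<sigma>(i := - 1))) = exp (?K \<sigma>) * exp (- ?l \<sigma>)" for \<sigma>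
      by (simp_all only: hamiltonian_split exp_add mult_1_left mult_minus1)
    ultimately show ?thesis
      unfolding sum_spin_configs sum_distrib_left by (intro sum.cong refl) (simp add: algebra_simps)
  qed
  have "gibbs_mean \<beta> h N (\<lambda>a b. y (min a b, max a b)) f = (\<Sum>\<tau>\<in>spin_configs N. f \<tau> * exp (?H \<tau>)) / (\<Sum>\<tau>\<in>spin_configs N. 1 * exp (?H \<tau>))"
    by (simp add: gibbs_mean_def gibbs_weight_def sum_divide_distrib)
  also have "\<dots> = (Z * (\<Sum>\<sigma>\<in>configs. cavity_weight \<beta> h y \<sigma> * (f (\<sigma>(i := 1)) * exp (?l \<sigma>) + f (\<sigma>(i := - 1)) * exp (- ?l \<sigma>))))
      / (Z * (\<Sum>\<sigma>\<in>configs. cavity_weight \<beta> h y \<sigma> * (1 * exp (?l \<sigma>) + 1 * exp (- ?l \<sigma>))))"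
    unfolding num num [of "\<lambda>_. 1"] ..
  finally show ?thesis using Z by simp
qed

lemma magnetization_cavity:
  "magnetization \<beta> h N (\<lambda>a b. y (min a b, max a b)) i
    = (\<Sum>\<sigma>\<in>configs. cavity_weight \<beta> h y \<sigma> * (exp (local_field \<beta> y \<sigma> + h) - exp (- (local_field \<beta> y \<sigma> + h))))
      / (\<Sum>\<sigma>\<in>configs. cavity_weight \<beta> h y \<sigma> * (exp (local_field \<beta> y \<sigma> + h) + exp (- (local_field \<beta> y \<sigma> + h))))"
  unfolding magnetization_def gibbs_mean_split by simp

text \<open>For \<open>j\<close> other than \<open>i\<close> the observable ignores the spin at
  \<open>i\<close>, so by linearity the sum over the row is the tilted mean of the local field, the
  quantity \<open>L\<close> of \<open>cavity_estimate\<close>.\<close>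

lemma local_field_magnetization:
  "\<beta> / sqrt N * (\<Sum>j\<in>V. y (min i j, max i j) * magnetization \<beta> h N (\<lambda>a b. y (min a b, max a b)) j)
    = (\<Sum>\<sigma>\<in>configs. cavity_weight \<beta> h y \<sigma> * (local_field \<beta> y \<sigma> * (exp (local_field \<beta> y \<sigma> + h) + exp (- (local_field \<beta> y \<sigma> + h)))))
      / (\<Sum>\<sigma>\<in>configs. cavity_weight \<beta> h y \<sigma> * (exp (local_field \<beta> y \<sigma> + h) + exp (- (local_field \<beta> y \<sigma> + h))))"
proof -
  let ?e = "\<lambda>\<sigma>. cavity_weight \<beta> h y \<sigma> * (exp (local_field \<beta> y \<sigma> + h) + exp (- (local_field \<beta> y \<sigma> + h)))"
  let ?Z = "\<Sum>\<sigma>\<in>configs. ?e \<sigma>"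
  have m: "magnetization \<beta> h N (\<lambda>a b. y (min a b, max a b)) j = (\<Sum>\<sigma>\<in>configs. \<sigma> j * ?e \<sigma>) / ?Z" if "j \<in> V" for j
  proof -
    have "j \<noteq> i" using that i by auto
    then show ?thesis unfolding magnetization_def gibbs_mean_split by (simp add: distrib_left mult_ac)
  qed
  have "\<beta> / sqrt N * (\<Sum>j\<in>V. y (min i j, max i j) * magnetization \<beta> h N (\<lambda>a b. y (min a b, max a b)) j)
      = (\<Sum>j\<in>V. \<Sum>\<sigma>\<in>configs. y (min i j, max i j) * (\<beta> / sqrt N * \<sigma> j) * ?e \<sigma>) / ?Z"
    unfolding sum_distrib_left sum_divide_distrib
    by (intro sum.cong refl) (simp add: m sum_distrib_left sum_distrib_right sum_divide_distrib mult_ac)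
  also have "(\<Sum>j\<in>V. \<Sum>\<sigma>\<in>configs. y (min i j, max i j) * (\<beta> / sqrt N * \<sigma> j) * ?e \<sigma>)
      = (\<Sum>\<sigma>\<in>configs. (\<Sum>j\<in>V. y (min i j, max i j) * (\<beta> / sqrt N * \<sigma> j)) * ?e \<sigma>)"
    unfolding sum_distrib_right by (rule sum.swap)
  also have "\<dots> = (\<Sum>\<sigma>\<in>configs. local_field \<beta> y \<sigma> * ?e \<sigma>)"
  proof (intro sum.cong refl)
    fix \<sigma>
    have "local_field \<beta> y \<sigma> = (\<Sum>j\<in>V. y (min i j, max i j) * (\<beta> / sqrt N * \<sigma> j))"
      unfolding local_field_def sum_row by (intro sum.cong refl) (simp add: other_row)
    then show "(\<Sum>j\<in>V. y (min i j, max i j) * (\<beta> / sqrt N * \<sigma> j)) * ?e \<sigma> = local_field \<beta> y \<sigma> * ?e \<sigma>" by simp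
  qed
  finally show ?thesis by (simp only: mult.left_commute)
qed

end

text \<open>Jensen for a finite average. As \<open>a\<close> may change sign, the tangent is taken
  at the mean of \<open>\<bar>a\<bar>\<close>, and evenness removes the absolute values.\<close>

lemma power_average_le:
  fixes p a :: "'s \<Rightarrow> real"
  assumes p: "\<And>\<sigma>. \<sigma> \<in> S \<Longrightarrow> 0 \<le> p \<sigma>" and p1: "sum p S = 1" and n: "even n"
  shows "(\<Sum>\<sigma>\<in>S. p \<sigma> * a \<sigma>) ^ n \<le> (\<Sum>\<sigma>\<in>S. p \<sigma> * a \<sigma> ^ n)"
proof -
  define b where "b = (\<Sum>\<sigma>\<in>S. p \<sigma> * \<bar>a \<sigma>\<bar>)"
  have b: "0 \<le> b" unfolding b_def by (intro sum_nonneg mult_nonneg_nonneg p) auto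
  have "\<bar>\<Sum>\<sigma>\<in>S. p \<sigma> * a \<sigma>\<bar> \<le> b"
    unfolding b_def by (rule order_trans [OF sum_abs]) (simp add: abs_mult p)
  then have "\<bar>\<Sum>\<sigma>\<in>S. p \<sigma> * a \<sigma>\<bar> ^ n \<le> b ^ n" by (rule power_mono) simp
  also have "b ^ n = (\<Sum>\<sigma>\<in>S. p \<sigma> * (b ^ n + real n * b ^ (n - 1) * (\<bar>a \<sigma>\<bar> - b)))"
  proof -
    have "(\<Sum>\<sigma>\<in>S. p \<sigma> * (b ^ n + real n * b ^ (n - 1) * (\<bar>a \<sigma>\<bar> - b)))
        = (\<Sum>\<sigma>\<in>S. p \<sigma> * (b ^ n - real n * b ^ (n - 1) * b) + real n * b ^ (n - 1) * (p \<sigma> * \<bar>a \<sigma>\<bar>))"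
      by (intro sum.cong refl) (simp add: algebra_simps)
    also have "\<dots> = b ^ n - real n * b ^ (n - 1) * b + real n * b ^ (n - 1) * b"
      unfolding sum.distrib sum_distrib_left [symmetric] sum_distrib_right [symmetric] p1 b_def [symmetric] by simp
    finally show ?thesis by simp
  qed
  also have "\<dots> \<le> (\<Sum>\<sigma>\<in>S. p \<sigma> * \<bar>a \<sigma>\<bar> ^ n)"
    by (intro sum_mono mult_left_mono power_tangent_le b p) auto
  finally show ?thesis using n by (simp add: power_even_abs)
qed

text \<open>Jensen with four weights \<open>1 / 4\<close>, the values being multiplied by 4.\<close>

lemma even_power_sum4_le:
  fixes a b c d :: real
  assumes n: "even n"
  shows "(a + b + c + d) ^ n \<le> 4 ^ n * (a ^ n + b ^ n + c ^ n + d ^ n)"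
proof -
  let ?p = "\<lambda>_::nat. 1 / 4 :: real" and ?f = "\<lambda>i::nat. if i = 0 then 4 * a else if i = 1 then 4 * b else if i = 2 then 4 * c else 4 * d"
  have s: "(\<Sum>i<4. g i) = g 0 + g 1 + g 2 + g 3" for g :: "nat \<Rightarrow> real"
    by (simp add: eval_nat_numeral)
  have "(\<Sum>i<4. ?p i * ?f i) ^ n \<le> (\<Sum>i<4. ?p i * ?f i ^ n)"
    by (rule power_average_le [OF _ _ n]) auto
  also have "\<dots> = 4 ^ n * ((a ^ n + b ^ n + c ^ n + d ^ n) / 4)"
    unfolding s by (simp add: power_mult_distrib algebra_simps)
  also have "\<dots> \<le> 4 ^ n * (a ^ n + b ^ n + c ^ n + d ^ n)"
    using n by (intro mult_left_mono) (auto intro!: add_nonneg_nonneg)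
  finally show ?thesis unfolding s by simp
qed

section \<open>Moments of the covariances of the cavity field\<close>

context msk_sites
begin

text \<open>The coefficient of the Onsager reaction term, and the value around which
  \<open>covariance s \<sigma> \<sigma>\<close> concentrates.\<close>

definition onsager :: "nat \<Rightarrow> real" where "onsager s = \<beta>\<^sup>2 * (\<Sum>t<m. d s t * (lam t * (1 - q t)))"

context
  fixes p :: "(nat \<Rightarrow> real) \<Rightarrow> real"
  assumes p: "\<And>\<sigma>. \<sigma> \<in> spins \<Longrightarrow> 0 \<le> p \<sigma>" and p1: "sum p spins = 1"
begin

definition site_mean :: "nat \<Rightarrow> real" where "site_mean j = (\<Sum>\<sigma>\<in>spins. p \<sigma> * \<sigma> j)"

definition W_mean :: "nat \<Rightarrow> (nat \<Rightarrow> real) \<Rightarrow> real" where "W_mean t \<sigma> = (\<Sum>\<rho>\<in>spins. p \<rho> * W t \<sigma> \<rho>)"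

definition W_moment :: "nat \<Rightarrow> nat \<Rightarrow> real" where
  "W_moment n t = (\<Sum>\<sigma>\<in>spins. \<Sum>\<tau>\<in>spins. p \<sigma> * p \<tau> * W t \<sigma> \<tau> ^ n)"

definition covariance :: "nat \<Rightarrow> (nat \<Rightarrow> real) \<Rightarrow> (nat \<Rightarrow> real) \<Rightarrow> real" where
  "covariance s \<sigma> \<tau> = \<beta>\<^sup>2 / N * (\<Sum>j\<in>V. d s (sp j) * ((\<sigma> j - site_mean j) * (\<tau> j - site_mean j)))"

abbreviation V_of :: "nat \<Rightarrow> nat set" where "V_of t \<equiv> {j. j \<in> V \<and> sp j = t}"

lemma W_mean_eq: "W_mean t \<sigma> = (\<Sum>j\<in>V_of t. \<sigma> j * site_mean j) - N * lam t * q t"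
proof -
  have "W_mean t \<sigma> = (\<Sum>\<rho>\<in>spins. p \<rho> * overlap t \<sigma> \<rho>) - N * lam t * q t"
    unfolding W_mean_def W_def by (simp add: right_diff_distrib sum_subtractf p1 flip: sum_distrib_right)
  also have "(\<Sum>\<rho>\<in>spins. p \<rho> * overlap t \<sigma> \<rho>) = (\<Sum>j\<in>V_of t. \<sigma> j * site_mean j)"
    unfolding overlap_def site_mean_def sum_distrib_left by (subst sum.swap) (simp add: mult_ac)
  finally show ?thesis .
qed

lemma W_mean2_eq: "(\<Sum>\<sigma>\<in>spins. p \<sigma> * W_mean t \<sigma>) = (\<Sum>j\<in>V_of t. site_mean j * site_mean j) - N * lam t * q t"
proof -
  have "(\<Sum>\<sigma>\<in>spins. p \<sigma> * W_mean t \<sigma>) = (\<Sum>\<sigma>\<in>spins. p \<sigma> * (\<Sum>j\<in>V_of t. \<sigma> j * site_mean j)) - N * lam t * q t"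
    unfolding W_mean_eq by (simp add: right_diff_distrib sum_subtractf p1 flip: sum_distrib_right)
  also have "(\<Sum>\<sigma>\<in>spins. p \<sigma> * (\<Sum>j\<in>V_of t. \<sigma> j * site_mean j)) = (\<Sum>j\<in>V_of t. (\<Sum>\<sigma>\<in>spins. p \<sigma> * \<sigma> j) * site_mean j)"
    unfolding sum_distrib_left sum_distrib_right by (subst sum.swap) (simp add: mult_ac)
  finally show ?thesis by (simp only: site_mean_def)
qed

text \<open>A site mean is an average over a further replica, so the centred overlap is a double
  difference of overlaps. The centring \<open>N * lam t * q t\<close> cancels in it, which lets the
  deviations \<open>W\<close> take their place.\<close>

lemma centered_overlap:
  "(\<Sum>j\<in>V_of t. (\<sigma> j - site_mean j) * (\<tau> j - site_mean j))
    = W t \<sigma> \<tau> - W_mean t \<sigma> - W_mean t \<tau> + (\<Sum>\<rho>\<in>spins. p \<rho> * W_mean t \<rho>)"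
proof -
  have "(\<Sum>j\<in>V_of t. (\<sigma> j - site_mean j) * (\<tau> j - site_mean j))
     = (\<Sum>j\<in>V_of t. \<sigma> j * \<tau> j - \<sigma> j * site_mean j - \<tau> j * site_mean j + site_mean j * site_mean j)"
    by (intro sum.cong refl) (simp add: algebra_simps)
  then show ?thesis
    unfolding W_mean2_eq unfolding W_mean_eq W_def overlap_def by (simp add: sum.distrib sum_subtractf)
qed

text \<open>Since spins square to 1, the overlap of \<open>\<sigma>\<close> with itself is the
  number of sites of the species, within one of \<open>lam t * N\<close>; the remaining terms are
  averages of deviations.\<close>

lemma centered_self_overlap:
  assumes "\<sigma> \<in> spins"
  shows "(\<Sum>j\<in>V_of t. (\<sigma> j - site_mean j) * (\<sigma> j - site_mean j)) - N * (lam t * (1 - q t))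
    = (card (V_of t) - lam t * N) + (- W_mean t \<sigma>) + (- W_mean t \<sigma>) + (\<Sum>\<rho>\<in>spins. p \<rho> * W_mean t \<rho>)"
proof -
  have "(\<Sum>j\<in>V_of t. (\<sigma> j - site_mean j) * (\<sigma> j - site_mean j))
     = (\<Sum>j\<in>V_of t. 1 - \<sigma> j * site_mean j - \<sigma> j * site_mean j + site_mean j * site_mean j)"
  proof (intro sum.cong refl)
    fix j assume "j \<in> V_of t"
    then have "\<sigma> j * \<sigma> j = 1" using spin_square [OF assms] by simp
    then show "(\<sigma> j - site_mean j) * (\<sigma> j - site_mean j) = 1 - \<sigma> j * site_mean j - \<sigma> j * site_mean j + site_mean j * site_mean j"
      by (simp add: algebra_simps)
  qed
  then show ?thesis
    unfolding W_mean2_eq unfolding W_mean_eq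
    by (simp only: sum.distrib sum_subtractf sum_constant) (simp add: right_diff_distrib)
qed

lemma covariance_eq:
  "covariance s \<sigma> \<tau> = (\<Sum>t<m. \<beta>\<^sup>2 / N * d s t * (\<Sum>j\<in>V_of t. (\<sigma> j - site_mean j) * (\<tau> j - site_mean j)))"
  unfolding covariance_def by (subst sum_by_species [where g = "d s"]) (simp add: sum_distrib_left mult_ac)

lemma covariance_diff_eq:
  "covariance s \<sigma> \<sigma> - onsager s = (\<Sum>t<m. \<beta>\<^sup>2 / N * d s t *
     ((\<Sum>j\<in>V_of t. (\<sigma> j - site_mean j) * (\<sigma> j - site_mean j)) - N * (lam t * (1 - q t))))"
proof -
  have "onsager s = (\<Sum>t<m. \<beta>\<^sup>2 / N * d s t * (N * (lam t * (1 - q t))))"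
    unfolding onsager_def sum_distrib_left using N by (intro sum.cong refl) simp
  then show ?thesis
    unfolding covariance_eq by (simp only: right_diff_distrib sum_subtractf)
qed

context
  fixes n :: nat
  assumes n: "even n" "0 < n"
begin

lemma W_moment_nonneg: "0 \<le> W_moment n t"
  unfolding W_moment_def using n(1) by (intro sum_nonneg mult_nonneg_nonneg p) auto

lemma W_mean_moment: "(\<Sum>\<sigma>\<in>spins. p \<sigma> * W_mean t \<sigma> ^ n) \<le> W_moment n t"
proof -
  have "(\<Sum>\<sigma>\<in>spins. p \<sigma> * W_mean t \<sigma> ^ n) \<le> (\<Sum>\<sigma>\<in>spins. p \<sigma> * (\<Sum>\<tau>\<in>spins. p \<tau> * W t \<sigma> \<tau> ^ n))"
    unfolding W_mean_def by (intro sum_mono mult_left_mono power_average_le p p1 n)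
  then show ?thesis by (simp only: W_moment_def sum_distrib_left mult.assoc)
qed

lemma W_mean2_moment: "(\<Sum>\<sigma>\<in>spins. p \<sigma> * W_mean t \<sigma>) ^ n \<le> W_moment n t"
  by (rule order_trans [OF power_average_le W_mean_moment]) (auto intro: p p1 n)

text \<open>Each of the four terms of the double difference has an \<open>n\<close>-th moment of at
  most \<open>W_moment n t\<close>, by Jensen. The summand 1 gives the bound the same form as for
  the self-overlap, where it covers the error in the species count.\<close>

lemma centered_overlap_moment:
  "(\<Sum>\<sigma>\<in>spins. \<Sum>\<tau>\<in>spins. p \<sigma> * p \<tau> * (\<Sum>j\<in>V_of t. (\<sigma> j - site_mean j) * (\<tau> j - site_mean j)) ^ n)
    \<le> 4 ^ n * (4 * (1 + W_moment n t))"
proof -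
  let ?A = "\<Sum>\<rho>\<in>spins. p \<rho> * W_mean t \<rho>"
  have "(\<Sum>\<sigma>\<in>spins. \<Sum>\<tau>\<in>spins. p \<sigma> * p \<tau> * (\<Sum>j\<in>V_of t. (\<sigma> j - site_mean j) * (\<tau> j - site_mean j)) ^ n)
     \<le> (\<Sum>\<sigma>\<in>spins. \<Sum>\<tau>\<in>spins. p \<sigma> * p \<tau> * (4 ^ n * (W t \<sigma> \<tau> ^ n + W_mean t \<sigma> ^ n + W_mean t \<tau> ^ n + ?A ^ n)))"
  proof (intro sum_mono mult_left_mono mult_nonneg_nonneg p)
    fix \<sigma> \<tau>
    have "W t \<sigma> \<tau> - W_mean t \<sigma> - W_mean t \<tau> + ?A = W t \<sigma> \<tau> + (- W_mean t \<sigma>) + (- W_mean t \<tau>) + ?A" by simp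
    then show "(\<Sum>j\<in>V_of t. (\<sigma> j - site_mean j) * (\<tau> j - site_mean j)) ^ n
        \<le> 4 ^ n * (W t \<sigma> \<tau> ^ n + W_mean t \<sigma> ^ n + W_mean t \<tau> ^ n + ?A ^ n)"
      unfolding centered_overlap using even_power_sum4_le [OF n(1), of "W t \<sigma> \<tau>" "- W_mean t \<sigma>" "- W_mean t \<tau>" ?A] n(1) by simp
  qed
  also have "\<dots> = 4 ^ n * (W_moment n t + (\<Sum>\<sigma>\<in>spins. p \<sigma> * W_mean t \<sigma> ^ n) + (\<Sum>\<tau>\<in>spins. p \<tau> * W_mean t \<tau> ^ n) + ?A ^ n)"
  proof -
    have "(\<Sum>\<sigma>\<in>spins. \<Sum>\<tau>\<in>spins. p \<sigma> * p \<tau> * (4 ^ n * (W t \<sigma> \<tau> ^ n + W_mean t \<sigma> ^ n + W_mean t \<tau> ^ n + ?A ^ n)))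
      = 4 ^ n * (\<Sum>\<sigma>\<in>spins. \<Sum>\<tau>\<in>spins. p \<sigma> * p \<tau> * W t \<sigma> \<tau> ^ n + (p \<sigma> * W_mean t \<sigma> ^ n) * p \<tau> + p \<sigma> * (p \<tau> * W_mean t \<tau> ^ n) + (p \<sigma> * ?A ^ n) * p \<tau>)"
      unfolding sum_distrib_left by (intro sum.cong refl) (simp add: algebra_simps)
    also have "(\<Sum>\<sigma>\<in>spins. \<Sum>\<tau>\<in>spins. p \<sigma> * p \<tau> * W t \<sigma> \<tau> ^ n + (p \<sigma> * W_mean t \<sigma> ^ n) * p \<tau> + p \<sigma> * (p \<tau> * W_mean t \<tau> ^ n) + (p \<sigma> * ?A ^ n) * p \<tau>)
      = W_moment n t + (\<Sum>\<sigma>\<in>spins. p \<sigma> * W_mean t \<sigma> ^ n) + (\<Sum>\<tau>\<in>spins. p \<tau> * W_mean t \<tau> ^ n) + ?A ^ n"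
      unfolding sum.distrib sum_distrib_left [symmetric] sum_distrib_right [symmetric] p1 W_moment_def [symmetric] by simp
    finally show ?thesis .
  qed
  also have "\<dots> \<le> 4 ^ n * (4 * (1 + W_moment n t))"
    using W_mean_moment [of t] W_mean2_moment [of t] by (intro mult_left_mono) auto
  finally show ?thesis .
qed

lemma centered_self_overlap_moment:
  assumes t: "t < m"
  shows "(\<Sum>\<sigma>\<in>spins. p \<sigma> * ((\<Sum>j\<in>V_of t. (\<sigma> j - site_mean j) * (\<sigma> j - site_mean j)) - N * (lam t * (1 - q t))) ^ n)
    \<le> 4 ^ n * (4 * (1 + W_moment n t))"
proof -
  let ?A = "\<Sum>\<rho>\<in>spins. p \<rho> * W_mean t \<rho>" and ?e = "card (V_of t) - lam t * N"
  have "\<bar>?e\<bar> \<le> 1" using card_le [OF t] card_ge [OF t] by (simp add: abs_le_iff)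
  then have "\<bar>?e\<bar> ^ n \<le> 1" by (intro power_le_one) auto
  then have e: "?e ^ n \<le> 1" using n(1) by (simp add: power_even_abs)
  have "(\<Sum>\<sigma>\<in>spins. p \<sigma> * ((\<Sum>j\<in>V_of t. (\<sigma> j - site_mean j) * (\<sigma> j - site_mean j)) - N * (lam t * (1 - q t))) ^ n)
     \<le> (\<Sum>\<sigma>\<in>spins. p \<sigma> * (4 ^ n * (1 + 2 * W_mean t \<sigma> ^ n + ?A ^ n)))"
  proof (intro sum_mono mult_left_mono p)
    fix \<sigma> assume s: "\<sigma> \<in> spins"
    have "4 ^ n * (?e ^ n + (- W_mean t \<sigma>) ^ n + (- W_mean t \<sigma>) ^ n + ?A ^ n) \<le> 4 ^ n * (1 + 2 * W_mean t \<sigma> ^ n + ?A ^ n)"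
      using e n(1) by (intro mult_left_mono) auto
    then show "((\<Sum>j\<in>V_of t. (\<sigma> j - site_mean j) * (\<sigma> j - site_mean j)) - N * (lam t * (1 - q t))) ^ n
       \<le> 4 ^ n * (1 + 2 * W_mean t \<sigma> ^ n + ?A ^ n)"
      unfolding centered_self_overlap [OF s] by (rule order_trans [OF even_power_sum4_le [OF n(1)]])
  qed
  also have "\<dots> = (\<Sum>\<sigma>\<in>spins. p \<sigma> * (4 ^ n * (1 + ?A ^ n)) + 4 ^ n * 2 * (p \<sigma> * W_mean t \<sigma> ^ n))"
    by (intro sum.cong refl) (simp add: algebra_simps)
  also have "\<dots> = 4 ^ n * (1 + ?A ^ n) + 4 ^ n * 2 * (\<Sum>\<sigma>\<in>spins. p \<sigma> * W_mean t \<sigma> ^ n)"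
    unfolding sum.distrib sum_distrib_left [symmetric] sum_distrib_right [symmetric] p1 by simp
  also have "\<dots> = 4 ^ n * (1 + ?A ^ n + 2 * (\<Sum>\<sigma>\<in>spins. p \<sigma> * W_mean t \<sigma> ^ n))"
    by (simp add: algebra_simps)
  also have "\<dots> \<le> 4 ^ n * (4 * (1 + W_moment n t))"
    using W_mean_moment [of t] W_mean2_moment [of t] W_moment_nonneg [of t] by (intro mult_left_mono) auto
  finally show ?thesis .
qed

lemma weighted_sum_power_le:
  assumes s: "s < m" and D: "\<And>t. t < m \<Longrightarrow> d s t \<le> D"
  shows "(\<Sum>t<m. \<beta>\<^sup>2 / N * d s t * z t) ^ n \<le> (m * (\<beta>\<^sup>2 * D / N)) ^ n * (\<Sum>t<m. z t ^ n)"
proof -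
  have "(\<Sum>t<m. \<beta>\<^sup>2 / N * d s t * z t) ^ n = \<bar>\<Sum>t<m. \<beta>\<^sup>2 / N * d s t * z t\<bar> ^ n"
    using n(1) by (simp add: power_even_abs)
  also have "\<dots> \<le> (\<Sum>t<m. \<beta>\<^sup>2 * D / N * \<bar>z t\<bar>) ^ n"
  proof (intro power_mono order_trans [OF sum_abs] sum_mono)
    fix t assume "t \<in> {..<m}"
    then have t: "t < m" by simp
    have "\<beta>\<^sup>2 / N * d s t * \<bar>z t\<bar> \<le> \<beta>\<^sup>2 / N * D * \<bar>z t\<bar>"
      by (intro mult_left_mono mult_right_mono D t) auto
    then show "\<bar>\<beta>\<^sup>2 / N * d s t * z t\<bar> \<le> \<beta>\<^sup>2 * D / N * \<bar>z t\<bar>"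
      using d_nonneg [OF s t] by (simp add: abs_mult)
  qed simp
  also have "\<dots> = (\<beta>\<^sup>2 * D / N) ^ n * (\<Sum>t<m. \<bar>z t\<bar>) ^ n"
    by (simp only: sum_distrib_left [symmetric] power_mult_distrib)
  also have "\<dots> \<le> (\<beta>\<^sup>2 * D / N) ^ n * (real (card {..<m}) ^ n * (\<Sum>t<m. \<bar>z t\<bar> ^ n))"
    using n by (intro mult_left_mono sum_power_le) auto
  also have "\<dots> = (m * (\<beta>\<^sup>2 * D / N)) ^ n * (\<Sum>t<m. z t ^ n)"
    using n(1) by (simp only: power_mult_distrib power_even_abs card_lessThan mult_ac)
  finally show ?thesis .
qed

text \<open>The prefactor carries \<open>N\<close> to the power \<open>- n\<close>, whereas the
  expectation of \<open>W_moment n\<close> will be of order \<open>N\<close> to the power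
  \<open>n / 2\<close>; the difference is the rate of the theorem.\<close>

lemma covariance_moment:
  assumes s: "s < m" and D: "\<And>t. t < m \<Longrightarrow> d s t \<le> D"
  shows "(\<Sum>\<sigma>\<in>spins. \<Sum>\<tau>\<in>spins. p \<sigma> * p \<tau> * covariance s \<sigma> \<tau> ^ n) + (\<Sum>\<sigma>\<in>spins. p \<sigma> * (covariance s \<sigma> \<sigma> - onsager s) ^ n)
    \<le> (m * (\<beta>\<^sup>2 * D / N)) ^ n * (8 * 4 ^ n) * (\<Sum>t<m. 1 + W_moment n t)"
proof -
  let ?c = "(m * (\<beta>\<^sup>2 * D / N)) ^ n"
  let ?z = "\<lambda>t \<sigma> \<tau>. \<Sum>j\<in>V_of t. (\<sigma> j - site_mean j) * (\<tau> j - site_mean j)"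
  let ?z' = "\<lambda>t \<sigma>. ?z t \<sigma> \<sigma> - N * (lam t * (1 - q t))"
  have c: "0 \<le> ?c" by (rule zero_le_even_power [OF n(1)])
  have "(\<Sum>\<sigma>\<in>spins. \<Sum>\<tau>\<in>spins. p \<sigma> * p \<tau> * covariance s \<sigma> \<tau> ^ n)
     \<le> (\<Sum>\<sigma>\<in>spins. \<Sum>\<tau>\<in>spins. p \<sigma> * p \<tau> * (?c * (\<Sum>t<m. ?z t \<sigma> \<tau> ^ n)))"
    unfolding covariance_eq by (intro sum_mono mult_left_mono mult_nonneg_nonneg p weighted_sum_power_le s D)
  also have "\<dots> = ?c * (\<Sum>t<m. \<Sum>\<sigma>\<in>spins. \<Sum>\<tau>\<in>spins. p \<sigma> * p \<tau> * ?z t \<sigma> \<tau> ^ n)"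
  proof -
    have sw: "(\<Sum>t<m. \<Sum>\<sigma>\<in>spins. \<Sum>\<tau>\<in>spins. f t \<sigma> \<tau>) = (\<Sum>\<sigma>\<in>spins. \<Sum>\<tau>\<in>spins. \<Sum>t<m. f t \<sigma> \<tau>)" for f :: "nat \<Rightarrow> _ \<Rightarrow> _ \<Rightarrow> real"
      by (subst sum.swap) (rule sum.cong [OF refl], rule sum.swap)
    show ?thesis
      unfolding sw sum_distrib_left
      by (rule sum.cong [OF refl], rule sum.cong [OF refl], rule sum.cong [OF refl]) (simp only: mult_ac)
  qed
  also have "\<dots> \<le> ?c * (\<Sum>t<m. 4 ^ n * (4 * (1 + W_moment n t)))"
    by (intro mult_left_mono sum_mono centered_overlap_moment c)
  finally have 1: "(\<Sum>\<sigma>\<in>spins. \<Sum>\<tau>\<in>spins. p \<sigma> * p \<tau> * covariance s \<sigma> \<tau> ^ n) \<le> ?c * (\<Sum>t<m. 4 ^ n * (4 * (1 + W_moment n t)))" .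
  have "(\<Sum>\<sigma>\<in>spins. p \<sigma> * (covariance s \<sigma> \<sigma> - onsager s) ^ n) \<le> (\<Sum>\<sigma>\<in>spins. p \<sigma> * (?c * (\<Sum>t<m. ?z' t \<sigma> ^ n)))"
    unfolding covariance_diff_eq by (intro sum_mono mult_left_mono p weighted_sum_power_le s D)
  also have "\<dots> = ?c * (\<Sum>t<m. \<Sum>\<sigma>\<in>spins. p \<sigma> * ?z' t \<sigma> ^ n)"
    unfolding sum_distrib_left
    by (subst sum.swap, rule sum.cong [OF refl], rule sum.cong [OF refl]) (simp only: mult_ac)
  also have "\<dots> \<le> ?c * (\<Sum>t<m. 4 ^ n * (4 * (1 + W_moment n t)))"
    by (intro mult_left_mono sum_mono centered_self_overlap_moment c) auto
  finally have 2: "(\<Sum>\<sigma>\<in>spins. p \<sigma> * (covariance s \<sigma> \<sigma> - onsager s) ^ n) \<le> ?c * (\<Sum>t<m. 4 ^ n * (4 * (1 + W_moment n t)))" .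
  have "?c * (\<Sum>t<m. 4 ^ n * (4 * (1 + W_moment n t))) + ?c * (\<Sum>t<m. 4 ^ n * (4 * (1 + W_moment n t)))
     = ?c * (8 * 4 ^ n) * (\<Sum>t<m. 1 + W_moment n t)"
  proof -
    have "(\<Sum>t<m. 4 ^ n * (4 * (1 + W_moment n t))) = 4 ^ n * (4 * (\<Sum>t<m. 1 + W_moment n t))"
      by (simp only: sum_distrib_left)
    then show ?thesis by simp
  qed
  then show ?thesis using 1 2 by linarith
qed

end

lemma site_mean_abs: "j \<in> V \<Longrightarrow> \<bar>site_mean j\<bar> \<le> 1"
proof -
  assume j: "j \<in> V"
  have "\<bar>site_mean j\<bar> \<le> (\<Sum>\<sigma>\<in>spins. p \<sigma> * 1)"
    unfolding site_mean_def
  proof (intro order_trans [OF sum_abs] sum_mono)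
    fix \<sigma> assume "\<sigma> \<in> spins"
    then show "\<bar>p \<sigma> * \<sigma> j\<bar> \<le> p \<sigma> * 1" using p spin_abs [OF _ j] by (simp add: abs_mult)
  qed
  then show ?thesis by (simp add: p1)
qed

lemma centered_spin_abs: "\<sigma> \<in> spins \<Longrightarrow> j \<in> V \<Longrightarrow> \<bar>\<sigma> j - site_mean j\<bar> \<le> 2"
  using site_mean_abs [of j] spin_abs [of \<sigma> j] by linarith

text \<open>A deterministic bound free of \<open>N\<close>, for the exponential factor in
  \<open>row_const\<close>.\<close>

lemma covariance_abs:
  assumes s: "s < m" and D: "\<And>t. t < m \<Longrightarrow> d s t \<le> D" and cardV: "card V \<le> N"
    and st: "\<sigma> \<in> spins" "\<tau> \<in> spins"
  shows "\<bar>covariance s \<sigma> \<tau>\<bar> \<le> 4 * \<beta>\<^sup>2 * D"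
proof -
  have D0: "0 \<le> D" using d_nonneg [OF s s] D [OF s] by linarith
  have "\<bar>\<Sum>j\<in>V. d s (sp j) * ((\<sigma> j - site_mean j) * (\<tau> j - site_mean j))\<bar> \<le> (\<Sum>j\<in>V. D * (2 * 2))"
  proof (intro order_trans [OF sum_abs] sum_mono)
    fix j assume j: "j \<in> V"
    show "\<bar>d s (sp j) * ((\<sigma> j - site_mean j) * (\<tau> j - site_mean j))\<bar> \<le> D * (2 * 2)"
      unfolding abs_mult using d_nonneg [OF s sp [OF j]] D [OF sp [OF j]]
      by (intro mult_mono centered_spin_abs st j) auto
  qed
  also have "\<dots> \<le> N * (4 * D)" using cardV D0 by (simp add: mult_left_mono)
  finally have "\<beta>\<^sup>2 / N * \<bar>\<Sum>j\<in>V. d s (sp j) * ((\<sigma> j - site_mean j) * (\<tau> j - site_mean j))\<bar> \<le> \<beta>\<^sup>2 / N * (N * (4 * D))"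
    by (intro mult_left_mono) auto
  then show ?thesis using N by (simp add: covariance_def abs_mult mult_ac)
qed

end

end

section \<open>The Thouless-Anderson-Palmer equations\<close>

lemma species_of_site:
  assumes "disjoint_family_on I {..<m}" "t < m" "j \<in> I t"
  shows "(THE t. t < m \<and> j \<in> I t) = t"
  using assms by (intro the_equality) (auto simp: disjoint_family_on_def)

text \<open>The disorder is absent here: Gaussian coordinates on the increasing pairs take its
  place, and the two laws are identified at the end.\<close>

locale tap_setting =
  fixes m k N i s :: nat and D L :: "real mat" and lam :: "nat \<Rightarrow> real" and \<beta> h :: real and q :: "real vec"
    and I :: "nat \<Rightarrow> nat set"
  assumes m: "2 \<le> m" and lam: "\<And>s. s < m \<Longrightarrow> 0 < lam s \<and> lam s < 1" and L: "L = mat_diag m lam"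
    and D: "D \<in> carrier_mat m m" and D_sym: "transpose_mat D = D"
    and D_nonneg: "\<And>s t. s < m \<Longrightarrow> t < m \<Longrightarrow> 0 \<le> D $$ (s, t)"
    and \<beta>: "0 < \<beta>" and k: "1 \<le> k"
    and fixed_point: "overlap_fixed_point m D L \<beta> h q" and partition: "species_partition m lam N I"
    and s: "s < m" and i: "i \<in> I s"
begin

definition sp :: "nat \<Rightarrow> nat" where "sp j = (THE t. t < m \<and> j \<in> I t)"

definition V :: "nat set" where "V = {1..N} - {i}"

abbreviation d :: "nat \<Rightarrow> nat \<Rightarrow> real" where "d a b \<equiv> D $$ (a, b)"

definition edge_var :: "nat \<times> nat \<Rightarrow> real" where "edge_var = (\<lambda>(a, b). d (sp a) (sp b))"

lemma sp: "t < m \<Longrightarrow> j \<in> I t \<Longrightarrow> sp j = t"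
  unfolding sp_def using partition by (intro species_of_site) (auto simp: species_partition_def)

lemma I_union: "(\<Union>t<m. I t) = {1..N}" using partition by (simp add: species_partition_def)

lemma I_card: "t < m \<Longrightarrow> real (card (I t)) = lam t * real N" using partition by (simp add: species_partition_def)

lemma i_site: "i \<in> {1..N}" using i s I_union by auto

lemma N: "0 < N" using i_site by simp

lemma sp_i: "sp i = s" using sp [OF s i] .

lemma sp_site: "j \<in> {1..N} \<Longrightarrow> sp j < m \<and> j \<in> I (sp j)"
proof -
  assume "j \<in> {1..N}"
  then obtain t where "t < m" "j \<in> I t" using I_union by blast
  then show ?thesis using sp by auto
qed

lemma I_finite: "t < m \<Longrightarrow> finite (I t)"
  using I_union finite_subset [of "I t" "{1..N}"] by auto

lemma sp_class: assumes "t < m" shows "{j \<in> V. sp j = t} = I t - {i}"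
proof (intro subset_antisym subsetI)
  fix j assume "j \<in> {j \<in> V. sp j = t}"
  then show "j \<in> I t - {i}" using sp_site [of j] by (auto simp: V_def)
next
  fix j assume "j \<in> I t - {i}"
  moreover have "j \<in> {1..N}" using calculation I_union assms by blast
  ultimately show "j \<in> {j \<in> V. sp j = t}" using sp [OF assms] by (auto simp: V_def)
qed

lemma d_sym: "a < m \<Longrightarrow> b < m \<Longrightarrow> d a b = d b a"
  using D_sym D index_transpose_mat(1) [of a D b] by auto

lemma DL_index: "x \<in> carrier_vec m \<Longrightarrow> t < m \<Longrightarrow> ((D * L) *\<^sub>v x) $ t = (\<Sum>r<m. d t r * lam r * x $ r)"
  unfolding L mat_diag_mult_right [OF D] by (simp add: scalar_prod_def atLeast0LessThan)

lemma q_carrier: "q \<in> carrier_vec m" using fixed_point by (simp add: overlap_fixed_point_def)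

lemma tanh_square_bounds: "0 \<le> (tanh y)\<^sup>2" "(tanh y)\<^sup>2 \<le> 1" for y :: real
  using tanh_real_bounds [of y] by (auto simp: abs_square_le_1 abs_le_iff)

lemma q_bounds: assumes "t < m" shows "0 \<le> q $ t \<and> q $ t \<le> 1"
proof -
  interpret prob_space std_normal_distribution by (rule prob_space_normal_density) simp
  let ?f = "\<lambda>x. (tanh (\<beta> * x * sqrt (((D * L) *\<^sub>v q) $ t) + h))\<^sup>2"
  have eq: "q $ t = (\<integral>x. ?f x \<partial>std_normal_distribution)"
    using fixed_point assms by (simp add: overlap_fixed_point_def)
  have "0 \<le> (\<integral>x. ?f x \<partial>std_normal_distribution)"
    by (rule Bochner_Integration.integral_nonneg) (rule tanh_square_bounds)
  moreover have "(\<integral>x. ?f x \<partial>std_normal_distribution) \<le> (\<integral>x. 1 \<partial>std_normal_distribution)"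
    by (rule integral_mono') (auto intro: tanh_square_bounds)
  ultimately show ?thesis using eq prob_space by simp
qed

lemma q_fixed:
  assumes t: "t < m"
  shows "q $ t = (\<integral>y. (tanh (\<beta> * y + h))\<^sup>2 \<partial>centered_gaussian (\<Sum>r<m. d t r * lam r * q $ r))"
proof -
  have "continuous_on UNIV (\<lambda>y. (tanh (\<beta> * y + h))\<^sup>2)"
    by (intro continuous_intros) auto
  then have "(\<lambda>y. (tanh (\<beta> * y + h))\<^sup>2) \<in> borel_measurable borel"
    by (rule borel_measurable_continuous_onI)
  from integral_centered_gaussian [OF this] show ?thesis
    using fixed_point t DL_index [OF q_carrier t] by (simp add: overlap_fixed_point_def mult_ac)
qed

text \<open>Removing \<open>i\<close> takes one site from the species \<open>s\<close> and none from
  the others, whence the slack of one in the counts.\<close>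

sublocale MS: msk_sites m N V sp d lam "\<lambda>t. q $ t" \<beta> h
proof
  show "finite V" by (simp add: V_def)
  show "sp j < m" if "j \<in> V" for j using sp_site [of j] that by (auto simp: V_def)
  show "0 < N" "0 < \<beta>" by (rule N \<beta>)+
  fix t assume t: "t < m"
  show "0 < lam t" using lam [OF t] by simp
  show "0 \<le> q $ t \<and> q $ t \<le> 1" by (rule q_bounds [OF t])
  show "q $ t = (\<integral>y. (tanh (\<beta> * y + h))\<^sup>2 \<partial>centered_gaussian (\<Sum>r<m. d t r * lam r * q $ r))"
    by (rule q_fixed [OF t])
  have c: "card {j \<in> V. sp j = t} \<le> card (I t)" "card (I t) \<le> card {j \<in> V. sp j = t} + 1"
    unfolding sp_class [OF t] using I_finite [OF t] by (auto simp: card_Diff_singleton_if card_mono)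
  then show "card {j \<in> V. sp j = t} \<le> lam t * N" "lam t * N - 1 \<le> card {j \<in> V. sp j = t}"
    unfolding I_card [OF t, symmetric] by linarith+
qed (rule d_sym D_nonneg; assumption)+

sublocale CV: cavity N i V
  by standard (use i_site in \<open>auto simp: V_def\<close>)

lemma configs_eq: "CV.configs = MS.spins" by (simp add: CV.configs_def MS.spins_def)
lemma edges_eq: "CV.edge_set = MS.edges" by (simp add: CV.edge_set_def MS.edges_def)

text \<open>At time 1 the site fields have coefficient 0, so the end of the path is the Gibbs
  measure without the site.\<close>

lemma weight_eq: "CV.cavity_weight \<beta> h y = MS.GI.p 1 y"
proof -
  have "CV.cavity_hamiltonian \<beta> h y = MS.GI.X 1 y"
    by (rule ext) (simp only: CV.cavity_hamiltonian_def MS.X_1 edges_eq)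
  then show ?thesis by (simp only: CV.cavity_weight_def MS.GI.p_def configs_eq)
qed

lemma edge_var_nonneg: assumes "e \<in> site_pairs N" shows "0 \<le> edge_var e"
proof -
  obtain a b where e: "e = (a, b)" "a \<in> {1..N}" "b \<in> {1..N}" using assms by (auto simp: site_pairs_def)
  then show ?thesis using sp_site [of a] sp_site [of b] by (auto simp: edge_var_def intro: D_nonneg)
qed

lemma edge_var_row: assumes "j \<in> V" shows "edge_var (min i j, max i j) = d s (sp j)"
proof -
  have "sp j < m" using sp_site [of j] assms by (auto simp: V_def)
  then show ?thesis using d_sym [OF s, of "sp j"] by (auto simp: edge_var_def min_def max_def sp_i)
qed

text \<open>A common bound for all entries; unlike a bound for row \<open>s\<close> alone, it makes
  the final constant independent of the species.\<close>

definition \<Delta> :: real where "\<Delta> = (\<Sum>s<m. \<Sum>t<m. d s t)"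

lemma d_le: assumes "a < m" "b < m" shows "d a b \<le> \<Delta>"
proof -
  have "d a b \<le> (\<Sum>t<m. d a t)" by (rule member_le_sum) (use assms D_nonneg in auto)
  also have "\<dots> \<le> \<Delta>" unfolding \<Delta>_def by (rule member_le_sum [where f = "\<lambda>a. \<Sum>t<m. d a t"]) (use assms D_nonneg in \<open>auto intro!: sum_nonneg\<close>)
  finally show ?thesis .
qed

lemma \<Delta>_nonneg: "0 \<le> \<Delta>" using d_le [OF s s] D_nonneg [OF s s] by linarith

lemma onsager_bounds: "0 \<le> MS.onsager s" "MS.onsager s \<le> \<beta>\<^sup>2 * (m * \<Delta>)"
proof -
  have term_le: "0 \<le> d s t * (lam t * (1 - q $ t)) \<and> d s t * (lam t * (1 - q $ t)) \<le> \<Delta>" if t: "t < m" for t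
  proof
    have lq: "0 \<le> lam t" "lam t \<le> 1" "0 \<le> 1 - q $ t" "1 - q $ t \<le> 1"
      using lam [OF t] q_bounds [OF t] by auto
    have b: "0 \<le> lam t * (1 - q $ t)" "lam t * (1 - q $ t) \<le> 1 * 1"
      by (rule mult_nonneg_nonneg [OF lq(1,3)], rule mult_mono [OF lq(2,4) _ lq(3)]) simp
    show "0 \<le> d s t * (lam t * (1 - q $ t))" using b D_nonneg [OF s t] by simp
    have "d s t * (lam t * (1 - q $ t)) \<le> \<Delta> * (1 * 1)"
      by (rule mult_mono [OF d_le [OF s t] b(2) \<Delta>_nonneg b(1)])
    then show "d s t * (lam t * (1 - q $ t)) \<le> \<Delta>" by simp
  qed
  show "0 \<le> MS.onsager s"
    unfolding MS.onsager_def by (intro mult_nonneg_nonneg [OF zero_le_power2] sum_nonneg) (use term_le in auto)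
  have "(\<Sum>t<m. d s t * (lam t * (1 - q $ t))) \<le> (\<Sum>t<m. \<Delta>)" using term_le by (intro sum_mono) auto
  then show "MS.onsager s \<le> \<beta>\<^sup>2 * (m * \<Delta>)"
    unfolding MS.onsager_def by (intro mult_left_mono) auto
qed

text \<open>The disorder is split into the part \<open>x\<close> between the sites of \<open>V\<close> and the row \<open>u\<close> of the site \<open>i\<close>.\<close>

definition cavity_error :: "(nat \<times> nat \<Rightarrow> real) \<Rightarrow> (nat \<times> nat \<Rightarrow> real) \<Rightarrow> real" where
  "cavity_error x u = (let w = MS.GI.p 1 x; f = CV.local_field \<beta> u;
     Z = \<Sum>\<sigma>\<in>MS.spins. w \<sigma> * (exp (f \<sigma> + h) + exp (- (f \<sigma> + h)));
     si = (\<Sum>\<sigma>\<in>MS.spins. w \<sigma> * (exp (f \<sigma> + h) - exp (- (f \<sigma> + h)))) / Z;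
     L = (\<Sum>\<sigma>\<in>MS.spins. w \<sigma> * (f \<sigma> * (exp (f \<sigma> + h) + exp (- (f \<sigma> + h))))) / Z
   in (si - tanh (L + h - MS.onsager s * si)) ^ (2 * k))"

text \<open>Both arguments of \<open>cavity_error\<close> are the same \<open>y\<close>, because
  each of them reads only its own coordinates. The sums over species regroup into sums over
  \<open>V\<close>.\<close>

lemma tap_error_eq:
  "(magnetization \<beta> h N (\<lambda>a b. y (min a b, max a b)) i
     - tanh (tap_field m D L \<beta> h q N I (\<lambda>a b. y (min a b, max a b)) s i)) ^ (2 * k) = cavity_error y y"
proof -
  let ?mag = "magnetization \<beta> h N (\<lambda>a b. y (min a b, max a b))"
  have "(\<Sum>t<m. \<Sum>j\<in>I t - {i}. y (min i j, max i j) * ?mag j) = (\<Sum>j\<in>V. y (min i j, max i j) * ?mag j)"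
  proof -
    have "(\<Sum>t<m. \<Sum>j\<in>I t - {i}. y (min i j, max i j) * ?mag j) = (\<Sum>t<m. \<Sum>j | j \<in> V \<and> sp j = t. y (min i j, max i j) * ?mag j)"
      by (intro sum.cong refl) (simp_all add: sp_class)
    also have "\<dots> = (\<Sum>j\<in>V. y (min i j, max i j) * ?mag j)"
      using MS.sum_by_species [of "\<lambda>_. 1" "\<lambda>j. y (min i j, max i j) * ?mag j"] by simp
    finally show ?thesis .
  qed
  moreover have "\<beta>\<^sup>2 * ((D * L) *\<^sub>v (Matrix.vec m (\<lambda>_. 1) - q)) $ s = MS.onsager s"
  proof -
    have "((D * L) *\<^sub>v (Matrix.vec m (\<lambda>_. 1) - q)) $ s = (\<Sum>r<m. d s r * lam r * (Matrix.vec m (\<lambda>_. 1) - q) $ r)"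
      by (rule DL_index [OF _ s]) (use q_carrier in auto)
    also have "\<dots> = (\<Sum>r<m. d s r * (lam r * (1 - q $ r)))"
      using q_carrier by (intro sum.cong refl) auto
    finally show ?thesis by (simp only: MS.onsager_def)
  qed
  ultimately show ?thesis
    unfolding tap_field_def CV.local_field_magnetization CV.magnetization_cavity cavity_error_def Let_def
    by (simp only: CV.local_field_magnetization CV.magnetization_cavity weight_eq configs_eq)
qed

definition row_factor :: real where
  "row_factor = exp (k * (\<beta>\<^sup>2 * (m * \<Delta>))) * 4 ^ (2 * k) * (4 * row_const (2 * k) (\<beta>\<^sup>2 * \<Delta> * (4 + m)))"

lemma row_factor_nonneg: "0 \<le> row_factor"
  unfolding row_factor_def by (intro mult_nonneg_nonneg row_const_nonneg) auto

text \<open>With \<open>x\<close> frozen the weights \<open>w\<close> are fixed and only the row is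
  averaged, so the abstract row estimates apply; they are used at the arguments 1 and -1.\<close>

lemma cavity_error_row:
  "(\<integral>u. cavity_error x u \<partial>gaussian_product CV.row edge_var)
    \<le> row_factor * ((m * (\<beta>\<^sup>2 * \<Delta> / N)) ^ (2 * k) * (8 * 4 ^ (2 * k)) * (\<Sum>t<m. 1 + MS.W_moment (MS.GI.p 1 x) (2 * k) t))"
proof -
  define w where "w = MS.GI.p 1 x"
  let ?v = "MS.onsager s" and ?n = "2 * k"
  let ?mean = "MS.site_mean w" and ?cov = "MS.covariance w s"
  have w0: "\<And>\<sigma>. \<sigma> \<in> MS.spins \<Longrightarrow> 0 \<le> w \<sigma>" unfolding w_def by (rule MS.GI.p_nonneg)
  have w1: "sum w MS.spins = 1" unfolding w_def by (rule MS.GI.p_sum)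
  have mean_eq: "?mean j = (\<Sum>\<sigma>\<in>MS.spins. w \<sigma> * \<sigma> j)" for j
    by (rule MS.site_mean_def) (use w0 w1 in auto)
  \<comment> \<open>Scaled centred spins: their combination with the row is the local field minus
    its Gibbs mean, and their covariance is \<open>covariance s\<close>.\<close>
  define \<xi> where "\<xi> e \<sigma> = \<beta> / sqrt N * (\<sigma> (CV.other e) - ?mean (CV.other e))" for e and \<sigma> :: "nat \<Rightarrow> real"
  interpret RA: row_average MS.spins w CV.row edge_var \<xi> ?v
  proof
    show "finite MS.spins" "sum w MS.spins = 1" "finite CV.row" "0 \<le> ?v"
      by (rule MS.finite_spins w1 CV.row_finite onsager_bounds)+
    show "0 \<le> w \<sigma>" for \<sigma> unfolding w_def by (rule MS.GI.p_nonneg)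
    show "0 \<le> edge_var e" if "e \<in> CV.row" for e
      using that CV.site_pairs_split by (intro edge_var_nonneg) auto
    show "(\<Sum>\<sigma>\<in>MS.spins. w \<sigma> * \<xi> e \<sigma>) = 0" for e
    proof -
      have "(\<Sum>\<sigma>\<in>MS.spins. w \<sigma> * \<xi> e \<sigma>) = \<beta> / sqrt N * (\<Sum>\<sigma>\<in>MS.spins. w \<sigma> * \<sigma> (CV.other e) - w \<sigma> * ?mean (CV.other e))"
        unfolding sum_distrib_left by (intro sum.cong refl) (simp add: \<xi>_def algebra_simps)
      also have "(\<Sum>\<sigma>\<in>MS.spins. w \<sigma> * \<sigma> (CV.other e) - w \<sigma> * ?mean (CV.other e)) = 0"
        unfolding sum_subtractf sum_distrib_right [symmetric] w1 by (simp add: mean_eq)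
      finally show ?thesis by simp
    qed
  qed
  have c_eq: "RA.c \<sigma> \<tau> = ?cov \<sigma> \<tau>" for \<sigma> \<tau>
  proof -
    have sq: "\<beta> / sqrt N * (\<beta> / sqrt N) = \<beta>\<^sup>2 / N" by (simp add: power2_eq_square)
    have "RA.c \<sigma> \<tau> = (\<Sum>j\<in>V. d s (sp j) * (\<beta> / sqrt N * (\<sigma> j - ?mean j)) * (\<beta> / sqrt N * (\<tau> j - ?mean j)))"
      unfolding RA.c_def CV.sum_row by (intro sum.cong refl) (simp add: \<xi>_def CV.other_row edge_var_row)
    also have "\<dots> = (\<beta> / sqrt N * (\<beta> / sqrt N)) * (\<Sum>j\<in>V. d s (sp j) * ((\<sigma> j - ?mean j) * (\<tau> j - ?mean j)))"
      unfolding sum_distrib_left by (intro sum.cong refl) (simp only: mult_ac)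
    also have "\<dots> = ?cov \<sigma> \<tau>" unfolding sq by (rule MS.covariance_def [symmetric]) (use w0 w1 in auto)
    finally show ?thesis .
  qed
  have x_eq: "RA.x u \<sigma> = CV.local_field \<beta> u \<sigma> - (\<Sum>\<tau>\<in>MS.spins. w \<tau> * CV.local_field \<beta> u \<tau>)" for u \<sigma>
  proof -
    have "(\<Sum>\<tau>\<in>MS.spins. w \<tau> * CV.local_field \<beta> u \<tau>) = (\<Sum>e\<in>CV.row. u e * (\<beta> / sqrt N * ?mean (CV.other e)))"
      unfolding CV.local_field_def mean_eq sum_distrib_left by (subst sum.swap) (simp add: mult_ac)
    then show ?thesis
      unfolding RA.x_def CV.local_field_def \<xi>_def by (simp add: right_diff_distrib sum_subtractf)
  qed
  have cardV: "card V \<le> N" unfolding V_def using i_site by simp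
  \<comment> \<open>The sum of the deterministic bounds for the covariance and for the Onsager
    coefficient, so that one constant serves \<open>c\<close> and \<open>c - v\<close>.\<close>
  let ?B = "\<beta>\<^sup>2 * \<Delta> * (4 + m)"
  have covB: "\<bar>?cov \<sigma> \<tau>\<bar> \<le> 4 * \<beta>\<^sup>2 * \<Delta>" if "\<sigma> \<in> MS.spins" "\<tau> \<in> MS.spins" for \<sigma> \<tau>
    by (rule MS.covariance_abs [OF w0 w1 s d_le [OF s] cardV that])
  have mB: "0 \<le> \<beta>\<^sup>2 * (m * \<Delta>)" using \<Delta>_nonneg by simp
  have Beq: "?B = 4 * \<beta>\<^sup>2 * \<Delta> + \<beta>\<^sup>2 * (m * \<Delta>)" by (simp add: algebra_simps)
  have B1: "\<bar>RA.c \<sigma> \<tau>\<bar> \<le> ?B" if "\<sigma> \<in> MS.spins" "\<tau> \<in> MS.spins" for \<sigma> \<tau>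
    unfolding c_eq Beq using covB [OF that] mB by linarith
  have B2: "\<bar>RA.c \<sigma> \<sigma> - ?v\<bar> \<le> ?B" if "\<sigma> \<in> MS.spins" for \<sigma>
    unfolding c_eq Beq using covB [OF that that] onsager_bounds by linarith
  have \<xi>B: "\<bar>\<xi> e \<sigma>\<bar> \<le> \<beta> * 2" if e: "e \<in> CV.row" "\<sigma> \<in> MS.spins" for e \<sigma>
  proof -
    obtain j where j: "j \<in> V" "e = (min i j, max i j)" using e(1) unfolding CV.row_def by blast
    have "\<beta> / sqrt N \<le> \<beta> / 1" using \<beta> MS.N_sqrt by (intro divide_left_mono) auto
    then have "\<beta> / sqrt N * \<bar>\<sigma> j - ?mean j\<bar> \<le> \<beta> * 2"
      using \<beta> MS.centered_spin_abs [OF w0 w1 e(2) j(1)] by (intro mult_mono) auto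
    then show ?thesis using \<beta> by (simp add: \<xi>_def j CV.other_row abs_mult)
  qed
  define U where "U = (\<Sum>\<sigma>\<in>MS.spins. \<Sum>\<tau>\<in>MS.spins. w \<sigma> * w \<tau> * RA.c \<sigma> \<tau> ^ ?n) + (\<Sum>\<sigma>\<in>MS.spins. w \<sigma> * (RA.c \<sigma> \<sigma> - ?v) ^ ?n)"
  have k0: "0 < k" using k by simp
  have Y1: "integrable RA.G (\<lambda>u. norm (RA.Y u \<zeta> - 1) ^ ?n)" "(\<integral>u. norm (RA.Y u \<zeta> - 1) ^ ?n \<partial>RA.G) \<le> row_const ?n ?B * U"
    and Y2: "integrable RA.G (\<lambda>u. norm (RA.Y' u \<zeta>) ^ ?n)" "(\<integral>u. norm (RA.Y' u \<zeta>) ^ ?n \<partial>RA.G) \<le> row_const ?n ?B * U"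
    if "norm \<zeta> = 1" for \<zeta>
  proof -
    have z: "norm \<zeta> \<le> 2" "norm \<zeta> \<le> 1" using that by auto
    show "integrable RA.G (\<lambda>u. norm (RA.Y u \<zeta> - 1) ^ ?n)" by (rule RA.row_bound(1) [OF z(1) k0 \<xi>B B1 B2])
    show "integrable RA.G (\<lambda>u. norm (RA.Y' u \<zeta>) ^ ?n)" by (rule RA.row_derivative_bound(1) [OF z(2) k0 \<xi>B B1 B2])
    show "(\<integral>u. norm (RA.Y u \<zeta> - 1) ^ ?n \<partial>RA.G) \<le> row_const ?n ?B * U"
      unfolding U_def by (rule RA.row_bound(2) [OF z(1) k0 \<xi>B B1 B2])
    show "(\<integral>u. norm (RA.Y' u \<zeta>) ^ ?n \<partial>RA.G) \<le> row_const ?n ?B * U"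
      unfolding U_def by (rule RA.row_derivative_bound(2) [OF z(2) k0 \<xi>B B1 B2])
  qed
  let ?E = "exp (k * (\<beta>\<^sup>2 * (m * \<Delta>))) * 4 ^ ?n"
  have point: "cavity_error x u \<le> ?E * (norm (RA.Y u 1 - 1) ^ ?n + norm (RA.Y u (- 1) - 1) ^ ?n
      + norm (RA.Y' u 1) ^ ?n + norm (RA.Y' u (- 1)) ^ ?n)" for u
  proof -
    let ?x = "\<lambda>\<sigma>. CV.local_field \<beta> u \<sigma> - (\<Sum>\<tau>\<in>MS.spins. w \<tau> * CV.local_field \<beta> u \<tau>)"
    define y where "y r = (\<Sum>\<sigma>\<in>MS.spins. w \<sigma> * exp (r * ?x \<sigma> - r\<^sup>2 * ?v / 2))" for r
    define y' where "y' r = (\<Sum>\<sigma>\<in>MS.spins. w \<sigma> * ((?x \<sigma> - r * ?v) * exp (r * ?x \<sigma> - r\<^sup>2 * ?v / 2)))" for r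
    have Y: "RA.Y u (of_real r) = of_real (y r)" for r
      unfolding RA.Y_def y_def x_eq by (simp add: exp_of_real [symmetric])
    have Y': "RA.Y' u (of_real r) = of_real (y' r)" for r
      unfolding RA.Y'_def y'_def x_eq by (simp add: exp_of_real [symmetric])
    have n1: "norm (RA.Y u 1 - 1) = \<bar>y 1 - 1\<bar>" "norm (RA.Y u (- 1) - 1) = \<bar>y (- 1) - 1\<bar>"
      using norm_of_real [of "y 1 - 1", where 'a = complex] norm_of_real [of "y (- 1) - 1", where 'a = complex] Y [of 1] Y [of "- 1"]
      by (simp_all only: of_real_diff of_real_minus of_real_1)
    have n2: "norm (RA.Y' u 1) = \<bar>y' 1\<bar>" "norm (RA.Y' u (- 1)) = \<bar>y' (- 1)\<bar>"
      using Y' [of 1] Y' [of "- 1"] by (simp_all only: of_real_minus of_real_1 norm_of_real)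
    define T where "T = \<bar>y 1 - 1\<bar> + \<bar>y (- 1) - 1\<bar> + \<bar>y' 1\<bar> + \<bar>y' (- 1)\<bar>"
    have "\<exists>a. cavity_error x u = a ^ ?n \<and> \<bar>a\<bar> \<le> exp (?v / 2) * T"
      unfolding cavity_error_def Let_def w_def [symmetric] T_def y_def y'_def
      by (rule exI, rule conjI [OF refl], rule cavity_estimate [OF MS.finite_spins w0 w1 onsager_bounds(1)])
    then obtain a where a: "cavity_error x u = a ^ ?n" "\<bar>a\<bar> \<le> exp (?v / 2) * T" by blast
    have "a ^ ?n = \<bar>a\<bar> ^ ?n" by (simp add: power_even_abs)
    also have "\<dots> \<le> (exp (?v / 2) * T) ^ ?n" by (rule power_mono [OF a(2)]) simp
    also have "\<dots> = exp (k * ?v) * T ^ ?n"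
      by (simp add: power_mult_distrib exp_of_nat_mult [symmetric])
    also have "\<dots> \<le> exp (k * (\<beta>\<^sup>2 * (m * \<Delta>))) * (4 ^ ?n * (\<bar>y 1 - 1\<bar> ^ ?n + \<bar>y (- 1) - 1\<bar> ^ ?n + \<bar>y' 1\<bar> ^ ?n + \<bar>y' (- 1)\<bar> ^ ?n))"
    proof (rule mult_mono)
      show "exp (k * ?v) \<le> exp (k * (\<beta>\<^sup>2 * (m * \<Delta>)))"
        using onsager_bounds(2) by (simp add: mult_left_mono)
      show "T ^ ?n \<le> 4 ^ ?n * (\<bar>y 1 - 1\<bar> ^ ?n + \<bar>y (- 1) - 1\<bar> ^ ?n + \<bar>y' 1\<bar> ^ ?n + \<bar>y' (- 1)\<bar> ^ ?n)"
        unfolding T_def by (rule even_power_sum4_le) simp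
    qed simp_all
    finally show ?thesis unfolding a(1) n1 n2 by (simp only: mult.assoc)
  qed
  have "(\<integral>u. cavity_error x u \<partial>RA.G) \<le> (\<integral>u. ?E * (norm (RA.Y u 1 - 1) ^ ?n + norm (RA.Y u (- 1) - 1) ^ ?n
      + norm (RA.Y' u 1) ^ ?n + norm (RA.Y' u (- 1)) ^ ?n) \<partial>RA.G)"
  proof (rule integral_mono')
    show "integrable RA.G (\<lambda>u. ?E * (norm (RA.Y u 1 - 1) ^ ?n + norm (RA.Y u (- 1) - 1) ^ ?n
      + norm (RA.Y' u 1) ^ ?n + norm (RA.Y' u (- 1)) ^ ?n))"
      by (intro integrable_mult_right Bochner_Integration.integrable_add Y1(1) Y2(1)) auto
    show "cavity_error x u \<le> ?E * (norm (RA.Y u 1 - 1) ^ ?n + norm (RA.Y u (- 1) - 1) ^ ?n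
      + norm (RA.Y' u 1) ^ ?n + norm (RA.Y' u (- 1)) ^ ?n)" for u by (rule point)
    show "0 \<le> ?E * (norm (RA.Y u 1 - 1) ^ ?n + norm (RA.Y u (- 1) - 1) ^ ?n
      + norm (RA.Y' u 1) ^ ?n + norm (RA.Y' u (- 1)) ^ ?n)" for u
      by (intro mult_nonneg_nonneg add_nonneg_nonneg zero_le_power norm_ge_zero) auto
  qed
  also have "\<dots> = ?E * ((\<integral>u. norm (RA.Y u 1 - 1) ^ ?n \<partial>RA.G) + (\<integral>u. norm (RA.Y u (- 1) - 1) ^ ?n \<partial>RA.G)
      + (\<integral>u. norm (RA.Y' u 1) ^ ?n \<partial>RA.G) + (\<integral>u. norm (RA.Y' u (- 1)) ^ ?n \<partial>RA.G))"
  proof -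
    have "norm (1 :: complex) = 1" "norm (- 1 :: complex) = 1" by simp_all
    note i1 = Y1(1) [OF this(1)] and i2 = Y1(1) [OF this(2)] and i3 = Y2(1) [OF this(1)] and i4 = Y2(1) [OF this(2)]
    show ?thesis
      by (simp only: Bochner_Integration.integral_mult_right_zero
          Bochner_Integration.integral_add [OF Bochner_Integration.integrable_add [OF Bochner_Integration.integrable_add [OF i1 i2] i3] i4]
          Bochner_Integration.integral_add [OF Bochner_Integration.integrable_add [OF i1 i2] i3]
          Bochner_Integration.integral_add [OF i1 i2])
  qed
  also have "\<dots> \<le> ?E * (4 * row_const ?n ?B * U)"
    using Y1(2) [of 1] Y1(2) [of "- 1"] Y2(2) [of 1] Y2(2) [of "- 1"] by (intro mult_left_mono) auto
  also have "\<dots> = row_factor * U" by (simp add: row_factor_def mult_ac)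
  also have "\<dots> \<le> row_factor * ((m * (\<beta>\<^sup>2 * \<Delta> / N)) ^ ?n * (8 * 4 ^ ?n) * (\<Sum>t<m. 1 + MS.W_moment w ?n t))"
    unfolding U_def c_eq using k
    by (intro mult_left_mono row_factor_nonneg MS.covariance_moment [OF w0 w1] s d_le) auto
  finally show ?thesis unfolding w_def .
qed

end

section \<open>Averaging over the whole disorder\<close>

context tap_setting
begin

lemma cavity_weight_cong:
  assumes "\<And>e. e \<in> CV.edge_set \<Longrightarrow> x e = y e"
  shows "MS.GI.p 1 x = MS.GI.p 1 y"
proof -
  have "CV.cavity_hamiltonian \<beta> h x = CV.cavity_hamiltonian \<beta> h y"
    unfolding CV.cavity_hamiltonian_def using assms by (intro ext arg_cong2 [where f = plus] arg_cong2 [where f = times] refl sum.cong) auto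
  then show ?thesis unfolding weight_eq [symmetric] CV.cavity_weight_def by simp
qed

lemma local_field_cong:
  assumes "\<And>e. e \<in> CV.row \<Longrightarrow> u e = v e"
  shows "CV.local_field \<beta> u = CV.local_field \<beta> v"
  unfolding CV.local_field_def using assms by (intro ext sum.cong) auto

lemma cavity_error_cong:
  assumes "\<And>e. e \<in> CV.edge_set \<Longrightarrow> x e = y e" "\<And>e. e \<in> CV.row \<Longrightarrow> u e = v e"
  shows "cavity_error x u = cavity_error y v"
proof -
  have "MS.GI.p 1 x = MS.GI.p 1 y" by (rule cavity_weight_cong) (rule assms(1))
  moreover have "CV.local_field \<beta> u = CV.local_field \<beta> v" by (rule local_field_cong) (rule assms(2))
  ultimately show ?thesis unfolding cavity_error_def by presburger
qed

lemma cavity_weight_measurable: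
  assumes "CV.edge_set \<subseteq> J" "\<sigma> \<in> MS.spins"
  shows "(\<lambda>x. MS.GI.p 1 x \<sigma>) \<in> borel_measurable (gaussian_product J v)"
  unfolding weight_eq [symmetric] CV.cavity_weight_def configs_eq
proof (rule gibbs_measurable [OF MS.finite_spins _ assms(2)])
  fix \<tau>
  show "(\<lambda>x. CV.cavity_hamiltonian \<beta> h x \<tau>) \<in> borel_measurable (gaussian_product J v)"
    unfolding CV.cavity_hamiltonian_def split_def
    using assms(1) by (intro borel_measurable_add borel_measurable_times borel_measurable_const borel_measurable_sum gaussian_product_component) auto
qed

lemma local_field_measurable:
  assumes "CV.row \<subseteq> J"
  shows "(\<lambda>u. CV.local_field \<beta> u \<sigma>) \<in> borel_measurable (gaussian_product J v)"
  unfolding CV.local_field_def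
  using assms by (intro borel_measurable_times borel_measurable_const borel_measurable_sum gaussian_product_component) auto

lemma cavity_error_measurable:
  "(\<lambda>y. cavity_error y y) \<in> borel_measurable (gaussian_product (site_pairs N) v)"
proof -
  have w: "(\<lambda>x. MS.GI.p 1 x \<sigma>) \<in> borel_measurable (gaussian_product (site_pairs N) v)" if "\<sigma> \<in> MS.spins" for \<sigma>
    by (rule cavity_weight_measurable [OF _ that]) (simp add: CV.site_pairs_split)
  have f: "(\<lambda>u. CV.local_field \<beta> u \<sigma>) \<in> borel_measurable (gaussian_product (site_pairs N) v)" for \<sigma>
    by (rule local_field_measurable) (simp add: CV.site_pairs_split)
  have "tanh \<in> borel_measurable (borel :: real measure)"
    by (intro borel_measurable_continuous_onI continuous_intros) auto
  note tanh = measurable_compose [OF _ this] and exp = measurable_compose [OF _ borel_measurable_exp]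
  show ?thesis
    unfolding cavity_error_def Let_def
    by (intro borel_measurable_power borel_measurable_diff tanh borel_measurable_add borel_measurable_divide
        borel_measurable_sum borel_measurable_times borel_measurable_const exp borel_measurable_uminus w f)
qed

text \<open>A magnetization and a hyperbolic tangent both lie between -1 and 1; this bound provides
  the integrability that Fubini asks for.\<close>

lemma cavity_error_bound: "\<bar>cavity_error x u\<bar> \<le> 2 ^ (2 * k)"
proof -
  define w where "w = MS.GI.p 1 x"
  define f where "f = CV.local_field \<beta> u"
  let ?n = "\<Sum>\<sigma>\<in>MS.spins. w \<sigma> * (exp (f \<sigma> + h) - exp (- (f \<sigma> + h)))" and ?d = "\<Sum>\<sigma>\<in>MS.spins. w \<sigma> * (exp (f \<sigma> + h) + exp (- (f \<sigma> + h)))"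
  have w0: "0 \<le> w \<sigma>" for \<sigma> unfolding w_def by (rule MS.GI.p_nonneg)
  have "\<bar>?n\<bar> \<le> ?d"
  proof (intro order_trans [OF sum_abs] sum_mono)
    fix \<sigma>
    have "\<bar>exp (f \<sigma> + h) - exp (- (f \<sigma> + h))\<bar> \<le> exp (f \<sigma> + h) + exp (- (f \<sigma> + h))"
      using exp_gt_zero [of "f \<sigma> + h"] exp_gt_zero [of "- (f \<sigma> + h)"] by linarith
    then show "\<bar>w \<sigma> * (exp (f \<sigma> + h) - exp (- (f \<sigma> + h)))\<bar> \<le> w \<sigma> * (exp (f \<sigma> + h) + exp (- (f \<sigma> + h)))"
      unfolding abs_mult abs_of_nonneg [OF w0] by (rule mult_left_mono [OF _ w0])
  qed
  then have r: "\<bar>?n / ?d\<bar> \<le> 1"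
    unfolding abs_divide by (intro divide_le_eq_1 [THEN iffD2]) linarith
  have "\<exists>z. cavity_error x u = (?n / ?d - tanh z) ^ (2 * k)"
    unfolding cavity_error_def Let_def w_def [symmetric] f_def [symmetric] by (rule exI, rule refl)
  then obtain z where z: "cavity_error x u = (?n / ?d - tanh z) ^ (2 * k)" by blast
  have "\<bar>a - tanh z\<bar> \<le> 2" if "\<bar>a\<bar> \<le> 1" for a using that tanh_real_bounds [of z] by auto
  from this [OF r] have "\<bar>?n / ?d - tanh z\<bar> \<le> 2" .
  then show ?thesis unfolding z power_abs by (rule power_mono) simp
qed

text \<open>The row and the remaining edges are disjoint sets of independent coordinates, so the row
  can be integrated with the cavity system held fixed.\<close>

lemma cavity_error_fold:
  "(\<integral>y. cavity_error y y \<partial>gaussian_product (site_pairs N) edge_var)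
    = (\<integral>x. \<integral>u. cavity_error x u \<partial>gaussian_product CV.row edge_var \<partial>gaussian_product CV.edge_set edge_var)"
proof -
  interpret GP: prob_space "gaussian_product (site_pairs N) edge_var" by (rule prob_space_gaussian_product)
  interpret PP: product_prob_space "\<lambda>e. centered_gaussian (edge_var e)" "site_pairs N"
    by (rule product_prob_space_gaussian)
  have int: "integrable (gaussian_product (CV.edge_set \<union> CV.row) edge_var) (\<lambda>y. cavity_error y y)"
    unfolding CV.site_pairs_split [symmetric]
  proof (rule GP.integrable_const_bound [where B = "2 ^ (2 * k)"])
    show "AE y in gaussian_product (site_pairs N) edge_var. norm (cavity_error y y) \<le> 2 ^ (2 * k)"
      unfolding real_norm_def by (rule always_eventually, rule allI, rule cavity_error_bound)
  qed (rule cavity_error_measurable)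
  have "(\<integral>y. cavity_error y y \<partial>gaussian_product (CV.edge_set \<union> CV.row) edge_var)
    = (\<integral>x. \<integral>u. cavity_error (merge CV.edge_set CV.row (x, u)) (merge CV.edge_set CV.row (x, u))
        \<partial>gaussian_product CV.row edge_var \<partial>gaussian_product CV.edge_set edge_var)"
    by (rule PP.product_integral_fold [OF CV.edge_row_disjoint CV.edge_set_finite CV.row_finite int])
  also have "\<dots> = (\<integral>x. \<integral>u. cavity_error x u \<partial>gaussian_product CV.row edge_var \<partial>gaussian_product CV.edge_set edge_var)"
  proof -
    have "cavity_error (merge CV.edge_set CV.row (x, u)) (merge CV.edge_set CV.row (x, u)) = cavity_error x u" for x u
      using CV.edge_row_disjoint by (intro cavity_error_cong) (auto simp: merge_def)
    then show ?thesis by presburger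
  qed
  finally show ?thesis unfolding CV.site_pairs_split .
qed

lemma W_moment_eq: "MS.W_moment (MS.GI.p 1 x) n t = MS.GI.avg2 (\<lambda>\<sigma> \<tau>. MS.W t \<sigma> \<tau> ^ n) 1 x"
proof -
  define w where "w = MS.GI.p 1 x"
  have "MS.W_moment w n t = (\<Sum>\<sigma>\<in>MS.spins. \<Sum>\<tau>\<in>MS.spins. w \<sigma> * w \<tau> * MS.W t \<sigma> \<tau> ^ n)"
    by (rule MS.W_moment_def) (auto simp: w_def intro: MS.GI.p_nonneg MS.GI.p_sum)
  also have "\<dots> = (\<Sum>\<sigma>\<in>MS.spins. \<Sum>\<tau>\<in>MS.spins. MS.W t \<sigma> \<tau> ^ n * (w \<sigma> * w \<tau>))"
    by (intro sum.cong refl) (simp add: mult.commute)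
  finally show ?thesis unfolding MS.GI.avg2_def w_def .
qed

text \<open>Concentration was proved on a space that also carries the auxiliary site fields. At time
  1 nothing depends on them, so the expectation is that of the marginal on the edges.\<close>

lemma W_moment_edges:
  shows "integrable (gaussian_product CV.edge_set edge_var) (\<lambda>x. MS.W_moment (MS.GI.p 1 x) n t)"
    and "(\<integral>x. MS.W_moment (MS.GI.p 1 x) n t \<partial>gaussian_product CV.edge_set edge_var)
      = (\<integral>y. MS.GI.avg2 (\<lambda>\<sigma> \<tau>. MS.W t \<sigma> \<tau> ^ n) 1 y \<partial>gaussian_product MS.pairs MS.var)"
proof -
  let ?f = "MS.GI.avg2 (\<lambda>\<sigma> \<tau>. MS.W t \<sigma> \<tau> ^ n) 1" and ?P = "gaussian_product MS.pairs MS.var" and ?E = "gaussian_product CV.edge_set MS.var"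
  interpret GP: prob_space ?P by (rule prob_space_gaussian_product)
  interpret PP: product_prob_space "\<lambda>e. centered_gaussian (MS.var e)" MS.pairs
    by (rule product_prob_space_gaussian)
  have E: "gaussian_product CV.edge_set edge_var = ?E"
    by (rule PiM_cong) (auto simp: edges_eq MS.edges_def edge_var_def MS.var_def)
  have sub: "CV.edge_set \<subseteq> MS.pairs" unfolding edges_eq MS.pairs_def by auto
  have D: "?E = distr ?P ?E (\<lambda>y. restrict y CV.edge_set)"
    by (rule PP.distr_restrict [OF sub MS.finite_pairs])
  have meas: "?f \<in> borel_measurable ?E"
    unfolding MS.GI.avg2_def [abs_def]
    by (intro borel_measurable_sum borel_measurable_times borel_measurable_const cavity_weight_measurable order_refl)
  have r: "(\<lambda>y. restrict y CV.edge_set) \<in> measurable ?P ?E" by (rule measurable_restrict_subset [OF sub])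
  have f_r: "?f (restrict y CV.edge_set) = ?f y" for y
  proof -
    have "MS.GI.p 1 (restrict y CV.edge_set) = MS.GI.p 1 y" by (rule cavity_weight_cong) simp
    then show ?thesis unfolding MS.GI.avg2_def by presburger
  qed
  have intP: "integrable ?P ?f"
  proof (rule GP.integrable_const_bound [where B = "\<Sum>\<sigma>\<in>MS.spins. \<Sum>\<tau>\<in>MS.spins. \<bar>MS.W t \<sigma> \<tau> ^ n\<bar>"])
    have "\<bar>MS.W t \<sigma> \<tau> ^ n\<bar> \<le> (\<Sum>\<sigma>\<in>MS.spins. \<Sum>\<tau>\<in>MS.spins. \<bar>MS.W t \<sigma> \<tau> ^ n\<bar>)" if "\<sigma> \<in> MS.spins" "\<tau> \<in> MS.spins" for \<sigma> \<tau>
    proof -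
      have "\<bar>MS.W t \<sigma> \<tau> ^ n\<bar> \<le> (\<Sum>\<tau>\<in>MS.spins. \<bar>MS.W t \<sigma> \<tau> ^ n\<bar>)"
        by (rule member_le_sum [OF that(2) abs_ge_zero MS.finite_spins])
      also have "\<dots> \<le> (\<Sum>\<sigma>\<in>MS.spins. \<Sum>\<tau>\<in>MS.spins. \<bar>MS.W t \<sigma> \<tau> ^ n\<bar>)"
        by (rule member_le_sum [OF that(1) sum_nonneg [OF abs_ge_zero] MS.finite_spins])
      finally show ?thesis .
    qed
    note b = MS.GI.avg2_bound [OF this]
    show "AE y in ?P. norm (?f y) \<le> (\<Sum>\<sigma>\<in>MS.spins. \<Sum>\<tau>\<in>MS.spins. \<bar>MS.W t \<sigma> \<tau> ^ n\<bar>)"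
      unfolding real_norm_def by (rule always_eventually, rule allI, rule b)
  qed (rule MS.GI.avg2_measurable)
  have "integrable (distr ?P ?E (\<lambda>y. restrict y CV.edge_set)) ?f"
    unfolding integrable_distr_eq [OF r meas] f_r by (rule intP)
  then show "integrable (gaussian_product CV.edge_set edge_var) (\<lambda>x. MS.W_moment (MS.GI.p 1 x) n t)"
    unfolding W_moment_eq E D [symmetric] .
  have "integral\<^sup>L (distr ?P ?E (\<lambda>y. restrict y CV.edge_set)) ?f = (\<integral>y. ?f y \<partial>?P)"
    unfolding integral_distr [OF r meas] f_r by (rule refl)
  then show "(\<integral>x. MS.W_moment (MS.GI.p 1 x) n t \<partial>gaussian_product CV.edge_set edge_var) = (\<integral>y. ?f y \<partial>?P)"
    unfolding W_moment_eq E D [symmetric] .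
qed

text \<open>Its ingredients are \<open>m\<close>, \<open>k\<close>, \<open>D\<close>,
  \<open>lam\<close>, \<open>\<beta>\<close> and the two exponents; this lets the constant be chosen
  before \<open>h\<close>, \<open>q\<close>, the size and the site.\<close>

definition tap_const :: "real \<Rightarrow> real \<Rightarrow> real" where
  "tap_const \<kappa> \<delta> = row_factor * ((m * (\<beta>\<^sup>2 * \<Delta>)) ^ (2 * k) * (8 * 4 ^ (2 * k)) *
     (\<Sum>t<m. 1 + fact k * (lam t / \<delta>) ^ k * overlap_bound m lam \<kappa>))"

text \<open>Counting powers: the covariances give \<open>N\<close> to the power
  \<open>- 2 * k\<close>, and the overlap moments give back \<open>N ^ k\<close>.\<close>

lemma cavity_error_expectation:
  assumes quad: "\<And>w. \<bar>\<Sum>s<m. \<Sum>t<m. d s t * w s * w t\<bar> \<le> \<rho> * (\<Sum>s<m. (w s)\<^sup>2 / lam s)" and \<rho>: "0 \<le> \<rho>"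
    and al: "al = 1 \<and> (\<forall>w. 0 \<le> (\<Sum>s<m. \<Sum>t<m. d s t * w s * w t)) \<or> al = 2"
    and \<kappa>: "2 * al * \<beta>\<^sup>2 * \<rho> < \<kappa>" "\<kappa> < 1 / 2"
  shows "(\<integral>y. cavity_error y y \<partial>gaussian_product (site_pairs N) edge_var)
    \<le> tap_const \<kappa> (\<kappa> - 2 * al * \<beta>\<^sup>2 * \<rho>) / real N ^ k"
proof -
  define \<delta> where "\<delta> = \<kappa> - 2 * al * \<beta>\<^sup>2 * \<rho>"
  define B where "B = overlap_bound m lam \<kappa>"
  interpret GP: prob_space "gaussian_product CV.edge_set edge_var" by (rule prob_space_gaussian_product)
  define c where "c = (m * (\<beta>\<^sup>2 * \<Delta> / N)) ^ (2 * k) * (8 * 4 ^ (2 * k))"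
  have c: "0 \<le> c" unfolding c_def using \<Delta>_nonneg by (intro mult_nonneg_nonneg zero_le_power) auto
  have W0: "0 \<le> MS.W_moment (MS.GI.p 1 x) (2 * k) t" for x t
    by (rule MS.W_moment_nonneg) (use k in \<open>auto intro: MS.GI.p_nonneg MS.GI.p_sum\<close>)
  have one: "integrable (gaussian_product CV.edge_set edge_var) (\<lambda>_. 1 :: real)" by (rule GP.integrable_const)
  have int: "integrable (gaussian_product CV.edge_set edge_var) (\<lambda>x. \<Sum>t<m. 1 + MS.W_moment (MS.GI.p 1 x) (2 * k) t)"
    by (intro Bochner_Integration.integrable_sum Bochner_Integration.integrable_add one W_moment_edges(1))
  have "(\<integral>y. cavity_error y y \<partial>gaussian_product (site_pairs N) edge_var)
      \<le> (\<integral>x. row_factor * (c * (\<Sum>t<m. 1 + MS.W_moment (MS.GI.p 1 x) (2 * k) t)) \<partial>gaussian_product CV.edge_set edge_var)"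
    unfolding cavity_error_fold
  proof (rule integral_mono')
    show "integrable (gaussian_product CV.edge_set edge_var) (\<lambda>x. row_factor * (c * (\<Sum>t<m. 1 + MS.W_moment (MS.GI.p 1 x) (2 * k) t)))"
      by (intro integrable_mult_right int)
    show "(\<integral>u. cavity_error x u \<partial>gaussian_product CV.row edge_var) \<le> row_factor * (c * (\<Sum>t<m. 1 + MS.W_moment (MS.GI.p 1 x) (2 * k) t))" for x
      unfolding c_def by (rule cavity_error_row)
    show "0 \<le> row_factor * (c * (\<Sum>t<m. 1 + MS.W_moment (MS.GI.p 1 x) (2 * k) t))" for x
      by (intro mult_nonneg_nonneg row_factor_nonneg c sum_nonneg add_nonneg_nonneg W0 zero_le_one)
  qed
  also have "\<dots> = row_factor * (c * (\<Sum>t<m. 1 + (\<integral>y. MS.GI.avg2 (\<lambda>\<sigma> \<tau>. MS.W t \<sigma> \<tau> ^ (2 * k)) 1 y \<partial>gaussian_product MS.pairs MS.var)))"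
  proof -
    have "(\<integral>x. 1 + MS.W_moment (MS.GI.p 1 x) (2 * k) t \<partial>gaussian_product CV.edge_set edge_var)
        = 1 + (\<integral>y. MS.GI.avg2 (\<lambda>\<sigma> \<tau>. MS.W t \<sigma> \<tau> ^ (2 * k)) 1 y \<partial>gaussian_product MS.pairs MS.var)" for t
      unfolding Bochner_Integration.integral_add [OF one W_moment_edges(1)] W_moment_edges(2)
      by (simp only: lebesgue_integral_const GP.prob_space scaleR_one)
    moreover have "(\<integral>x. (\<Sum>t<m. 1 + MS.W_moment (MS.GI.p 1 x) (2 * k) t) \<partial>gaussian_product CV.edge_set edge_var)
        = (\<Sum>t<m. \<integral>x. 1 + MS.W_moment (MS.GI.p 1 x) (2 * k) t \<partial>gaussian_product CV.edge_set edge_var)"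
      by (intro Bochner_Integration.integral_sum Bochner_Integration.integrable_add one W_moment_edges(1))
    ultimately show ?thesis by (simp only: Bochner_Integration.integral_mult_right_zero)
  qed
  also have "\<dots> \<le> row_factor * (c * (\<Sum>t<m. real N ^ k * (1 + fact k * (lam t / \<delta>) ^ k * B)))"
  proof (intro mult_left_mono row_factor_nonneg c sum_mono)
    fix t assume "t \<in> {..<m}"
    then have t: "t < m" by simp
    have "(\<integral>y. MS.GI.avg2 (\<lambda>\<sigma> \<tau>. MS.W t \<sigma> \<tau> ^ (2 * k)) 1 y \<partial>gaussian_product MS.pairs MS.var)
      \<le> fact k * (lam t * N / \<delta>) ^ k * B"
      unfolding \<delta>_def B_def by (rule MS.overlap_moment [OF quad \<rho> al \<kappa> t])
    also have "\<dots> = real N ^ k * (fact k * (lam t / \<delta>) ^ k * B)" by (simp add: power_mult_distrib power_divide)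
    finally have 1: "(\<integral>y. MS.GI.avg2 (\<lambda>\<sigma> \<tau>. MS.W t \<sigma> \<tau> ^ (2 * k)) 1 y \<partial>gaussian_product MS.pairs MS.var)
      \<le> real N ^ k * (fact k * (lam t / \<delta>) ^ k * B)" .
    \<comment> \<open>The summand 1, left by the error in the species counts, is absorbed into the
      order \<open>N ^ k\<close> of the moments.\<close>
    have 2: "1 \<le> real N ^ k" using N by (intro one_le_power) simp
    show "1 + (\<integral>y. MS.GI.avg2 (\<lambda>\<sigma> \<tau>. MS.W t \<sigma> \<tau> ^ (2 * k)) 1 y \<partial>gaussian_product MS.pairs MS.var)
        \<le> real N ^ k * (1 + fact k * (lam t / \<delta>) ^ k * B)"
      unfolding distrib_left mult_1_right by (rule add_mono [OF 2 1])
  qed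
  also have "\<dots> = tap_const \<kappa> \<delta> / real N ^ k"
  proof -
    have Nk: "(0::real) < real N ^ k" using N by simp
    have "c = (m * (\<beta>\<^sup>2 * \<Delta>)) ^ (2 * k) * (8 * 4 ^ (2 * k)) / (real N ^ k * real N ^ k)"
      unfolding c_def times_divide_eq_right power_divide by (simp add: mult_2 power_add)
    moreover have "r * (a / (n * n) * (n * b)) = r * (a * b) / n" if "0 < n" for r a b n :: real
      using that by simp
    from this [OF Nk] have "row_factor * (a / (real N ^ k * real N ^ k) * (real N ^ k * b)) = row_factor * (a * b) / real N ^ k" for a b .
    ultimately show ?thesis
      unfolding tap_const_def B_def [symmetric] sum_distrib_left [symmetric] by (simp only:)
  qed
  finally show ?thesis unfolding \<delta>_def .
qed

text \<open>A ratio strictly between 0 and 1 puts the size of a species strictly between 0 and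
  \<open>N\<close>, which excludes \<open>N = 1\<close>. The description of independence by a
  product law is applied to a nonempty index set.\<close>

lemma site_pairs_nonempty: "site_pairs N \<noteq> {}"
proof -
  have "real (card (I 0)) = lam 0 * N" "0 < lam 0" "lam 0 < 1" using I_card [of 0] lam [of 0] m by auto
  then have "0 < real (card (I 0))" "real (card (I 0)) < real N" using N by auto
  then have "0 < card (I 0)" "card (I 0) < N" by simp_all
  then have "2 \<le> N" by linarith
  then have "(1, 2) \<in> site_pairs N" by (simp add: site_pairs_def)
  then show ?thesis by blast
qed

text \<open>Independence and the marginals determine the joint law on the increasing pairs, and
  symmetry recovers the other entries, so the given probability space can be replaced by the
  Gaussian product.\<close>

lemma disorder_expectation:
  assumes "msk_disorder m D N I M g"
  shows "(\<integral>\<omega>. (magnetization \<beta> h N (\<lambda>i j. g i j \<omega>) i - tanh (tap_field m D L \<beta> h q N I (\<lambda>i j. g i j \<omega>) s i)) ^ (2 * k) \<partial>M)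
    = (\<integral>y. cavity_error y y \<partial>gaussian_product (site_pairs N) edge_var)"
proof -
  interpret M: prob_space M using assms by (simp add: msk_disorder_def)
  let ?X = "\<lambda>(a, b). g a b" and ?B = "PiM (site_pairs N) (\<lambda>_. borel :: real measure)"
  have ind: "M.indep_vars (\<lambda>_. borel) ?X (site_pairs N)" using assms by (simp add: msk_disorder_def)
  have dist: "distr M borel (g a b) = centered_gaussian (D $$ (r, t))"
    if "r < m" "t < m" "a \<in> I r" "b \<in> I t" "a < b" for r t a b
    using assms that unfolding msk_disorder_def by blast
  have g_sym: "g b a \<omega> = g a b \<omega>" if "a \<in> {1..N}" "b \<in> {1..N}" "\<omega> \<in> space M" for a b \<omega>
    using assms that unfolding msk_disorder_def by blast
  have rv: "?X e \<in> borel_measurable M" if "e \<in> site_pairs N" for e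
    using ind that unfolding M.indep_vars_def by blast
  have "distr M ?B (\<lambda>\<omega>. \<lambda>e\<in>site_pairs N. ?X e \<omega>) = (\<Pi>\<^sub>M e\<in>site_pairs N. distr M borel (?X e))"
    using M.indep_vars_iff_distr_eq_PiM' [where M' = "\<lambda>_. borel", OF site_pairs_nonempty rv] ind by simp
  also have "\<dots> = gaussian_product (site_pairs N) edge_var"
  proof (rule PiM_cong [OF refl])
    fix e assume "e \<in> site_pairs N"
    then obtain a b where e: "e = (a, b)" "a \<in> {1..N}" "b \<in> {1..N}" "a < b" by (auto simp: site_pairs_def)
    show "distr M borel (?X e) = centered_gaussian (edge_var e)"
      using dist [of "sp a" "sp b" a b] sp_site [OF e(2)] sp_site [OF e(3)] e by (simp add: edge_var_def)
  qed
  finally have law: "distr M ?B (\<lambda>\<omega>. \<lambda>e\<in>site_pairs N. ?X e \<omega>) = gaussian_product (site_pairs N) edge_var" .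
  have X: "(\<lambda>\<omega>. \<lambda>e\<in>site_pairs N. ?X e \<omega>) \<in> measurable M ?B" by (rule measurable_restrict [OF rv])
  have "sets ?B = sets (gaussian_product (site_pairs N) edge_var)" unfolding law [symmetric] by simp
  then have meas: "(\<lambda>y. cavity_error y y) \<in> borel_measurable ?B"
    using cavity_error_measurable [of edge_var] measurable_cong_sets [OF _ refl] by blast
  have "(\<integral>y. cavity_error y y \<partial>gaussian_product (site_pairs N) edge_var)
      = (\<integral>\<omega>. cavity_error (\<lambda>e\<in>site_pairs N. ?X e \<omega>) (\<lambda>e\<in>site_pairs N. ?X e \<omega>) \<partial>M)"
    unfolding law [symmetric] by (rule integral_distr [OF X meas])
  also have "\<dots> = (\<integral>\<omega>. (magnetization \<beta> h N (\<lambda>i j. g i j \<omega>) i - tanh (tap_field m D L \<beta> h q N I (\<lambda>i j. g i j \<omega>) s i)) ^ (2 * k) \<partial>M)"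
  proof (rule Bochner_Integration.integral_cong [OF refl])
    fix \<omega> assume \<omega>: "\<omega> \<in> space M"
    define y where "y = (\<lambda>e\<in>site_pairs N. ?X e \<omega>)"
    have y: "y (min a b, max a b) = g a b \<omega>" if "a \<in> {1..N}" "b \<in> {1..N}" "a \<noteq> b" for a b
    proof (cases "a < b")
      case True
      then show ?thesis using that by (simp add: y_def site_pairs_def)
    next
      case False
      then show ?thesis using that g_sym [OF that(1,2) \<omega>] by (simp add: y_def site_pairs_def min_def max_def)
    qed
    have "hamiltonian \<beta> h N (\<lambda>a b. y (min a b, max a b)) = hamiltonian \<beta> h N (\<lambda>a b. g a b \<omega>)"
    proof
      fix \<sigma>
      have "(\<Sum>(a, b)\<in>site_pairs N. y (min a b, max a b) * \<sigma> a * \<sigma> b) = (\<Sum>(a, b)\<in>site_pairs N. g a b \<omega> * \<sigma> a * \<sigma> b)"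
        by (intro sum.cong refl) (auto simp: site_pairs_def y_def min_def max_def)
      then show "hamiltonian \<beta> h N (\<lambda>a b. y (min a b, max a b)) \<sigma> = hamiltonian \<beta> h N (\<lambda>a b. g a b \<omega>) \<sigma>"
        unfolding hamiltonian_def by simp
    qed
    then have mag: "magnetization \<beta> h N (\<lambda>a b. y (min a b, max a b)) = magnetization \<beta> h N (\<lambda>a b. g a b \<omega>)"
      unfolding magnetization_def [abs_def] gibbs_mean_def gibbs_weight_def by simp
    have "(\<Sum>t<m. \<Sum>j\<in>I t - {i}. y (min i j, max i j) * F j) = (\<Sum>t<m. \<Sum>j\<in>I t - {i}. g i j \<omega> * F j)" for F :: "nat \<Rightarrow> real"
    proof (intro sum.cong refl)
      fix t j assume "t \<in> {..<m}" "j \<in> I t - {i}"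
      then have "j \<in> {1..N}" "i \<noteq> j" using I_union by auto
      then show "y (min i j, max i j) * F j = g i j \<omega> * F j" using y [OF i_site] by simp
    qed
    then have "tap_field m D L \<beta> h q N I (\<lambda>a b. y (min a b, max a b)) s i = tap_field m D L \<beta> h q N I (\<lambda>a b. g a b \<omega>) s i"
      unfolding tap_field_def mag by simp
    then show "cavity_error (\<lambda>e\<in>site_pairs N. ?X e \<omega>) (\<lambda>e\<in>site_pairs N. ?X e \<omega>)
        = (magnetization \<beta> h N (\<lambda>i j. g i j \<omega>) i - tanh (tap_field m D L \<beta> h q N I (\<lambda>i j. g i j \<omega>) s i)) ^ (2 * k)"
      using tap_error_eq [of y] mag by (simp only: y_def [symmetric])
  qed
  finally show ?thesis by (rule sym)
qed

end

theorem theorem1p2: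
  fixes m k :: nat and D L :: "real mat" and lam :: "nat \<Rightarrow> real" and \<beta> :: real
  assumes "m \<ge> 2"
    and "\<And>s. s < m \<Longrightarrow> 0 < lam s \<and> lam s < 1"
    and "L = mat_diag m lam"
    and "D \<in> carrier_mat m m"
    and "transpose_mat D = D"
    and "\<And>s t. s < m \<Longrightarrow> t < m \<Longrightarrow> 0 \<le> D $$ (s, t)"
    and "0 < \<beta>"
    and "ereal \<beta> < beta_0 D L"
    and "k \<ge> 1"
  shows "\<exists>C::real. \<forall>h q N I (M :: 'w measure) g.
    0 \<le> h \<longrightarrow> overlap_fixed_point m D L \<beta> h q \<longrightarrow>
    species_partition m lam N I \<longrightarrow> msk_disorder m D N I M g \<longrightarrow>
    (\<forall>s<m. \<forall>i\<in>I s.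
      (\<integral>\<omega>. (magnetization \<beta> h N (\<lambda>i j. g i j \<omega>) i
             - tanh (tap_field m D L \<beta> h q N I (\<lambda>i j. g i j \<omega>) s i)) ^ (2 * k) \<partial>M)
      \<le> C / real N ^ k)"
proof -
  obtain \<rho> where \<rho>: "0 < \<rho>" "4 * alpha D * \<beta>\<^sup>2 * \<rho> < 1"
    and quad: "\<And>w. \<bar>\<Sum>s<m. \<Sum>t<m. D $$ (s, t) * w s * w t\<bar> \<le> \<rho> * (\<Sum>s<m. (w s)\<^sup>2 / lam s)"
    using high_temperature_constant [OF assms(4,5) _ _ assms(7), of lam] assms(1,2,3,8) by force
  have al: "alpha D = 1 \<and> (\<forall>w. 0 \<le> (\<Sum>s<m. \<Sum>t<m. D $$ (s, t) * w s * w t)) \<or> alpha D = 2"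
    unfolding alpha_def using positive_semidefinite_quadratic_form [OF _ assms(4)] by auto
  \<comment> \<open>The midpoint between the exponent lost along the path,
    \<open>2 * alpha D * \<beta>\<^sup>2 * \<rho>\<close>, and the limit \<open>1 / 2\<close> at the
    independent end.\<close>
  define \<kappa> where "\<kappa> = alpha D * \<beta>\<^sup>2 * \<rho> + 1 / 4"
  have \<kappa>: "2 * alpha D * \<beta>\<^sup>2 * \<rho> < \<kappa>" "\<kappa> < 1 / 2" using \<rho>(2) unfolding \<kappa>_def mult.assoc by linarith+
  define C where "C = tap_setting.tap_const m k D lam \<beta> \<kappa> (\<kappa> - 2 * alpha D * \<beta>\<^sup>2 * \<rho>)"
  show ?thesis
  proof (intro exI [of _ C] allI impI ballI)
    fix h q N I and M :: "'w measure" and g s i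
    assume fixed_point: "overlap_fixed_point m D L \<beta> h q" and part: "species_partition m lam N I"
      and disorder: "msk_disorder m D N I M g" and s: "s < m" and i: "i \<in> I s"
    interpret tap_setting m k N i s D L lam \<beta> h q I
      by standard (fact assms fixed_point part s i)+
    show "(\<integral>\<omega>. (magnetization \<beta> h N (\<lambda>i j. g i j \<omega>) i
             - tanh (tap_field m D L \<beta> h q N I (\<lambda>i j. g i j \<omega>) s i)) ^ (2 * k) \<partial>M) \<le> C / real N ^ k"
      unfolding disorder_expectation [OF disorder] C_def
      by (rule cavity_error_expectation [OF quad less_imp_le [OF \<rho>(1)] al \<kappa>])
  qed
qed

end
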